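(* Let $n\geq 4$ be an integer and let $(R,\Delta)$ be a Hermitian form ring with $R$ commutative. Suppose that $H\lhd_d G$ where $d$ is a positive integer and $G$ is a subgroup of $\mathrm{U}_{2n+1}(R,\Delta)$ containing $\mathrm{EU}_{2n+1}(R,\Delta)$. Suppose $U(H)=(I,\Omega)$. Then \[\mathrm{EU}_{2n+1}((R,\Delta),U(H)\ast I^{k})\leq H \leq \mathrm{CU}_{2n+1}((R,\Delta),U(H))\] where $k=\frac{10^d-1}{9}-1$.
   Context: Subnormality. $H\lhd_d G$ means that there are subgroups $H=H_0\lhd H_1\lhd\dots\lhd H_{d-1}\lhd H_d=G$, each normal in the next. Convention: $I^0=R$. Form rings. Rings are associative with $1\neq 0$; $R$ is a commutative ring. A Hermitian ring $(R,\bar{\ },\lambda,\mu)$ consists of $R$, a bijection $x\mapsto\bar x$ of $R$ with $\overline{x+y}=\bar x+\bar y$, $\overline{xy}=\bar y\bar x$, $\bar 1=1$, an element $\lambda\in R$ with $\bar{\bar x}=\lambda x\bar\lambda$ for all $x\in R$ (it follows that $\bar\lambda=\lambda^{-1}$), and an element $\mu\in R$ with $\mu=\bar\mu\lambda$. A subset $A\subseteq R$ is involution invariant if $\bar x\in A$ for all $x\in A$. The Heisenberg group $\mathfrak{H}$ is $R\times R$ with group operation $(x_1,y_1)\dotplus(x_2,y_2)=(x_1+x_2,\,y_1+y_2-\bar x_1\mu x_2)$; the inverse of $\alpha$ is written $\dot{-}\alpha$, and $\alpha\,\dot{-}\,\beta:=\alpha\dotplus(\dot{-}\beta)$. For $a\in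 R$ put $(x,y)\circ a=(xa,\bar a y a)$; $\circ$ has higher priority than $\dotplus$ and $\dot{-}$. An $R^{\bullet}$-submodule of $\mathfrak{H}$ is a subgroup stable under all maps $\alpha\mapsto\alpha\circ a$ ($a\in R$). For $A\subseteq\mathfrak{H}$, $B\subseteq R$, $A\circ B$ is the subgroup of $\mathfrak{H}$ generated by all $\alpha\circ b$ ($\alpha\in A$, $b\in B$); for $A,B\subseteq \mathfrak{H}$, $A\dotplus B=\{\alpha\dotplus\beta\mid\alpha\in A,\beta\in B\}$. For a subgroup $\Omega$ of $\mathfrak{H}$, $\alpha\equiv\beta\bmod\Omega$ means $\alpha\,\dot{-}\,\beta\in\Omega$. Let $\Delta_{\min}=\{(0,x-\bar x\lambda)\mid x\in R\}$ and $\Delta_{\max}=\{(x,y)\mid \bar x\mu x+y+\bar y\lambda=0\}$. An odd form parameter is an $R^\bullet$-submodule $\Delta$ of $\mathfrak{H}$ with $\Delta_{\min}\subseteq\Delta\subseteq\Delta_{\max}$; then $(R,\Delta)$ (short for $((R,\bar{\ },\lambda,\mu),\Delta)$) is called a Hermitian form ring. Put $J(\Delta)=\{y\in R\mid\exists z\in R:(y,z)\in\Delta\}$. For an involution invariant ideal $I$ of $R$ put $\tilde I=\{x\in R\mid\overline{J(\Delta)}\mu x\subseteq I\}$, $\Omega^I_{\min}=\{(0,x-\bar x\lambda)\mid x\in I\}\dotplus\Delta\circ I$ and $\Omega^I_{\max}=\Delta\cap(\tilde I\times I)$. An odd form ideal of $(R,\Delta)$ is a pair $(I,\Omega)$ where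 $I$ is an involution invariant ideal and $\Omega$ is an $R^\bullet$-submodule of $\mathfrak{H}$ with $\Omega^I_{\min}\subseteq\Omega\subseteq\Omega^I_{\max}$. Put $\Delta^{1}=\Delta$, $\Delta^{-1}=\{(x,y)\mid(x,\bar y)\in\Delta\}$, $\Omega^1=\Omega$, $\Omega^{-1}=\{(x,y)\mid(x,\bar y)\in\Omega\}$. Product. For an odd form ideal $(J,\Sigma)$ and an involution invariant ideal $K$, $(J,\Sigma)\ast K$ is the odd form ideal $(JK,\Omega^{JK}_{\min}\dotplus\Sigma\circ K)$. Groups. Let $\Theta_+=\{1,\dots,n\}$, $\Theta_-=\{-n,\dots,-1\}$, $\Theta=\Theta_+\cup\{0\}\cup\Theta_-$, $\Theta_{\mathrm{hb}}=\Theta\setminus\{0\}$, $\epsilon(i)=1$ for $i\in\Theta_+$ and $\epsilon(i)=-1$ for $i\in\Theta_-$. Coordinates of $M=R^{2n+1}$ (columns) and rows/columns of $(2n+1)\times(2n+1)$ matrices are indexed by $\Theta$ in the order $1,\dots,n,0,-n,\dots,-1$. $\sigma_{ij}$ is the $(i,j)$ entry and $\sigma_{*j}$ the $j$-th column of $\sigma$; $\sigma_{\mathrm{hb}}=(\sigma_{ij})_{i,j\in\Theta_{\mathrm{hb}}}$; $e$ is the identity matrix, $e^{ij}$ a matrix unit. For $u,v\in M$ let $B(u,v)=\sum_{i=1}^n\bar u_iv_{-i}+\bar u_0\mu v_0+\sum_{i=-n}^{-1}\bar u_i\lambda v_{-i}$ and $Q(u)=(u_0,\sum_{i=1}^n\bar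 u_iu_{-i})\in\mathfrak{H}$. $\mathrm{U}_{2n+1}(R,\Delta)$ is the group of $\sigma\in\mathrm{GL}_{2n+1}(R)$ with $B(\sigma u,\sigma v)=B(u,v)$ and $Q(\sigma u)\equiv Q(u)\bmod\Delta$ for all $u,v\in M$. Elementary subgroups. For $i,j\in\Theta_{\mathrm{hb}}$, $i\neq\pm j$, $x\in R$: $T_{ij}(x)=e+xe^{ij}-\lambda^{(\epsilon(j)-1)/2}\bar x\lambda^{(1-\epsilon(i))/2}e^{-j,-i}$. For $i\in\Theta_{\mathrm{hb}}$, $(x,y)\in\Delta^{-\epsilon(i)}$: $T_i(x,y)=e+xe^{0,-i}-\lambda^{-(1+\epsilon(i))/2}\bar x\mu e^{i0}+ye^{i,-i}$. $\mathrm{EU}_{2n+1}(R,\Delta)$ is the subgroup of $\mathrm{U}_{2n+1}(R,\Delta)$ generated by all these elements. For an odd form ideal $(I,\Omega)$, $\mathrm{EU}_{2n+1}(I,\Omega)$ is the subgroup generated by all $T_{ij}(x)$ with $x\in I$ and all $T_i(x,y)$ with $(x,y)\in\Omega^{-\epsilon(i)}$, and $\mathrm{EU}_{2n+1}((R,\Delta),(I,\Omega))$ is the normal closure of $\mathrm{EU}_{2n+1}(I,\Omega)$ in $\mathrm{EU}_{2n+1}(R,\Delta)$. Congruence subgroups. Let $M(R,\Delta)=\{u\in M\mid u_0\in J(\Delta)\}$. $\mathrm{U}_{2n+1}((R,\Delta),(I,\Omega))$ is the group of $\sigma\in\mathrm{U}_{2n+1}(R,\Delta)$ with $\sigma_{\mathrm{hb}}\equiv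 e_{\mathrm{hb}}\bmod I$ and $Q(\sigma u)\equiv Q(u)\bmod\Omega$ for all $u\in M(R,\Delta)$. $\mathrm{NU}_{2n+1}((R,\Delta),(I,\Omega))$ is its normaliser in $\mathrm{U}_{2n+1}(R,\Delta)$, and $\mathrm{CU}_{2n+1}((R,\Delta),(I,\Omega))=\{\sigma\in\mathrm{NU}_{2n+1}((R,\Delta),(I,\Omega))\mid[\sigma,\mathrm{EU}_{2n+1}(R,\Delta)]\leq\mathrm{U}_{2n+1}((R,\Delta),(I,\Omega))\}$, where $[g,h]=ghg^{-1}h^{-1}$. Upper level. For a subgroup $H\leq\mathrm{U}_{2n+1}(R,\Delta)$, the upper level $U(H)$ is the odd form ideal $(J,\Sigma)$ where $J$ is the ideal generated by $Y\cup\bar Y$, $Y$ being the set of all elements $\sigma_{ij}$, $\sigma_{ii}-\sigma_{jj}$ and all elements of the sets $\sigma_{i0}J(\Delta)$, $\overline{J(\Delta)}\mu\sigma_{0j}$, $\overline{J(\Delta)}\mu(\sigma_{00}-\sigma_{jj})J(\Delta)$ with $\sigma\in H$, $i\neq j\in\Theta_{\mathrm{hb}}$; and $\Sigma=\Omega^J_{\min}\dotplus Z\circ R$, where $Z$ is the set of all $Q(\sigma_{*j})$ and $(Q(\sigma_{*0})\,\dot{-}\,(1,0))\circ y\dotplus(y,z)\,\dot{-}\,(y,z)\circ\sigma_{ii}$ with $\sigma\in H$, $i,j\in\Theta_{\mathrm{hb}}$, $(y,z)\in\Delta$. *)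

theory Defs
  imports
    "HOL-Analysis.Determinants"
    "HOL-Algebra.Algebraic_Closure_Type"
    "HOL-Algebra.Ideal_Product"
    "HOL-Algebra.Group_Action"
begin

(* this notation would make "$" on vectors ambiguous *)
no_notation fps_nth (infixl \<open>$\<close> 75)

section \<open>Group-theoretic notions\<close>

definition subnormal :: "nat \<Rightarrow> 'g set \<Rightarrow> ('g, 'b) monoid_scheme \<Rightarrow> bool" where
  "subnormal d H G \<longleftrightarrow>
     (\<exists>K :: nat \<Rightarrow> 'g set. K 0 = H \<and> K d = carrier G \<and>
        (\<forall>i<d. K i \<lhd> G\<lparr>carrier := K (Suc i)\<rparr>))"

definition normal_closure :: "('g, 'b) monoid_scheme \<Rightarrow> 'g set \<Rightarrow> 'g set" where
  "normal_closure G S = \<Inter>{N. N \<lhd> G \<and> S \<subseteq> N}"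

definition commutator_subgroup ::
    "('g, 'b) monoid_scheme \<Rightarrow> 'g set \<Rightarrow> 'g set \<Rightarrow> 'g set" where
  "commutator_subgroup G A B =
     generate G {g \<otimes>\<^bsub>G\<^esub> h \<otimes>\<^bsub>G\<^esub> inv\<^bsub>G\<^esub> g \<otimes>\<^bsub>G\<^esub> inv\<^bsub>G\<^esub> h | g h. g \<in> A \<and> h \<in> B}"

section \<open>Hermitian form rings\<close>

text \<open>The ring \<open>R\<close> is a whole type of class \<^class>\<open>comm_ring_1\<close> (in which \<open>1 \<noteq> 0\<close>);
  ideals, their products and powers are those of HOL-Algebra, taken in
  \<^const>\<open>ring_of_type_algebra\<close>, the same ring viewed as a record.\<close>

abbreviation ring_UNIV :: "'a::comm_ring_1 ring" where
  "ring_UNIV \<equiv> ring_of_type_algebra"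

record 'a hermitian_data =
  bar :: "'a \<Rightarrow> 'a"
  lam :: 'a
  mu :: 'a

locale hermitian_ring =
  fixes F :: "('a::comm_ring_1, 'b) hermitian_data_scheme"
  assumes bar_bij: "bij (bar F)"
    and bar_add: "bar F (x + y) = bar F x + bar F y"
    and bar_mult: "bar F (x * y) = bar F y * bar F x"
    and bar_one: "bar F 1 = 1"
    and bar_bar: "bar F (bar F x) = lam F * x * bar F (lam F)"
    and mu_eq: "mu F = bar F (mu F) * lam F"

subsection \<open>The Heisenberg group\<close>

definition heis :: "('a::comm_ring_1, 'b) hermitian_data_scheme \<Rightarrow> ('a \<times> 'a) monoid" where
  "heis F = \<lparr>carrier = UNIV,
     mult = (\<lambda>(x\<^sub>1, y\<^sub>1) (x\<^sub>2, y\<^sub>2). (x\<^sub>1 + x\<^sub>2, y\<^sub>1 + y\<^sub>2 - bar F x\<^sub>1 * mu F * x\<^sub>2)),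
     one = (0, 0)\<rparr>"

definition hminus ::
    "('a::comm_ring_1, 'b) hermitian_data_scheme \<Rightarrow> 'a \<times> 'a \<Rightarrow> 'a \<times> 'a \<Rightarrow> 'a \<times> 'a" where
  "hminus F \<alpha> \<beta> = \<alpha> \<otimes>\<^bsub>heis F\<^esub> inv\<^bsub>heis F\<^esub> \<beta>"

definition circ ::
    "('a::comm_ring_1, 'b) hermitian_data_scheme \<Rightarrow> 'a \<times> 'a \<Rightarrow> 'a \<Rightarrow> 'a \<times> 'a" where
  "circ F \<alpha> a = (fst \<alpha> * a, bar F a * snd \<alpha> * a)"

definition circ_set ::
    "('a::comm_ring_1, 'b) hermitian_data_scheme \<Rightarrow> ('a \<times> 'a) set \<Rightarrow> 'a set \<Rightarrow> ('a \<times> 'a) set" where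
  "circ_set F A B = generate (heis F) {circ F \<alpha> b | \<alpha> b. \<alpha> \<in> A \<and> b \<in> B}"

definition bullet_submodule ::
    "('a::comm_ring_1, 'b) hermitian_data_scheme \<Rightarrow> ('a \<times> 'a) set \<Rightarrow> bool" where
  "bullet_submodule F \<Omega> \<longleftrightarrow>
     subgroup \<Omega> (heis F) \<and> (\<forall>\<alpha>\<in>\<Omega>. \<forall>a. circ F \<alpha> a \<in> \<Omega>)"

definition heis_cong ::
    "('a::comm_ring_1, 'b) hermitian_data_scheme \<Rightarrow> 'a \<times> 'a \<Rightarrow> 'a \<times> 'a \<Rightarrow> ('a \<times> 'a) set \<Rightarrow> bool" where
  "heis_cong F \<alpha> \<beta> \<Omega> \<longleftrightarrow> hminus F \<alpha> \<beta> \<in> \<Omega>"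

subsection \<open>Odd form parameters\<close>

definition trace_pairs ::
    "('a::comm_ring_1, 'b) hermitian_data_scheme \<Rightarrow> 'a set \<Rightarrow> ('a \<times> 'a) set" where
  "trace_pairs F I = {(0, x - bar F x * lam F) | x. x \<in> I}"

definition Delta_min ::
    "('a::comm_ring_1, 'b) hermitian_data_scheme \<Rightarrow> ('a \<times> 'a) set" where
  "Delta_min F = trace_pairs F UNIV"

definition Delta_max ::
    "('a::comm_ring_1, 'b) hermitian_data_scheme \<Rightarrow> ('a \<times> 'a) set" where
  "Delta_max F = {(x, y). bar F x * mu F * x + y + bar F y * lam F = 0}"

record 'a form_data = "'a hermitian_data" +
  Delta :: "('a \<times> 'a) set"

locale hermitian_form_ring = hermitian_ring F
  for F :: "('a::comm_ring_1, 'b) form_data_scheme" +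
  assumes Delta_submodule: "bullet_submodule F (Delta F)"
    and Delta_min_le: "Delta_min F \<subseteq> Delta F"
    and Delta_le_max: "Delta F \<subseteq> Delta_max F"

definition J_Delta :: "('a::comm_ring_1, 'b) form_data_scheme \<Rightarrow> 'a set" where
  "J_Delta F = {y. \<exists>z. (y, z) \<in> Delta F}"

definition Omega_min ::
    "('a::comm_ring_1, 'b) form_data_scheme \<Rightarrow> 'a set \<Rightarrow> ('a \<times> 'a) set" where
  "Omega_min F I = trace_pairs F I <#>\<^bsub>heis F\<^esub> circ_set F (Delta F) I"

definition ideal_tilde :: "('a::comm_ring_1, 'b) form_data_scheme \<Rightarrow> 'a set \<Rightarrow> 'a set" where
  "ideal_tilde F I = {x. \<forall>y\<in>J_Delta F. bar F y * mu F * x \<in> I}"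

definition Omega_max ::
    "('a::comm_ring_1, 'b) form_data_scheme \<Rightarrow> 'a set \<Rightarrow> ('a \<times> 'a) set" where
  "Omega_max F I = Delta F \<inter> (ideal_tilde F I \<times> I)"

definition involution_invariant ::
    "('a::comm_ring_1, 'b) hermitian_data_scheme \<Rightarrow> 'a set \<Rightarrow> bool" where
  "involution_invariant F A \<longleftrightarrow> (\<forall>x\<in>A. bar F x \<in> A)"

definition odd_form_ideal ::
    "('a::comm_ring_1, 'b) form_data_scheme \<Rightarrow> 'a set \<times> ('a \<times> 'a) set \<Rightarrow> bool" where
  "odd_form_ideal F = (\<lambda>(I, \<Omega>).
     ideal I ring_UNIV \<and> involution_invariant F I \<and> bullet_submodule F \<Omega> \<and>
     Omega_min F I \<subseteq> \<Omega> \<and> \<Omega> \<subseteq> Omega_max F I)"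

definition form_ideal_prod ::
    "('a::comm_ring_1, 'b) form_data_scheme \<Rightarrow> 'a set \<times> ('a \<times> 'a) set \<Rightarrow> 'a set
       \<Rightarrow> 'a set \<times> ('a \<times> 'a) set" where
  "form_ideal_prod F = (\<lambda>(J, \<Sigma>) K.
     (ideal_prod ring_UNIV J K,
      Omega_min F (ideal_prod ring_UNIV J K) <#>\<^bsub>heis F\<^esub> circ_set F \<Sigma> K))"

text \<open>\<open>signed_param F \<Omega> s\<close> is \<open>\<Omega>\<^sup>s\<close> for \<open>s = 1\<close> and \<open>s = -1\<close>.\<close>

definition signed_param ::
    "('a::comm_ring_1, 'b) hermitian_data_scheme \<Rightarrow> ('a \<times> 'a) set \<Rightarrow> int \<Rightarrow> ('a \<times> 'a) set" where
  "signed_param F \<Omega> s = (if s = 1 then \<Omega> else {(x, y). (x, bar F y) \<in> \<Omega>})"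

section \<open>Odd-dimensional unitary groups\<close>

text \<open>With \<open>n = CARD('n)\<close>, the elements \<open>Pos k\<close>, \<open>Mid\<close>, \<open>Neg k\<close> of the index type stand
  for \<open>k\<close>, \<open>0\<close>, \<open>-k\<close>, where \<open>k\<close> runs over \<open>1, \<dots>, n\<close>; matrices of size \<open>2n + 1\<close> have type
  \<open>'a^'n signed^'n signed\<close>.\<close>

datatype 'n signed = Pos 'n | Mid | Neg 'n

instantiation signed :: (type) "{zero, uminus}"
begin

definition zero_signed :: "'n signed" where
  "zero_signed = Mid"

fun uminus_signed :: "'n signed \<Rightarrow> 'n signed" where
  "uminus_signed (Pos k) = Neg k"
| "uminus_signed Mid = Mid"
| "uminus_signed (Neg k) = Pos k"

instance ..

end

lemma UNIV_signed: "UNIV = range Pos \<union> {Mid} \<union> range Neg"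
proof -
  have "i \<in> range Pos \<union> {Mid} \<union> range Neg" for i :: "'n signed"
    by (cases i) auto
  then show ?thesis by blast
qed

instance signed :: (finite) finite
  by standard (simp add: UNIV_signed)

abbreviation Theta_pos :: "'n signed set" where
  "Theta_pos \<equiv> range Pos"

abbreviation Theta_neg :: "'n signed set" where
  "Theta_neg \<equiv> range Neg"

abbreviation Theta_hb :: "'n signed set" where
  "Theta_hb \<equiv> UNIV - {0}"

text \<open>The value of \<open>eps\<close> at \<open>0\<close> is never used.\<close>

definition eps :: "'n signed \<Rightarrow> int" where
  "eps i = (if i \<in> Theta_pos then 1 else - 1)"

type_synonym ('a, 'n) sq_mat = "'a^'n signed^'n signed"

definition GL :: "('a::comm_ring_1, 'n::finite) sq_mat monoid" where
  "GL = \<lparr>carrier = {\<sigma>. invertible \<sigma>}, mult = (**), one = mat 1\<rparr>"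

definition B_form ::
    "('a::comm_ring_1, 'b) hermitian_data_scheme \<Rightarrow> 'a^'n::finite signed \<Rightarrow> 'a^'n signed \<Rightarrow> 'a" where
  "B_form F u v =
     (\<Sum>i\<in>Theta_pos. bar F (u $ i) * v $ (- i)) +
     bar F (u $ 0) * mu F * v $ 0 +
     (\<Sum>i\<in>Theta_neg. bar F (u $ i) * lam F * v $ (- i))"

definition Q_form ::
    "('a::comm_ring_1, 'b) hermitian_data_scheme \<Rightarrow> 'a^'n::finite signed \<Rightarrow> 'a \<times> 'a" where
  "Q_form F u = (u $ 0, \<Sum>i\<in>Theta_pos. bar F (u $ i) * u $ (- i))"

definition U_grp ::
    "('a::comm_ring_1, 'b) form_data_scheme \<Rightarrow> ('a, 'n::finite) sq_mat monoid" where
  "U_grp F = GL\<lparr>carrier := {\<sigma> \<in> carrier GL.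
     (\<forall>u v. B_form F (\<sigma> *v u) (\<sigma> *v v) = B_form F u v) \<and>
     (\<forall>u. heis_cong F (Q_form F (\<sigma> *v u)) (Q_form F u) (Delta F))}\<rparr>"

subsection \<open>Elementary subgroups\<close>

text \<open>\<open>mat_unit x i j\<close> is \<open>x e\<^sup>i\<^sup>j\<close>.\<close>

definition mat_unit :: "'a::zero \<Rightarrow> 'n \<Rightarrow> 'n \<Rightarrow> 'a^'n^'n" where
  "mat_unit x i j = (\<chi> k l. if k = i \<and> l = j then x else 0)"

text \<open>An integer power in \<^const>\<open>ring_of_type_algebra\<close>; \<^const>\<open>lam\<close> is invertible in a Hermitian
  ring, with inverse \<open>bar F (lam F)\<close>. The divisions by 2 below are exact.\<close>

definition lam_pow :: "('a::comm_ring_1, 'b) hermitian_data_scheme \<Rightarrow> int \<Rightarrow> 'a" where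
  "lam_pow F z = lam F [^]\<^bsub>ring_UNIV\<^esub> z"

definition T_short ::
    "('a::comm_ring_1, 'b) hermitian_data_scheme \<Rightarrow> 'n::finite signed \<Rightarrow> 'n signed \<Rightarrow> 'a
       \<Rightarrow> ('a, 'n) sq_mat" where
  "T_short F i j x =
     mat 1 + mat_unit x i j
     - mat_unit (lam_pow F ((eps j - 1) div 2) * bar F x * lam_pow F ((1 - eps i) div 2)) (- j) (- i)"

definition T_long ::
    "('a::comm_ring_1, 'b) hermitian_data_scheme \<Rightarrow> 'n::finite signed \<Rightarrow> 'a \<times> 'a
       \<Rightarrow> ('a, 'n) sq_mat" where
  "T_long F i = (\<lambda>(x, y).
     mat 1 + mat_unit x 0 (- i)
     - mat_unit (lam_pow F (- ((1 + eps i) div 2)) * bar F x * mu F) i 0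
     + mat_unit y i (- i))"

definition EU_ideal ::
    "('a::comm_ring_1, 'b) form_data_scheme \<Rightarrow> 'a set \<times> ('a \<times> 'a) set
       \<Rightarrow> ('a, 'n::finite) sq_mat set" where
  "EU_ideal F = (\<lambda>(I, \<Omega>). generate (U_grp F)
     ({T_short F i j x | i j x. i \<in> Theta_hb \<and> j \<in> Theta_hb \<and> i \<noteq> j \<and> i \<noteq> - j \<and> x \<in> I} \<union>
      {T_long F i \<alpha> | i \<alpha>. i \<in> Theta_hb \<and> \<alpha> \<in> signed_param F \<Omega> (- eps i)}))"

definition EU :: "('a::comm_ring_1, 'b) form_data_scheme \<Rightarrow> ('a, 'n::finite) sq_mat set" where
  "EU F = EU_ideal F (UNIV, Delta F)"

definition EU_rel ::
    "('a::comm_ring_1, 'b) form_data_scheme \<Rightarrow> 'a set \<times> ('a \<times> 'a) set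
       \<Rightarrow> ('a, 'n::finite) sq_mat set" where
  "EU_rel F L = normal_closure ((U_grp F)\<lparr>carrier := EU F\<rparr>) (EU_ideal F L)"

subsection \<open>Congruence subgroups\<close>

definition M_Delta :: "('a::comm_ring_1, 'b) form_data_scheme \<Rightarrow> ('a^'n::finite signed) set" where
  "M_Delta F = {u. u $ 0 \<in> J_Delta F}"

definition U_rel ::
    "('a::comm_ring_1, 'b) form_data_scheme \<Rightarrow> 'a set \<times> ('a \<times> 'a) set
       \<Rightarrow> ('a, 'n::finite) sq_mat set" where
  "U_rel F = (\<lambda>(I, \<Omega>). {\<sigma> \<in> carrier (U_grp F).
     (\<forall>i\<in>Theta_hb. \<forall>j\<in>Theta_hb. \<sigma> $ i $ j - (mat 1 :: ('a, 'n) sq_mat) $ i $ j \<in> I) \<and>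
     (\<forall>u\<in>M_Delta F. heis_cong F (Q_form F (\<sigma> *v u)) (Q_form F u) \<Omega>)})"

definition NU ::
    "('a::comm_ring_1, 'b) form_data_scheme \<Rightarrow> 'a set \<times> ('a \<times> 'a) set
       \<Rightarrow> ('a, 'n::finite) sq_mat set" where
  "NU F L = normalizer (U_grp F) (U_rel F L)"

definition CU ::
    "('a::comm_ring_1, 'b) form_data_scheme \<Rightarrow> 'a set \<times> ('a \<times> 'a) set
       \<Rightarrow> ('a, 'n::finite) sq_mat set" where
  "CU F L = {\<sigma> \<in> NU F L. commutator_subgroup (U_grp F) {\<sigma>} (EU F) \<subseteq> U_rel F L}"

subsection \<open>The upper level of a subgroup\<close>

definition upper_Y ::
    "('a::comm_ring_1, 'b) form_data_scheme \<Rightarrow> ('a, 'n::finite) sq_mat set \<Rightarrow> 'a set" where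
  "upper_Y F H = (\<Union>\<sigma>\<in>H. \<Union>i\<in>Theta_hb. \<Union>j\<in>Theta_hb - {i}.
     {\<sigma> $ i $ j, \<sigma> $ i $ i - \<sigma> $ j $ j}
     \<union> {\<sigma> $ i $ 0 * y | y. y \<in> J_Delta F}
     \<union> {bar F y * mu F * \<sigma> $ 0 $ j | y. y \<in> J_Delta F}
     \<union> {bar F y * mu F * (\<sigma> $ 0 $ 0 - \<sigma> $ j $ j) * y' | y y'.
          y \<in> J_Delta F \<and> y' \<in> J_Delta F})"

definition upper_ideal ::
    "('a::comm_ring_1, 'b) form_data_scheme \<Rightarrow> ('a, 'n::finite) sq_mat set \<Rightarrow> 'a set" where
  "upper_ideal F H = genideal ring_UNIV (upper_Y F H \<union> bar F ` upper_Y F H)"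

definition upper_Z ::
    "('a::comm_ring_1, 'b) form_data_scheme \<Rightarrow> ('a, 'n::finite) sq_mat set \<Rightarrow> ('a \<times> 'a) set" where
  "upper_Z F H =
     {Q_form F (column j \<sigma>) | \<sigma> j. \<sigma> \<in> H \<and> j \<in> Theta_hb} \<union>
     {hminus F
        (circ F (hminus F (Q_form F (column 0 \<sigma>)) (1, 0)) y \<otimes>\<^bsub>heis F\<^esub> (y, z))
        (circ F (y, z) (\<sigma> $ i $ i))
      | \<sigma> i y z. \<sigma> \<in> H \<and> i \<in> Theta_hb \<and> (y, z) \<in> Delta F}"

definition upper_level ::
    "('a::comm_ring_1, 'b) form_data_scheme \<Rightarrow> ('a, 'n::finite) sq_mat set
       \<Rightarrow> 'a set \<times> ('a \<times> 'a) set" where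
  "upper_level F H =
     (upper_ideal F H,
      Omega_min F (upper_ideal F H) <#>\<^bsub>heis F\<^esub> circ_set F (upper_Z F H) UNIV)"

end

theory Submission
  imports Defs
begin

text \<open>Short and long root elements are Siegel transformations \<open>Ei u v y\<close>, and conjugation by a unitary matrix
  acts on their two vectors. All computations thereby become evaluations of the Hermitian form and of the quadratic
  map on vectors, most of them columns of elements of \<open>H\<close>.

  The upper inclusion rests on elements that act as a scalar modulo a form ideal (\<open>scal_mod\<close>). The
  generators of the upper level are exactly the obstructions to acting as a scalar, so the upper level is the
  smallest form ideal modulo which all elements of \<open>H\<close> are scalars. Being a scalar is stable under elementary
  conjugation, with the same scalar (\<open>scal_mod_conj_EU\<close>), and acting as the scalar 1 is membership in the congruence
  subgroup. Hence commutators of elements of \<open>H\<close> with elementary ones lie in the congruence subgroup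
  (\<open>upper_bound\<close>). The same argument shows that elementary conjugation of \<open>H\<close> leaves its upper level unchanged
  (\<open>upper_cjg\<close>); the lower inclusion uses this throughout.

  For the lower inclusion suppose that \<open>H\<close> is normalised by the relative elementary group \<open>EJ\<close> of an ideal
  \<open>J\<close>. The claim is that \<open>H\<close> contains the relative elementary group of the product of its upper level with
  \<open>J\<^sup>1\<^sup>0\<close> (\<open>normal_step\<close>). Let \<open>\<sigma>\<close> be in \<open>H\<close> and let \<open>t\<close> in \<open>EJ\<close> fix the column \<open>\<sigma> e\<^sub>k\<close>. Modulo \<open>H\<close>, \<open>t\<close> agrees with
  its conjugate under \<open>\<sigma>\<close>, which fixes \<open>e\<^sub>k\<close>. Commutators with the unipotent radical of the stabiliser of \<open>e\<^sub>k\<close>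
  distinguish the two and give root elements in \<open>H\<close> (\<open>extraction\<close>). Suitable \<open>t\<close> are transvections along Koszul
  vectors, which are orthogonal to the column (\<open>koszul_transvection\<close>); the resulting parameters are products of two
  coefficients of the column, and since the column is unimodular the coefficients themselves follow
  (\<open>column_entries\<close>). Applied to all elementary conjugates of \<open>H\<close> this yields all short root elements with
  parameters in the product of the upper ideal and \<open>J\<^sup>9\<close> (\<open>upper_ideal_LB\<close>, \<open>core_Rt\<close>).

  Modulo these elements the same transvections \<open>t\<close> need only one commutator: it gives a long root element whose
  parameter is, up to a unit, a multiple of the quadratic value of a column (\<open>column_Lo_product\<close>). A tenth factor
  from \<open>J\<close> reaches all columns, and conjugation by long root elements gives the remaining generators of the form
  parameter (\<open>column0_long_params\<close>).

  Along the subnormal chain this is applied with powers of the upper ideal \<open>I\<close> of \<open>H\<close>, which is contained in the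
  upper ideals of all members of the chain. If one member contains the relative elementary group of \<open>I\<^sup>m\<close>, then
  the next one contains that of \<open>I\<close> to the power \<open>10 m + 1\<close>; starting from exponent 0 at \<open>G\<close> and
  taking the whole upper level in place of \<open>I\<close> in the last step, one arrives at the exponent of the
  theorem (\<open>subnormal_lower_bound\<close>).\<close>

section \<open>Hermitian rings over a commutative base\<close>

lemma Theta_pos_neg_disjoint [simp]: "Pos a \<noteq> 0" "Neg a \<noteq> 0" "(0::'n signed) \<noteq> Pos a" "(0::'n signed) \<noteq> Neg a"
  by (simp_all add: zero_signed_def)

lemma signed_minus_minus [simp]: "- (- i) = (i::'n signed)"
  by (cases i) auto

lemma signed_minus_zero [simp]: "- 0 = (0::'n signed)"
  by (simp add: zero_signed_def)

lemma signed_minus_eq_iff [simp]: "- i = - j \<longleftrightarrow> i = (j::'n signed)"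
  by (metis signed_minus_minus)

lemma signed_minus_eq_0_iff [simp]: "- i = 0 \<longleftrightarrow> i = (0::'n signed)"
  by (metis signed_minus_minus signed_minus_zero)

lemma signed_minus_neq [simp]: "i \<noteq> 0 \<Longrightarrow> - i \<noteq> i" "i \<noteq> 0 \<Longrightarrow> i \<noteq> - i" for i :: "'n signed"
  by (cases i; simp add: zero_signed_def)+

lemma bij_uminus_signed: "bij (uminus :: 'n signed \<Rightarrow> 'n signed)"
  by (rule involuntory_imp_bij) simp

lemma sum_signed: "(\<Sum>i\<in>UNIV. f i) = (\<Sum>k\<in>UNIV. f (Pos k)) + f 0 + (\<Sum>k\<in>UNIV. f (Neg k))"
  for f :: "'n::finite signed \<Rightarrow> 'a::comm_monoid_add"
proof -
  have *: "inj (Pos :: 'n \<Rightarrow> _)" "inj (Neg :: 'n \<Rightarrow> _)" by (auto intro: injI)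
  have "(\<Sum>i\<in>UNIV. f i) = sum f (range Pos \<union> {Mid}) + sum f (range Neg)"
    unfolding UNIV_signed by (rule sum.union_disjoint) auto
  also have "sum f (range Pos \<union> {Mid}) = sum f (range Pos) + sum f {Mid}"
    by (rule sum.union_disjoint) auto
  finally show ?thesis
    using * by (simp add: sum.reindex zero_signed_def o_def)
qed

lemma matrix_vector_scale: "A *v (c *s x) = c *s (A *v x)" for A :: "'a::comm_ring_1^'n^'m"
  by (simp add: vec_eq_iff matrix_vector_mult_def sum_distrib_left ac_simps)

context hermitian_ring
begin

abbreviation cj where "cj x \<equiv> bar F x"

lemma lam_cj [simp]: "lam F * cj (lam F) = 1"
  using bar_bar[of 1] by (simp add: bar_one)

lemma cj_lam [simp]: "cj (lam F) * lam F = 1"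
  using lam_cj by (simp add: mult.commute)

lemma cj_cj [simp]: "cj (cj x) = x"
proof -
  have "cj (cj x) = (lam F * cj (lam F)) * x" unfolding bar_bar by (simp only: ac_simps)
  then show ?thesis by simp
qed

lemmas cj_add [simp] = bar_add
lemmas cj_one [simp] = bar_one

lemma cj_mult [simp]: "cj (x * y) = cj x * cj y"
  by (simp add: bar_mult mult.commute)

lemma cj_0 [simp]: "cj 0 = 0"
  using cj_add[of 0 0] by simp

lemma cj_minus [simp]: "cj (- x) = - cj x"
  using cj_add[of x "- x"] by (simp add: eq_neg_iff_add_eq_0 add.commute)

lemma cj_diff [simp]: "cj (x - y) = cj x - cj y"
  using cj_add[of x "- y"] by simp

lemma cj_sum [simp]: "cj (sum f A) = (\<Sum>i\<in>A. cj (f i))"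
  by (induction A rule: infinite_finite_induct) auto

lemma cj_mu: "cj (mu F) = mu F * cj (lam F)"
proof -
  have "mu F * cj (lam F) = cj (mu F) * (lam F * cj (lam F))"
    by (subst (1) mu_eq) (simp only: ac_simps)
  then show ?thesis by simp
qed

subsection \<open>The Hermitian form\<close>

text \<open>The Gram matrix of the Hermitian form is monomial, and \<open>kap i\<close> is its entry in the row
  of \<open>i\<close> and the column of \<open>- i\<close>. Keeping it symbolic makes most computations uniform in
  the sign of the index.\<close>

definition kap :: "'n signed \<Rightarrow> 'a" where
  "kap i = (case i of Pos _ \<Rightarrow> 1 | Mid \<Rightarrow> mu F | Neg _ \<Rightarrow> lam F)"

lemma kap_simps [simp]: "kap (Pos k) = 1" "kap 0 = mu F" "kap (Neg k) = lam F"
  by (simp_all add: kap_def zero_signed_def)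

lemma cj_kap: "cj (kap i) * lam F = kap (- i)"
  by (cases i) (simp_all add: kap_def mu_eq[symmetric])

lemma kap_unit: "i \<noteq> 0 \<Longrightarrow> kap i * cj (kap i) = 1"
  by (cases i) (simp_all add: kap_def zero_signed_def)

abbreviation Bf :: "'a^'n::finite signed \<Rightarrow> 'a^'n signed \<Rightarrow> 'a" where "Bf \<equiv> B_form F"

text \<open>Half of the Hermitian form: its diagonal is the second component of the quadratic map,
  and it enters every formula for that map through traces only.\<close>

definition bq :: "'a^'n::finite signed \<Rightarrow> 'a^'n signed \<Rightarrow> 'a" where
  "bq u v = (\<Sum>k\<in>UNIV. cj (u $ Pos k) * v $ Neg k)"

abbreviation q :: "'a^'n::finite signed \<Rightarrow> 'a" where "q u \<equiv> bq u u"

lemma Q_form_eq: "Q_form F u = (u $ 0, q u)"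
proof -
  have *: "inj (Pos :: 'n \<Rightarrow> _)" by (auto intro: injI)
  show ?thesis unfolding Q_form_def bq_def by (simp add: sum.reindex[OF *] o_def)
qed

lemma B_form_eq_sum: "Bf u v = (\<Sum>i\<in>UNIV. cj (u $ i) * kap i * v $ (- i))"
proof -
  have *: "inj (Pos :: 'n \<Rightarrow> _)" "inj (Neg :: 'n \<Rightarrow> _)" by (auto intro: injI)
  show ?thesis
    unfolding B_form_def sum_signed sum.reindex[OF *(1)] sum.reindex[OF *(2)] by simp
qed

lemma B_add_left: "Bf (u + v) w = Bf u w + Bf v w"
  by (simp add: B_form_eq_sum algebra_simps sum.distrib)
lemma B_add_right: "Bf w (u + v) = Bf w u + Bf w v"
  by (simp add: B_form_eq_sum algebra_simps sum.distrib)
lemma B_diff_left: "Bf (u - v) w = Bf u w - Bf v w"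
  by (simp add: B_form_eq_sum algebra_simps sum_subtractf)
lemma B_diff_right: "Bf w (u - v) = Bf w u - Bf w v"
  by (simp add: B_form_eq_sum algebra_simps sum_subtractf)
lemma B_scale_left: "Bf (c *s u) w = cj c * Bf u w"
  by (simp add: B_form_eq_sum sum_distrib_left ac_simps)
lemma B_scale_right: "Bf w (c *s u) = c * Bf w u"
  by (simp add: B_form_eq_sum sum_distrib_left ac_simps)
lemma B_zero_left: "Bf 0 w = 0"
  by (simp add: B_form_eq_sum)
lemma B_zero_right: "Bf w 0 = 0"
  by (simp add: B_form_eq_sum)
lemma B_minus_left: "Bf (- u) w = - Bf u w"
  by (simp add: B_form_eq_sum sum_negf)
lemma B_minus_right: "Bf w (- u) = - Bf w u"
  by (simp add: B_form_eq_sum sum_negf)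

lemmas B_lin = B_add_left B_add_right B_diff_left B_diff_right B_scale_left B_scale_right
  B_zero_left B_zero_right B_minus_left B_minus_right

lemma B_herm: "Bf v u = cj (Bf u v) * lam F"
proof -
  have "cj (Bf u v) * lam F = (\<Sum>i\<in>UNIV. u $ i * kap (- i) * cj (v $ (- i)))"
    by (simp add: B_form_eq_sum sum_distrib_left sum_distrib_right cj_kap[symmetric] ac_simps)
  also have "\<dots> = (\<Sum>i\<in>UNIV. u $ (- i) * kap i * cj (v $ i))"
    using sum.reindex_bij_betw[OF bij_uminus_signed, where g = "\<lambda>i. u $ (- i) * kap i * cj (v $ i)"] by simp
  finally show ?thesis by (simp add: B_form_eq_sum ac_simps)
qed

lemma B_axis_left: "Bf (axis i x) w = cj x * kap i * w $ (- i)"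
proof -
  have "Bf (axis i x) w = (\<Sum>j\<in>UNIV. if j = i then cj x * kap i * w $ (- i) else 0)"
    unfolding B_form_eq_sum axis_def by (rule sum.cong) auto
  then show ?thesis by simp
qed

lemma B_axis_right: "Bf w (axis i x) = cj (w $ (- i)) * kap (- i) * x"
proof -
  have "Bf w (axis i x) = (\<Sum>j\<in>UNIV. if j = - i then cj (w $ (- i)) * kap (- i) * x else 0)"
    unfolding B_form_eq_sum axis_def by (rule sum.cong) auto
  then show ?thesis by simp
qed

lemma B_axis_axis: "Bf (axis i x) (axis j y) = (if j = - i then cj x * kap i * y else 0)"
  by (auto simp: B_axis_left) (auto simp: axis_def)

lemma B_expand_right: "Bf u w = (\<Sum>i\<in>UNIV. Bf u (axis i 1) * w $ i)"
  unfolding B_axis_right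
  using sum.reindex_bij_betw[OF bij_uminus_signed, where g = "\<lambda>i. cj (u $ i) * kap i * w $ (- i)"]
  by (simp add: B_form_eq_sum)

lemma bq_add_left: "bq (u + v) w = bq u w + bq v w"
  by (simp add: bq_def algebra_simps sum.distrib)
lemma bq_add_right: "bq w (u + v) = bq w u + bq w v"
  by (simp add: bq_def algebra_simps sum.distrib)
lemma bq_diff_left: "bq (u - v) w = bq u w - bq v w"
  by (simp add: bq_def algebra_simps sum_subtractf)
lemma bq_diff_right: "bq w (u - v) = bq w u - bq w v"
  by (simp add: bq_def algebra_simps sum_subtractf)
lemma bq_scale_left: "bq (c *s u) w = cj c * bq u w"
  by (simp add: bq_def sum_distrib_left ac_simps)
lemma bq_scale_right: "bq w (c *s u) = c * bq w u"
  by (simp add: bq_def sum_distrib_left ac_simps)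
lemma bq_zero_left: "bq 0 w = 0"
  by (simp add: bq_def)
lemma bq_zero_right: "bq w 0 = 0"
  by (simp add: bq_def)

lemma bq_minus_left: "bq (- u) w = - bq u w"
  by (simp add: bq_def sum_negf)
lemma bq_minus_right: "bq w (- u) = - bq w u"
  by (simp add: bq_def sum_negf)

lemmas bq_lin = bq_add_left bq_add_right bq_diff_left bq_diff_right bq_scale_left bq_scale_right
  bq_zero_left bq_zero_right bq_minus_left bq_minus_right

lemma bq_axis_left: "bq (axis i x) w = (if i \<in> Theta_pos then cj x * w $ (- i) else 0)"
proof (cases i)
  case (Pos a)
  have "bq (axis i x) w = (\<Sum>k\<in>UNIV. if k = a then cj x * w $ Neg a else 0)"
    unfolding bq_def axis_def Pos by (rule sum.cong) auto
  then show ?thesis by (simp add: Pos)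
qed (auto simp: bq_def axis_def)

lemma bq_axis_right: "bq w (axis i x) = (if i \<in> Theta_neg then cj (w $ (- i)) * x else 0)"
proof (cases i)
  case (Neg a)
  have "bq w (axis i x) = (\<Sum>k\<in>UNIV. if k = a then cj (w $ Pos a) * x else 0)"
    unfolding bq_def axis_def Neg by (rule sum.cong) auto
  then show ?thesis by (simp add: Neg)
qed (auto simp: bq_def axis_def)

lemma B_eq_bq: "Bf u v = bq u v + cj (bq v u) * lam F + cj (u $ 0) * mu F * v $ 0"
  by (simp add: B_form_eq_sum sum_signed bq_def zero_signed_def sum_distrib_left sum_distrib_right kap_def
      ac_simps)

text \<open>The second components of the pairs in \<open>Delta_min F\<close>.\<close>

definition tr :: "'a \<Rightarrow> 'a" where "tr x = x - cj x * lam F"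

lemma tr_add: "tr (x + y) = tr x + tr y" by (simp add: tr_def algebra_simps)
lemma tr_minus: "tr (- x) = - tr x" by (simp add: tr_def algebra_simps)
lemma tr_0 [simp]: "tr 0 = 0" by (simp add: tr_def)

lemma tr_scale: "cj a * tr x * a = tr (cj a * x * a)"
  by (simp add: tr_def algebra_simps)

lemma q_add: "q (u + v) = q u + q v + Bf u v - cj (u $ 0) * mu F * v $ 0 + tr (bq v u)"
  by (simp add: B_eq_bq bq_lin tr_def algebra_simps)

subsection \<open>Eichler transformations\<close>

text \<open>For isotropic \<open>u\<close> orthogonal to \<open>v\<close> this is the Siegel (or Eichler) transformation of
  \<open>u\<close> and \<open>v\<close>. Short and long root elements are both of this form, with \<open>v\<close> a multiple
  of a basis vector. The advantage over matrix units is that conjugation by an isometry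
  acts on the two vectors.\<close>

definition Ei :: "'a^'n::finite signed \<Rightarrow> 'a^'n signed \<Rightarrow> 'a \<Rightarrow> ('a, 'n) sq_mat" where
  "Ei u v y = (\<chi> i j. (if i = j then 1 else 0) + u $ i * Bf v (axis j 1)
      - v $ i * cj (lam F) * Bf u (axis j 1) + u $ i * y * Bf u (axis j 1))"

abbreviation ET where "ET u v \<equiv> Ei u v 0"

lemma Ei_apply: "Ei u v y *v w =
    w + Bf v w *s u - (cj (lam F) * Bf u w) *s v + (y * Bf u w) *s u"
proof -
  have "(Ei u v y *v w) $ i = w $ i + Bf v w * u $ i - cj (lam F) * Bf u w * v $ i + y * Bf u w * u $ i" for i
  proof -
    have "(Ei u v y *v w) $ i = (\<Sum>j\<in>UNIV. (if i = j then w $ j else 0) + u $ i * (Bf v (axis j 1) * w $ j)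
      - v $ i * cj (lam F) * (Bf u (axis j 1) * w $ j) + u $ i * y * (Bf u (axis j 1) * w $ j))"
      unfolding matrix_vector_mult_def Ei_def by (auto intro!: sum.cong simp: algebra_simps)
    also have "\<dots> = w $ i + u $ i * Bf v w - v $ i * cj (lam F) * Bf u w + u $ i * y * Bf u w"
      unfolding sum.distrib sum_subtractf sum_distrib_left[symmetric] B_expand_right[symmetric] by simp
    finally show ?thesis by (simp add: ac_simps)
  qed
  then show ?thesis by (simp add: vec_eq_iff)
qed

lemma B_self_skew: "Bf u v = 0 \<longleftrightarrow> Bf v u = 0"
proof -
  have "Bf u v = 0 \<Longrightarrow> Bf v u = 0" for u v by (subst B_herm) simp
  then show ?thesis by blast
qed

text \<open>For a fixed vector \<open>u\<close> these transformations form a group of Heisenberg type, the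
  unipotent radical of the stabiliser of \<open>u\<close>; the centre is given by the scalar.\<close>

lemma Ei_mult:
  assumes "Bf u u = 0" "Bf u v = 0" "Bf u v' = 0"
  shows "Ei u v y ** Ei u v' y' = Ei u (v + v') (y + y' - Bf v v' * cj (lam F))"
proof -
  have [simp]: "Bf v u = 0" using assms B_self_skew by metis
  have "(Ei u v y ** Ei u v' y') *v w = Ei u (v + v') (y + y' - Bf v v' * cj (lam F)) *v w" for w
    unfolding matrix_vector_mul_assoc[symmetric]
    by (simp add: Ei_apply B_lin assms vec_eq_iff algebra_simps)
  then show ?thesis by (subst matrix_eq) blast
qed

lemma Ei_zero [simp]: "Ei u 0 0 = mat 1"
  by (subst matrix_eq) (simp add: Ei_apply B_lin)

lemma Ei_conj:
  assumes "\<And>u v. Bf (g *v u) (g *v v) = Bf u v"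
  shows "g ** Ei u v y = Ei (g *v u) (g *v v) y ** g"
proof -
  have "(g ** Ei u v y) *v w = (Ei (g *v u) (g *v v) y ** g) *v w" for w
    unfolding matrix_vector_mul_assoc[symmetric]
    by (simp add: Ei_apply assms matrix_vector_right_distrib matrix_vector_mult_diff_distrib matrix_vector_scale)
  then show ?thesis by (subst matrix_eq) blast
qed

lemma ET_swap: "ET u v = ET (- cj (lam F) *s v) u"
proof -
  have "ET u v *v w = ET (- cj (lam F) *s v) u *v w" for w
  proof -
    obtain A1 A2 where A: "lam F = A1" "cj A1 = A2" by blast
    have A': "A1 * A2 = 1" "cj A2 = A1" using A lam_cj by auto
    have A'': "A1 * (A2 * z) = z" for z using A'(1) by (metis mult.assoc mult_1)
    show ?thesis by (simp add: Ei_apply B_lin vec_eq_iff algebra_simps A A' A'')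
  qed
  then show ?thesis by (subst matrix_eq) blast
qed

lemma Ei_scale: "Ei (c *s u) v y = Ei u (cj c *s v) (y * c * cj c)"
  by (subst matrix_eq) (simp add: Ei_apply B_lin vec_eq_iff algebra_simps)

text \<open>The condition on the scalar says that the pair \<open>(v, y)\<close> lies in the Heisenberg-type
  group that parametrises the unipotent radical of \<open>u\<close>.\<close>

lemma Ei_isometry:
  assumes "Bf u u = 0" "Bf u v = 0" "lam F * y + cj y + Bf v v = 0"
  shows "Bf (Ei u v y *v w) (Ei u v y *v w') = Bf w w'"
proof -
  have vu: "Bf v u = 0" using assms(2) B_self_skew by metis
  have wu: "Bf w u = cj (Bf u w) * lam F" "Bf w v = cj (Bf v w) * lam F" by (rule B_herm)+
  have l: "lam F * cj (lam F) = 1" by simp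
  have y: "Bf v v = - (lam F * y) - cj y"
    using assms(3) by (metis (no_types, lifting) add_diff_cancel_left' add_uminus_conv_diff diff_0 minus_add_distrib)
  obtain A1 A2 where A: "lam F = A1" "cj A1 = A2" by blast
  have A': "A1 * A2 = 1" "cj A2 = A1" using A lam_cj by auto
  have A'': "A1 * (A2 * z) = z" for z using A'(1) by (metis mult.assoc mult_1)
  show ?thesis
    unfolding Ei_apply by (simp add: B_lin vu assms(1,2) wu y A A' A'' algebra_simps)
qed

end

section \<open>The Heisenberg group and elementary matrices\<close>

lemma ideal_UNIV_iff:
  "ideal I (ring_UNIV :: 'a::comm_ring_1 ring) \<longleftrightarrow>
     0 \<in> I \<and> (\<forall>x\<in>I. \<forall>y\<in>I. x + y \<in> I) \<and> (\<forall>r. \<forall>x\<in>I. r * x \<in> I)" (is "_ \<longleftrightarrow> ?R")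
proof
  assume "ideal I (ring_UNIV :: 'a ring)"
  note I = this additive_subgroup.zero_closed[OF ideal.axioms(1)[OF this]]
    additive_subgroup.a_closed[OF ideal.axioms(1)[OF this]] ideal.I_l_closed[OF this]
  have "0 \<in> I" using I(2) by (simp add: ring_of_type_algebra_def)
  moreover have "x + y \<in> I" if "x \<in> I" "y \<in> I" for x y
    using I(3)[OF that] by (simp add: ring_of_type_algebra_def)
  moreover have "r * x \<in> I" if "x \<in> I" for r x
    using I(4)[OF that, of r] by (simp add: ring_of_type_algebra_def)
  ultimately show ?R by blast
next
  assume R: ?R
  have R_minus: "- x \<in> I" if "x \<in> I" for x
    using R that by (metis mult_minus1)
  have R_right: "x * r \<in> I" if "x \<in> I" for x r
    using R that by (metis mult.commute)
  have inv: "inv\<^bsub>add_monoid (ring_UNIV :: 'a ring)\<^esub> x = - x" for x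
  proof -
    interpret ring "ring_UNIV :: 'a ring" by (rule ring_from_type_algebra)
    show ?thesis
      using minus_equality[of "- x" x] by (simp add: ring_of_type_algebra_def a_inv_def)
  qed
  show "ideal I (ring_UNIV :: 'a ring)"
  proof (rule idealI)
    show "ring (ring_UNIV :: 'a ring)" by (rule ring_from_type_algebra)
    show "subgroup I (add_monoid (ring_UNIV :: 'a ring))"
    proof
      show "I \<subseteq> carrier (add_monoid (ring_UNIV :: 'a ring))" by (simp add: ring_of_type_algebra_def)
      show "inv\<^bsub>add_monoid ring_UNIV\<^esub> x \<in> I" if "x \<in> I" for x using that R_minus inv by simp
    qed (use R in \<open>auto simp: ring_of_type_algebra_def\<close>)
  qed (use R R_right in \<open>auto simp: ring_of_type_algebra_def\<close>)
qed

lemma matrix_eqI: "(\<And>w. A *v w = B *v w) \<Longrightarrow> A = B" for A B :: "'a::semiring_1^'n^'m"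
  by (subst matrix_eq) blast

context hermitian_ring
begin

subsection \<open>The Heisenberg group\<close>

abbreviation hadd (infixl "\<boxplus>" 65) where "a \<boxplus> b \<equiv> a \<otimes>\<^bsub>heis F\<^esub> b"
abbreviation hsub (infixl "\<boxminus>" 65) where "a \<boxminus> b \<equiv> hminus F a b"
abbreviation hcirc (infixl "\<star>" 70) where "a \<star> r \<equiv> circ F a r"

lemma hadd_pair: "(x\<^sub>1, y\<^sub>1) \<boxplus> (x\<^sub>2, y\<^sub>2) = (x\<^sub>1 + x\<^sub>2, y\<^sub>1 + y\<^sub>2 - cj x\<^sub>1 * mu F * x\<^sub>2)"
  by (simp add: heis_def)

lemma heis_carrier [simp]: "carrier (heis F) = UNIV" by (simp add: heis_def)
lemma heis_one: "\<one>\<^bsub>heis F\<^esub> = (0, 0)" by (simp add: heis_def)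

lemma circ_pair: "(x, y) \<star> r = (x * r, cj r * y * r)" by (simp add: circ_def)

lemma group_heis: "group (heis F)"
proof (rule groupI)
  fix x assume "x \<in> carrier (heis F)"
  obtain a b where x: "x = (a, b)" by force
  show "\<exists>y\<in>carrier (heis F). y \<boxplus> x = \<one>\<^bsub>heis F\<^esub>"
    by (rule bexI[of _ "(- a, - b - cj a * mu F * a)"]) (simp_all add: x hadd_pair heis_one)
qed (auto simp: hadd_pair heis_one algebra_simps split: prod.splits)

lemma heis_inv: "inv\<^bsub>heis F\<^esub> (x, y) = (- x, - y - cj x * mu F * x)"
proof -
  interpret group "heis F" by (rule group_heis)
  show ?thesis by (rule inv_equality) (simp_all add: hadd_pair heis_one)
qed

lemma hminus_pair: "(x\<^sub>1, y\<^sub>1) \<boxminus> (x\<^sub>2, y\<^sub>2)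
    = (x\<^sub>1 - x\<^sub>2, y\<^sub>1 - y\<^sub>2 - cj x\<^sub>2 * mu F * x\<^sub>2 + cj x\<^sub>1 * mu F * x\<^sub>2)"
  by (simp add: hminus_def heis_inv hadd_pair)

lemma hadd_assoc: "a \<boxplus> b \<boxplus> c = a \<boxplus> (b \<boxplus> c)"
  using group.is_monoid[OF group_heis, THEN monoid.m_assoc, of a b c] by simp

lemma circ_hadd: "(a \<boxplus> b) \<star> r = a \<star> r \<boxplus> b \<star> r"
  by (cases a; cases b) (simp add: hadd_pair circ_pair algebra_simps)

lemma circ_hminus: "(a \<boxminus> b) \<star> r = a \<star> r \<boxminus> b \<star> r"
  by (cases a; cases b) (simp add: hminus_pair circ_pair algebra_simps)

lemma circ_inv: "(inv\<^bsub>heis F\<^esub> a) \<star> r = inv\<^bsub>heis F\<^esub> (a \<star> r)"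
  by (cases a) (simp add: heis_inv circ_pair algebra_simps)

lemma circ_circ: "a \<star> r \<star> s = a \<star> (r * s)"
  by (simp add: circ_def ac_simps)

lemma circ_one [simp]: "a \<star> 1 = a"
  by (simp add: circ_def)

text \<open>The scalar action is additive up to a trace, because the defining equation of
  \<open>Delta_max F\<close> turns the mixed terms into one.\<close>

lemma circ_plus:
  assumes "(x, y) \<in> Delta_max F"
  shows "(x, y) \<star> (r + s) = (x, y) \<star> r \<boxplus> (x, y) \<star> s \<boxplus> (0, tr (cj s * y * r))"
proof -
  have "cj x * mu F * x + y + cj y * lam F = 0"
    using assms by (simp add: Delta_max_def)
  then have *: "(cj x * mu F * x + y + cj y * lam F) * (s * cj r) = 0" by simp
  have "(x, y) \<star> (r + s) = (x, y) \<star> r \<boxplus> (x, y) \<star> s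
      \<boxplus> (0, tr (cj s * y * r) + (cj x * mu F * x + y + cj y * lam F) * (s * cj r))"
    by (simp add: circ_pair hadd_pair tr_def algebra_simps)
  then show ?thesis unfolding * by simp
qed

lemma Q_form_add: "Q_form F (u + v) = Q_form F u \<boxplus> Q_form F v \<boxplus> (0, Bf u v + tr (bq v u))"
  by (simp add: Q_form_eq hadd_pair q_add)

lemma Q_form_scale: "Q_form F (r *s u) = Q_form F u \<star> r"
  by (simp add: Q_form_eq circ_pair bq_lin ac_simps)

subsection \<open>Elementary matrices as Eichler transformations\<close>

abbreviation ax :: "'n::finite signed \<Rightarrow> 'a^'n signed" where "ax i \<equiv> axis i 1"

text \<open>A short root is written as the pair of the two basis vectors that span its isotropic
  plane. Up to a unit this is \<open>T_short F a (- b) x\<close>, but the two indices now play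
  symmetric roles.\<close>

definition Rt :: "'n::finite signed \<Rightarrow> 'n signed \<Rightarrow> 'a \<Rightarrow> ('a, 'n) sq_mat" where
  "Rt a b x = ET (axis a x) (ax b)"

definition Lt :: "'n::finite signed \<Rightarrow> 'a \<Rightarrow> 'a \<Rightarrow> ('a, 'n) sq_mat" where
  "Lt a x y = Ei (ax a) (axis 0 x) y"

lemma ring_UNIV_simps [simp]: "carrier (ring_UNIV :: 'a ring) = UNIV" "mult (ring_UNIV :: 'a ring) = (*)"
  "one (ring_UNIV :: 'a ring) = 1" "add (ring_UNIV :: 'a ring) = (+)" "zero (ring_UNIV :: 'a ring) = 0"
  by (simp_all add: ring_of_type_algebra_def)

lemma lam_pow_simps: "lam_pow F 0 = 1" "lam_pow F 1 = lam F" "lam_pow F (-1) = cj (lam F)"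
proof -
  interpret cring "ring_UNIV :: 'a ring" by (rule cring_from_type_algebra)
  show "lam_pow F 0 = 1" by (simp add: lam_pow_def int_pow_def2)
  show "lam_pow F 1 = lam F" by (simp add: lam_pow_def int_pow_def2)
  have "inv\<^bsub>ring_UNIV\<^esub> (lam F) = cj (lam F)"
    by (rule comm_inv_char) simp_all
  then show "lam_pow F (-1) = cj (lam F)" by (simp add: lam_pow_def int_pow_def2)
qed

lemma mat_unit_apply: "(mat_unit x i j :: ('a, 'n::finite) sq_mat) *v w = axis i (x * w $ j)"
proof -
  have "(mat_unit x i j *v w) $ k = (axis i (x * w $ j) :: 'a^'n signed) $ k" for k
  proof -
    have "(mat_unit x i j *v w) $ k = (\<Sum>l\<in>UNIV. if l = j then (if k = i then x * w $ j else 0) else 0)"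
      unfolding matrix_vector_mult_def mat_unit_def vec_lambda_beta by (intro sum.cong) auto
    also have "\<dots> = axis i (x * w $ j) $ k" by (simp add: axis_def)
    finally show ?thesis .
  qed
  then show ?thesis by (simp add: vec_eq_iff)
qed

lemma axis_scale: "c *s axis i x = axis i (c * x)" for c :: 'a
  by (simp add: vec_eq_iff axis_def)

lemma axis_add: "axis i x + axis i y = axis i (x + y)" for x :: 'a
  by (simp add: vec_eq_iff axis_def)

lemma axis_minus: "- axis i x = axis i (- x)" for x :: 'a
  by (simp add: vec_eq_iff axis_def)

lemma lam_pow_kap:
  assumes "j \<noteq> 0"
  shows "lam_pow F ((eps j - 1) div 2) = cj (lam F) * kap (- j)"
    and "lam_pow F ((1 - eps j) div 2) = kap j"
    and "lam_pow F (- ((1 + eps j) div 2)) = cj (lam F) * kap j"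
  using assms lam_pow_simps by (cases j; auto simp: eps_def zero_signed_def kap_def)+

lemma T_short_eq_Rt:
  assumes "i \<noteq> 0" "j \<noteq> 0"
  shows "T_short F i j x = Rt i (- j) (x * cj (kap (- j)))"
proof (rule matrix_eqI)
  fix w
  obtain A1 A2 where A: "kap (- j) = A1" "cj A1 = A2" by blast
  have A': "A1 * A2 = 1" using assms A kap_unit[of "- j"] by auto
  have A'': "A1 * (A2 * z) = z" for z using A' by (metis mult.assoc mult_1)
  show "T_short F i j x *v w = Rt i (- j) (x * cj (kap (- j))) *v w"
    using assms
    by (simp add: T_short_def Rt_def Ei_apply mat_unit_apply B_axis_left lam_pow_kap
        matrix_vector_mult_add_rdistrib matrix_vector_mult_diff_rdistrib axis_scale)
       (simp add: vec_eq_iff axis_def A A' A'' algebra_simps)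
qed

lemma Rt_eq_T_short:
  assumes "i \<noteq> 0" "j \<noteq> 0"
  shows "Rt i j x = T_short F i (- j) (x * kap j)"
proof -
  have "kap j * cj (kap j) = 1" using assms by (intro kap_unit) simp
  then show ?thesis using assms by (subst T_short_eq_Rt) (simp_all add: mult.assoc)
qed

lemma T_long_eq_Lt:
  assumes "i \<noteq> 0"
  shows "T_long F i (x, y) = Lt i (- x * lam F * cj (kap i)) (y * cj (kap i))"
proof (rule matrix_eqI)
  fix w
  obtain A1 A2 where A: "lam F = A1" "cj A1 = A2" by blast
  have A': "A1 * A2 = 1" "cj A2 = A1" using A lam_cj by auto
  have A'': "A1 * (A2 * z) = z" for z using A'(1) by (metis mult.assoc mult_1)
  obtain A3 A4 where K: "kap i = A3" "cj A3 = A4" by blast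
  have K': "A3 * A4 = 1" "cj A4 = A3" using assms K kap_unit[of i] by auto
  have K'': "A3 * (A4 * z) = z" for z using K' by (metis mult.assoc mult_1)
  show "T_long F i (x, y) *v w = Lt i (- x * lam F * cj (kap i)) (y * cj (kap i)) *v w"
    using assms
    by (simp add: T_long_def Lt_def Ei_apply mat_unit_apply B_axis_left lam_pow_kap
        matrix_vector_mult_add_rdistrib matrix_vector_mult_diff_rdistrib axis_scale)
       (simp add: vec_eq_iff axis_def algebra_simps A A' A'' K K' K'')
qed

end

context hermitian_form_ring
begin

section \<open>The odd form parameter\<close>

abbreviation \<Delta> where "\<Delta> \<equiv> Delta F"
abbreviation JD where "JD \<equiv> J_Delta F"

lemma Delta_subgroup: "subgroup \<Delta> (heis F)"
  using Delta_submodule by (simp add: bullet_submodule_def)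

lemma Delta_circ: "a \<in> \<Delta> \<Longrightarrow> a \<star> r \<in> \<Delta>"
  using Delta_submodule by (auto simp: bullet_submodule_def)

lemma Delta_add: "a \<in> \<Delta> \<Longrightarrow> b \<in> \<Delta> \<Longrightarrow> a \<boxplus> b \<in> \<Delta>"
  using subgroup.m_closed[OF Delta_subgroup] .

lemma Delta_inv: "a \<in> \<Delta> \<Longrightarrow> inv\<^bsub>heis F\<^esub> a \<in> \<Delta>"
  using subgroup.m_inv_closed[OF Delta_subgroup] .

lemma Delta_minus: "a \<in> \<Delta> \<Longrightarrow> b \<in> \<Delta> \<Longrightarrow> a \<boxminus> b \<in> \<Delta>"
  by (simp add: hminus_def Delta_add Delta_inv)

lemma Delta_tr: "(0, tr x) \<in> \<Delta>"
  using Delta_min_le by (auto simp: Delta_min_def trace_pairs_def tr_def)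

lemma Delta_zero: "(0, 0) \<in> \<Delta>"
  using Delta_tr[of 0] by simp

lemma Delta_in_max: "a \<in> \<Delta> \<Longrightarrow> a \<in> Delta_max F"
  using Delta_le_max by blast

lemma Delta_maxD: "(x, y) \<in> \<Delta> \<Longrightarrow> cj x * mu F * x + y + cj y * lam F = 0"
  using Delta_in_max by (auto simp: Delta_max_def)

lemma JD_I: "(x, y) \<in> \<Delta> \<Longrightarrow> x \<in> JD"
  by (auto simp: J_Delta_def)

lemma JD_E: assumes "x \<in> JD" obtains y where "(x, y) \<in> \<Delta>"
  using assms by (auto simp: J_Delta_def)

lemma JD_zero: "0 \<in> JD" using Delta_zero JD_I by blast

lemma JD_add: "x \<in> JD \<Longrightarrow> y \<in> JD \<Longrightarrow> x + y \<in> JD"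
  by (elim JD_E) (drule (1) Delta_add, auto simp: hadd_pair intro: JD_I)

lemma JD_mult: "x \<in> JD \<Longrightarrow> x * r \<in> JD"
  by (elim JD_E) (drule Delta_circ[of _ r], auto simp: circ_pair intro: JD_I)

section \<open>The unitary group\<close>

abbreviation UG :: "('a, 'n::finite) sq_mat monoid" where "UG \<equiv> U_grp F"
abbreviation UU :: "('a, 'n::finite) sq_mat set" where "UU \<equiv> carrier UG"

lemma UG_simps [simp]: "mult UG = (**)" "one UG = mat 1"
  by (simp_all add: U_grp_def GL_def)

lemma in_UU: "\<sigma> \<in> UU \<longleftrightarrow> invertible \<sigma> \<and> (\<forall>u v. Bf (\<sigma> *v u) (\<sigma> *v v) = Bf u v) \<and>
   (\<forall>u. Q_form F (\<sigma> *v u) \<boxminus> Q_form F u \<in> \<Delta>)"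
  by (simp add: U_grp_def GL_def heis_cong_def)

lemma UU_B: "\<sigma> \<in> UU \<Longrightarrow> Bf (\<sigma> *v u) (\<sigma> *v v) = Bf u v" by (simp add: in_UU)
lemma UU_Q: "\<sigma> \<in> UU \<Longrightarrow> Q_form F (\<sigma> *v u) \<boxminus> Q_form F u \<in> \<Delta>" by (simp add: in_UU)

lemma hminus_trans: "(a \<boxminus> b) \<boxplus> (b \<boxminus> c) = a \<boxminus> c"
  by (cases a; cases b; cases c) (simp add: hminus_pair hadd_pair algebra_simps)

lemma hminus_swap: "inv\<^bsub>heis F\<^esub> (a \<boxminus> b) = b \<boxminus> a"
  by (cases a; cases b) (simp add: hminus_pair heis_inv algebra_simps)

lemma hminus_self: "a \<boxminus> a = (0, 0)"
  by (cases a) (simp add: hminus_pair)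

lemma group_UG: "group (UG :: ('a, 'n::finite) sq_mat monoid)"
proof (rule groupI)
  show "x \<otimes>\<^bsub>UG\<^esub> y \<in> UU" if x: "x \<in> UU" and y: "y \<in> UU" for x y :: "('a, 'n) sq_mat"
  proof -
    have inv: "invertible (x ** y)" using x y by (simp add: in_UU invertible_mult)
    have "Q_form F (x *v (y *v u)) \<boxminus> Q_form F u \<in> \<Delta>" for u
      using Delta_add[OF UU_Q[OF x, of "y *v u"] UU_Q[OF y, of u]] by (simp add: hminus_trans)
    then show ?thesis using x y inv by (simp add: in_UU matrix_vector_mul_assoc[symmetric])
  qed
  show "x \<otimes>\<^bsub>UG\<^esub> y \<otimes>\<^bsub>UG\<^esub> z = x \<otimes>\<^bsub>UG\<^esub> (y \<otimes>\<^bsub>UG\<^esub> z)" for x y z :: "('a, 'n) sq_mat"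
    by (simp add: matrix_mul_assoc)
  show "\<one>\<^bsub>UG\<^esub> \<in> (UU :: ('a, 'n) sq_mat set)"
    unfolding in_UU by (simp add: hminus_self Delta_zero) (auto simp: invertible_def intro: exI[of _ "mat 1"])
  show "\<one>\<^bsub>UG\<^esub> \<otimes>\<^bsub>UG\<^esub> x = x" for x :: "('a, 'n) sq_mat" by simp
  show "\<exists>y\<in>UU. y \<otimes>\<^bsub>UG\<^esub> x = \<one>\<^bsub>UG\<^esub>" if x: "x \<in> UU" for x :: "('a, 'n) sq_mat"
  proof -
    obtain x' where x': "x ** x' = mat 1" "x' ** x = mat 1" using x by (auto simp: in_UU invertible_def)
    have c: "x *v (x' *v u) = u" for u by (simp add: matrix_vector_mul_assoc x')
    have "x' \<in> UU"
      unfolding in_UU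
    proof (intro conjI allI)
      show "invertible x'" using x' by (auto simp: invertible_def)
      show "Bf (x' *v u) (x' *v v) = Bf u v" for u v
        using UU_B[OF x, of "x' *v u" "x' *v v"] by (simp add: c)
      show "Q_form F (x' *v u) \<boxminus> Q_form F u \<in> \<Delta>" for u
        using Delta_inv[OF UU_Q[OF x, of "x' *v u"]] by (simp add: c hminus_swap)
    qed
    then show ?thesis using x' by auto
  qed
qed

abbreviation iv :: "('a, 'n::finite) sq_mat \<Rightarrow> ('a, 'n) sq_mat" where "iv \<sigma> \<equiv> inv\<^bsub>UG\<^esub> \<sigma>"

lemma iv_UU: "\<sigma> \<in> UU \<Longrightarrow> iv \<sigma> \<in> UU" by (rule group.inv_closed[OF group_UG])
lemma mult_UU: "\<sigma> \<in> UU \<Longrightarrow> \<tau> \<in> UU \<Longrightarrow> \<sigma> ** \<tau> \<in> UU"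
  using monoid.m_closed[OF group.is_monoid[OF group_UG]] by simp
lemma one_UU: "mat 1 \<in> UU" using monoid.one_closed[OF group.is_monoid[OF group_UG]] by simp
lemma iv_right: "\<sigma> \<in> UU \<Longrightarrow> \<sigma> ** iv \<sigma> = mat 1" using group.r_inv[OF group_UG, of \<sigma>] by simp
lemma iv_left: "\<sigma> \<in> UU \<Longrightarrow> iv \<sigma> ** \<sigma> = mat 1" using group.l_inv[OF group_UG, of \<sigma>] by simp
lemma iv_unique: "\<sigma> \<in> UU \<Longrightarrow> \<tau> \<in> UU \<Longrightarrow> \<tau> ** \<sigma> = mat 1 \<Longrightarrow> iv \<sigma> = \<tau>"
  using group.inv_equality[OF group_UG, of \<tau> \<sigma>] by simp
lemma iv_iv: "\<sigma> \<in> UU \<Longrightarrow> iv (iv \<sigma>) = \<sigma>" by (rule group.inv_inv[OF group_UG])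
lemma iv_mult: "\<sigma> \<in> UU \<Longrightarrow> \<tau> \<in> UU \<Longrightarrow> iv (\<sigma> ** \<tau>) = iv \<tau> ** iv \<sigma>"
  using group.inv_mult_group[OF group_UG, of \<sigma> \<tau>] by simp
lemma iv_apply: "\<sigma> \<in> UU \<Longrightarrow> iv \<sigma> *v (\<sigma> *v u) = u" "\<sigma> \<in> UU \<Longrightarrow> \<sigma> *v (iv \<sigma> *v u) = u"
  by (simp_all add: matrix_vector_mul_assoc iv_left iv_right)

lemma iv_B: "\<sigma> \<in> UU \<Longrightarrow> Bf u (iv \<sigma> *v v) = Bf (\<sigma> *v u) v"
  using UU_B[of \<sigma> u "iv \<sigma> *v v"] by (simp add: iv_apply)

lemma Ei_conj_UU: "g \<in> UU \<Longrightarrow> g ** Ei u v y ** iv g = Ei (g *v u) (g *v v) y"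
proof -
  assume g: "g \<in> UU"
  have "g ** Ei u v y ** iv g = Ei (g *v u) (g *v v) y ** (g ** iv g)"
    using Ei_conj[of g u v y] UU_B[OF g] by (simp add: matrix_mul_assoc)
  then show ?thesis by (simp add: iv_right[OF g])
qed

lemma Ei_invertible:
  assumes "Bf u u = 0" "Bf u v = 0" "lam F * y + cj y + Bf v v = 0"
  shows "invertible (Ei u v y)" and "Ei u (- v) (- y - Bf v v * cj (lam F)) ** Ei u v y = mat 1"
proof -
  let ?y = "- y - Bf v v * cj (lam F)"
  have a: "Ei u v y ** Ei u (- v) ?y = mat 1"
    using assms by (subst Ei_mult) (simp_all add: B_lin)
  show b: "Ei u (- v) ?y ** Ei u v y = mat 1"
    using assms by (subst Ei_mult) (simp_all add: B_lin)
  show "invertible (Ei u v y)" unfolding invertible_def using a b by blast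
qed

lemma hminus_0: "((x, y) \<boxplus> (0, t)) \<boxminus> (x, y) = (0, t)"
  by (simp add: hadd_pair hminus_pair)

text \<open>Traces belong to every form parameter, so this formula makes short root elements
  unitary, and it shows how they act on quadratic data modulo any form ideal.\<close>

lemma Q_form_Rt:
  assumes "a \<noteq> 0" "b \<noteq> 0" "a \<noteq> b" "a \<noteq> - b"
  shows "Q_form F (Rt a b x *v w) = Q_form F w \<boxplus> (0, tr (cj (Bf (axis a x) w) * lam F * Bf (ax b) w
     + bq (Bf (ax b) w *s axis a x - (cj (lam F) * Bf (axis a x) w) *s ax b) w))"
proof -
  define d where "d = Bf (ax b) w *s axis a x - (cj (lam F) * Bf (axis a x) w) *s ax b"
  have *: "Rt a b x *v w = w + d" by (simp add: Rt_def Ei_apply d_def)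
  have ab: "- a \<noteq> b" "- b \<noteq> a" using assms by auto
  have "Q_form F d = (0, 0)"
    using assms ab by (simp add: d_def Q_form_eq bq_lin bq_axis_left axis_scale) (auto simp: axis_def)
  moreover have "Bf w d = tr (cj (Bf (axis a x) w) * lam F * Bf (ax b) w)"
  proof -
    have 1: "Bf w (axis a x) = cj (Bf (axis a x) w) * lam F" "Bf w (ax b) = cj (Bf (ax b) w) * lam F"
      by (rule B_herm)+
    obtain A1 A2 where A: "lam F = A1" "cj A1 = A2" by blast
    have A': "A1 * A2 = 1" "cj A2 = A1" using A lam_cj by auto
    have A'': "A1 * (A2 * z) = z" for z using A'(1) by (metis mult.assoc mult_1)
    show ?thesis unfolding d_def B_lin 1 tr_def by (simp add: A A' A'' algebra_simps)
  qed
  ultimately show ?thesis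
    unfolding * Q_form_add d_def[symmetric] by (simp add: tr_add Q_form_eq hadd_pair)
qed

lemma Rt_UU:
  assumes "a \<noteq> 0" "b \<noteq> 0" "a \<noteq> b" "a \<noteq> - b"
  shows "Rt a b x \<in> UU"
  unfolding in_UU
proof (intro conjI allI)
  have ab: "- a \<noteq> b" "- b \<noteq> a" using assms by auto
  have c: "Bf (axis a x) (axis a x) = 0" "Bf (axis a x) (ax b) = 0" "lam F * 0 + cj 0 + Bf (ax b) (ax b) = 0"
    using assms ab by (auto simp: B_axis_axis)
  show "invertible (Rt a b x)" unfolding Rt_def by (rule Ei_invertible[OF c])
  show "Bf (Rt a b x *v u) (Rt a b x *v v) = Bf u v" for u v
    unfolding Rt_def by (rule Ei_isometry[OF c])
  show "Q_form F (Rt a b x *v u) \<boxminus> Q_form F u \<in> \<Delta>" for u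
    unfolding Q_form_Rt[OF assms] by (simp only: Q_form_eq hminus_0 Delta_tr)
qed

text \<open>The order of the two summands depends on the sign of the index, since the Heisenberg
  group is not commutative; keeping both formulas exact avoids congruences later.\<close>

lemma Q_form_T_long_Pos:
  "Q_form F (T_long F (Pos k) (x, y) *v w) = Q_form F w \<boxplus> (x, cj y) \<star> (w $ Neg k)"
proof -
  obtain A1 A2 where A: "lam F = A1" "cj A1 = A2" by blast
  have A': "A1 * A2 = 1" "cj A2 = A1" using A lam_cj by auto
  have A'': "A1 * (A2 * z) = z" for z using A'(1) by (metis mult.assoc mult_1)
  have v: "T_long F (Pos k) (x, y) *v w = w + axis 0 (x * w $ Neg k)
     + axis (Pos k) (y * w $ Neg k - cj (lam F) * cj x * mu F * w $ 0)"
    by (simp add: T_long_def mat_unit_apply lam_pow_simps eps_def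
        matrix_vector_mult_add_rdistrib matrix_vector_mult_diff_rdistrib)
      (simp add: vec_eq_iff axis_def zero_signed_def algebra_simps)
  show ?thesis unfolding v
    by (simp add: Q_form_eq bq_lin bq_axis_left bq_axis_right hadd_pair circ_pair cj_mu)
      (simp add: zero_signed_def axis_def image_iff A A' A'' algebra_simps)
qed

lemma Q_form_T_long_Neg:
  "Q_form F (T_long F (Neg k) (x, y) *v w) = (x, y) \<star> (w $ Pos k) \<boxplus> Q_form F w"
proof -
  have v: "T_long F (Neg k) (x, y) *v w = w + axis 0 (x * w $ Pos k)
     + axis (Neg k) (y * w $ Pos k - cj x * mu F * w $ 0)"
    by (simp add: T_long_def mat_unit_apply lam_pow_simps eps_def image_iff
        matrix_vector_mult_add_rdistrib matrix_vector_mult_diff_rdistrib)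
      (simp add: vec_eq_iff axis_def zero_signed_def algebra_simps)
  show ?thesis unfolding v
    by (simp add: Q_form_eq bq_lin bq_axis_left bq_axis_right hadd_pair circ_pair cj_mu)
      (simp add: zero_signed_def axis_def image_iff algebra_simps)
qed

text \<open>\<open>Lo i \<alpha>\<close> is the long root element of index \<open>i\<close> whose parameter, brought back to \<open>\<Delta>\<close>,
  is \<open>\<alpha>\<close>.\<close>

definition Lo :: "'n::finite signed \<Rightarrow> 'a \<times> 'a \<Rightarrow> ('a, 'n) sq_mat" where
  "Lo i \<alpha> = T_long F i (fst \<alpha>, if i \<in> Theta_pos then cj (snd \<alpha>) else snd \<alpha>)"

lemma Lo_range: "{T_long F i \<alpha> | \<alpha>. \<alpha> \<in> signed_param F \<Omega> (- eps i)} = Lo i ` \<Omega>" if "i \<noteq> 0"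
proof (cases "i \<in> Theta_pos")
  case True
  then have "{T_long F i \<alpha> | \<alpha>. \<alpha> \<in> signed_param F \<Omega> (- eps i)} = {T_long F i (x, y) | x y. (x, cj y) \<in> \<Omega>}"
    by (auto simp: signed_param_def eps_def)
  also have "\<dots> = Lo i ` \<Omega>"
    using True by (force simp: Lo_def image_iff)
  finally show ?thesis .
qed (auto simp: signed_param_def eps_def Lo_def)

lemma Q_form_Lo:
  "Q_form F (Lo (Pos k) \<alpha> *v w) = Q_form F w \<boxplus> \<alpha> \<star> (w $ Neg k)"
  "Q_form F (Lo (Neg k) \<alpha> *v w) = \<alpha> \<star> (w $ Pos k) \<boxplus> Q_form F w"
  by (cases \<alpha>, simp add: Lo_def Q_form_T_long_Pos Q_form_T_long_Neg image_iff)+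

lemma Lo_eq_Ei:
  assumes "i \<noteq> 0"
  shows "Lo i (x, y) = Ei (ax i) (axis 0 (- x * lam F * cj (kap i)))
     (if i \<in> Theta_pos then cj y else y * cj (lam F))"
  using assms by (cases i) (auto simp: Lo_def T_long_eq_Lt Lt_def zero_signed_def)

lemma Lo_Ei_iso:
  assumes "i \<noteq> 0" "(x, y) \<in> Delta_max F"
  shows "lam F * (if i \<in> Theta_pos then cj y else y * cj (lam F)) + cj (if i \<in> Theta_pos then cj y else y * cj (lam F))
     + Bf (axis 0 (- x * lam F * cj (kap i))) (axis 0 (- x * lam F * cj (kap i)) :: 'a^'n::finite signed) = 0"
proof -
  have D: "cj x * mu F * x + y + cj y * lam F = 0"
    using assms by (simp add: Delta_max_def)
  have k: "kap i * cj (kap i) = 1" using assms(1) by (rule kap_unit)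
  have "cj (- x * lam F * cj (kap i)) * mu F * (- x * lam F * cj (kap i))
    = cj x * mu F * x * (lam F * cj (lam F)) * (kap i * cj (kap i))"
    unfolding cj_mult cj_minus cj_cj by (simp only: ac_simps minus_mult_minus mult_minus_left mult_minus_right minus_minus)
  also have "\<dots> = cj x * mu F * x" unfolding k by simp
  finally have "Bf (axis 0 (- x * lam F * cj (kap i))) (axis 0 (- x * lam F * cj (kap i)) :: 'a^'n signed) = cj x * mu F * x"
    by (simp add: B_axis_axis)
  moreover have "lam F * (y * cj (lam F)) = y" by (metis mult.commute mult.assoc lam_cj mult_1)
  ultimately show ?thesis using D by (auto simp: algebra_simps)
qed

lemma hminus_hadd_normal: "(a \<boxplus> b) \<boxminus> a = b \<boxplus> (0, tr (- (cj (fst a) * mu F * fst b)))"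
proof -
  obtain A1 A2 where A: "lam F = A1" "cj A1 = A2" by blast
  have A': "A1 * A2 = 1" using A lam_cj by auto
  have A'': "A1 * (A2 * z) = z" for z using A' by (metis mult.assoc mult_1)
  obtain A3 where M: "mu F = A3" "cj A3 = A2 * A3" using cj_mu A by (metis mult.commute)
  show ?thesis by (cases a; cases b) (simp add: hadd_pair hminus_pair tr_def M A A' A'' algebra_simps)
qed

lemma hadd_hminus: "(b \<boxplus> a) \<boxminus> a = b"
  by (cases a; cases b) (simp add: hadd_pair hminus_pair algebra_simps)

lemma Lo_UU:
  assumes "i \<noteq> 0" "\<alpha> \<in> \<Delta>"
  shows "Lo i \<alpha> \<in> (UU :: ('a, 'n::finite) sq_mat set)"
  unfolding in_UU
proof (intro conjI allI)
  obtain x y where \<alpha>: "\<alpha> = (x, y)" by force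
  let ?v = "axis 0 (- x * lam F * cj (kap i)) :: 'a^'n signed"
  have c: "Bf (ax i) (ax i :: 'a^'n signed) = 0" "Bf (ax i) ?v = 0" using assms by (auto simp: B_axis_axis)
  note c' = Lo_Ei_iso[OF assms(1) Delta_in_max[OF assms(2)[unfolded \<alpha>]]]
  show "invertible (Lo i \<alpha>)" unfolding \<alpha> Lo_eq_Ei[OF assms(1)] by (rule Ei_invertible[OF c c'])
  show "Bf (Lo i \<alpha> *v u) (Lo i \<alpha> *v v) = Bf u v" for u v
    unfolding \<alpha> Lo_eq_Ei[OF assms(1)] by (rule Ei_isometry[OF c c'])
  show "Q_form F (Lo i \<alpha> *v u) \<boxminus> Q_form F u \<in> \<Delta>" for u
  proof (cases i)
    case (Pos k)
    show ?thesis unfolding Pos Q_form_Lo hminus_hadd_normal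
      by (intro Delta_add Delta_circ Delta_tr assms)
  next
    case (Neg k)
    show ?thesis unfolding Neg Q_form_Lo hadd_hminus
      by (intro Delta_circ assms)
  qed (use assms in \<open>simp add: zero_signed_def\<close>)
qed

lemma Lo_mult:
  "Lo (Pos k) \<alpha> ** Lo (Pos k) \<beta> = Lo (Pos k) (\<beta> \<boxplus> \<alpha>)"
  "Lo (Neg k) \<alpha> ** Lo (Neg k) \<beta> = Lo (Neg k) (\<alpha> \<boxplus> \<beta>)"
proof -
  obtain x y x' y' where \<alpha>: "\<alpha> = (x, y)" "\<beta> = (x', y')" by force
  obtain A1 A2 where A: "lam F = A1" "cj A1 = A2" by blast
  have A': "A1 * A2 = 1" "cj A2 = A1" using A lam_cj by auto
  have A'': "A1 * (A2 * z) = z" for z using A'(1) by (metis mult.assoc mult_1)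
  obtain A3 where M: "mu F = A3" "cj A3 = A2 * A3" using cj_mu A by (metis mult.commute)
  show "Lo (Pos k) \<alpha> ** Lo (Pos k) \<beta> = Lo (Pos k) (\<beta> \<boxplus> \<alpha>)"
    unfolding \<alpha> hadd_pair
    by (simp add: Lo_eq_Ei B_axis_axis Ei_mult axis_add axis_minus)
       (simp add: A A' A'' M algebra_simps, simp only: diff_conv_add_uminus add.commute)
  show "Lo (Neg k) \<alpha> ** Lo (Neg k) \<beta> = Lo (Neg k) (\<alpha> \<boxplus> \<beta>)"
    unfolding \<alpha> hadd_pair
    by (simp add: Lo_eq_Ei B_axis_axis Ei_mult axis_add axis_minus image_iff)
       (simp add: A A' A'' M algebra_simps)
qed

lemma axis_0 [simp]: "axis i 0 = 0"
  by (simp add: vec_eq_iff axis_def)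

lemma Lo_zero: "Lo i (0, 0) = mat 1" if "i \<noteq> 0"
  using that by (simp add: Lo_eq_Ei)

lemma Rt_mult:
  assumes "a \<noteq> 0" "b \<noteq> 0" "a \<noteq> b" "a \<noteq> - b"
  shows "Rt a b x ** Rt a b y = Rt a b (x + y)"
proof -
  have ab: "- a \<noteq> b" "- b \<noteq> a" using assms by auto
  have *: "Rt a b x = Ei (ax a) (axis b (cj x)) 0" for x
  proof -
    have "axis a x = x *s (ax a :: 'a^'c signed)" "axis b (cj x) = cj x *s (ax b :: 'a^'c signed)"
      by (simp_all add: axis_scale)
    then show ?thesis unfolding Rt_def by (simp add: Ei_scale)
  qed
  show ?thesis unfolding * using assms ab by (subst Ei_mult) (auto simp: B_axis_axis axis_add)
qed

lemma Rt_zero: "Rt a b 0 = mat 1"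
  by (rule matrix_eqI) (simp add: Rt_def Ei_apply B_lin)

lemma iv_Rt:
  assumes "a \<noteq> 0" "b \<noteq> 0" "a \<noteq> b" "a \<noteq> - b"
  shows "iv (Rt a b x) = Rt a b (- x)"
  using assms by (intro iv_unique Rt_UU) (simp_all add: Rt_mult Rt_zero)

lemma hadd_inv: "a \<boxplus> inv\<^bsub>heis F\<^esub> a = (0, 0)" "inv\<^bsub>heis F\<^esub> a \<boxplus> a = (0, 0)"
  by (cases a, simp add: heis_inv hadd_pair)+

lemma iv_Lo:
  assumes "i \<noteq> 0" "\<alpha> \<in> \<Delta>"
  shows "iv (Lo i \<alpha>) = Lo i (inv\<^bsub>heis F\<^esub> \<alpha>)"
proof (rule iv_unique)
  show "Lo i \<alpha> \<in> UU" "Lo i (inv\<^bsub>heis F\<^esub> \<alpha>) \<in> UU" using assms by (auto intro: Lo_UU Delta_inv)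
  have "Lo i (0, 0) = mat 1" using assms Lo_zero by blast
  then show "Lo i (inv\<^bsub>heis F\<^esub> \<alpha>) ** Lo i \<alpha> = mat 1"
    using assms(1) by (cases i) (simp_all add: Lo_mult hadd_inv zero_signed_def)
qed

lemma ax_M [simp]: "i \<noteq> 0 \<Longrightarrow> axis i x \<in> M_Delta F"
  by (simp add: M_Delta_def axis_def JD_zero)

lemma ax0_M: "y \<in> JD \<Longrightarrow> axis 0 y \<in> M_Delta F"
  by (simp add: M_Delta_def axis_def)

lemma UU_M: "\<sigma> \<in> UU \<Longrightarrow> u \<in> M_Delta F \<Longrightarrow> \<sigma> *v u \<in> M_Delta F"
proof -
  assume "\<sigma> \<in> UU" "u \<in> M_Delta F"
  then have "(\<sigma> *v u) $ 0 - u $ 0 \<in> JD" "u $ 0 \<in> JD"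
    using UU_Q[of \<sigma> u] by (auto simp: Q_form_eq hminus_pair M_Delta_def intro: JD_I)
  from JD_add[OF this] show ?thesis by (simp add: M_Delta_def)
qed

lemma M_add: "u \<in> M_Delta F \<Longrightarrow> v \<in> M_Delta F \<Longrightarrow> u + v \<in> M_Delta F"
  by (simp add: M_Delta_def JD_add)

text \<open>A vector together with a scalar that corrects its quadratic value. If the result lies in
  \<open>\<Delta>\<close>, it does so for the image under every unitary transformation and the same scalar.
  In this way the pairs in \<open>\<Delta>\<close>, which belong to multiples of the zeroth basis vector,
  are moved to arbitrary vectors of \<open>M_Delta F\<close>.\<close>

definition P :: "'a^'n::finite signed \<Rightarrow> 'a \<Rightarrow> 'a \<times> 'a" where
  "P u \<zeta> = (u $ 0, q u + \<zeta>)"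

lemma P_Q: "P u \<zeta> = Q_form F u \<boxplus> (0, \<zeta>)" by (simp add: P_def Q_form_eq hadd_pair)

lemma P_diff: "P u \<zeta> \<boxminus> P v \<zeta> = Q_form F u \<boxminus> Q_form F v"
  by (simp add: P_def Q_form_eq hminus_pair)

lemma P_UU: "\<sigma> \<in> UU \<Longrightarrow> P u \<zeta> \<in> \<Delta> \<Longrightarrow> P (\<sigma> *v u) \<zeta> \<in> \<Delta>"
proof -
  assume \<sigma>: "\<sigma> \<in> UU" and P: "P u \<zeta> \<in> \<Delta>"
  have "(P (\<sigma> *v u) \<zeta> \<boxminus> P u \<zeta>) \<boxplus> P u \<zeta> \<in> \<Delta>"
    unfolding P_diff using \<sigma> P by (intro Delta_add UU_Q)
  moreover have "(a \<boxminus> b) \<boxplus> b = a" for a b by (cases a; cases b) (simp add: hminus_pair hadd_pair algebra_simps)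
  ultimately show ?thesis by simp
qed

text \<open>The scalar may be distributed over the two summands in any way. In the applications \<open>\<xi>\<close>
  is chosen such that both summands lie in \<open>\<Delta>\<close>.\<close>

lemma P_add: "P (u + v) \<zeta> = P u \<xi> \<boxplus> P v (\<zeta> + Bf u v - \<xi>) \<boxplus> (0, tr (bq v u))"
  by (simp add: P_def q_add hadd_pair)

lemma P_M: "P u \<zeta> \<in> \<Delta> \<Longrightarrow> u \<in> M_Delta F"
  by (auto simp: P_def M_Delta_def intro: JD_I)

lemma M_P: assumes "u \<in> M_Delta F" obtains \<zeta> where "P u \<zeta> \<in> \<Delta>"
proof -
  obtain z where "(u $ 0, z) \<in> \<Delta>" using assms by (auto simp: M_Delta_def J_Delta_def)
  then have "P u (z - q u) \<in> \<Delta>" by (simp add: P_def)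
  then show ?thesis using that by blast
qed

end

section \<open>Scalars modulo a form ideal\<close>

locale inv_ideal = hermitian_form_ring F
  for F :: "('a::comm_ring_1, 'b) form_data_scheme" +
  fixes I :: "'a set"
  assumes I_ideal: "ideal I ring_UNIV" and I_inv: "involution_invariant F I"
begin

lemma I_zero [simp]: "0 \<in> I" using I_ideal by (simp add: ideal_UNIV_iff)
lemma I_add: "x \<in> I \<Longrightarrow> y \<in> I \<Longrightarrow> x + y \<in> I" using I_ideal by (simp add: ideal_UNIV_iff)
lemma I_mult: "x \<in> I \<Longrightarrow> r * x \<in> I" using I_ideal by (simp add: ideal_UNIV_iff)
lemma I_mult2: "x \<in> I \<Longrightarrow> x * r \<in> I" by (subst mult.commute) (rule I_mult)
lemma I_minus: "x \<in> I \<Longrightarrow> - x \<in> I" using I_mult[of x "-1"] by simp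
lemma I_diff: "x \<in> I \<Longrightarrow> y \<in> I \<Longrightarrow> x - y \<in> I" using I_add[of x "- y"] I_minus by simp
lemma I_cj: "x \<in> I \<Longrightarrow> cj x \<in> I" using I_inv by (auto simp: involution_invariant_def)
lemma I_sum: "(\<And>i. i \<in> A \<Longrightarrow> f i \<in> I) \<Longrightarrow> sum f A \<in> I"
  by (induction A rule: infinite_finite_induct) (auto intro: I_add)

abbreviation cI (infix "\<approx>" 50) where "x \<approx> y \<equiv> x - y \<in> I"

lemma cI_refl [simp]: "x \<approx> x" by simp
lemma cI_sym: "x \<approx> y \<Longrightarrow> y \<approx> x" using I_minus[of "x - y"] by simp
lemma cI_trans [trans]: "x \<approx> y \<Longrightarrow> y \<approx> z \<Longrightarrow> x \<approx> z" using I_add[of "x - y" "y - z"] by simp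
lemma cI_add: "x \<approx> y \<Longrightarrow> x' \<approx> y' \<Longrightarrow> x + x' \<approx> y + y'"
  using I_add[of "x - y" "x' - y'"] by (simp add: algebra_simps)
lemma cI_diff: "x \<approx> y \<Longrightarrow> x' \<approx> y' \<Longrightarrow> x - x' \<approx> y - y'"
  using I_diff[of "x - y" "x' - y'"] by (simp add: algebra_simps)
lemma cI_mult: "x \<approx> y \<Longrightarrow> x' \<approx> y' \<Longrightarrow> x * x' \<approx> y * y'"
proof -
  assume "x \<approx> y" "x' \<approx> y'"
  then have "(x - y) * x' + y * (x' - y') \<in> I" by (intro I_add I_mult I_mult2)
  then show ?thesis by (simp add: algebra_simps)
qed
lemma cI_cj: "x \<approx> y \<Longrightarrow> cj x \<approx> cj y" using I_cj[of "x - y"] by simp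
lemma cI_sum: "(\<And>i. i \<in> A \<Longrightarrow> f i \<approx> g i) \<Longrightarrow> sum f A \<approx> sum g A"
  by (simp add: sum_subtractf[symmetric] I_sum)

lemma tilde_iff: "x \<in> ideal_tilde F I \<longleftrightarrow> (\<forall>y\<in>JD. cj y * mu F * x \<in> I)"
  by (simp add: ideal_tilde_def)

lemma tilde_cj: "x \<in> ideal_tilde F I \<Longrightarrow> y \<in> JD \<Longrightarrow> cj x * mu F * y \<in> I"
proof -
  assume "x \<in> ideal_tilde F I" "y \<in> JD"
  then have "cj (cj y * mu F * x) * lam F \<in> I" unfolding tilde_iff by - (rule I_mult2, rule I_cj, blast)
  moreover have "cj (cj y * mu F * x) * lam F = cj x * mu F * y * (cj (lam F) * lam F)"
    unfolding cj_mult cj_cj cj_mu by (simp only: ac_simps)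
  ultimately show ?thesis by simp
qed

lemma Omega_max_iff: "(x, y) \<in> Omega_max F I \<longleftrightarrow> (x, y) \<in> \<Delta> \<and> (\<forall>z\<in>JD. cj z * mu F * x \<in> I) \<and> y \<in> I"
  by (auto simp: Omega_max_def tilde_iff)

text \<open>Multiplication by \<open>c\<close> on the module \<open>M_Delta F\<close>, as far as the Hermitian form with
  values modulo \<open>I\<close> can see it. The vectors are restricted to \<open>M_Delta F\<close> because the
  generators of the upper ideal involve the zeroth row and column only through
  \<open>J_Delta F\<close>.\<close>

definition scal :: "'a \<Rightarrow> ('a, 'n::finite) sq_mat \<Rightarrow> bool" where
  "scal c \<sigma> \<longleftrightarrow> \<sigma> \<in> UU \<and> (\<forall>u\<in>M_Delta F. \<forall>v\<in>M_Delta F. Bf v (\<sigma> *v u) \<approx> Bf v u * c)"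

lemma scalD: "scal c \<sigma> \<Longrightarrow> u \<in> M_Delta F \<Longrightarrow> v \<in> M_Delta F \<Longrightarrow> Bf v (\<sigma> *v u) \<approx> Bf v u * c"
  by (simp add: scal_def)
lemma scal_UU: "scal c \<sigma> \<Longrightarrow> \<sigma> \<in> UU" by (simp add: scal_def)

lemma scal_left:
  assumes "scal c \<sigma>" "u \<in> M_Delta F" "v \<in> M_Delta F"
  shows "Bf (\<sigma> *v u) v \<approx> Bf u v * cj c"
proof -
  have "cj (Bf v (\<sigma> *v u)) * lam F \<approx> cj (Bf v u * c) * lam F"
    by (intro cI_mult cI_cj scalD assms) simp
  also have "cj (Bf v u * c) * lam F = cj (Bf v u) * lam F * cj c" by (simp add: ac_simps)
  finally show ?thesis by (simp only: B_herm[symmetric])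
qed

text \<open>The Hermitian form takes unit values and is preserved.\<close>

lemma scal_norm:
  fixes \<sigma> :: "('a, 'n::finite) sq_mat"
  assumes "scal c \<sigma>"
  shows "c * cj c \<approx> 1"
proof -
  let ?u = "ax (Neg undefined) :: 'a^'n signed" and ?v = "ax (Pos undefined) :: 'a^'n signed"
  have B: "Bf ?v ?u = 1" by (simp add: B_axis_axis)
  have "Bf (\<sigma> *v ?v) (\<sigma> *v ?u) \<approx> Bf (\<sigma> *v ?v) ?u * c"
    by (intro scalD assms UU_M scal_UU[OF assms]) simp_all
  also have "Bf (\<sigma> *v ?v) ?u * c \<approx> Bf ?v ?u * cj c * c"
    by (intro cI_mult scal_left assms) simp_all
  finally show ?thesis
    unfolding UU_B[OF scal_UU[OF assms]] B by (simp add: cI_sym mult.commute)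
qed

lemma scal_coord:
  assumes "scal c \<sigma>" "u \<in> M_Delta F" "i \<noteq> 0"
  shows "(\<sigma> *v u) $ i \<approx> u $ i * c"
proof -
  have k: "cj (kap (- i)) * kap (- i) = 1" using kap_unit[of "- i"] assms by (simp add: mult.commute)
  have "cj (kap (- i)) * Bf (ax (- i)) (\<sigma> *v u) \<approx> cj (kap (- i)) * (Bf (ax (- i)) u * c)"
    using assms by (intro cI_mult scalD) simp_all
  then show ?thesis by (simp add: B_axis_left mult.assoc[symmetric] k)
qed

lemma scal_coord0:
  assumes "scal c \<sigma>" "u \<in> M_Delta F"
  shows "(\<sigma> *v u) $ 0 - u $ 0 * c \<in> ideal_tilde F I"
  unfolding tilde_iff
proof
  fix y assume "y \<in> JD"
  then have "Bf (axis 0 y) (\<sigma> *v u) \<approx> Bf (axis 0 y) u * c" by (intro scalD assms ax0_M)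
  then show "cj y * mu F * ((\<sigma> *v u) $ 0 - u $ 0 * c) \<in> I"
    by (simp add: B_axis_left algebra_simps)
qed

lemma scal_bq:
  assumes "scal c \<sigma>" "u \<in> M_Delta F" "v \<in> M_Delta F"
  shows "bq (\<sigma> *v u) (\<sigma> *v v) \<approx> cj c * bq u v * c"
proof -
  have "bq (\<sigma> *v u) (\<sigma> *v v) \<approx> (\<Sum>k\<in>UNIV. cj (u $ Pos k * c) * (v $ Neg k * c))"
    unfolding bq_def by (intro cI_sum cI_mult cI_cj scal_coord assms) simp_all
  also have "(\<Sum>k\<in>UNIV. cj (u $ Pos k * c) * (v $ Neg k * c)) = cj c * bq u v * c"
    by (simp add: bq_def sum_distrib_left sum_distrib_right ac_simps)
  finally show ?thesis .
qed

text \<open>An element that acts as a scalar modulo \<open>I\<close> controls quadratic data only up to the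
  largest form parameter of level \<open>I\<close>; anything finer is an additional condition.\<close>

lemma scal_Omega_max:
  assumes "scal c \<sigma>" "P u \<zeta> \<in> \<Delta>"
  shows "P (\<sigma> *v u) \<zeta> \<boxminus> P u \<zeta> \<star> c \<in> Omega_max F I"
proof -
  have u: "u \<in> M_Delta F" by (rule P_M[OF assms(2)])
  have D: "P (\<sigma> *v u) \<zeta> \<boxminus> P u \<zeta> \<star> c \<in> \<Delta>"
    by (intro Delta_minus Delta_circ P_UU scal_UU[OF assms(1)] assms)
  have 0: "(\<sigma> *v u) $ 0 - u $ 0 * c \<in> ideal_tilde F I" by (rule scal_coord0[OF assms(1) u])
  have "q (\<sigma> *v u) - cj c * q u * c \<in> I" by (rule scal_bq[OF assms(1) u u])
  moreover have "\<zeta> * (1 - c * cj c) \<in> I" by (rule I_mult, rule cI_sym, rule scal_norm[OF assms(1)])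
  moreover have "cj ((\<sigma> *v u) $ 0 - u $ 0 * c) * mu F * (u $ 0 * c) \<in> I"
    using u by (intro tilde_cj[OF 0] JD_mult) (simp add: M_Delta_def)
  ultimately have "(q (\<sigma> *v u) - cj c * q u * c) + \<zeta> * (1 - c * cj c)
      + cj ((\<sigma> *v u) $ 0 - u $ 0 * c) * mu F * (u $ 0 * c) \<in> I" by (intro I_add)
  then show ?thesis using D 0
    by (simp add: P_def circ_pair hminus_pair Omega_max_iff tilde_iff algebra_simps)
qed

text \<open>The deviation from a scalar, evaluated on two vectors, is a sum over the entries of \<open>\<sigma>\<close>,
  and each entry occurs with the weights that the hypotheses account for.\<close>

lemma scal_of_entries:
  fixes \<sigma> :: "('a, 'n::finite) sq_mat"
  assumes "\<sigma> \<in> UU"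
    and ij: "\<And>i j. i \<noteq> 0 \<Longrightarrow> j \<noteq> 0 \<Longrightarrow> i \<noteq> j \<Longrightarrow> \<sigma> $ i $ j \<in> I"
    and ii: "\<And>i. i \<noteq> 0 \<Longrightarrow> \<sigma> $ i $ i \<approx> c"
    and i0: "\<And>i y. i \<noteq> 0 \<Longrightarrow> y \<in> JD \<Longrightarrow> \<sigma> $ i $ 0 * y \<in> I"
    and j0: "\<And>j y. j \<noteq> 0 \<Longrightarrow> y \<in> JD \<Longrightarrow> cj y * mu F * \<sigma> $ 0 $ j \<in> I"
    and 00: "\<And>y y'. y \<in> JD \<Longrightarrow> y' \<in> JD \<Longrightarrow> cj y * mu F * (\<sigma> $ 0 $ 0 - c) * y' \<in> I"
  shows "scal c \<sigma>"
  unfolding scal_def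
proof (intro conjI ballI assms(1))
  fix u v :: "'a^'n signed" assume "u \<in> M_Delta F" "v \<in> M_Delta F"
  then have u0: "u $ 0 \<in> JD" "v $ 0 \<in> JD" by (simp_all add: M_Delta_def)
  have *: "cj (v $ i) * kap i * (\<sigma> $ (- i) $ j - (if - i = j then c else 0)) * u $ j \<in> I" for i j
  proof (cases "i = 0"; cases "j = 0")
    assume "i = 0" "j = 0" then show ?thesis using 00[OF u0(2) u0(1)] by (simp add: mult.assoc)
  next
    assume "i = 0" "j \<noteq> 0" then show ?thesis using j0[OF _ u0(2), of j] by (auto intro: I_mult2)
  next
    assume "i \<noteq> 0" "j = 0" then show ?thesis
      using i0[OF _ u0(1), of "- i"] by (auto simp: mult.assoc intro!: I_mult)
  next
    assume "i \<noteq> 0" "j \<noteq> 0"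
    then have "\<sigma> $ (- i) $ j - (if - i = j then c else 0) \<in> I"
      using ij[of "- i" j] ii[of "- i"] by auto
    then show ?thesis by - (rule I_mult2, rule I_mult)
  qed
  have "Bf v (\<sigma> *v u) - Bf v u * c
    = (\<Sum>i\<in>UNIV. \<Sum>j\<in>UNIV. cj (v $ i) * kap i * (\<sigma> $ (- i) $ j - (if - i = j then c else 0)) * u $ j)"
  proof -
    have "cj (v $ i) * kap i * (\<sigma> *v u) $ (- i) - cj (v $ i) * kap i * u $ (- i) * c
      = (\<Sum>j\<in>UNIV. cj (v $ i) * kap i * (\<sigma> $ (- i) $ j - (if - i = j then c else 0)) * u $ j)" for i
    proof -
      have 1: "(\<Sum>j\<in>UNIV. (if - i = j then c else 0) * u $ j) = c * u $ (- i)"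
        by (simp add: if_distrib[of "\<lambda>x. x * _"] cong: if_cong)
      have "(\<Sum>j\<in>UNIV. cj (v $ i) * kap i * (\<sigma> $ (- i) $ j - (if - i = j then c else 0)) * u $ j)
        = (\<Sum>j\<in>UNIV. (cj (v $ i) * kap i) * (\<sigma> $ (- i) $ j * u $ j)
            - (cj (v $ i) * kap i) * ((if - i = j then c else 0) * u $ j))"
        by (intro sum.cong refl) (simp only: right_diff_distrib left_diff_distrib mult.assoc)
      also have "\<dots> = (cj (v $ i) * kap i) * (\<sigma> *v u) $ (- i) - (cj (v $ i) * kap i) * (c * u $ (- i))"
        unfolding sum_subtractf sum_distrib_left[symmetric] 1 by (simp add: matrix_vector_mult_def)
      finally show ?thesis by (simp only: ac_simps)
    qed
    then show ?thesis
      unfolding B_form_eq_sum sum_distrib_right sum_subtractf[symmetric] by (intro sum.cong refl)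
  qed
  also have "\<dots> \<in> I" by (intro I_sum *)
  finally show "Bf v (\<sigma> *v u) \<approx> Bf v u * c" .
qed

end

locale form_ideal = inv_ideal F I
  for F :: "('a::comm_ring_1, 'b) form_data_scheme" and I :: "'a set" +
  fixes \<Omega> :: "('a \<times> 'a) set"
  assumes Omega_submodule: "bullet_submodule F \<Omega>"
    and Omega_min_le: "Omega_min F I \<subseteq> \<Omega>" and Omega_le_max: "\<Omega> \<subseteq> Omega_max F I"

context hermitian_form_ring
begin

lemma circ_setI: "\<alpha> \<in> A \<Longrightarrow> r \<in> B \<Longrightarrow> \<alpha> \<star> r \<in> circ_set F A B"
  unfolding circ_set_def by (rule generate.incl) blast

lemma circ_set_zero: "(0, 0) \<in> circ_set F A B"
  unfolding circ_set_def using generate.one[of "heis F"] by (simp add: heis_one)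

lemma trace_pairs_iff: "a \<in> trace_pairs F I \<longleftrightarrow> (\<exists>x\<in>I. a = (0, tr x))"
  by (auto simp: trace_pairs_def tr_def)

lemma set_multI: "a \<in> A \<Longrightarrow> b \<in> B \<Longrightarrow> a \<boxplus> b \<in> A <#>\<^bsub>heis F\<^esub> B"
  by (auto simp: set_mult_def)

lemma hadd_zero: "(0, 0) \<boxplus> a = a" "a \<boxplus> (0, 0) = a"
  by (cases a, simp add: hadd_pair)+

end

context form_ideal
begin

lemma Omega_subgroup: "subgroup \<Omega> (heis F)"
  using Omega_submodule by (simp add: bullet_submodule_def)
lemma Omega_circ: "a \<in> \<Omega> \<Longrightarrow> a \<star> r \<in> \<Omega>"
  using Omega_submodule by (auto simp: bullet_submodule_def)
lemma Omega_add: "a \<in> \<Omega> \<Longrightarrow> b \<in> \<Omega> \<Longrightarrow> a \<boxplus> b \<in> \<Omega>"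
  using subgroup.m_closed[OF Omega_subgroup] .
lemma Omega_neg: "a \<in> \<Omega> \<Longrightarrow> inv\<^bsub>heis F\<^esub> a \<in> \<Omega>"
  using subgroup.m_inv_closed[OF Omega_subgroup] .
lemma Omega_minus: "a \<in> \<Omega> \<Longrightarrow> b \<in> \<Omega> \<Longrightarrow> a \<boxminus> b \<in> \<Omega>"
  by (simp add: hminus_def Omega_add Omega_neg)
lemma Omega_zero: "(0, 0) \<in> \<Omega>"
  using subgroup.one_closed[OF Omega_subgroup] by (simp add: heis_one)

lemma Omega_tr: "x \<in> I \<Longrightarrow> (0, tr x) \<in> \<Omega>"
proof -
  assume x: "x \<in> I"
  have "(0, tr x) \<boxplus> (0, 0) \<in> Omega_min F I"
    unfolding Omega_min_def using x by (intro set_multI circ_set_zero) (auto simp: trace_pairs_iff)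
  then show ?thesis using Omega_min_le by (auto simp: hadd_zero)
qed

lemma Omega_circ_I: "\<alpha> \<in> \<Delta> \<Longrightarrow> x \<in> I \<Longrightarrow> \<alpha> \<star> x \<in> \<Omega>"
proof -
  assume "\<alpha> \<in> \<Delta>" "x \<in> I"
  then have "(0, 0) \<boxplus> (\<alpha> \<star> x) \<in> Omega_min F I"
    unfolding Omega_min_def by (intro set_multI circ_setI) (auto simp: trace_pairs_iff intro: bexI[of _ 0])
  then show ?thesis using Omega_min_le by (auto simp: hadd_zero)
qed

lemma Omega_Delta: "a \<in> \<Omega> \<Longrightarrow> a \<in> \<Delta>"
  using Omega_le_max by (auto simp: Omega_max_def)
lemma Omega_fst: "(x, y) \<in> \<Omega> \<Longrightarrow> z \<in> JD \<Longrightarrow> cj z * mu F * x \<in> I"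
  using Omega_le_max by (auto simp: Omega_max_iff)
lemma Omega_snd: "(x, y) \<in> \<Omega> \<Longrightarrow> y \<in> I"
  using Omega_le_max by (auto simp: Omega_max_iff)

text \<open>Congruence modulo \<open>\<Omega>\<close>. Commutators of \<open>\<Delta>\<close> with \<open>\<Omega>\<close> are traces of elements of \<open>I\<close>, so \<open>\<Omega>\<close>
  is normal in \<open>\<Delta>\<close>, and congruences may be added although the group is not commutative.\<close>

definition cg :: "'a \<times> 'a \<Rightarrow> 'a \<times> 'a \<Rightarrow> bool" (infix "\<doteq>" 50) where
  "a \<doteq> b \<longleftrightarrow> a \<in> \<Delta> \<and> b \<in> \<Delta> \<and> a \<boxminus> b \<in> \<Omega>"

lemma cg_refl: "a \<in> \<Delta> \<Longrightarrow> a \<doteq> a" by (simp add: cg_def hminus_self Omega_zero)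
lemma cg_sym: "a \<doteq> b \<Longrightarrow> b \<doteq> a" using Omega_neg[of "a \<boxminus> b"] by (simp add: cg_def hminus_swap)
lemma cg_trans [trans]: "a \<doteq> b \<Longrightarrow> b \<doteq> c \<Longrightarrow> a \<doteq> c"
  using Omega_add[of "a \<boxminus> b" "b \<boxminus> c"] by (simp add: cg_def hminus_trans)
lemma cg_circ: "a \<doteq> b \<Longrightarrow> a \<star> r \<doteq> b \<star> r"
  by (simp add: cg_def circ_hminus[symmetric] Omega_circ Delta_circ)

lemma Omega_conj: "a \<in> \<Delta> \<Longrightarrow> w \<in> \<Omega> \<Longrightarrow> (a \<boxplus> w) \<boxminus> a \<in> \<Omega>"
proof -
  assume a: "a \<in> \<Delta>" and w: "w \<in> \<Omega>"
  have "fst a \<in> JD" using a by (cases a) (auto intro: JD_I)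
  then have "- (cj (fst a) * mu F * fst w) \<in> I"
    using w by (cases w) (auto intro: I_minus Omega_fst)
  then show ?thesis unfolding hminus_hadd_normal using w by (intro Omega_add Omega_tr)
qed

lemma cg_add: "a \<doteq> b \<Longrightarrow> a' \<doteq> b' \<Longrightarrow> a \<boxplus> a' \<doteq> b \<boxplus> b'"
proof -
  assume 1: "a \<doteq> b" and 2: "a' \<doteq> b'"
  have "(a \<boxminus> b) \<boxplus> ((b \<boxplus> (a' \<boxminus> b')) \<boxminus> b) \<in> \<Omega>"
    using 1 2 by (intro Omega_add Omega_conj) (auto simp: cg_def)
  moreover have "(a \<boxminus> b) \<boxplus> ((b \<boxplus> (a' \<boxminus> b')) \<boxminus> b) = (a \<boxplus> a') \<boxminus> (b \<boxplus> b')"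
    by (cases a; cases b; cases a'; cases b') (simp add: hadd_pair hminus_pair algebra_simps)
  ultimately show ?thesis using 1 2 by (simp add: cg_def Delta_add)
qed

lemma cg_tr: "x \<approx> y \<Longrightarrow> (0, tr x) \<doteq> (0, tr y)"
proof -
  assume "x \<approx> y"
  then have "(0, tr (x - y)) \<in> \<Omega>" by (rule Omega_tr)
  moreover have "(0, tr x) \<boxminus> (0, tr y) = (0, tr (x - y))" by (simp add: hminus_pair tr_def algebra_simps)
  ultimately show ?thesis by (simp add: cg_def Delta_tr)
qed

lemma cg_Omega: "a \<in> \<Omega> \<Longrightarrow> b \<in> \<Omega> \<Longrightarrow> a \<doteq> b"
  by (simp add: cg_def Omega_Delta Omega_minus)

lemma cg_imp_Omega: "a \<doteq> b \<Longrightarrow> b \<in> \<Omega> \<Longrightarrow> a \<in> \<Omega>"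
proof -
  assume "a \<doteq> b" "b \<in> \<Omega>"
  then have "(a \<boxminus> b) \<boxplus> b \<in> \<Omega>" by (intro Omega_add) (simp_all add: cg_def)
  moreover have "(a \<boxminus> b) \<boxplus> b = a" by (cases a; cases b) (simp add: hminus_pair hadd_pair algebra_simps)
  ultimately show ?thesis by simp
qed

lemma cg_add_Omega: "a \<in> \<Delta> \<Longrightarrow> \<omega> \<in> \<Omega> \<Longrightarrow> a \<boxplus> \<omega> \<doteq> a"
  using cg_add[OF cg_refl cg_Omega[OF _ Omega_zero], of a \<omega>] by (simp add: hadd_zero)

lemma cg_Omega_add: "a \<in> \<Delta> \<Longrightarrow> \<omega> \<in> \<Omega> \<Longrightarrow> \<omega> \<boxplus> a \<doteq> a"
  using cg_add[OF cg_Omega[OF _ Omega_zero] cg_refl, of \<omega> a] by (simp add: hadd_zero)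

lemma cg_circ_scalar: "r \<approx> s \<Longrightarrow> a \<in> \<Delta> \<Longrightarrow> a \<star> r \<doteq> a \<star> s"
proof -
  assume rs: "r \<approx> s" and a: "a \<in> \<Delta>"
  obtain x y where xy: "a = (x, y)" by force
  have "a \<star> (s + (r - s)) = a \<star> s \<boxplus> a \<star> (r - s) \<boxplus> (0, tr (cj (r - s) * y * s))"
    unfolding xy by (rule circ_plus) (use a xy Delta_in_max in blast)
  moreover have "a \<star> s \<boxplus> a \<star> (r - s) \<boxplus> (0, tr (cj (r - s) * y * s)) \<doteq> a \<star> s \<boxplus> (0, 0) \<boxplus> (0, 0)"
    using rs a by (intro cg_add cg_refl cg_Omega Omega_circ_I Omega_tr Omega_zero Delta_circ I_mult2 I_cj)
  ultimately show ?thesis by (simp add: hadd_zero)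
qed

text \<open>Acting as the scalar \<open>c\<close> modulo a form ideal, on the Hermitian form and on quadratic
  data. For \<open>c = 1\<close> this is membership in the congruence subgroup; for the upper level
  of \<open>H\<close> every element of \<open>H\<close> acts as some scalar. The point of the notion is that it is
  stable under products, inverses and elementary conjugation.\<close>

definition scal_mod :: "'a \<Rightarrow> ('a, 'n::finite) sq_mat \<Rightarrow> bool" where
  "scal_mod c \<sigma> \<longleftrightarrow> scal c \<sigma> \<and> (\<forall>u \<zeta>. P u \<zeta> \<in> \<Delta> \<longrightarrow> P (\<sigma> *v u) \<zeta> \<doteq> P u \<zeta> \<star> c)"

lemma scal_modD: "scal_mod c \<sigma> \<Longrightarrow> P u \<zeta> \<in> \<Delta> \<Longrightarrow> P (\<sigma> *v u) \<zeta> \<doteq> P u \<zeta> \<star> c" by (simp add: scal_mod_def)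
lemma scal_mod_scal: "scal_mod c \<sigma> \<Longrightarrow> scal c \<sigma>" by (simp add: scal_mod_def)
lemma scal_mod_UU: "scal_mod c \<sigma> \<Longrightarrow> \<sigma> \<in> UU" using scal_mod_scal scal_UU by blast

lemma scal_mod_cong: "scal_mod c \<sigma> \<Longrightarrow> c \<approx> c' \<Longrightarrow> scal_mod c' \<sigma>"
proof -
  assume C: "scal_mod c \<sigma>" and c: "c \<approx> c'"
  have "Bf v (\<sigma> *v u) \<approx> Bf v u * c'" if "u \<in> M_Delta F" "v \<in> M_Delta F" for u v
    by (rule cI_trans[OF scalD[OF scal_mod_scal[OF C] that]]) (intro cI_mult c cI_refl)
  moreover have "P (\<sigma> *v u) \<zeta> \<doteq> P u \<zeta> \<star> c'" if "P u \<zeta> \<in> \<Delta>" for u \<zeta>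
    by (rule cg_trans[OF scal_modD[OF C that]]) (intro cg_circ_scalar c that)
  ultimately show ?thesis using C by (simp add: scal_mod_def scal_def)
qed

lemma scal_mod_mult: "scal_mod c \<sigma> \<Longrightarrow> scal_mod c' \<sigma>' \<Longrightarrow> scal_mod (c * c') (\<sigma> ** \<sigma>')"
proof -
  assume C: "scal_mod c \<sigma>" and C': "scal_mod c' \<sigma>'"
  have "Bf v (\<sigma> *v (\<sigma>' *v u)) \<approx> Bf v u * (c * c')" if u: "u \<in> M_Delta F" "v \<in> M_Delta F" for u v
  proof -
    have "Bf v (\<sigma> *v (\<sigma>' *v u)) \<approx> Bf v (\<sigma>' *v u) * c"
      using u by (intro scalD[OF scal_mod_scal[OF C]] UU_M scal_mod_UU[OF C'])
    also have "Bf v (\<sigma>' *v u) * c \<approx> Bf v u * c' * c"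
      using u by (intro cI_mult scalD[OF scal_mod_scal[OF C']] cI_refl)
    finally show ?thesis by (simp add: ac_simps)
  qed
  moreover have "P (\<sigma> *v (\<sigma>' *v u)) \<zeta> \<doteq> P u \<zeta> \<star> (c * c')" if u: "P u \<zeta> \<in> \<Delta>" for u \<zeta>
  proof -
    have "P (\<sigma> *v (\<sigma>' *v u)) \<zeta> \<doteq> P (\<sigma>' *v u) \<zeta> \<star> c"
      using u by (intro scal_modD[OF C] P_UU scal_mod_UU[OF C'])
    also have "P (\<sigma>' *v u) \<zeta> \<star> c \<doteq> P u \<zeta> \<star> c' \<star> c" using u by (intro cg_circ scal_modD[OF C'])
    finally show ?thesis by (simp add: circ_circ mult.commute)
  qed
  ultimately show ?thesis
    using C C' by (simp add: scal_mod_def scal_def mult_UU matrix_vector_mul_assoc)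
qed

lemma scal_mod_iv: "scal_mod c \<sigma> \<Longrightarrow> scal_mod (cj c) (iv \<sigma>)"
proof -
  assume C: "scal_mod c \<sigma>"
  note U = scal_mod_UU[OF C]
  have "Bf v (iv \<sigma> *v u) \<approx> Bf v u * cj c" if u: "u \<in> M_Delta F" "v \<in> M_Delta F" for u v
    unfolding iv_B[OF U] using u by (intro scal_left scal_mod_scal[OF C])
  moreover have "P (iv \<sigma> *v u) \<zeta> \<doteq> P u \<zeta> \<star> cj c" if u: "P u \<zeta> \<in> \<Delta>" for u \<zeta>
  proof -
    let ?p = "P (iv \<sigma> *v u) \<zeta>"
    have p: "?p \<in> \<Delta>" using u by (intro P_UU iv_UU U)
    have "P (\<sigma> *v (iv \<sigma> *v u)) \<zeta> \<star> cj c \<doteq> ?p \<star> c \<star> cj c" by (intro cg_circ scal_modD[OF C] p)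
    then have "P u \<zeta> \<star> cj c \<doteq> ?p \<star> (c * cj c)" by (simp add: iv_apply[OF U] circ_circ)
    also have "?p \<star> (c * cj c) \<doteq> ?p \<star> 1" by (intro cg_circ_scalar scal_norm[OF scal_mod_scal[OF C]] p)
    finally show ?thesis by (simp add: cg_sym)
  qed
  ultimately show ?thesis using U by (simp add: scal_mod_def scal_def iv_UU)
qed

text \<open>The isometry \<open>\<tau>\<close> transports the values of the Hermitian form, so only quadratic data
  have to be examined, and for these it suffices that \<open>\<tau>\<close> itself is compatible with the
  scalar.\<close>

lemma scal_mod_conj:
  assumes C: "scal_mod c \<sigma>" and U: "\<tau> \<in> UU"
    and G: "\<And>u \<zeta>. P u \<zeta> \<in> \<Delta> \<Longrightarrow> P (\<tau> *v (\<sigma> *v u)) \<zeta> \<doteq> P (\<tau> *v u) \<zeta> \<star> c"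
  shows "scal_mod c (\<tau> ** \<sigma> ** iv \<tau>)"
proof -
  have "Bf v (\<tau> *v (\<sigma> *v (iv \<tau> *v u))) \<approx> Bf v u * c" if u: "u \<in> M_Delta F" "v \<in> M_Delta F" for u v
  proof -
    have "Bf (iv \<tau> *v v) (\<sigma> *v (iv \<tau> *v u)) \<approx> Bf (iv \<tau> *v v) (iv \<tau> *v u) * c"
      using u by (intro scalD[OF scal_mod_scal[OF C]] UU_M iv_UU U)
    then show ?thesis
      using UU_B[OF iv_UU[OF U], of v u] UU_B[OF U, of "iv \<tau> *v v" "\<sigma> *v (iv \<tau> *v u)"]
      by (simp add: iv_apply[OF U])
  qed
  moreover have "P (\<tau> *v (\<sigma> *v (iv \<tau> *v u))) \<zeta> \<doteq> P u \<zeta> \<star> c" if u: "P u \<zeta> \<in> \<Delta>" for u \<zeta>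
    using G[OF P_UU[OF iv_UU[OF U] u]] by (simp add: iv_apply[OF U])
  ultimately show ?thesis
    using scal_mod_UU[OF C] U by (simp add: scal_mod_def scal_def mult_UU iv_UU matrix_vector_mul_assoc[symmetric])
qed

lemma hadd_central: "a \<boxplus> (0, t) = (0, t) \<boxplus> a"
  by (cases a) (simp add: hadd_pair)

lemma scal_bq_axis:
  assumes "scal c \<sigma>" "u \<in> M_Delta F" "i \<noteq> 0"
  shows "bq (axis i x) (\<sigma> *v u) \<approx> bq (axis i x) u * c"
proof (cases "i \<in> Theta_pos")
  case True
  have "cj x * (\<sigma> *v u) $ (- i) \<approx> cj x * (u $ (- i) * c)"
    using assms by (intro cI_mult scal_coord cI_refl) simp_all
  then show ?thesis using True by (simp add: bq_axis_left mult.assoc)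
qed (simp add: bq_axis_left)

text \<open>The change of quadratic data under a short root element is a trace of a Hermitian
  expression in the vector, which scales as the quadratic data do.\<close>

lemma scal_mod_conj_Rt:
  fixes \<sigma> :: "('a, 'n::finite) sq_mat"
  assumes C: "scal_mod c \<sigma>" and ab: "a \<noteq> 0" "b \<noteq> 0" "a \<noteq> b" "a \<noteq> - b"
  shows "scal_mod c (Rt a b x ** \<sigma> ** iv (Rt a b x))"
proof (rule scal_mod_conj[OF C Rt_UU[OF ab]])
  fix u :: "'a^'n signed" and \<zeta> assume u: "P u \<zeta> \<in> \<Delta>"
  define s where "s = (\<lambda>w :: 'a^'n signed. cj (Bf (axis a x) w) * lam F * Bf (ax b) w
     + bq (Bf (ax b) w *s axis a x - (cj (lam F) * Bf (axis a x) w) *s ax b) w)"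
  have PR: "P (Rt a b x *v w) \<zeta> = P w \<zeta> \<boxplus> (0, tr (s w))" for w
    unfolding P_Q Q_form_Rt[OF ab] s_def by (simp add: Q_form_eq hadd_pair add.commute)
  have M: "u \<in> M_Delta F" by (rule P_M[OF u])
  note S = scal_mod_scal[OF C]
  let ?X = "cj (Bf (axis a x) u * c) * lam F * (Bf (ax b) u * c)
     + (cj (Bf (ax b) u * c) * (bq (axis a x) u * c) - cj (cj (lam F) * (Bf (axis a x) u * c)) * (bq (ax b) u * c))"
  have "s (\<sigma> *v u) \<approx> ?X"
    unfolding s_def bq_lin using ab M
    by (intro cI_add cI_diff cI_mult cI_cj scal_bq_axis[OF S] scalD[OF S] ax_M cI_refl)
  also have "?X = cj c * s u * c" by (simp add: s_def bq_lin algebra_simps)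
  finally have "P (Rt a b x *v (\<sigma> *v u)) \<zeta> \<doteq> P u \<zeta> \<star> c \<boxplus> (0, tr (cj c * s u * c))"
    unfolding PR by (intro cg_add scal_modD[OF C u] cg_tr)
  also have "P u \<zeta> \<star> c \<boxplus> (0, tr (cj c * s u * c)) = P (Rt a b x *v u) \<zeta> \<star> c"
    unfolding PR circ_hadd by (simp add: circ_pair tr_scale)
  finally show "P (Rt a b x *v (\<sigma> *v u)) \<zeta> \<doteq> P (Rt a b x *v u) \<zeta> \<star> c" .
qed

lemma cg_circ_coord:
  assumes "scal c \<sigma>" "u \<in> M_Delta F" "i \<noteq> 0" "\<alpha> \<in> \<Delta>"
  shows "\<alpha> \<star> ((\<sigma> *v u) $ i) \<doteq> \<alpha> \<star> (u $ i) \<star> c"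
  unfolding circ_circ by (intro cg_circ_scalar scal_coord assms)

lemma scal_mod_conj_Lo:
  fixes \<sigma> :: "('a, 'n::finite) sq_mat"
  assumes C: "scal_mod c \<sigma>" and i: "i \<noteq> 0" and \<alpha>: "\<alpha> \<in> \<Delta>"
  shows "scal_mod c (Lo i \<alpha> ** \<sigma> ** iv (Lo i \<alpha>))"
proof (rule scal_mod_conj[OF C Lo_UU[OF i \<alpha>]])
  fix u :: "'a^'n signed" and \<zeta> assume u: "P u \<zeta> \<in> \<Delta>"
  have M: "u \<in> M_Delta F" by (rule P_M[OF u])
  note S = scal_mod_scal[OF C]
  show "P (Lo i \<alpha> *v (\<sigma> *v u)) \<zeta> \<doteq> P (Lo i \<alpha> *v u) \<zeta> \<star> c"
  proof (cases i)
    case (Pos k)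
    have *: "P (Lo i \<alpha> *v w) \<zeta> = P w \<zeta> \<boxplus> \<alpha> \<star> (w $ Neg k)" for w
      unfolding Pos P_Q Q_form_Lo hadd_assoc by (simp add: hadd_central)
    show ?thesis unfolding * circ_hadd
      by (intro cg_add scal_modD[OF C u] cg_circ_coord[OF S M] \<alpha>) simp
  next
    case (Neg k)
    have *: "P (Lo i \<alpha> *v w) \<zeta> = \<alpha> \<star> (w $ Pos k) \<boxplus> P w \<zeta>" for w
      unfolding Neg P_Q Q_form_Lo hadd_assoc ..
    show ?thesis unfolding * circ_hadd
      by (intro cg_add scal_modD[OF C u] cg_circ_coord[OF S M] \<alpha>) simp
  qed (use i in \<open>simp add: zero_signed_def\<close>)
qed

end

context hermitian_form_ring
begin

text \<open>The generators of the relative elementary group in terms of \<open>Rt\<close> and \<open>Lo\<close>: the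
  parameters of the long ones then range over \<open>\<Omega>\<close> for both signs of the index.\<close>

definition gens :: "'a set \<Rightarrow> ('a \<times> 'a) set \<Rightarrow> ('a, 'n::finite) sq_mat set" where
  "gens I \<Omega> = {Rt a b x | a b x. a \<noteq> 0 \<and> b \<noteq> 0 \<and> a \<noteq> b \<and> a \<noteq> - b \<and> x \<in> I} \<union>
     {Lo i \<alpha> | i \<alpha>. i \<noteq> 0 \<and> \<alpha> \<in> \<Omega>}"

lemma gens_Rt: "a \<noteq> 0 \<Longrightarrow> b \<noteq> 0 \<Longrightarrow> a \<noteq> b \<Longrightarrow> a \<noteq> - b \<Longrightarrow> x \<in> I \<Longrightarrow> Rt a b x \<in> gens I \<Omega>"
  unfolding gens_def by blast

lemma gens_Lo: "i \<noteq> 0 \<Longrightarrow> \<alpha> \<in> \<Omega> \<Longrightarrow> Lo i \<alpha> \<in> gens I \<Omega>"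
  unfolding gens_def by blast

lemma gens_cases:
  assumes "g \<in> gens I \<Omega>"
  obtains (Rt) a b x where "g = Rt a b x" "a \<noteq> 0" "b \<noteq> 0" "a \<noteq> b" "a \<noteq> - b" "x \<in> I"
    | (Lo) i \<alpha> where "g = Lo i \<alpha>" "i \<noteq> 0" "\<alpha> \<in> \<Omega>"
  using assms unfolding gens_def by blast

lemma EU_ideal_gens:
  assumes "ideal I ring_UNIV"
  shows "EU_ideal F (I, \<Omega>) = (generate UG (gens I \<Omega>) :: ('a, 'n::finite) sq_mat set)"
proof -
  have m: "x * r \<in> I" if "x \<in> I" for x r
    using assms that unfolding ideal_UNIV_iff by (metis mult.commute)
  have "{T_short F i j x :: ('a, 'n) sq_mat | i j x. i \<in> Theta_hb \<and> j \<in> Theta_hb \<and> i \<noteq> j \<and> i \<noteq> - j \<and> x \<in> I}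
    = {Rt a b x :: ('a, 'n) sq_mat | a b x. a \<noteq> 0 \<and> b \<noteq> 0 \<and> a \<noteq> b \<and> a \<noteq> - b \<and> x \<in> I}" (is "?A = ?B")
  proof
    show "?A \<subseteq> ?B"
    proof
      fix g assume "g \<in> ?A"
      then obtain i j x where g: "g = T_short F i j x" "i \<noteq> 0" "j \<noteq> 0" "i \<noteq> j" "i \<noteq> - j" "x \<in> I" by auto
      have "- j \<noteq> 0" "i \<noteq> - j" "i \<noteq> - (- j)" "x * cj (kap (- j)) \<in> I" using g m by auto
      then show "g \<in> ?B" unfolding g(1) T_short_eq_Rt[OF g(2,3)] using g(2) by blast
    qed
    show "?B \<subseteq> ?A"
    proof
      fix g assume "g \<in> ?B"
      then obtain i j x where g: "g = Rt i j x" "i \<noteq> 0" "j \<noteq> 0" "i \<noteq> j" "i \<noteq> - j" "x \<in> I" by auto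
      have "i \<in> Theta_hb" "- j \<in> Theta_hb" "i \<noteq> - j" "i \<noteq> - (- j)" "x * kap j \<in> I" using g m by auto
      then show "g \<in> ?A" unfolding g(1) Rt_eq_T_short[OF g(2,3)] by blast
    qed
  qed
  moreover have "{T_long F i \<alpha> :: ('a, 'n) sq_mat | i \<alpha>. i \<in> Theta_hb \<and> \<alpha> \<in> signed_param F \<Omega> (- eps i)}
     = {Lo i \<alpha> :: ('a, 'n) sq_mat | i \<alpha>. i \<noteq> 0 \<and> \<alpha> \<in> \<Omega>}"
  proof -
    have "{T_long F i \<alpha> :: ('a, 'n) sq_mat | i \<alpha>. i \<in> Theta_hb \<and> \<alpha> \<in> signed_param F \<Omega> (- eps i)}
      = (\<Union>i\<in>Theta_hb. {T_long F i \<alpha> :: ('a, 'n) sq_mat | \<alpha>. \<alpha> \<in> signed_param F \<Omega> (- eps i)})" by blast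
    also have "\<dots> = (\<Union>i\<in>Theta_hb. (Lo i :: _ \<Rightarrow> ('a, 'n) sq_mat) ` \<Omega>)" by (rule SUP_cong[OF refl], rule Lo_range, simp)
    finally show ?thesis by blast
  qed
  ultimately show ?thesis by (simp only: EU_ideal_def gens_def prod.case)
qed

lemma ideal_UNIV: "ideal UNIV (ring_UNIV :: 'a ring)" by (simp add: ideal_UNIV_iff)

lemma EU_gens: "EU F = generate UG (gens UNIV \<Delta>)"
  unfolding EU_def by (rule EU_ideal_gens[OF ideal_UNIV])

lemma gens_UU: "\<Omega> \<subseteq> \<Delta> \<Longrightarrow> gens I \<Omega> \<subseteq> UU"
  unfolding gens_def by (auto intro: Rt_UU Lo_UU)

lemma subgroup_EU: "subgroup (EU F) UG"
  unfolding EU_gens by (rule group.generate_is_subgroup[OF group_UG gens_UU]) simp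

lemma EU_UU: "\<tau> \<in> EU F \<Longrightarrow> \<tau> \<in> UU"
  using subgroup.subset[OF subgroup_EU] by blast

lemma Rt_EU: "a \<noteq> 0 \<Longrightarrow> b \<noteq> 0 \<Longrightarrow> a \<noteq> b \<Longrightarrow> a \<noteq> - b \<Longrightarrow> Rt a b x \<in> EU F"
  unfolding EU_gens by (rule generate.incl) (simp add: gens_Rt)

lemma Lo_EU: "i \<noteq> 0 \<Longrightarrow> \<alpha> \<in> \<Delta> \<Longrightarrow> Lo i \<alpha> \<in> EU F"
  unfolding EU_gens by (rule generate.incl) (simp add: gens_Lo)

lemma iv_gens: "g \<in> gens UNIV \<Delta> \<Longrightarrow> iv g \<in> gens UNIV \<Delta>"
  by (erule gens_cases) (simp_all add: iv_Rt iv_Lo gens_Rt gens_Lo Delta_inv)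

lemma EU_iv: "\<tau> \<in> EU F \<Longrightarrow> iv \<tau> \<in> EU F"
  by (rule subgroup.m_inv_closed[OF subgroup_EU])

lemma EU_mult: "\<tau> \<in> EU F \<Longrightarrow> \<rho> \<in> EU F \<Longrightarrow> \<tau> ** \<rho> \<in> EU F"
  using subgroup.m_closed[OF subgroup_EU] by simp

end

lemma (in form_ideal) scal_mod_conj_EU:
  assumes "\<tau> \<in> EU F" "scal_mod c \<sigma>" shows "scal_mod c (\<tau> ** \<sigma> ** iv \<tau>)"
  using assms unfolding EU_gens
proof (induction arbitrary: \<sigma> rule: generate.induct)
  case one
  have "iv (mat 1) = (mat 1 :: ('a, 'c) sq_mat)" by (intro iv_unique one_UU) simp
  then show ?case using one by simp
next
  case (incl h)
  then show ?case using scal_mod_conj_Rt[OF incl(2)] scal_mod_conj_Lo[OF incl(2)] by (auto elim: gens_cases)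
next
  case (inv h)
  have "iv h \<in> gens UNIV \<Delta>" using inv by (intro iv_gens)
  then show ?case using scal_mod_conj_Rt[OF inv(2)] scal_mod_conj_Lo[OF inv(2)] by (auto elim: gens_cases)
next
  case (eng h1 h2)
  have "h1 \<in> UU" "h2 \<in> UU" using eng EU_UU by (auto simp: EU_gens)
  then show ?case using eng.IH(1)[OF eng.IH(2)[OF eng.prems]]
    by (simp add: iv_mult matrix_mul_assoc)
qed

section \<open>The upper level\<close>

lemma matrix_vector_axis: "(A *v axis j x) $ i = A $ i $ j * x" for A :: "'a::comm_ring_1^'n^'m"
proof -
  have "(A *v axis j x) $ i = (\<Sum>k\<in>UNIV. if k = j then A $ i $ j * x else 0)"
    unfolding matrix_vector_mult_def vec_lambda_beta axis_def by (intro sum.cong) auto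
  then show ?thesis by simp
qed

lemma column_eq: "column j A = A *v axis j 1" for A :: "'a::comm_ring_1^'n^'m"
  by (simp add: vec_eq_iff column_def matrix_vector_axis)

context hermitian_form_ring
begin

lemma axis_nth_neq: "i \<noteq> j \<Longrightarrow> axis i x $ j = 0" by (simp add: axis_def)
text \<open>Both kinds of generators of the form parameter in the upper level are quadratic data of
  images of vectors of \<open>M_Delta F\<close>, so they measure exactly how far an element is from
  acting as a scalar.\<close>

lemma Z2_eq:
  fixes \<sigma> :: "('a, 'n::finite) sq_mat"
  shows "(Q_form F (column 0 \<sigma>) \<boxminus> (1, 0)) \<star> y \<boxplus> (y, z) = P (\<sigma> *v axis 0 y) z"
proof -
  have "\<sigma> *v axis 0 y = y *s (\<sigma> *v ax 0)"
    by (simp add: vec_eq_iff matrix_vector_axis mult.commute)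
  then show ?thesis
    by (simp add: P_def column_eq Q_form_eq hminus_pair circ_pair hadd_pair bq_lin algebra_simps)
qed

lemma Z1_eq: "Q_form F (column j \<sigma>) = P (\<sigma> *v ax j) 0"
  by (simp add: P_def column_eq Q_form_eq)

lemma q_axis: "q (axis i x) = 0"
  by (cases i) (auto simp: bq_axis_left axis_nth_neq)

lemma P_axis: "i \<noteq> 0 \<Longrightarrow> P (axis i x) 0 = (0, 0)" "P (axis 0 y) z = (y, z)"
  by (auto simp: P_def q_axis axis_nth axis_nth_neq)

lemma upper_Y_I:
  assumes "\<sigma> \<in> H" "i \<noteq> 0" "j \<noteq> 0" "i \<noteq> j"
  shows "\<sigma> $ i $ j \<in> upper_Y F H" "\<sigma> $ i $ i - \<sigma> $ j $ j \<in> upper_Y F H"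
    "y \<in> JD \<Longrightarrow> \<sigma> $ i $ 0 * y \<in> upper_Y F H"
    "y \<in> JD \<Longrightarrow> cj y * mu F * \<sigma> $ 0 $ j \<in> upper_Y F H"
    "y \<in> JD \<Longrightarrow> y' \<in> JD \<Longrightarrow> cj y * mu F * (\<sigma> $ 0 $ 0 - \<sigma> $ j $ j) * y' \<in> upper_Y F H"
proof -
  have *: "i \<in> Theta_hb" "j \<in> Theta_hb - {i}" using assms by auto
  show "\<sigma> $ i $ j \<in> upper_Y F H" "\<sigma> $ i $ i - \<sigma> $ j $ j \<in> upper_Y F H"
    "y \<in> JD \<Longrightarrow> \<sigma> $ i $ 0 * y \<in> upper_Y F H"
    "y \<in> JD \<Longrightarrow> cj y * mu F * \<sigma> $ 0 $ j \<in> upper_Y F H"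
    "y \<in> JD \<Longrightarrow> y' \<in> JD \<Longrightarrow> cj y * mu F * (\<sigma> $ 0 $ 0 - \<sigma> $ j $ j) * y' \<in> upper_Y F H"
    unfolding upper_Y_def by (intro UN_I[OF assms(1)] UN_I[OF *(1)] UN_I[OF *(2)], blast)+
qed

lemma upper_Y_cases:
  assumes "x \<in> upper_Y F H"
  obtains \<sigma> i j where "\<sigma> \<in> H" "i \<noteq> 0" "j \<noteq> 0" "i \<noteq> j"
    "x = \<sigma> $ i $ j \<or> x = \<sigma> $ i $ i - \<sigma> $ j $ j \<or> (\<exists>y\<in>JD. x = \<sigma> $ i $ 0 * y)
     \<or> (\<exists>y\<in>JD. x = cj y * mu F * \<sigma> $ 0 $ j)
     \<or> (\<exists>y\<in>JD. \<exists>y'\<in>JD. x = cj y * mu F * (\<sigma> $ 0 $ 0 - \<sigma> $ j $ j) * y')"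
  using assms unfolding upper_Y_def by fastforce

lemma upper_ideal_ideal: "ideal (upper_ideal F H) ring_UNIV"
  unfolding upper_ideal_def by (rule ring.genideal_ideal[OF ring_from_type_algebra]) simp

lemma upper_ideal_incl: "x \<in> upper_Y F H \<Longrightarrow> x \<in> upper_ideal F H"
  unfolding upper_ideal_def
  using ring.genideal_self[OF ring_from_type_algebra, of "upper_Y F H \<union> bar F ` upper_Y F H"] by auto

lemma upper_ideal_min:
  assumes "inv_ideal F I" "upper_Y F H \<subseteq> I" shows "upper_ideal F H \<subseteq> I"
proof -
  interpret inv_ideal F I by fact
  show ?thesis unfolding upper_ideal_def
    using assms(2) by (intro ring.genideal_minimal[OF ring_from_type_algebra] I_ideal) (auto intro: I_cj)
qed

lemma upper_ideal_inv: "inv_ideal F (upper_ideal F H)"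
proof -
  let ?I = "upper_ideal F H"
  let ?J = "{x. cj x \<in> ?I}"
  have I: "0 \<in> ?I" "\<And>x y. x \<in> ?I \<Longrightarrow> y \<in> ?I \<Longrightarrow> x + y \<in> ?I" "\<And>r x. x \<in> ?I \<Longrightarrow> r * x \<in> ?I"
    using upper_ideal_ideal[of H] unfolding ideal_UNIV_iff by auto
  have J: "ideal ?J ring_UNIV" unfolding ideal_UNIV_iff using I by auto
  have "upper_Y F H \<union> bar F ` upper_Y F H \<subseteq> ?I"
    unfolding upper_ideal_def by (rule ring.genideal_self[OF ring_from_type_algebra]) simp
  then have "upper_Y F H \<union> bar F ` upper_Y F H \<subseteq> ?J" by auto
  then have "?I \<subseteq> ?J" unfolding upper_ideal_def[of F H]
    using J upper_ideal_def[of F H] by (intro ring.genideal_minimal[OF ring_from_type_algebra]) simp_all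
  then show ?thesis
    using upper_ideal_ideal hermitian_form_ring_axioms
    by (auto simp: inv_ideal_def inv_ideal_axioms_def involution_invariant_def)
qed

end

context inv_ideal
begin

lemma scal_upper_Y:
  assumes "\<And>\<sigma>. \<sigma> \<in> H \<Longrightarrow> \<exists>c. scal c \<sigma>"
  shows "upper_Y F H \<subseteq> I"
proof
  fix x assume "x \<in> upper_Y F H"
  then obtain \<sigma> i j where \<sigma>: "\<sigma> \<in> H" "i \<noteq> 0" "j \<noteq> 0" "i \<noteq> j" and
    x: "x = \<sigma> $ i $ j \<or> x = \<sigma> $ i $ i - \<sigma> $ j $ j \<or> (\<exists>y\<in>JD. x = \<sigma> $ i $ 0 * y)
     \<or> (\<exists>y\<in>JD. x = cj y * mu F * \<sigma> $ 0 $ j)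
     \<or> (\<exists>y\<in>JD. \<exists>y'\<in>JD. x = cj y * mu F * (\<sigma> $ 0 $ 0 - \<sigma> $ j $ j) * y')"
    by (rule upper_Y_cases)
  obtain c where c: "scal c \<sigma>" using assms \<sigma>(1) by blast
  have ii: "\<sigma> $ i $ i \<approx> c" if "i \<noteq> 0" for i
    using scal_coord[OF c, of "ax i" i] that by (simp add: matrix_vector_axis axis_nth)
  have ij: "\<sigma> $ i $ j \<in> I"
    using scal_coord[OF c, of "ax j" i] \<sigma> by (simp add: matrix_vector_axis axis_nth_neq)
  have i0: "\<sigma> $ i $ 0 * y \<in> I" if "y \<in> JD" for y
    using scal_coord[OF c ax0_M[OF that], of i] \<sigma> by (simp add: matrix_vector_axis axis_nth_neq)
  have j0: "cj y * mu F * \<sigma> $ 0 $ j \<in> I" if "y \<in> JD" for y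
    using scalD[OF c ax_M[OF \<sigma>(3)] ax0_M[OF that], of 1] \<sigma>(3)
    by (simp add: B_axis_left matrix_vector_axis axis_nth_neq)
  have 00: "cj y * mu F * (\<sigma> $ 0 $ 0 - \<sigma> $ j $ j) * y' \<in> I" if y: "y \<in> JD" "y' \<in> JD" for y y'
  proof -
    have "cj y * mu F * (\<sigma> $ 0 $ 0 * y') - cj y * mu F * y' * c \<in> I"
      using scalD[OF c ax0_M[OF y(2)] ax0_M[OF y(1)]] by (simp add: B_axis_left matrix_vector_axis axis_nth)
    moreover have "cj y * mu F * y' * (c - \<sigma> $ j $ j) \<in> I" by (rule I_mult, rule cI_sym, rule ii, fact)
    ultimately have "cj y * mu F * (\<sigma> $ 0 $ 0 * y') - cj y * mu F * y' * c + cj y * mu F * y' * (c - \<sigma> $ j $ j) \<in> I"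
      by (rule I_add)
    then show ?thesis by (simp add: algebra_simps)
  qed
  show "x \<in> I" using x ij cI_trans[OF ii[OF \<sigma>(2)] cI_sym[OF ii[OF \<sigma>(3)]]] i0 j0 00 by auto
qed

lemma scal_of_upper_Y:
  assumes "\<sigma> \<in> H" "\<sigma> \<in> UU" "upper_Y F H \<subseteq> I" "i \<noteq> 0"
  shows "scal (\<sigma> $ i $ i) \<sigma>"
proof (rule scal_of_entries[OF assms(2)])
  note U = upper_Y_I[OF assms(1)]
  have *: "j \<noteq> 0 \<Longrightarrow> j \<noteq> - j" "j \<noteq> 0 \<Longrightarrow> - j \<noteq> j" for j :: "'c signed" by simp_all
  show "\<sigma> $ a $ b \<in> I" if "a \<noteq> 0" "b \<noteq> 0" "a \<noteq> b" for a b using U(1)[OF that] assms by blast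
  show ii: "\<sigma> $ j $ j \<approx> \<sigma> $ i $ i" if "j \<noteq> 0" for j using U(2)[OF that assms(4)] assms by (cases "j = i") auto
  show "\<sigma> $ j $ 0 * y \<in> I" if "j \<noteq> 0" "y \<in> JD" for j y
    using U(3)[OF that(1) _ _ that(2), of "- j"] * that assms by auto
  show "cj y * mu F * \<sigma> $ 0 $ j \<in> I" if "j \<noteq> 0" "y \<in> JD" for j y
    using U(4)[OF _ that(1) _ that(2), of "- j"] * that assms by auto
  show "cj y * mu F * (\<sigma> $ 0 $ 0 - \<sigma> $ i $ i) * y' \<in> I" if "y \<in> JD" "y' \<in> JD" for y y'
    using U(5)[OF _ assms(4) _ that, of "- i"] * that assms by auto
qed

text \<open>Elements that act as scalars modulo \<open>I\<close> have their quadratic data in the largest form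
  parameter of level \<open>I\<close>; hence the upper level is a form ideal.\<close>

lemma upper_Z_Omega_max:
  assumes "\<And>\<sigma>. \<sigma> \<in> H \<Longrightarrow> \<sigma> \<in> UU" "upper_Y F H \<subseteq> I"
  shows "upper_Z F (H :: ('a, 'n::finite) sq_mat set) \<subseteq> Omega_max F I"
proof
  fix a assume "a \<in> upper_Z F H"
  then consider \<sigma> j where "\<sigma> \<in> H" "j \<noteq> 0" "a = Q_form F (column j \<sigma>)"
    | \<sigma> i y z where "\<sigma> \<in> H" "i \<noteq> 0" "(y, z) \<in> \<Delta>"
       "a = ((Q_form F (column 0 \<sigma>) \<boxminus> (1, 0)) \<star> y \<boxplus> (y, z)) \<boxminus> (y, z) \<star> (\<sigma> $ i $ i)"
    unfolding upper_Z_def by blast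
  then show "a \<in> Omega_max F I"
  proof cases
    case (1 \<sigma> j)
    have "a = P (\<sigma> *v ax j) 0 \<boxminus> P (ax j :: 'a^'n signed) 0 \<star> (\<sigma> $ j $ j)"
      unfolding P_axis(1)[OF 1(2)] 1(3) Z1_eq by (simp add: P_def circ_pair hminus_pair)
    also have "\<dots> \<in> Omega_max F I"
      using 1 assms by (intro scal_Omega_max scal_of_upper_Y[where H = H]) (simp_all add: P_axis Delta_zero)
    finally show ?thesis .
  next
    case (2 \<sigma> i y z)
    have "a = P (\<sigma> *v axis 0 y) z \<boxminus> P (axis 0 y :: 'a^'n signed) z \<star> (\<sigma> $ i $ i)"
      unfolding 2(4) Z2_eq by (simp add: P_axis)
    also have "\<dots> \<in> Omega_max F I"
      using 2 assms by (intro scal_Omega_max scal_of_upper_Y[where H = H]) (simp_all add: P_axis)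
    finally show ?thesis .
  qed
qed

end

context form_ideal
begin

lemma scal_mod_upper_Z:
  assumes "\<And>\<sigma>. \<sigma> \<in> H \<Longrightarrow> \<exists>c. scal_mod c \<sigma>"
  shows "upper_Z F (H :: ('a, 'n::finite) sq_mat set) \<subseteq> \<Omega>"
proof
  fix a assume "a \<in> upper_Z F H"
  then consider \<sigma> j where "\<sigma> \<in> H" "j \<noteq> 0" "a = Q_form F (column j \<sigma>)"
    | \<sigma> i y z where "\<sigma> \<in> H" "i \<noteq> 0" "(y, z) \<in> \<Delta>"
       "a = ((Q_form F (column 0 \<sigma>) \<boxminus> (1, 0)) \<star> y \<boxplus> (y, z)) \<boxminus> (y, z) \<star> (\<sigma> $ i $ i)"
    unfolding upper_Z_def by blast
  then show "a \<in> \<Omega>"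
  proof cases
    case (1 \<sigma> j)
    obtain c where c: "scal_mod c \<sigma>" using assms 1 by blast
    have "P (\<sigma> *v ax j) 0 \<doteq> P (ax j :: 'a^'n signed) 0 \<star> c"
      using 1 by (intro scal_modD[OF c]) (simp_all add: P_axis Delta_zero)
    then show ?thesis unfolding 1(3) Z1_eq P_axis(1)[OF 1(2)]
      by (rule cg_imp_Omega) (simp add: circ_pair Omega_zero)
  next
    case (2 \<sigma> i y z)
    obtain c where c: "scal_mod c \<sigma>" using assms 2 by blast
    have "c \<approx> \<sigma> $ i $ i"
      using cI_sym[OF scal_coord[OF scal_mod_scal[OF c], of "ax i" i]] 2 by (simp add: matrix_vector_axis axis_nth)
    then have "scal_mod (\<sigma> $ i $ i) \<sigma>" by (rule scal_mod_cong[OF c])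
    from scal_modD[OF this, of "axis 0 y" z] 2 show ?thesis unfolding 2(4) Z2_eq by (simp add: P_axis cg_def)
  qed
qed

text \<open>The condition on quadratic data is additive in the vector up to traces of elements of
  \<open>I\<close>; therefore it has to be verified only on multiples of basis vectors, and there it
  is one of the generators.\<close>

lemma scal_mod_of_upper:
  fixes H :: "('a, 'n::finite) sq_mat set"
  assumes "\<sigma> \<in> H" "\<sigma> \<in> UU" "upper_Y F H \<subseteq> I" "upper_Z F H \<subseteq> \<Omega>" "i \<noteq> 0"
  shows "scal_mod (\<sigma> $ i $ i) \<sigma>"
proof -
  define c where "c = \<sigma> $ i $ i"
  have S: "scal c \<sigma>" unfolding c_def by (rule scal_of_upper_Y[OF assms(1-3,5)])
  define good where "good = (\<lambda>u. u \<in> M_Delta F \<and> (\<forall>\<zeta>. P u \<zeta> \<in> \<Delta> \<longrightarrow> P (\<sigma> *v u) \<zeta> \<doteq> P u \<zeta> \<star> c))"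
  have 0: "(y, z) \<in> \<Delta> \<Longrightarrow> P (\<sigma> *v axis 0 y) z \<doteq> (y, z) \<star> c" for y z
  proof -
    assume yz: "(y, z) \<in> \<Delta>"
    have "P (\<sigma> *v axis 0 y) z \<boxminus> (y, z) \<star> c \<in> upper_Z F H"
      unfolding Z2_eq[symmetric] c_def upper_Z_def using assms yz by blast
    then show ?thesis using assms(4) yz unfolding cg_def
      by (auto intro: P_UU[OF assms(2)] Delta_circ simp: P_axis)
  qed
  have good0: "good (axis 0 y)" if "y \<in> JD" for y
    unfolding good_def using 0 by (auto simp: ax0_M[OF that] P_axis)
  have goodi: "good (axis j y)" if j: "j \<noteq> 0" for j y
    unfolding good_def
  proof (intro conjI allI impI ax_M[OF j])
    fix \<zeta> assume "P (axis j y :: 'a^'n signed) \<zeta> \<in> \<Delta>"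
    moreover have Pj: "P (axis j y :: 'a^'n signed) \<zeta> = (0, \<zeta>)" using j by (auto simp: P_def q_axis axis_nth_neq)
    ultimately have \<zeta>: "(0, \<zeta>) \<in> \<Delta>" by simp
    have "\<sigma> *v axis j y = y *s (\<sigma> *v ax j)"
      by (simp add: vec_eq_iff matrix_vector_axis mult.commute)
    then have "P (\<sigma> *v axis j y) \<zeta> = Q_form F (column j \<sigma>) \<star> y \<boxplus> (0, \<zeta>)"
      by (simp add: P_Q Q_form_scale column_eq)
    also have "\<dots> \<doteq> (0, 0) \<boxplus> (0, \<zeta>) \<star> c"
    proof (rule cg_add)
      have "Q_form F (column j \<sigma>) \<in> upper_Z F H" unfolding upper_Z_def using assms j by blast
      then show "Q_form F (column j \<sigma>) \<star> y \<doteq> (0, 0)"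
        using assms(4) by (intro cg_Omega Omega_circ Omega_zero) blast
      show "(0, \<zeta>) \<doteq> (0, \<zeta>) \<star> c" using 0[OF \<zeta>] by (simp add: P_def bq_lin)
    qed
    finally show "P (\<sigma> *v axis j y) \<zeta> \<doteq> P (axis j y) \<zeta> \<star> c" by (simp add: Pj hadd_zero)
  qed
  have good_add: "good (u + v)" if "good u" "good v" for u v
    unfolding good_def
  proof (intro conjI allI impI)
    have M: "u \<in> M_Delta F" "v \<in> M_Delta F" using that by (auto simp: good_def)
    show "u + v \<in> M_Delta F" by (intro M_add M)
    fix \<zeta> assume p: "P (u + v) \<zeta> \<in> \<Delta>"
    obtain \<xi> where \<xi>: "P u \<xi> \<in> \<Delta>" using M M_P by blast
    define \<xi>' where "\<xi>' = \<zeta> + Bf u v - \<xi>"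
    have e: "P (u + v) \<zeta> = P u \<xi> \<boxplus> P v \<xi>' \<boxplus> (0, tr (bq v u))" by (simp add: P_add \<xi>'_def)
    have "inv\<^bsub>heis F\<^esub> (P u \<xi>) \<boxplus> (P (u + v) \<zeta> \<boxminus> (0, tr (bq v u))) \<in> \<Delta>"
      by (intro Delta_add Delta_inv Delta_minus Delta_tr \<xi> p)
    also have "inv\<^bsub>heis F\<^esub> (P u \<xi>) \<boxplus> (P (u + v) \<zeta> \<boxminus> (0, tr (bq v u))) = P v \<xi>'"
      unfolding e by (simp add: P_def hadd_pair hminus_pair heis_inv algebra_simps)
    finally have \<xi>': "P v \<xi>' \<in> \<Delta>" .
    have "P (\<sigma> *v (u + v)) \<zeta> = P (\<sigma> *v u) \<xi> \<boxplus> P (\<sigma> *v v) \<xi>' \<boxplus> (0, tr (bq (\<sigma> *v v) (\<sigma> *v u)))"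
      unfolding matrix_vector_right_distrib P_add[of _ _ _ \<xi>] by (simp add: UU_B[OF assms(2)] \<xi>'_def)
    also have "\<dots> \<doteq> P u \<xi> \<star> c \<boxplus> P v \<xi>' \<star> c \<boxplus> (0, tr (cj c * bq v u * c))"
      using that \<xi> \<xi>' unfolding good_def by (intro cg_add cg_tr scal_bq[OF S] M) auto
    also have "\<dots> = P (u + v) \<zeta> \<star> c"
      unfolding e circ_hadd by (simp add: circ_pair tr_scale)
    finally show "P (\<sigma> *v (u + v)) \<zeta> \<doteq> P (u + v) \<zeta> \<star> c" .
  qed
  have "good u" if "u \<in> M_Delta F" for u
  proof -
    have "good (\<Sum>i\<in>A. axis i (u $ i))" if "finite A" for A
      using that
    proof induction
      case empty
      have "good (axis undefined 0)" using good0[OF JD_zero] by simp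
      then show ?case by simp
    next
      case (insert j A)
      have "good (axis j (u $ j))" using goodi good0 \<open>u \<in> M_Delta F\<close> by (cases "j = 0") (auto simp: M_Delta_def)
      then show ?case using insert good_add by simp
    qed
    moreover have "(\<Sum>i\<in>UNIV. axis i (u $ i)) = u"
      by (simp add: vec_eq_iff axis_def)
    ultimately show ?thesis using finite by metis
  qed
  then show ?thesis using S P_M unfolding scal_mod_def good_def c_def by blast
qed

end

context hermitian_form_ring
begin

section \<open>Form ideals given by generators\<close>

lemma subgroup_set_mult:
  assumes A: "subgroup A (heis F)" and B: "subgroup B (heis F)"
    and n: "\<And>a b. a \<in> A \<Longrightarrow> b \<in> B \<Longrightarrow> (b \<boxplus> a) \<boxminus> b \<in> A"
  shows "subgroup (A <#>\<^bsub>heis F\<^esub> B) (heis F)"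
proof -
  interpret G: group "heis F" by (rule group_heis)
  interpret A: subgroup A "heis F" by fact
  interpret B: subgroup B "heis F" by fact
  have m: "a \<boxplus> b \<in> A <#>\<^bsub>heis F\<^esub> B" if "a \<in> A" "b \<in> B" for a b using that by (rule set_multI)
  show ?thesis
  proof
    show "A <#>\<^bsub>heis F\<^esub> B \<subseteq> carrier (heis F)" by simp
    show "\<one>\<^bsub>heis F\<^esub> \<in> A <#>\<^bsub>heis F\<^esub> B" using m[OF A.one_closed B.one_closed] by simp
  next
    fix x y assume "x \<in> A <#>\<^bsub>heis F\<^esub> B" "y \<in> A <#>\<^bsub>heis F\<^esub> B"
    then obtain a b a' b' where x: "x = a \<boxplus> b" "a \<in> A" "b \<in> B" and y: "y = a' \<boxplus> b'" "a' \<in> A" "b' \<in> B"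
      unfolding set_mult_def by blast
    have "a \<boxplus> ((b \<boxplus> a') \<boxminus> b) \<boxplus> (b \<boxplus> b') \<in> A <#>\<^bsub>heis F\<^esub> B"
      by (intro m A.m_closed B.m_closed n x y)
    also have "a \<boxplus> ((b \<boxplus> a') \<boxminus> b) \<boxplus> (b \<boxplus> b') = x \<boxplus> y"
      unfolding x y by (cases a; cases b; cases a'; cases b') (simp add: hadd_pair hminus_pair algebra_simps)
    finally show "x \<boxplus> y \<in> A <#>\<^bsub>heis F\<^esub> B" .
  next
    fix x assume "x \<in> A <#>\<^bsub>heis F\<^esub> B"
    then obtain a b where x: "x = a \<boxplus> b" "a \<in> A" "b \<in> B" unfolding set_mult_def by blast
    let ?i = "\<lambda>z. inv\<^bsub>heis F\<^esub> z"
    have "((?i b \<boxplus> ?i a) \<boxminus> ?i b) \<boxplus> ?i b \<in> A <#>\<^bsub>heis F\<^esub> B"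
      by (intro m n A.m_inv_closed B.m_inv_closed x)
    also have "((?i b \<boxplus> ?i a) \<boxminus> ?i b) \<boxplus> ?i b = ?i x"
      unfolding x by (cases a; cases b) (simp add: hadd_pair hminus_pair heis_inv algebra_simps)
    finally show "?i x \<in> A <#>\<^bsub>heis F\<^esub> B" .
  qed
qed

lemma set_mult_circ:
  assumes "\<And>a r. a \<in> A \<Longrightarrow> a \<star> r \<in> A" "\<And>a r. a \<in> B \<Longrightarrow> a \<star> r \<in> B" "x \<in> A <#>\<^bsub>heis F\<^esub> B"
  shows "x \<star> r \<in> A <#>\<^bsub>heis F\<^esub> B"
proof -
  obtain a b where "x = a \<boxplus> b" "a \<in> A" "b \<in> B" using assms(3) unfolding set_mult_def by blast
  then show ?thesis using assms(1,2) by (simp add: circ_hadd set_multI)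
qed

lemma circ_set_subgroup: "subgroup (circ_set F A B) (heis F)"
  unfolding circ_set_def by (rule group.generate_is_subgroup[OF group_heis]) simp

lemma circ_set_least:
  assumes "subgroup S (heis F)" "\<And>\<alpha> r. \<alpha> \<in> A \<Longrightarrow> r \<in> B \<Longrightarrow> \<alpha> \<star> r \<in> S"
  shows "circ_set F A B \<subseteq> S"
  unfolding circ_set_def using assms by (intro group.generate_subgroup_incl[OF group_heis]) auto

lemma circ_set_circ:
  assumes B: "\<And>b r. b \<in> B \<Longrightarrow> b * r \<in> B" and x: "x \<in> circ_set F A B"
  shows "x \<star> r \<in> circ_set F A B"
proof -
  have "circ_set F A B \<subseteq> {x. x \<star> r \<in> circ_set F A B}"
  proof (rule circ_set_least)
    interpret S: subgroup "circ_set F A B" "heis F" by (rule circ_set_subgroup)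
    show "subgroup {x. x \<star> r \<in> circ_set F A B} (heis F)"
    proof
      have "(0, 0) \<star> r = (0, 0)" by (simp add: circ_pair)
      then show "\<one>\<^bsub>heis F\<^esub> \<in> {x. x \<star> r \<in> circ_set F A B}" using circ_set_zero by (simp add: heis_one)
    qed (use S.m_closed S.m_inv_closed in \<open>simp_all add: circ_hadd circ_inv\<close>)
    show "\<alpha> \<star> s \<in> {x. x \<star> r \<in> circ_set F A B}" if "\<alpha> \<in> A" "s \<in> B" for \<alpha> s
      using that B by (simp add: circ_circ circ_setI)
  qed
  then show ?thesis using x by blast
qed

end

context inv_ideal
begin

lemma trace_subgroup: "subgroup (trace_pairs F I) (heis F)"
proof
  show "\<one>\<^bsub>heis F\<^esub> \<in> trace_pairs F I" by (auto simp: heis_one trace_pairs_iff intro: bexI[of _ 0])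
  show "x \<boxplus> y \<in> trace_pairs F I" if "x \<in> trace_pairs F I" "y \<in> trace_pairs F I" for x y
    using that by (auto simp: trace_pairs_iff hadd_pair tr_add[symmetric] intro: I_add)
  show "inv\<^bsub>heis F\<^esub> x \<in> trace_pairs F I" if "x \<in> trace_pairs F I" for x
    using that by (auto simp: trace_pairs_iff heis_inv tr_minus[symmetric] intro: I_minus)
qed simp

lemma trace_circ: "x \<in> trace_pairs F I \<Longrightarrow> x \<star> r \<in> trace_pairs F I"
proof -
  assume "x \<in> trace_pairs F I"
  then obtain y where y: "y \<in> I" "x = (0, tr y)" by (auto simp: trace_pairs_iff)
  then have "x \<star> r = (0, tr (cj r * y * r))" "cj r * y * r \<in> I"
    by (simp_all add: circ_pair tr_scale) (rule I_mult2, rule I_mult)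
  then show ?thesis unfolding trace_pairs_iff by blast
qed

lemma Omega_max_subgroup: "subgroup (Omega_max F I) (heis F)"
proof
  show "\<one>\<^bsub>heis F\<^esub> \<in> Omega_max F I" by (simp add: heis_one Omega_max_iff Delta_zero)
next
  fix a b assume ab: "a \<in> Omega_max F I" "b \<in> Omega_max F I"
  obtain x y x' y' where xy: "a = (x, y)" "b = (x', y')" by force
  have 1: "a \<boxplus> b \<in> \<Delta>" using ab unfolding xy Omega_max_iff by (intro Delta_add) auto
  have 2: "cj x * mu F * x' \<in> I" using ab unfolding xy Omega_max_iff by (auto intro: JD_I)
  show "a \<boxplus> b \<in> Omega_max F I"
    using ab 1 2 unfolding xy hadd_pair Omega_max_iff by (auto intro!: I_add I_diff simp: distrib_left)
next
  fix a assume a: "a \<in> Omega_max F I"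
  obtain x y where xy: "a = (x, y)" by force
  have 1: "inv\<^bsub>heis F\<^esub> a \<in> \<Delta>" using a unfolding xy Omega_max_iff by (intro Delta_inv) auto
  have 2: "cj x * mu F * x \<in> I" using a unfolding xy Omega_max_iff by (auto intro: JD_I)
  show "inv\<^bsub>heis F\<^esub> a \<in> Omega_max F I"
    using a 1 2 unfolding xy heis_inv Omega_max_iff by (auto intro: I_minus I_diff)
qed simp

lemma Omega_max_circ: "a \<in> Omega_max F I \<Longrightarrow> a \<star> r \<in> Omega_max F I"
proof -
  assume a: "a \<in> Omega_max F I"
  obtain x y where xy: "a = (x, y)" by force
  have "a \<star> r \<in> \<Delta>" using a unfolding xy Omega_max_iff by (auto intro: Delta_circ)
  then show ?thesis using a unfolding xy circ_pair Omega_max_iff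
    by (auto simp: mult.assoc[symmetric] intro: I_mult I_mult2)
qed

lemma Omega_min_subgroup: "subgroup (Omega_min F I) (heis F)"
  unfolding Omega_min_def
proof (rule subgroup_set_mult[OF trace_subgroup circ_set_subgroup])
  fix a b assume "a \<in> trace_pairs F I"
  then show "(b \<boxplus> a) \<boxminus> b \<in> trace_pairs F I"
    unfolding hminus_hadd_normal by (auto simp: trace_pairs_iff hadd_pair)
qed

lemma Omega_min_circ: "a \<in> Omega_min F I \<Longrightarrow> a \<star> r \<in> Omega_min F I"
  unfolding Omega_min_def by (rule set_mult_circ[OF trace_circ circ_set_circ]) (auto intro: I_mult2)

lemma I_tr: "x \<in> I \<Longrightarrow> tr x \<in> I"
  unfolding tr_def by (rule I_diff, assumption, rule I_mult2, rule I_cj)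

lemma trace_Omega_max: "trace_pairs F I \<subseteq> Omega_max F I"
  by (auto simp: trace_pairs_iff Omega_max_iff Delta_tr I_tr)

lemma circ_Omega_max: "\<alpha> \<in> \<Delta> \<Longrightarrow> x \<in> I \<Longrightarrow> \<alpha> \<star> x \<in> Omega_max F I"
  using Delta_circ[of \<alpha> x] I_mult by (cases \<alpha>) (auto simp: Omega_max_iff circ_pair mult.assoc[symmetric])

lemma set_mult_least:
  assumes "subgroup S (heis F)" "A \<subseteq> S" "B \<subseteq> S" shows "A <#>\<^bsub>heis F\<^esub> B \<subseteq> S"
  using assms subgroup.m_closed[OF assms(1)] unfolding set_mult_def by blast

lemma Omega_min_le_max: "Omega_min F I \<subseteq> Omega_max F I"
  unfolding Omega_min_def
  by (intro set_mult_least circ_set_least Omega_max_subgroup trace_Omega_max circ_Omega_max)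

lemma form_ideal_min: "form_ideal F I (Omega_min F I)"
  using inv_ideal_axioms Omega_min_subgroup Omega_min_circ Omega_min_le_max
  by (simp add: form_ideal_def form_ideal_axioms_def bullet_submodule_def)

text \<open>Since \<open>Omega_min F I\<close> is normalised by \<open>\<Delta>\<close>, its product with a bullet submodule of
  \<open>Omega_max F I\<close> is one again.\<close>

lemma form_ideal_generated:
  assumes Z: "Z \<subseteq> Omega_max F I"
  shows "form_ideal F I (Omega_min F I <#>\<^bsub>heis F\<^esub> circ_set F Z UNIV)"
proof -
  let ?O = "Omega_min F I <#>\<^bsub>heis F\<^esub> circ_set F Z UNIV"
  interpret m: form_ideal F I "Omega_min F I" by (rule form_ideal_min)
  have C: "circ_set F Z UNIV \<subseteq> Omega_max F I"
    using Z by (intro circ_set_least Omega_max_subgroup Omega_max_circ) blast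
  have "subgroup ?O (heis F)"
  proof (rule subgroup_set_mult[OF Omega_min_subgroup circ_set_subgroup])
    fix a b assume "a \<in> Omega_min F I" "b \<in> circ_set F Z UNIV"
    then show "(b \<boxplus> a) \<boxminus> b \<in> Omega_min F I"
      using C by (intro m.Omega_conj) (auto simp: Omega_max_def)
  qed
  moreover have "x \<star> r \<in> ?O" if "x \<in> ?O" for x r
    by (rule set_mult_circ[OF Omega_min_circ circ_set_circ that]) simp_all
  moreover have "Omega_min F I \<subseteq> ?O"
    using set_multI[OF _ circ_set_zero] by (force simp: hadd_zero)
  moreover have "?O \<subseteq> Omega_max F I"
    by (intro set_mult_least Omega_max_subgroup Omega_min_le_max C)
  ultimately show ?thesis
    using inv_ideal_axioms by (simp add: form_ideal_def form_ideal_axioms_def bullet_submodule_def)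
qed

end

context hermitian_form_ring
begin

definition upper_Omega :: "('a, 'n::finite) sq_mat set \<Rightarrow> ('a \<times> 'a) set" where
  "upper_Omega H = snd (upper_level F H)"

lemma upper_level_eq: "upper_level F H = (upper_ideal F H, upper_Omega H)"
  by (simp add: upper_Omega_def upper_level_def)

lemma upper_Omega_eq: "upper_Omega H = Omega_min F (upper_ideal F H) <#>\<^bsub>heis F\<^esub> circ_set F (upper_Z F H) UNIV"
  by (simp add: upper_Omega_def upper_level_def)

lemma upper_Y_le: "upper_Y F H \<subseteq> upper_ideal F H"
  using upper_ideal_incl by blast

lemma form_ideal_upper:
  assumes "H \<subseteq> UU" shows "form_ideal F (upper_ideal F H) (upper_Omega H)"
proof -
  interpret inv_ideal F "upper_ideal F H" by (rule upper_ideal_inv)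
  show ?thesis unfolding upper_Omega_eq
    using assms by (intro form_ideal_generated upper_Z_Omega_max upper_Y_le) blast
qed

lemma upper_Z_le: assumes "H \<subseteq> UU" shows "upper_Z F H \<subseteq> upper_Omega H"
proof
  interpret form_ideal F "upper_ideal F H" "Omega_min F (upper_ideal F H)"
    by (rule inv_ideal.form_ideal_min[OF upper_ideal_inv])
  fix a assume a: "a \<in> upper_Z F H"
  have "(0, 0) \<boxplus> a \<star> 1 \<in> upper_Omega H" unfolding upper_Omega_eq
    by (intro set_multI circ_setI a Omega_zero) simp
  then show "a \<in> upper_Omega H" by (simp add: hadd_zero)
qed

lemma upper_scal_mod:
  fixes H :: "('a, 'n::finite) sq_mat set"
  assumes "H \<subseteq> UU" "\<sigma> \<in> H" "i \<noteq> 0"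
  shows "form_ideal.scal_mod F (upper_ideal F H) (upper_Omega H) (\<sigma> $ i $ i) \<sigma>"
proof -
  interpret form_ideal F "upper_ideal F H" "upper_Omega H" by (rule form_ideal_upper[OF assms(1)])
  have "\<sigma> \<in> UU" using assms by blast
  then show ?thesis by (rule scal_mod_of_upper[OF assms(2) _ upper_Y_le upper_Z_le[OF assms(1)] assms(3)])
qed

text \<open>The upper level of \<open>H\<close> is the smallest form ideal modulo which every element of \<open>H\<close> acts
  as a scalar.\<close>

lemma upper_least:
  assumes "form_ideal F I \<Omega>" "\<And>\<sigma>. \<sigma> \<in> H \<Longrightarrow> \<exists>c. form_ideal.scal_mod F I \<Omega> c \<sigma>"
  shows "upper_ideal F H \<subseteq> I" "upper_Omega H \<subseteq> \<Omega>"
proof -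
  interpret form_ideal F I \<Omega> by fact
  have "upper_Y F H \<subseteq> I" using assms(2) scal_mod_scal by (intro scal_upper_Y) blast
  then show I: "upper_ideal F H \<subseteq> I" by (intro upper_ideal_min inv_ideal_axioms)
  interpret u: inv_ideal F "upper_ideal F H" by (rule upper_ideal_inv)
  have "upper_Z F H \<subseteq> \<Omega>" using assms(2) by (intro scal_mod_upper_Z)
  then have "circ_set F (upper_Z F H) UNIV \<subseteq> \<Omega>"
    by (intro circ_set_least Omega_subgroup Omega_circ) blast
  moreover have "Omega_min F (upper_ideal F H) \<subseteq> \<Omega>"
    unfolding Omega_min_def using I
    by (intro set_mult_least circ_set_least Omega_subgroup) (auto simp: trace_pairs_iff intro!: Omega_tr Omega_circ_I)
  ultimately show "upper_Omega H \<subseteq> \<Omega>"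
    unfolding upper_Omega_eq by (intro set_mult_least Omega_subgroup)
qed

definition cjg :: "('a, 'n::finite) sq_mat \<Rightarrow> ('a, 'n) sq_mat \<Rightarrow> ('a, 'n) sq_mat" where
  "cjg \<tau> \<sigma> = \<tau> ** \<sigma> ** iv \<tau>"

lemma cjg_UU: "\<tau> \<in> UU \<Longrightarrow> \<sigma> \<in> UU \<Longrightarrow> cjg \<tau> \<sigma> \<in> UU"
  by (simp add: cjg_def mult_UU iv_UU)

lemma cjg_cjg: "\<tau> \<in> UU \<Longrightarrow> \<rho> \<in> UU \<Longrightarrow> cjg \<tau> (cjg \<rho> \<sigma>) = cjg (\<tau> ** \<rho>) \<sigma>"
  by (simp add: cjg_def iv_mult matrix_mul_assoc)

lemma cjg_iv:
  fixes \<sigma> :: "('a, 'n::finite) sq_mat"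
  shows "\<tau> \<in> UU \<Longrightarrow> cjg (iv \<tau>) (cjg \<tau> \<sigma>) = \<sigma>" "\<tau> \<in> UU \<Longrightarrow> cjg \<tau> (cjg (iv \<tau>) \<sigma>) = \<sigma>"
proof -
  have 1: "iv (mat 1) = (mat 1 :: ('a, 'n) sq_mat)" by (intro iv_unique one_UU) simp
  show "cjg (iv \<tau>) (cjg \<tau> \<sigma>) = \<sigma>" "cjg \<tau> (cjg (iv \<tau>) \<sigma>) = \<sigma>" if "\<tau> \<in> UU"
    using that 1 by (simp_all add: cjg_cjg iv_UU iv_left iv_right) (simp_all add: cjg_def 1)
qed

lemma cjg_mult: "\<tau> \<in> UU \<Longrightarrow> cjg \<tau> (\<sigma> ** \<rho>) = cjg \<tau> \<sigma> ** cjg \<tau> \<rho>"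
proof -
  assume t: "\<tau> \<in> UU"
  have "cjg \<tau> \<sigma> ** cjg \<tau> \<rho> = \<tau> ** \<sigma> ** (iv \<tau> ** \<tau>) ** \<rho> ** iv \<tau>"
    by (simp only: cjg_def matrix_mul_assoc)
  then show ?thesis using iv_left[OF t] by (simp add: cjg_def matrix_mul_assoc)
qed

lemma cjg_of_iv: "\<tau> \<in> UU \<Longrightarrow> \<sigma> \<in> UU \<Longrightarrow> cjg \<tau> (iv \<sigma>) = iv (cjg \<tau> \<sigma>)"
  by (simp add: cjg_def iv_mult mult_UU iv_UU iv_iv matrix_mul_assoc)

text \<open>The minimality of the upper level together with the stability of scalars under
  elementary conjugation. Therefore any statement about the upper level of \<open>H\<close> may be
  proved after an elementary conjugation.\<close>

lemma upper_cjg: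
  fixes H :: "('a, 'n::finite) sq_mat set"
  assumes "H \<subseteq> UU" "\<tau> \<in> EU F"
  shows "upper_ideal F (cjg \<tau> ` H) = upper_ideal F H" "upper_Omega (cjg \<tau> ` H) = upper_Omega H"
proof -
  have le: "upper_ideal F (cjg \<tau> ` H) \<subseteq> upper_ideal F H \<and> upper_Omega (cjg \<tau> ` H) \<subseteq> upper_Omega H"
    if "H \<subseteq> UU" "\<tau> \<in> EU F" for H :: "('a, 'n) sq_mat set" and \<tau>
  proof -
    interpret form_ideal F "upper_ideal F H" "upper_Omega H" by (rule form_ideal_upper[OF that(1)])
    have "\<exists>c. scal_mod c \<sigma>" if s: "\<sigma> \<in> cjg \<tau> ` H" for \<sigma>
    proof -
      obtain \<rho> where "\<rho> \<in> H" "\<sigma> = cjg \<tau> \<rho>" using s by blast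
      then show ?thesis
        using scal_mod_conj_EU[OF \<open>\<tau> \<in> EU F\<close> upper_scal_mod[OF \<open>H \<subseteq> UU\<close>, of \<rho> "Pos undefined"]]
        by (auto simp: cjg_def)
    qed
    then show ?thesis using upper_least[OF form_ideal_axioms, of "cjg \<tau> ` H"] by blast
  qed
  have \<tau>: "\<tau> \<in> UU" by (rule EU_UU[OF assms(2)])
  have "cjg (iv \<tau>) ` cjg \<tau> ` H = H" using \<tau> by (simp add: image_image cjg_iv)
  moreover have "cjg \<tau> ` H \<subseteq> UU" using \<tau> assms(1) by (auto intro: cjg_UU)
  ultimately show "upper_ideal F (cjg \<tau> ` H) = upper_ideal F H" "upper_Omega (cjg \<tau> ` H) = upper_Omega H"
    using le[OF assms] le[of "cjg \<tau> ` H" "iv \<tau>"] EU_iv[OF assms(2)] by auto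
qed

end

section \<open>The upper bound\<close>

context form_ideal
begin

lemma U_rel_iff:
  fixes \<sigma> :: "('a, 'n::finite) sq_mat"
  shows "\<sigma> \<in> U_rel F (I, \<Omega>) \<longleftrightarrow> scal_mod 1 \<sigma>"
proof
  assume C: "scal_mod 1 \<sigma>"
  have "\<sigma> $ i $ j - (mat 1 :: ('a, 'n) sq_mat) $ i $ j \<in> I" if "i \<noteq> 0" "j \<noteq> 0" for i j
    using scal_coord[OF scal_mod_scal[OF C] ax_M[OF that(2), of 1] that(1)]
    by (simp add: matrix_vector_axis) (auto simp: axis_def mat_def)
  moreover have "heis_cong F (Q_form F (\<sigma> *v u)) (Q_form F u) \<Omega>" if u: "u \<in> M_Delta F" for u
  proof -
    obtain \<zeta> where "P u \<zeta> \<in> \<Delta>" using M_P[OF u] .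
    then show ?thesis using scal_modD[OF C] by (auto simp: heis_cong_def cg_def P_diff)
  qed
  ultimately show "\<sigma> \<in> U_rel F (I, \<Omega>)" using scal_mod_UU[OF C] by (auto simp: U_rel_def)
next
  assume "\<sigma> \<in> U_rel F (I, \<Omega>)"
  then have U: "\<sigma> \<in> UU" and hb: "\<And>i j. i \<noteq> 0 \<Longrightarrow> j \<noteq> 0 \<Longrightarrow> \<sigma> $ i $ j \<approx> (mat 1 :: ('a, 'n) sq_mat) $ i $ j"
    and Q: "\<And>u. u \<in> M_Delta F \<Longrightarrow> Q_form F (\<sigma> *v u) \<boxminus> Q_form F u \<in> \<Omega>"
    by (auto simp: U_rel_def heis_cong_def)
  have t: "cj y * mu F * ((\<sigma> *v u) $ 0 - u $ 0) \<in> I" if "u \<in> M_Delta F" "y \<in> JD" for u y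
    using Q[OF that(1)] that(2) by (auto simp: Q_form_eq hminus_pair intro: Omega_fst)
  have "scal 1 \<sigma>"
  proof (rule scal_of_entries[OF U])
    show "\<sigma> $ i $ j \<in> I" if "i \<noteq> 0" "j \<noteq> 0" "i \<noteq> j" for i j using hb[of i j] that by (simp add: mat_def)
    show "\<sigma> $ i $ i \<approx> 1" if "i \<noteq> 0" for i using hb[of i i] that by (simp add: mat_def)
    show "cj y * mu F * \<sigma> $ 0 $ j \<in> I" if "j \<noteq> 0" "y \<in> JD" for j y
      using t[OF ax_M[OF that(1), of 1] that(2)] that by (simp add: matrix_vector_axis axis_nth_neq)
    show "cj y * mu F * (\<sigma> $ 0 $ 0 - 1) * y' \<in> I" if "y \<in> JD" "y' \<in> JD" for y y'
      using t[OF ax0_M[OF that(2)] that(1)] by (simp add: matrix_vector_axis axis_nth algebra_simps)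
    fix i :: "'n signed" and y assume i: "i \<noteq> 0" and y: "y \<in> JD"
    let ?w = "\<sigma> *v axis 0 y" and ?l = "- i"
    have w: "?w \<in> M_Delta F" by (intro UU_M U ax0_M y)
    have l: "?l \<noteq> 0" using i by simp
    have "Bf ?w (\<sigma> *v ax ?l - ax ?l) \<in> I"
    proof -
      have "cj (?w $ j) * kap j * ((\<sigma> *v ax ?l) $ (- j) - ax ?l $ (- j)) \<in> I" for j
      proof (cases "j = 0")
        case True
        then show ?thesis using t[OF ax_M[OF l] , of "?w $ 0" 1] w by (auto simp: M_Delta_def)
      next
        case False
        have "\<sigma> $ (- j) $ ?l \<approx> (mat 1 :: ('a, 'n) sq_mat) $ (- j) $ ?l" using False l by (intro hb) simp_all
        also have "(mat 1 :: ('a, 'n) sq_mat) $ (- j) $ ?l = ax ?l $ (- j)" by (auto simp: mat_def axis_def)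
        finally show ?thesis by (intro I_mult) (simp add: matrix_vector_axis)
      qed
      then show ?thesis by (simp add: B_form_eq_sum I_sum)
    qed
    moreover have "Bf ?w (\<sigma> *v ax ?l) = 0" using l by (simp add: UU_B[OF U] B_axis_axis)
    ultimately have "- Bf ?w (ax ?l) \<in> I" by (simp add: B_lin)
    then have "- (- Bf ?w (ax ?l)) \<in> I" by (rule I_minus)
    then have "cj (Bf ?w (ax ?l)) \<in> I" by (simp add: I_cj)
    moreover have "Bf ?w (ax ?l) = cj (\<sigma> $ i $ 0 * y) * kap i" by (simp add: B_axis_right matrix_vector_axis)
    ultimately have "cj (kap i) * (\<sigma> $ i $ 0 * y) \<in> I" by (simp add: mult.commute)
    then have "kap i * (cj (kap i) * (\<sigma> $ i $ 0 * y)) \<in> I" by (rule I_mult)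
    then show "\<sigma> $ i $ 0 * y \<in> I" using kap_unit[OF i] by (simp add: mult.assoc[symmetric])
  qed
  moreover have "P (\<sigma> *v u) \<zeta> \<doteq> P u \<zeta> \<star> 1" if "P u \<zeta> \<in> \<Delta>" for u \<zeta>
    using that Q[OF P_M[OF that]] P_UU[OF U that] by (simp add: cg_def P_diff)
  ultimately show "scal_mod 1 \<sigma>" by (simp add: scal_mod_def)
qed

lemma scal_mod_one: "scal_mod 1 \<sigma> \<Longrightarrow> scal_mod 1 \<rho> \<Longrightarrow> scal_mod 1 (\<sigma> ** \<rho>)" "scal_mod 1 \<sigma> \<Longrightarrow> scal_mod 1 (iv \<sigma>)"
  using scal_mod_mult[of 1 \<sigma> 1 \<rho>] scal_mod_iv[of 1 \<sigma>] by simp_all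

lemma scal_mod_id: "scal_mod 1 (mat 1)"
  by (auto simp: scal_mod_def scal_def one_UU intro: cg_refl)

lemma U_rel_subgroup: "subgroup (U_rel F (I, \<Omega>)) UG"
proof
  show "U_rel F (I, \<Omega>) \<subseteq> UU" by (auto simp: U_rel_iff scal_mod_UU)
qed (simp_all add: U_rel_iff scal_mod_one scal_mod_id)

lemma scal_mod_conj_U_rel: "scal_mod c \<sigma> \<Longrightarrow> \<rho> \<in> U_rel F (I, \<Omega>) \<Longrightarrow> \<sigma> ** \<rho> ** iv \<sigma> \<in> U_rel F (I, \<Omega>)"
proof -
  assume C: "scal_mod c \<sigma>" and r: "\<rho> \<in> U_rel F (I, \<Omega>)"
  have "scal_mod (c * 1 * cj c) (\<sigma> ** \<rho> ** iv \<sigma>)"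
    using r by (intro scal_mod_mult scal_mod_iv C) (simp add: U_rel_iff)
  moreover have "c * 1 * cj c \<approx> 1" using scal_norm[OF scal_mod_scal[OF C]] by simp
  ultimately show ?thesis unfolding U_rel_iff by (rule scal_mod_cong)
qed

text \<open>Conjugating an element of the congruence subgroup by a scalar gives an element acting as
  1, so scalars normalise that subgroup; and an elementary conjugate of \<open>\<sigma>\<close> acts as the
  same scalar as \<open>\<sigma>\<close>, so that their quotient acts as 1.\<close>

lemma scal_mod_in_CU:
  fixes \<sigma> :: "('a, 'n::finite) sq_mat"
  assumes C: "scal_mod c \<sigma>" shows "\<sigma> \<in> CU F (I, \<Omega>)"
proof -
  let ?U = "U_rel F (I, \<Omega>) :: ('a, 'n) sq_mat set"
  note U = scal_mod_UU[OF C]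
  have sub: "?U \<subseteq> UU" by (rule subgroup.subset[OF U_rel_subgroup])
  have eq: "\<sigma> <#\<^bsub>UG\<^esub> ?U #>\<^bsub>UG\<^esub> iv \<sigma> = (\<lambda>\<rho>. \<sigma> ** \<rho> ** iv \<sigma>) ` ?U"
    by (auto simp: l_coset_def r_coset_def)
  have "(\<lambda>\<rho>. \<sigma> ** \<rho> ** iv \<sigma>) ` ?U = ?U"
  proof
    show "(\<lambda>\<rho>. \<sigma> ** \<rho> ** iv \<sigma>) ` ?U \<subseteq> ?U" using scal_mod_conj_U_rel[OF C] by blast
    show "?U \<subseteq> (\<lambda>\<rho>. \<sigma> ** \<rho> ** iv \<sigma>) ` ?U"
    proof
      fix \<rho> assume "\<rho> \<in> ?U"
      then have m: "iv \<sigma> ** \<rho> ** iv (iv \<sigma>) \<in> ?U" by (rule scal_mod_conj_U_rel[OF scal_mod_iv[OF C]])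
      have "\<rho> = \<sigma> ** (iv \<sigma> ** \<rho> ** iv (iv \<sigma>)) ** iv \<sigma>"
        using cjg_iv(2)[OF U, of \<rho>] by (simp add: cjg_def)
      then show "\<rho> \<in> (\<lambda>\<rho>. \<sigma> ** \<rho> ** iv \<sigma>) ` ?U" by (rule image_eqI[OF _ m])
    qed
  qed
  then have "\<sigma> \<in> NU F (I, \<Omega>)"
    using U sub by (simp add: NU_def normalizer_def stabilizer_def eq)
  moreover have "commutator_subgroup UG {\<sigma>} (EU F) \<subseteq> ?U"
    unfolding commutator_subgroup_def
  proof (rule group.generate_subgroup_incl[OF group_UG _ U_rel_subgroup], safe)
    fix \<tau> :: "('a, 'n) sq_mat" assume t: "\<tau> \<in> EU F"
    have "scal_mod (c * cj c) (\<sigma> ** (\<tau> ** iv \<sigma> ** iv \<tau>))" by (intro scal_mod_mult C scal_mod_conj_EU t scal_mod_iv)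
    then have "scal_mod 1 (\<sigma> ** (\<tau> ** iv \<sigma> ** iv \<tau>))" using scal_norm[OF scal_mod_scal[OF C]] by (rule scal_mod_cong)
    then show "\<sigma> \<otimes>\<^bsub>UG\<^esub> \<tau> \<otimes>\<^bsub>UG\<^esub> iv \<sigma> \<otimes>\<^bsub>UG\<^esub> iv \<tau> \<in> ?U" by (simp add: U_rel_iff matrix_mul_assoc)
  qed
  ultimately show ?thesis by (simp add: CU_def)
qed

end

lemma (in hermitian_form_ring) upper_bound:
  assumes "H \<subseteq> UU" shows "H \<subseteq> CU F (upper_level F H)"
proof
  fix \<sigma> assume s: "\<sigma> \<in> H"
  interpret form_ideal F "upper_ideal F H" "upper_Omega H" by (rule form_ideal_upper[OF assms])
  show "\<sigma> \<in> CU F (upper_level F H)" unfolding upper_level_eq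
    by (rule scal_mod_in_CU[OF upper_scal_mod[OF assms s, of "Pos undefined"]]) simp
qed

section \<open>Commutators modulo a subgroup\<close>

context group
begin

definition commut :: "'a \<Rightarrow> 'a \<Rightarrow> 'a" where
  "commut x y = x \<otimes> y \<otimes> inv x \<otimes> inv y"

definition norms :: "'a set \<Rightarrow> 'a \<Rightarrow> bool" where
  "norms H g \<longleftrightarrow> g \<in> carrier G \<and> (\<forall>h\<in>H. g \<otimes> h \<otimes> inv g \<in> H \<and> inv g \<otimes> h \<otimes> g \<in> H)"

lemma norms_carrier: "norms H g \<Longrightarrow> g \<in> carrier G" by (simp add: norms_def)

lemma commut_closed: "x \<in> carrier G \<Longrightarrow> y \<in> carrier G \<Longrightarrow> commut x y \<in> carrier G"
  by (simp add: commut_def)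

lemma inv_cancel: "x \<in> carrier G \<Longrightarrow> y \<in> carrier G \<Longrightarrow> inv x \<otimes> (x \<otimes> y) = y"
  "x \<in> carrier G \<Longrightarrow> y \<in> carrier G \<Longrightarrow> x \<otimes> (inv x \<otimes> y) = y"
  by (simp_all add: m_assoc[symmetric])

lemma norms_inv: "norms H g \<Longrightarrow> norms H (inv g)"
  by (auto simp: norms_def)

lemma norms_mult:
  assumes "H \<subseteq> carrier G" "norms H g" "norms H g'" shows "norms H (g \<otimes> g')"
proof -
  have c: "g \<in> carrier G" "g' \<in> carrier G" "\<And>h. h \<in> H \<Longrightarrow> h \<in> carrier G"
    using assms by (auto simp: norms_def)
  have "g \<otimes> g' \<otimes> h \<otimes> inv (g \<otimes> g') = g \<otimes> (g' \<otimes> h \<otimes> inv g') \<otimes> inv g"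
    "inv (g \<otimes> g') \<otimes> h \<otimes> (g \<otimes> g') = inv g' \<otimes> (inv g \<otimes> h \<otimes> g) \<otimes> g'" if "h \<in> H" for h
    using c c(3)[OF that] by (simp_all add: inv_mult_group m_assoc)
  then show ?thesis using assms c unfolding norms_def by auto
qed

lemma norms_commut:
  assumes "H \<subseteq> carrier G" "norms H x" "norms H y" shows "norms H (commut x y)"
  unfolding commut_def using assms by (intro norms_mult norms_inv)

lemma norms_self: assumes "subgroup H G" "h \<in> H" shows "norms H h"
proof -
  interpret H: subgroup H G by fact
  show ?thesis using assms(2) by (auto simp: norms_def)
qed

text \<open>In the quotient of its normaliser by \<open>H\<close>, a commutator depends on classes only.\<close>

lemma commut_cong:
  assumes H: "subgroup H G" and n: "norms H t" "norms H t'" "norms H e" and tt: "t \<otimes> inv t' \<in> H"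
  shows "commut t e \<otimes> inv (commut t' e) \<in> H"
proof -
  interpret H: subgroup H G by fact
  define h where "h = t \<otimes> inv t'"
  have c: "t \<in> carrier G" "t' \<in> carrier G" "e \<in> carrier G" "h \<in> carrier G"
    using n H.subset tt by (auto simp: norms_def h_def)
  have t: "t = h \<otimes> t'" using c by (simp add: h_def m_assoc)
  define d where "d = commut t' e"
  have d: "norms H d" unfolding d_def by (intro norms_commut H.subset n)
  have dc: "d \<in> carrier G" by (rule norms_carrier[OF d])
  have k: "e \<otimes> inv h \<otimes> inv e \<in> H" using n(3) tt by (auto simp: norms_def h_def[symmetric])
  have "commut t e = h \<otimes> d \<otimes> (e \<otimes> inv h \<otimes> inv e)"
    unfolding t commut_def d_def using c by (simp add: m_assoc inv_mult_group inv_cancel)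
  then have "commut t e \<otimes> inv d = h \<otimes> (d \<otimes> (e \<otimes> inv h \<otimes> inv e) \<otimes> inv d)"
    using c dc by (simp add: m_assoc)
  moreover have "d \<otimes> (e \<otimes> inv h \<otimes> inv e) \<otimes> inv d \<in> H" using d k by (auto simp: norms_def)
  ultimately show ?thesis using tt by (simp add: d_def h_def)
qed

lemma commut3_cong:
  assumes H: "subgroup H G" and n: "norms H t" "norms H t'" "norms H e\<^sub>1" "norms H e\<^sub>2" "norms H e\<^sub>3"
    and tt: "t \<otimes> inv t' \<in> H" and one: "commut (commut (commut t' e\<^sub>1) e\<^sub>2) e\<^sub>3 = \<one>"
  shows "commut (commut (commut t e\<^sub>1) e\<^sub>2) e\<^sub>3 \<in> H"
proof -
  note s = subgroup.subset[OF H]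
  have "commut (commut (commut t e\<^sub>1) e\<^sub>2) e\<^sub>3 \<otimes> inv (commut (commut (commut t' e\<^sub>1) e\<^sub>2) e\<^sub>3) \<in> H"
    by (intro commut_cong norms_commut H s n tt)
  moreover have "commut (commut (commut t e\<^sub>1) e\<^sub>2) e\<^sub>3 \<in> carrier G"
    using n by (intro norms_carrier[of H] norms_commut s)
  ultimately show ?thesis unfolding one by simp
qed

end

lemma matrix_vector_neg: "(- A) *v w = - (A *v w)" for A :: "'a::comm_ring_1^'n^'m"
  by (simp add: vec_eq_iff matrix_vector_mult_def sum_negf)

lemma matrix_mult_add: "(A + B) ** C = A ** C + B ** C" "C ** (A + B) = C ** A + C ** B"
  for A B C :: "'a::comm_ring_1^'n^'n"
  by (rule matrix_eqI, simp add: matrix_vector_mul_assoc[symmetric] matrix_vector_mult_add_rdistrib matrix_vector_right_distrib)+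

lemma normal_closure_normal:
  assumes "group G" "S \<subseteq> carrier G"
  shows "normal_closure G S \<lhd> G" "S \<subseteq> normal_closure G S"
proof -
  interpret group G by fact
  have c: "carrier G \<lhd> G" by (rule normal_invI) (auto intro: subgroup_self)
  let ?A = "{N. N \<lhd> G \<and> S \<subseteq> N}"
  have ne: "?A \<noteq> {}" using c assms(2) by blast
  have sub: "subgroup (\<Inter>?A) G" by (rule subgroups_Inter) (use ne in \<open>auto dest: normal_imp_subgroup\<close>)
  show "normal_closure G S \<lhd> G"
    unfolding normal_closure_def
    by (rule normal_invI[OF sub]) (auto intro: normal.inv_op_closed2)
  show "S \<subseteq> normal_closure G S" unfolding normal_closure_def by blast
qed

context hermitian_form_ring
begin

abbreviation cmt :: "('a, 'n::finite) sq_mat \<Rightarrow> ('a, 'n) sq_mat \<Rightarrow> ('a, 'n) sq_mat" where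
  "cmt \<equiv> group.commut UG"

lemma cmt_eq: "x \<in> UU \<Longrightarrow> y \<in> UU \<Longrightarrow> cmt x y = cjg x y ** iv y"
  using group.commut_def[OF group_UG, of x y] by (simp add: cjg_def)

lemma cmt_eq2: "x \<in> UU \<Longrightarrow> y \<in> UU \<Longrightarrow> cmt x y = x ** cjg y (iv x)"
  using group.commut_def[OF group_UG, of x y] by (simp add: cjg_def matrix_mul_assoc)

lemma cjg_Ei: "g \<in> UU \<Longrightarrow> cjg g (Ei u v y) = Ei (g *v u) (g *v v) y"
  by (simp add: cjg_def Ei_conj_UU)

lemma group_EU: "group (UG\<lparr>carrier := EU F\<rparr> :: ('a, 'n::finite) sq_mat monoid)"
  by (rule subgroup.subgroup_is_group[OF subgroup_EU group_UG])

lemma EU_ideal_le_EU: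
  assumes "form_ideal F I \<Omega>" shows "EU_ideal F (I, \<Omega>) \<subseteq> (EU F :: ('a, 'n::finite) sq_mat set)"
proof -
  interpret form_ideal F I \<Omega> by fact
  have "gens I \<Omega> \<subseteq> (EU F :: ('a, 'n) sq_mat set)"
    by (auto elim!: gens_cases intro: Rt_EU Lo_EU Omega_Delta)
  then show ?thesis unfolding EU_ideal_gens[OF I_ideal]
    by (rule group.generate_subgroup_incl[OF group_UG _ subgroup_EU])
qed

lemma EU_rel_normal:
  assumes "form_ideal F I \<Omega>"
  shows "EU_rel F (I, \<Omega>) \<lhd> (UG\<lparr>carrier := EU F\<rparr> :: ('a, 'n::finite) sq_mat monoid)"
    "EU_ideal F (I, \<Omega>) \<subseteq> (EU_rel F (I, \<Omega>) :: ('a, 'n) sq_mat set)"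
  unfolding EU_rel_def using EU_ideal_le_EU[OF assms]
  by (intro normal_closure_normal group_EU; simp)+

lemma iv_EU_eq: "\<tau> \<in> EU F \<Longrightarrow> inv\<^bsub>UG\<lparr>carrier := EU F\<rparr>\<^esub> \<tau> = iv \<tau>"
  by (rule group.m_inv_consistent[OF group_UG subgroup_EU])

text \<open>The relative elementary group is a normal closure inside the elementary group, so it
  suffices to contain the generators and to be stable under elementary conjugation.\<close>

lemma EU_rel_least:
  fixes N :: "('a, 'n::finite) sq_mat set"
  assumes "form_ideal F I \<Omega>" and N: "subgroup N UG"
    and c: "\<And>\<tau> g. \<tau> \<in> EU F \<Longrightarrow> g \<in> N \<Longrightarrow> cjg \<tau> g \<in> N" and g: "gens I \<Omega> \<subseteq> N"
  shows "EU_rel F (I, \<Omega>) \<subseteq> N"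
proof -
  interpret f: form_ideal F I \<Omega> by fact
  interpret E: group "UG\<lparr>carrier := EU F\<rparr> :: ('a, 'n) sq_mat monoid" by (rule group_EU)
  have s: "subgroup (N \<inter> EU F) UG" by (rule group.subgroups_Inter_pair[OF group_UG N subgroup_EU])
  have "N \<inter> EU F \<lhd> (UG\<lparr>carrier := EU F\<rparr>)"
  proof (rule E.normal_invI)
    show "subgroup (N \<inter> EU F) (UG\<lparr>carrier := EU F\<rparr>)"
      by (rule group.subgroup_incl[OF group_UG s subgroup_EU]) simp
    fix x h :: "('a, 'n) sq_mat" assume "x \<in> carrier (UG\<lparr>carrier := EU F\<rparr>)" "h \<in> N \<inter> EU F"
    then show "x \<otimes>\<^bsub>UG\<lparr>carrier := EU F\<rparr>\<^esub> h \<otimes>\<^bsub>UG\<lparr>carrier := EU F\<rparr>\<^esub> inv\<^bsub>UG\<lparr>carrier := EU F\<rparr>\<^esub> x \<in> N \<inter> EU F"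
      using c[of x h] by (simp add: iv_EU_eq cjg_def EU_mult EU_iv)
  qed
  moreover have "EU_ideal F (I, \<Omega>) \<subseteq> N \<inter> EU F"
    using EU_ideal_le_EU[OF assms(1)] group.generate_subgroup_incl[OF group_UG g N]
    unfolding EU_ideal_gens[OF f.I_ideal] by blast
  ultimately show ?thesis unfolding EU_rel_def normal_closure_def by blast
qed

end

section \<open>Subgroups normalised by a relative elementary group\<close>

locale level = inv_ideal F J
  for F :: "('a::comm_ring_1, 'b) form_data_scheme" and J :: "'a set"
begin

abbreviation EJ :: "('a, 'n::finite) sq_mat set" where "EJ \<equiv> EU_rel F (J, Omega_min F J)"

lemma EJ_gens: "gens J (Omega_min F J) \<subseteq> EJ"
  using EU_rel_normal(2)[OF form_ideal_min] unfolding EU_ideal_gens[OF I_ideal]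
  by (meson generate.incl subset_iff)

lemma EJ_Rt: "a \<noteq> 0 \<Longrightarrow> b \<noteq> 0 \<Longrightarrow> a \<noteq> b \<Longrightarrow> a \<noteq> - b \<Longrightarrow> x \<in> J \<Longrightarrow> Rt a b x \<in> EJ"
  using EJ_gens gens_Rt by blast

lemma EJ_Lo: "i \<noteq> 0 \<Longrightarrow> \<alpha> \<in> Omega_min F J \<Longrightarrow> Lo i \<alpha> \<in> EJ"
  using EJ_gens gens_Lo by blast

lemma EJ_EU: "g \<in> EJ \<Longrightarrow> g \<in> EU F"
  using normal_imp_subgroup[OF EU_rel_normal(1)[OF form_ideal_min], THEN subgroup.subset] by auto

lemma EJ_UU: "g \<in> EJ \<Longrightarrow> g \<in> UU" by (rule EU_UU[OF EJ_EU])

lemma EJ_mult: "g \<in> EJ \<Longrightarrow> h \<in> EJ \<Longrightarrow> g ** h \<in> EJ"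
  using subgroup.m_closed[OF normal_imp_subgroup[OF EU_rel_normal(1)[OF form_ideal_min]]] by simp

lemma EJ_iv: "g \<in> EJ \<Longrightarrow> iv g \<in> EJ"
  using subgroup.m_inv_closed[OF normal_imp_subgroup[OF EU_rel_normal(1)[OF form_ideal_min]], of g]
  by (simp add: iv_EU_eq EJ_EU)

lemma EJ_cjg: "\<tau> \<in> EU F \<Longrightarrow> g \<in> EJ \<Longrightarrow> cjg \<tau> g \<in> EJ"
  using normal.inv_op_closed2[OF EU_rel_normal(1)[OF form_ideal_min], of \<tau> g] by (simp add: iv_EU_eq cjg_def)

text \<open>The subgroups that occur in one step of a subnormal chain whose upper member contains
  \<open>EJ\<close>. An elementary conjugate of such a subgroup is of the same kind and has the same
  upper level.\<close>

definition good :: "('a, 'n::finite) sq_mat set \<Rightarrow> bool" where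
  "good H \<longleftrightarrow> subgroup H UG \<and> (\<forall>g\<in>EJ. \<forall>h\<in>H. cjg g h \<in> H)"

lemma good_subgroup: "good H \<Longrightarrow> subgroup H UG" by (simp add: good_def)
lemma good_UU: "good H \<Longrightarrow> \<sigma> \<in> H \<Longrightarrow> \<sigma> \<in> UU" using subgroup.subset[OF good_subgroup] by blast
lemma good_mult: "good H \<Longrightarrow> \<sigma> \<in> H \<Longrightarrow> \<rho> \<in> H \<Longrightarrow> \<sigma> ** \<rho> \<in> H"
  using subgroup.m_closed[OF good_subgroup] by fastforce
lemma good_iv: "good H \<Longrightarrow> \<sigma> \<in> H \<Longrightarrow> iv \<sigma> \<in> H"
  using subgroup.m_inv_closed[OF good_subgroup] by blast
lemma good_one: "good H \<Longrightarrow> mat 1 \<in> H"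
  using subgroup.one_closed[OF good_subgroup] by fastforce
lemma good_EJ: "good H \<Longrightarrow> g \<in> EJ \<Longrightarrow> \<sigma> \<in> H \<Longrightarrow> cjg g \<sigma> \<in> H" by (simp add: good_def)

lemma good_norms: "good H \<Longrightarrow> g \<in> EJ \<Longrightarrow> group.norms UG H g"
  unfolding group.norms_def[OF group_UG]
  using good_EJ[of H g] good_EJ[of H "iv g"] EJ_iv[of g] EJ_UU[of g] by (simp add: cjg_def iv_iv)

lemma good_cjg:
  assumes H: "good H" and t: "\<tau> \<in> EU F" shows "good (cjg \<tau> ` H)"
proof -
  note tU = EU_UU[OF t]
  have "subgroup (cjg \<tau> ` H) UG"
  proof
    show "cjg \<tau> ` H \<subseteq> UU" using good_UU[OF H] tU by (auto intro: cjg_UU)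
    show "\<one>\<^bsub>UG\<^esub> \<in> cjg \<tau> ` H"
      using good_one[OF H] iv_right[OF tU] by (auto simp: cjg_def intro!: image_eqI[of _ _ "mat 1"])
    show "x \<otimes>\<^bsub>UG\<^esub> y \<in> cjg \<tau> ` H" if "x \<in> cjg \<tau> ` H" "y \<in> cjg \<tau> ` H" for x y
      using that good_mult[OF H] by (auto simp: cjg_mult[OF tU, symmetric])
    show "iv x \<in> cjg \<tau> ` H" if "x \<in> cjg \<tau> ` H" for x
      using that good_iv[OF H] good_UU[OF H] by (auto simp: cjg_of_iv[OF tU, symmetric])
  qed
  moreover have "cjg g (cjg \<tau> h) \<in> cjg \<tau> ` H" if "g \<in> EJ" "h \<in> H" for g h
  proof -
    have "cjg (iv \<tau>) g \<in> EJ" by (intro EJ_cjg EU_iv t that)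
    then have "cjg (cjg (iv \<tau>) g) h \<in> H" by (rule good_EJ[OF H _ that(2)])
    moreover have "cjg \<tau> (cjg (cjg (iv \<tau>) g) h) = cjg g (cjg \<tau> h)"
    proof -
      have gU: "g \<in> UU" by (rule EJ_UU[OF that(1)])
      have "\<tau> ** cjg (iv \<tau>) g = g ** \<tau>"
        using iv_right[OF tU] by (simp add: cjg_def iv_iv[OF tU] matrix_mul_assoc)
      then show ?thesis using tU gU by (simp add: cjg_cjg cjg_UU iv_UU)
    qed
    ultimately show ?thesis by (metis image_eqI)
  qed
  ultimately show ?thesis by (auto simp: good_def)
qed

subsection \<open>Totally isotropic transvections\<close>

text \<open>The nilpotent part of a transvection is additive in both vectors, and such parts
  annihilate each other when all vectors are orthogonal. Products of transvections along
  isotropic subspaces thus become sums.\<close>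

definition Nn :: "'a^'n::finite signed \<Rightarrow> 'a^'n signed \<Rightarrow> ('a, 'n) sq_mat" where
  "Nn a b = ET a b - mat 1"

lemma ET_Nn: "ET a b = mat 1 + Nn a b" by (simp add: Nn_def)

lemma Nn_apply: "Nn a b *v w = Bf b w *s a - (cj (lam F) * Bf a w) *s b"
  by (simp add: Nn_def matrix_vector_mult_diff_rdistrib Ei_apply)

lemma Nn_lin: "Nn (a + a') b = Nn a b + Nn a' b" "Nn a (b + b') = Nn a b + Nn a b'"
  "Nn (a - a') b = Nn a b - Nn a' b" "Nn a (b - b') = Nn a b - Nn a b'"
  "Nn (- a) b = - Nn a b" "Nn a (- b) = - Nn a b"
  by (rule matrix_eqI, simp add: Nn_apply B_lin matrix_vector_mult_add_rdistrib matrix_vector_mult_diff_rdistrib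
        matrix_vector_neg vec_eq_iff algebra_simps)+

lemma Nn_mult: "Bf a c = 0 \<Longrightarrow> Bf a d = 0 \<Longrightarrow> Bf b c = 0 \<Longrightarrow> Bf b d = 0 \<Longrightarrow> Nn a b ** Nn c d = 0"
  by (rule matrix_eqI) (simp add: matrix_vector_mul_assoc[symmetric] Nn_apply B_lin)

end

section \<open>Extraction of root elements\<close>

lemma matrix_vector_neg_right: "A *v (- w) = - (A *v w)" for A :: "'a::comm_ring_1^'n^'m"
  by (simp add: vec_eq_iff matrix_vector_mult_def sum_negf)

context level
begin

lemma ET_mult_iso:
  "Bf a c = 0 \<Longrightarrow> Bf a d = 0 \<Longrightarrow> Bf b c = 0 \<Longrightarrow> Bf b d = 0 \<Longrightarrow> ET a b ** ET c d = mat 1 + (Nn a b + Nn c d)"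
  unfolding ET_Nn by (simp add: matrix_mult_add Nn_mult add.assoc add.commute)

lemma ET_add_left: "Bf a b = 0 \<Longrightarrow> Bf a a' = 0 \<Longrightarrow> Bf b b = 0 \<Longrightarrow> Bf b a' = 0 \<Longrightarrow> ET (a + a') b = ET a b ** ET a' b"
  by (subst ET_mult_iso) (simp_all add: ET_Nn Nn_lin)

lemma ET_add_right: "Bf a b' = 0 \<Longrightarrow> Bf a a = 0 \<Longrightarrow> Bf b a = 0 \<Longrightarrow> Bf b b' = 0 \<Longrightarrow> ET a (b + b') = ET a b ** ET a b'"
  by (subst ET_mult_iso) (simp_all add: ET_Nn Nn_lin)

lemma iv_ET:
  assumes "ET a b \<in> UU" "Bf a a = 0" "Bf a b = 0" "Bf b b = 0"
  shows "iv (ET a b) = ET (- a) b" "ET (- a) b \<in> UU"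
proof -
  have ba: "Bf b a = 0" using assms(3) B_self_skew by metis
  have e: "ET (- a) b ** ET a b = mat 1" "ET a b ** ET (- a) b = mat 1"
    using assms ba by (simp_all add: ET_mult_iso B_lin Nn_lin)
  have "iv (ET a b) = ET (- a) b ** (ET a b ** iv (ET a b))" unfolding matrix_mul_assoc e by simp
  then show i: "iv (ET a b) = ET (- a) b" using iv_right[OF assms(1)] by simp
  show "ET (- a) b \<in> UU" unfolding i[symmetric] by (rule iv_UU[OF assms(1)])
qed

lemma Rt_ET_right:
  fixes a b :: "'n::finite signed"
  shows "Rt a b x = ET (ax a) (axis b (cj x))"
proof -
  have "axis a x = x *s (ax a :: 'a^'n signed)" "axis b (cj x) = cj x *s (ax b :: 'a^'n signed)"
    by (simp_all add: axis_scale)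
  then show ?thesis unfolding Rt_def by (simp add: Ei_scale)
qed

lemma Ei_fix:
  assumes A: "Ei u v y \<in> UU" and r: "r \<in> UU" "r *v u = u" "r *v v = v"
  shows "cmt (Ei u v y) r = mat 1"
proof -
  have "cjg r (iv (Ei u v y)) = iv (Ei u v y)" by (simp add: cjg_of_iv A r cjg_Ei)
  then show ?thesis using cmt_eq2[OF A r(1)] iv_right[OF A] by simp
qed

text \<open>Modulo \<open>H\<close> the element \<open>t\<close> agrees with its conjugate under \<open>\<sigma>\<close>. The conjugate fixes
  \<open>e\<^sub>k\<close>, because \<open>t\<close> fixes the \<open>k\<close>-th column of \<open>\<sigma>\<close>. Two commutators with elements of
  the unipotent radical of \<open>e\<^sub>k\<close> therefore move it into the centre of this radical, and
  a third one, with an element centralising that centre, trivialises it. For \<open>t\<close> itself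
  the same commutators leave a visible product of transvections, which hence lies in
  \<open>H\<close>.\<close>

lemma extraction_commutator:
  fixes k i j :: "'n::finite signed"
  assumes H: "good H" and s: "\<sigma> \<in> H" and t: "t \<in> EJ"
    and fix_p: "t *v (\<sigma> *v ax k) = \<sigma> *v ax k" and ti: "t *v ax i = ax i"
    and nz: "k \<noteq> 0" "i \<noteq> 0" "j \<noteq> 0"
    and ne: "i \<noteq> k" "i \<noteq> - k" "j \<noteq> k" "j \<noteq> - k" "j \<noteq> i" "j \<noteq> - i"
    and x: "x\<^sub>2 \<in> J" "x\<^sub>3 \<in> J" "x\<^sub>4 \<in> J"
  defines "f \<equiv> t *v ax k" and "w \<equiv> axis i x\<^sub>2" and "w' \<equiv> axis j x\<^sub>3"
  defines "w\<^sub>1 \<equiv> w - (x\<^sub>2 * (cj (lam F) * cj x\<^sub>4 * kap (- i))) *s ax j"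
    and "\<beta> \<equiv> cj (lam F) * Bf f (ax k)" and "\<delta> \<equiv> cj (lam F) * Bf f w'"
  shows "ET (ax k - \<beta> *s w) (w' - \<delta> *s w) ** ET (- (ax k - \<beta> *s w\<^sub>1)) (w' - \<delta> *s w\<^sub>1) \<in> H"
proof -
  have ne': "- i \<noteq> k" "- k \<noteq> i" "- k \<noteq> j" "- i \<noteq> j" "- j \<noteq> k" "- j \<noteq> i" "k \<noteq> i" "k \<noteq> j" "i \<noteq> j"
    "k \<noteq> - i" "k \<noteq> - j" "i \<noteq> - j"
    using ne by auto
  note N = nz ne ne'
  define \<epsilon> where "\<epsilon> = Rt k i (cj x\<^sub>2)"
  define \<eta> where "\<eta> = Rt k j (cj x\<^sub>3)"
  define \<rho> where "\<rho> = Rt (- i) j x\<^sub>4"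
  define t' where "t' = cjg (iv \<sigma>) t"
  have sU: "\<sigma> \<in> UU" by (rule good_UU[OF H s])
  have tU: "t \<in> UU" by (rule EJ_UU[OF t])
  have E: "\<epsilon> \<in> EJ" "\<eta> \<in> EJ" "\<rho> \<in> EJ"
    unfolding \<epsilon>_def \<eta>_def \<rho>_def using N x by (auto intro!: EJ_Rt I_cj)
  have EU: "\<epsilon> \<in> UU" "\<eta> \<in> UU" "\<rho> \<in> UU" using E EJ_UU by blast+
  have \<epsilon>: "\<epsilon> = ET (ax k) w" and \<eta>: "\<eta> = ET (ax k) w'" by (simp_all add: \<epsilon>_def \<eta>_def Rt_ET_right w_def w'_def)
  have B0: "Bf (ax k) (ax k) = 0" "Bf (ax k) w = 0" "Bf (ax k) w' = 0" "Bf w w = 0" "Bf w w' = 0" "Bf w' w' = 0"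
    "Bf w (ax k) = 0" "Bf w' (ax k) = 0" "Bf w' w = 0"
    using N by (auto simp: w_def w'_def B_axis_axis)
  have iv\<epsilon>: "iv \<epsilon> = ET (- ax k) w" unfolding \<epsilon> by (rule iv_ET) (use EU(1)[unfolded \<epsilon>] B0 in simp_all)
  have iv\<eta>: "iv \<eta> = ET (- ax k) w'" unfolding \<eta> by (rule iv_ET) (use EU(2)[unfolded \<eta>] B0 in simp_all)
  have neg: "ET (- a) b = ET a (- b)" for a b by (simp add: ET_Nn Nn_lin)
  have t'U: "t' \<in> UU" unfolding t'_def by (intro cjg_UU iv_UU sU tU)
  have t'k: "t' *v ax k = ax k"
    unfolding t'_def cjg_def by (simp add: matrix_vector_mul_assoc[symmetric] iv_iv sU fix_p iv_apply[OF sU])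
  have norms: "group.norms UG H t" "group.norms UG H \<epsilon>" "group.norms UG H \<eta>" "group.norms UG H \<rho>"
    using good_norms[OF H] t E by blast+
  have norm_s: "group.norms UG H \<sigma>" by (rule group.norms_self[OF group_UG good_subgroup[OF H] s])
  have Hs: "H \<subseteq> UU" using good_UU[OF H] by blast
  have norm_t': "group.norms UG H t'"
  proof -
    have "group.norms UG H (iv \<sigma> \<otimes>\<^bsub>UG\<^esub> t \<otimes>\<^bsub>UG\<^esub> \<sigma>)"
      by (intro group.norms_mult[OF group_UG Hs] group.norms_inv[OF group_UG] norm_s norms(1))
    then show ?thesis by (simp add: t'_def cjg_def iv_iv sU)
  qed
  (* t and its conjugate agree modulo H, as EJ normalises H *)
  have "t ** iv t' \<in> H"
  proof -
    have "t ** iv t' = cjg t (iv \<sigma>) ** \<sigma>"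
      unfolding t'_def by (simp add: cjg_def iv_mult mult_UU iv_UU iv_iv sU tU matrix_mul_assoc)
    then show ?thesis using good_mult[OF H good_EJ[OF H t good_iv[OF H s]] s] by simp
  qed
  (* the conjugate fixes e_k: the first commutator lies in the unipotent radical of e_k, the
     second in its centre, and rho centralises the centre *)
  moreover have "cmt (cmt (cmt t' \<epsilon>) \<eta>) \<rho> = mat 1"
  proof -
    let ?v = "t' *v w"
    have kv: "Bf (ax k) ?v = 0" using UU_B[OF t'U, of "ax k" w] by (simp add: t'k B0)
    define g where "g = cmt t' \<epsilon>"
    have gU: "g \<in> UU" unfolding g_def by (rule group.commut_closed[OF group_UG t'U EU(1)])
    have "g = ET (ax k) ?v ** ET (ax k) (- w)"
      unfolding g_def cmt_eq[OF t'U EU(1)] iv\<epsilon> neg unfolding \<epsilon> cjg_Ei[OF t'U] t'k ..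
    then have g: "g = Ei (ax k) (?v + - w) (0 + 0 - Bf ?v (- w) * cj (lam F))"
      by (simp only:) (rule Ei_mult, simp_all add: B0 kv B_lin)
    have gk: "g *v ax k = ax k"
    proof -
      have "Bf (?v + - w) (ax k) = 0"
        using kv B0 B_self_skew[of "ax k" ?v] by (simp add: B_lin)
      then show ?thesis unfolding g by (simp add: Ei_apply B0)
    qed
    define c where "c = Bf (?v + - w) w'"
    have gw': "g *v w' = w' + c *s ax k"
      unfolding g c_def by (simp add: Ei_apply B0)
    have "cmt g \<eta> = ET (ax k) (w' + c *s ax k) ** ET (ax k) (- w')"
      unfolding cmt_eq[OF gU EU(2)] iv\<eta> neg unfolding \<eta> cjg_Ei[OF gU] gk gw' ..
    also have "\<dots> = Ei (ax k) (w' + c *s ax k + - w') (0 + 0 - Bf (w' + c *s ax k) (- w') * cj (lam F))"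
      by (rule Ei_mult) (simp_all add: B0 B_lin)
    finally have Xc: "cmt g \<eta> = Ei (ax k) (c *s ax k) (- Bf (w' + c *s ax k) (- w') * cj (lam F))" by simp
    have XcU: "cmt g \<eta> \<in> UU" by (rule group.commut_closed[OF group_UG gU EU(2)])
    have "\<rho> *v ax k = ax k"
      unfolding \<rho>_def Rt_def Ei_apply using N by (simp add: B_axis_axis)
    then have "\<rho> *v (c *s ax k) = c *s ax k" "\<rho> *v ax k = ax k" by (simp_all add: matrix_vector_scale)
    then show ?thesis unfolding g_def[symmetric] Xc
      by (intro Ei_fix EU(3)) (use XcU Xc in simp_all)
  qed
  ultimately have main: "cmt (cmt (cmt t \<epsilon>) \<eta>) \<rho> \<in> H"
    using group.commut3_cong[OF group_UG good_subgroup[OF H] norms(1) norm_t' norms(2-4)] by simp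
  have tw: "t *v w = w"
  proof -
    have "w = x\<^sub>2 *s ax i" by (simp add: w_def axis_scale)
    then show ?thesis using ti by (simp add: matrix_vector_scale)
  qed
  have fw: "Bf f w = 0" using UU_B[OF tU, of "ax k" w] by (simp add: f_def tw B0)
  have wf: "Bf w f = 0" using fw B_self_skew by metis
  define g where "g = cmt t \<epsilon>"
  have gU: "g \<in> UU" unfolding g_def by (rule group.commut_closed[OF group_UG tU EU(1)])
  have g: "g = ET f w ** ET (- ax k) w"
    unfolding g_def cmt_eq[OF tU EU(1)] iv\<epsilon> unfolding \<epsilon> cjg_Ei[OF tU] tw f_def ..
  have gk: "g *v ax k = ax k - \<beta> *s w"
    unfolding g matrix_vector_mul_assoc[symmetric] \<beta>_def by (simp add: Ei_apply B_lin B0)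
  have gw': "g *v w' = w' - \<delta> *s w"
    unfolding g matrix_vector_mul_assoc[symmetric] \<delta>_def by (simp add: Ei_apply B_lin B0)
  define Xc where "Xc = cmt g \<eta>"
  let ?a = "ax k - \<beta> *s w" and ?b = "w' - \<delta> *s w" and ?a1 = "ax k - \<beta> *s w\<^sub>1" and ?b1 = "w' - \<delta> *s w\<^sub>1"
  have XcU: "Xc \<in> UU" unfolding Xc_def by (rule group.commut_closed[OF group_UG gU EU(2)])
  have Xc: "Xc = ET ?a ?b ** ET (- ax k) w'"
    unfolding Xc_def cmt_eq[OF gU EU(2)] iv\<eta> unfolding \<eta> cjg_Ei[OF gU] gk gw' ..
  have abU: "ET ?a ?b \<in> UU"
  proof -
    have "ET ?a ?b = cjg g \<eta>" unfolding \<eta> cjg_Ei[OF gU] gk gw' ..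
    then show ?thesis using cjg_UU[OF gU EU(2)] by simp
  qed
  have Bab: "Bf ?a ?a = 0" "Bf ?a ?b = 0" "Bf ?b ?b = 0" by (simp_all add: B_lin B0)
  have ivab: "iv (ET ?a ?b) = ET (- ?a) ?b" by (rule iv_ET(1)[OF abU Bab])
  have ivXc: "iv Xc = \<eta> ** ET (- ?a) ?b"
    unfolding Xc iv\<eta>[symmetric] using abU EU(2) by (simp add: iv_mult iv_UU iv_iv ivab)
  have rk: "\<rho> *v ax k = ax k" and rw': "\<rho> *v w' = w'"
    unfolding \<rho>_def Rt_def Ei_apply w'_def using N by (simp_all add: B_axis_axis)
  have rw: "\<rho> *v w = w\<^sub>1"
    unfolding \<rho>_def Rt_def Ei_apply w\<^sub>1_def w_def using N
    by (simp add: B_axis_axis) (simp add: ac_simps)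
  have "cjg \<rho> (iv Xc) = \<eta> ** ET (- ?a1) ?b1"
    unfolding ivXc cjg_mult[OF EU(3)] \<eta> cjg_Ei[OF EU(3)]
    by (simp add: matrix_vector_mult_diff_distrib matrix_vector_scale rk rw rw' matrix_vector_right_distrib
        matrix_vector_neg_right)
  then have "cmt Xc \<rho> = ET ?a ?b ** (iv \<eta> ** \<eta>) ** ET (- ?a1) ?b1"
    using cmt_eq2[OF XcU EU(3)] Xc by (simp add: iv\<eta>[symmetric] matrix_mul_assoc)
  then have "cmt Xc \<rho> = ET ?a ?b ** ET (- ?a1) ?b1" by (simp add: iv_left[OF EU(2)])
  then show ?thesis using main by (simp add: Xc_def g_def)
qed

lemma ET_axis:
  fixes a b :: "'c::finite signed"
  shows "ET (axis a x) (axis b y) = Rt a b (x * cj y)"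
proof -
  have "ET (axis a x) (axis b y :: 'a^'c signed) = ET (x *s ax a) (axis b y)" by (simp add: axis_scale)
  also have "\<dots> = ET (ax a) (cj x *s axis b y)" by (simp only: Ei_scale mult_zero_left)
  also have "\<dots> = ET (ax a) (axis b (cj x * y))" by (simp only: axis_scale)
  also have "\<dots> = Rt a b (x * cj y)" by (simp add: Rt_ET_right mult.commute)
  finally show ?thesis .
qed

lemma unit_cancel: "kap a * cj (kap a) = 1 \<Longrightarrow> kap b * cj (kap b) = 1 \<Longrightarrow>
    lam F * f * cj (kap a) * y\<^sub>3 * y\<^sub>2 * lam F * (cj (lam F) * cj (lam F) * kap a * kap b * y\<^sub>4) * cj (kap b)
    = f * (y\<^sub>2 * y\<^sub>3 * y\<^sub>4)"
proof -
  assume k: "kap a * cj (kap a) = 1" "kap b * cj (kap b) = 1"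
  have "lam F * f * cj (kap a) * y\<^sub>3 * y\<^sub>2 * lam F * (cj (lam F) * cj (lam F) * kap a * kap b * y\<^sub>4) * cj (kap b)
    = (lam F * cj (lam F)) * (lam F * cj (lam F)) * (kap a * cj (kap a)) * (kap b * cj (kap b)) * (f * (y\<^sub>2 * y\<^sub>3 * y\<^sub>4))"
    by (simp only: ac_simps)
  then show ?thesis by (simp add: k)
qed

text \<open>If \<open>t e\<^sub>k\<close> is orthogonal to \<open>e\<^sub>k\<close>, the element found above is already a root element. In
  general one more commutator, with a root element that adds a multiple of \<open>e\<^sub>b\<close> to
  \<open>e\<^sub>k\<close>, isolates a root element; it costs a further factor from \<open>J\<close>.\<close>

lemma extraction:
  fixes k i j :: "'n::finite signed"
  assumes H: "good H" and s: "\<sigma> \<in> H" and t: "t \<in> EJ"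
    and fix_p: "t *v (\<sigma> *v ax k) = \<sigma> *v ax k" and ti: "t *v ax i = ax i"
    and nz: "k \<noteq> 0" "i \<noteq> 0" "j \<noteq> 0"
    and ne: "i \<noteq> k" "i \<noteq> - k" "j \<noteq> k" "j \<noteq> - k" "j \<noteq> i" "j \<noteq> - i"
    and y: "y\<^sub>2 \<in> J" "y\<^sub>3 \<in> J" "y\<^sub>4 \<in> J"
  shows "Bf (t *v ax k) (ax k) = 0 \<Longrightarrow> Rt k j ((t *v ax k) $ (- j) * (y\<^sub>2 * y\<^sub>3 * y\<^sub>4)) \<in> H"
    and "b \<noteq> 0 \<Longrightarrow> b \<noteq> k \<Longrightarrow> b \<noteq> - k \<Longrightarrow> b \<noteq> - i \<Longrightarrow> b \<noteq> j \<Longrightarrow> b \<noteq> - j \<Longrightarrow> y\<^sub>5 \<in> J \<Longrightarrow>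
      Rt b j ((t *v ax k) $ (- j) * (y\<^sub>2 * y\<^sub>3 * y\<^sub>4 * y\<^sub>5)) \<in> H"
proof -
  define f where "f = t *v ax k"
  (* the units are chosen to cancel in the parameter of the resulting root element *)
  define x\<^sub>4 where "x\<^sub>4 = - (cj (lam F) * cj (lam F) * kap (- j) * kap (- i) * y\<^sub>4)"
  define w where "w = (axis i (cj y\<^sub>2) :: 'a^'n signed)"
  define w' where "w' = (axis j (cj y\<^sub>3) :: 'a^'n signed)"
  define g where "g = cj y\<^sub>2 * (cj (lam F) * cj x\<^sub>4 * kap (- i))"
  define w\<^sub>1 where "w\<^sub>1 = w - g *s ax j"
  define \<beta> where "\<beta> = cj (lam F) * Bf f (ax k)"
  define \<delta> where "\<delta> = cj (lam F) * Bf f w'"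
  define a where "a = ax k - \<beta> *s w"
  define a1 where "a1 = ax k - \<beta> *s w\<^sub>1"
  define b0 where "b0 = w' - \<delta> *s w"
  define b1 where "b1 = w' - \<delta> *s w\<^sub>1"
  have ne': "- i \<noteq> k" "- k \<noteq> i" "- k \<noteq> j" "- i \<noteq> j" "- j \<noteq> k" "- j \<noteq> i" "k \<noteq> i" "k \<noteq> j" "i \<noteq> j"
    "k \<noteq> - i" "k \<noteq> - j" "i \<noteq> - j"
    using ne by auto
  note N = nz ne ne'
  have "cj y\<^sub>2 \<in> J" "cj y\<^sub>3 \<in> J" "x\<^sub>4 \<in> J" using y by (auto simp: x\<^sub>4_def intro!: I_cj I_minus I_mult)
  from extraction_commutator[OF H s t fix_p ti nz ne this]
  have main: "ET a b0 ** ET (- a1) b1 \<in> H"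
    unfolding a_def a1_def b0_def b1_def \<beta>_def \<delta>_def w\<^sub>1_def g_def w_def w'_def f_def .
  have B0: "Bf (ax k) (ax k) = 0" "Bf (ax k) w = 0" "Bf (ax k) w' = 0" "Bf w w = 0" "Bf w w' = 0" "Bf w' w' = 0"
    "Bf w (ax k) = 0" "Bf w' (ax k) = 0" "Bf w' w = 0" "Bf (ax j) (ax j) = 0" "Bf (ax j) w = 0" "Bf (ax j) w' = 0"
    "Bf (ax k) (ax j) = 0" "Bf w (ax j) = 0" "Bf w' (ax j) = 0" "Bf (ax j) (ax k) = 0"
    using N by (auto simp: w_def w'_def B_axis_axis)
  have Y: "ET a b0 ** ET (- a1) b1 = mat 1 + (Nn a b0 - Nn a1 b1)"
    by (subst ET_mult_iso) (simp_all add: a_def a1_def b0_def b1_def w\<^sub>1_def B_lin B0 Nn_lin)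
  have b10: "b1 - b0 = axis j (\<delta> * g)"
    by (simp add: b1_def b0_def w\<^sub>1_def axis_scale[symmetric] vector_ssub_ldistrib vec_eq_iff algebra_simps)
       (simp add: axis_def)
  have ki: "kap (- i) * cj (kap (- i)) = 1" "kap (- j) * cj (kap (- j)) = 1"
    using N by (auto intro: kap_unit)
  have val: "cj (\<delta> * g) = - (f $ (- j) * (y\<^sub>2 * y\<^sub>3 * y\<^sub>4))"
  proof -
    have "cj (\<delta> * g) = - (lam F * f $ (- j) * cj (kap (- j)) * y\<^sub>3 * y\<^sub>2 * lam F
       * (cj (lam F) * cj (lam F) * kap (- j) * kap (- i) * y\<^sub>4) * cj (kap (- i)))"
      by (simp add: \<delta>_def g_def w'_def B_axis_right x\<^sub>4_def ac_simps)
    then show ?thesis unfolding unit_cancel[OF ki(2,1)] .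
  qed
  show "Rt k j ((t *v ax k) $ (- j) * (y\<^sub>2 * y\<^sub>3 * y\<^sub>4)) \<in> H" if "Bf (t *v ax k) (ax k) = 0"
  proof -
    have z: "Bf f (ax k) = 0" using that by (simp add: f_def)
    have "a = ax k" "a1 = ax k" by (simp_all add: a_def a1_def \<beta>_def z)
    then have "ET a b0 ** ET (- a1) b1 = mat 1 + Nn (ax k) (b0 - b1)"
      unfolding Y by (simp add: Nn_lin)
    also have "b0 - b1 = - axis j (\<delta> * g)" using b10 by (metis minus_diff_eq)
    also have "- axis j (\<delta> * g) = axis j (- (\<delta> * g))" by (rule axis_minus)
    also have "mat 1 + Nn (ax k) (axis j (- (\<delta> * g))) = Rt k j (- cj (\<delta> * g))"
      by (simp add: ET_Nn[symmetric] ET_axis)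
    finally show ?thesis using main val by (simp add: f_def)
  qed
  assume b: "b \<noteq> 0" "b \<noteq> k" "b \<noteq> - k" "b \<noteq> - i" "b \<noteq> j" "b \<noteq> - j" and y5: "y\<^sub>5 \<in> J"
  have b': "- b \<noteq> k" "- b \<noteq> i" "- b \<noteq> j" "k \<noteq> b" "k \<noteq> - b" "j \<noteq> b" "j \<noteq> - b" "i \<noteq> - b" "- k \<noteq> b" "- j \<noteq> b" using b by auto
  (* the element theta adds a multiple of e_b to e_k; comparing with the conjugate isolates the
     root (b, j) *)
  define x\<^sub>5 where "x\<^sub>5 = cj (lam F) * kap (- k) * cj y\<^sub>5"
  define h where "h = (axis b (- y\<^sub>5) :: 'a^'n signed)"
  define \<theta> where "\<theta> = Rt (- k) b x\<^sub>5"
  have \<theta>: "\<theta> \<in> EJ" unfolding \<theta>_def using b b' N y5 by (intro EJ_Rt) (auto simp: x\<^sub>5_def intro: I_mult I_cj)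
  note \<theta>U = EJ_UU[OF \<theta>]
  have kk: "kap (- k) * cj (kap (- k)) = 1" using N by (intro kap_unit) simp
  have tk: "\<theta> *v ax k = ax k + h"
  proof -
    have "cj (lam F) * (cj x\<^sub>5 * kap (- k)) = (lam F * cj (lam F)) * (kap (- k) * cj (kap (- k))) * y\<^sub>5"
      by (simp only: x\<^sub>5_def cj_mult cj_cj ac_simps)
    then have e: "cj (lam F) * (cj x\<^sub>5 * kap (- k)) = y\<^sub>5" by (simp add: kk)
    show ?thesis unfolding \<theta>_def Rt_def Ei_apply h_def using b b' N
      by (simp add: B_axis_axis e axis_scale axis_minus[symmetric])
  qed
  have tw: "\<theta> *v w = w" "\<theta> *v w' = w'" "\<theta> *v ax j = ax j"
    unfolding \<theta>_def Rt_def Ei_apply w_def w'_def using b b' N by (simp_all add: B_axis_axis)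
  have ta: "\<theta> *v a = a + h" "\<theta> *v a1 = a1 + h" "\<theta> *v b0 = b0" "\<theta> *v b1 = b1"
    by (simp_all add: a_def a1_def b0_def b1_def w\<^sub>1_def matrix_vector_mult_diff_distrib matrix_vector_scale tk tw)
  have Bh: "Bf h (ax k) = 0" "Bf h w = 0" "Bf h w' = 0" "Bf h (ax j) = 0" "Bf (ax k) h = 0" "Bf w h = 0"
     "Bf w' h = 0" "Bf (ax j) h = 0" "Bf h h = 0"
    using b b' N by (auto simp: h_def w_def w'_def B_axis_axis)
  have c1: "cjg \<theta> (ET a b0 ** ET (- a1) b1) = ET (a + h) b0 ** ET (- (a1 + h)) b1"
    unfolding cjg_mult[OF \<theta>U] cjg_Ei[OF \<theta>U] by (simp add: ta matrix_vector_neg_right)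
  have c2: "ET (a + h) b0 ** ET (- (a1 + h)) b1 = mat 1 + (Nn (a + h) b0 + Nn (- (a1 + h)) b1)"
    by (rule ET_mult_iso) (simp_all add: a_def a1_def b0_def b1_def w\<^sub>1_def B_lin B0 Bh)
  have c3: "Nn h (b0 - b1) ** Nn a b0 = 0" "Nn h (b0 - b1) ** Nn a1 b1 = 0"
    by (rule Nn_mult; simp add: a_def a1_def b0_def b1_def w\<^sub>1_def B_lin B0 Bh)+
  have c4: "Nn h (b0 - b1) ** (Nn a b0 - Nn a1 b1) = 0"
    using matrix_mult_add(2)[of "Nn h (b0 - b1)" "Nn a b0 - Nn a1 b1" "Nn a1 b1"] c3 by simp
  have "ET h (b0 - b1) ** (ET a b0 ** ET (- a1) b1) = cjg \<theta> (ET a b0 ** ET (- a1) b1)"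
  proof -
    have "Nn (a + h) b0 + Nn (- (a1 + h)) b1 = Nn h (b0 - b1) + (Nn a b0 - Nn a1 b1)" by (simp add: Nn_lin)
    then show ?thesis unfolding c1 c2 unfolding Y ET_Nn[of h "b0 - b1"] by (simp add: matrix_mult_add c4 add_ac)
  qed
  moreover have "cjg \<theta> (ET a b0 ** ET (- a1) b1) \<in> H" by (rule good_EJ[OF H \<theta> main])
  ultimately have "ET h (b0 - b1) ** (ET a b0 ** ET (- a1) b1) ** iv (ET a b0 ** ET (- a1) b1) \<in> H"
    using good_mult[OF H _ good_iv[OF H main]] by simp
  then have "ET h (b0 - b1) \<in> H"
    using iv_right[OF good_UU[OF H main]] by (simp add: matrix_mul_assoc[symmetric])
  moreover have "b0 - b1 = axis j (- (\<delta> * g))"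
    using b10 axis_minus[of j "\<delta> * g"] by (metis minus_diff_eq)
  ultimately have "Rt b j (- y\<^sub>5 * - cj (\<delta> * g)) \<in> H" by (simp add: h_def ET_axis)
  moreover have "- y\<^sub>5 * - cj (\<delta> * g) = - (f $ (- j) * (y\<^sub>2 * y\<^sub>3 * y\<^sub>4 * y\<^sub>5))"
    unfolding val by (simp add: ac_simps)
  ultimately have m: "Rt b j (- (f $ (- j) * (y\<^sub>2 * y\<^sub>3 * y\<^sub>4 * y\<^sub>5))) \<in> H" by simp
  have "iv (Rt b j (- (f $ (- j) * (y\<^sub>2 * y\<^sub>3 * y\<^sub>4 * y\<^sub>5)))) = Rt b j (f $ (- j) * (y\<^sub>2 * y\<^sub>3 * y\<^sub>4 * y\<^sub>5))"
    using b b' N by (subst iv_Rt) auto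
  then show "Rt b j ((t *v ax k) $ (- j) * (y\<^sub>2 * y\<^sub>3 * y\<^sub>4 * y\<^sub>5)) \<in> H"
    using good_iv[OF H m] by (simp add: f_def)
qed

end

section \<open>Roots and levels\<close>

text \<open>The indices of a short root: two basis vectors that span an isotropic plane.\<close>

definition rt :: "'n signed \<Rightarrow> 'n signed \<Rightarrow> bool" where
  "rt a b \<longleftrightarrow> a \<noteq> 0 \<and> b \<noteq> 0 \<and> a \<noteq> b \<and> a \<noteq> - b"

lemma rtD: "rt a b \<Longrightarrow> a \<noteq> 0" "rt a b \<Longrightarrow> b \<noteq> 0" "rt a b \<Longrightarrow> a \<noteq> b" "rt a b \<Longrightarrow> b \<noteq> a" "rt a b \<Longrightarrow> a \<noteq> - b"
  "rt a b \<Longrightarrow> - a \<noteq> b" "rt a b \<Longrightarrow> b \<noteq> - a" "rt a b \<Longrightarrow> - b \<noteq> a"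
  by (auto simp: rt_def)

lemma rt_sym: "rt a b \<Longrightarrow> rt b a" by (auto simp: rt_def)
lemma rt_minus [simp]: "rt (- a) b \<longleftrightarrow> rt a b" "rt a (- b) \<longleftrightarrow> rt a b"
  by (auto simp: rt_def)

lemma rt_other:
  fixes a b c :: "'n::finite signed"
  assumes "CARD('n) \<ge> 4"
  obtains x :: "'n signed" where "x \<noteq> 0" "x \<noteq> a" "x \<noteq> - a" "x \<noteq> b" "x \<noteq> - b" "x \<noteq> c" "x \<noteq> - c"
proof -
  define ix where "ix = (\<lambda>i::'n signed. case i of Pos k \<Rightarrow> k | Neg k \<Rightarrow> k | Mid \<Rightarrow> undefined)"
  have "card {ix a, ix b, ix c} \<le> 3" by (simp add: card_insert_if)
  then have "{ix a, ix b, ix c} \<noteq> UNIV" using assms by auto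
  then obtain i where i: "i \<notin> {ix a, ix b, ix c}" by blast
  have "Pos i \<noteq> y \<and> Pos i \<noteq> - y" if "i \<noteq> ix y" for y
    using that by (cases y) (auto simp: ix_def)
  then show ?thesis using that[of "Pos i"] i by auto
qed

context level
begin

definition Jp :: "nat \<Rightarrow> 'a set" where "Jp m = J [^]\<^bsub>ideals_set ring_UNIV\<^esub> m"

lemma Jp_0 [simp]: "Jp 0 = UNIV"
  by (simp add: Jp_def nat_pow_def ideals_set_def)

lemma Jp_Suc: "Jp (Suc m) = ideal_prod ring_UNIV (Jp m) J"
  by (simp add: Jp_def nat_pow_def) (simp add: ideals_set_def)

lemma Jp_ideal: "ideal (Jp m) ring_UNIV"
proof (induction m)
  case (Suc m)
  then show ?case unfolding Jp_Suc by (rule ring.ideal_prod_is_ideal[OF ring_from_type_algebra _ I_ideal])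
qed (simp add: ideal_UNIV)

lemma Jp_add: "x \<in> Jp m \<Longrightarrow> y \<in> Jp m \<Longrightarrow> x + y \<in> Jp m" using Jp_ideal[of m] by (simp add: ideal_UNIV_iff)
lemma Jp_mult: "x \<in> Jp m \<Longrightarrow> r * x \<in> Jp m" using Jp_ideal[of m] by (simp add: ideal_UNIV_iff)
lemma Jp_prod: "x \<in> Jp m \<Longrightarrow> z \<in> J \<Longrightarrow> x * z \<in> Jp (Suc m)"
  unfolding Jp_Suc using ideal_prod.prod[of x "Jp m" z J ring_UNIV] by simp

lemma Jp_Suc_induct [consumes 1, case_names prod sum]:
  assumes "x \<in> Jp (Suc m)" "\<And>y z. y \<in> Jp m \<Longrightarrow> z \<in> J \<Longrightarrow> Q (y * z)" "\<And>x y. Q x \<Longrightarrow> Q y \<Longrightarrow> Q (x + y)"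
  shows "Q x"
  using assms(1) unfolding Jp_Suc
  by (induction rule: ideal_prod.induct) (use assms(2,3) in auto)

lemma Jp_Suc_le: "Jp (Suc m) \<subseteq> Jp m"
proof
  fix x assume "x \<in> Jp (Suc m)" then show "x \<in> Jp m"
  proof (induction rule: Jp_Suc_induct)
    case (prod y z) then show ?case using Jp_mult[of y m z] by (simp add: mult.commute)
  qed (rule Jp_add)
qed

lemma Jp_mono: "m \<le> m' \<Longrightarrow> Jp m' \<subseteq> Jp m"
  by (induction m' rule: nat_induct_at_least) (use Jp_Suc_le in auto)

lemma Jp_cj: "x \<in> Jp m \<Longrightarrow> cj x \<in> Jp m"
proof (induction m arbitrary: x)
  case (Suc m)
  from Suc.prems show ?case
    by (induction rule: Jp_Suc_induct) (use Suc.IH in \<open>auto intro: Jp_prod I_cj Jp_add\<close>)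
qed simp

text \<open>The coefficients \<open>x\<close> such that the root subgroup of \<open>(a, b)\<close> meets \<open>H\<close> in all parameters
  from \<open>x J\<^sup>m\<close>. The exponent finally reached at all roots is 9, and one more for the
  form parameter makes the 10 of the theorem.\<close>

definition Lv :: "('a, 'n::finite) sq_mat set \<Rightarrow> 'n signed \<Rightarrow> 'n signed \<Rightarrow> nat \<Rightarrow> 'a set" where
  "Lv H a b m = {x. \<forall>y\<in>Jp m. Rt a b (x * y) \<in> H}"

lemma LvD: "x \<in> Lv H a b m \<Longrightarrow> y \<in> Jp m \<Longrightarrow> Rt a b (x * y) \<in> H" by (simp add: Lv_def)
lemma LvI: "(\<And>y. y \<in> Jp m \<Longrightarrow> Rt a b (x * y) \<in> H) \<Longrightarrow> x \<in> Lv H a b m" by (simp add: Lv_def)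

lemma Lv_mono: "x \<in> Lv H a b m \<Longrightarrow> m \<le> m' \<Longrightarrow> x \<in> Lv H a b m'"
  unfolding Lv_def using Jp_mono by blast

lemma Lv_mult: "x \<in> Lv H a b m \<Longrightarrow> r * x \<in> Lv H a b m"
  using Jp_mult[of _ m r] LvD[of x H a b m] by (auto intro!: LvI simp: mult.assoc mult.left_commute[of r])

lemma Lv_add:
  assumes "good H" "rt a b" shows "x \<in> Lv H a b m \<Longrightarrow> y \<in> Lv H a b m \<Longrightarrow> x + y \<in> Lv H a b m"
  using good_mult[OF assms(1)] rtD[OF assms(2)]
  by (auto intro!: LvI dest!: LvD simp: distrib_right Rt_mult[symmetric])

lemma Lv_minus: "x \<in> Lv H a b m \<Longrightarrow> - x \<in> Lv H a b m"
  using Lv_mult[of x H a b m "-1"] by simp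

lemma Lv_diff: "good H \<Longrightarrow> rt a b \<Longrightarrow> x \<in> Lv H a b m \<Longrightarrow> y \<in> Lv H a b m \<Longrightarrow> x - y \<in> Lv H a b m"
  unfolding diff_conv_add_uminus by (intro Lv_add Lv_minus)

lemma Lv_SucI:
  assumes "good H" "rt a b" "\<And>z. z \<in> J \<Longrightarrow> x * z \<in> Lv H a b m"
  shows "x \<in> Lv H a b (Suc m)"
proof (rule LvI)
  fix y assume "y \<in> Jp (Suc m)"
  then show "Rt a b (x * y) \<in> H"
  proof (induction rule: Jp_Suc_induct)
    case (prod y z)
    then show ?case using LvD[OF assms(3)[of z], of y] by (simp add: ac_simps)
  next
    case (sum y z)
    then show ?case using good_mult[OF assms(1) sum] rtD[OF assms(2)] by (simp add: Rt_mult distrib_left)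
  qed
qed

lemma Lv_4I:
  assumes "good H" "rt a b" "\<And>y\<^sub>1 y\<^sub>2 y\<^sub>3 y\<^sub>4. y\<^sub>1 \<in> J \<Longrightarrow> y\<^sub>2 \<in> J \<Longrightarrow> y\<^sub>3 \<in> J \<Longrightarrow> y\<^sub>4 \<in> J \<Longrightarrow> Rt a b (x * (y\<^sub>1 * y\<^sub>2 * y\<^sub>3 * y\<^sub>4)) \<in> H"
  shows "x \<in> Lv H a b 4"
proof -
  have "x * y\<^sub>1 * y\<^sub>2 * y\<^sub>3 * y\<^sub>4 \<in> Lv H a b 0" if "y\<^sub>1 \<in> J" "y\<^sub>2 \<in> J" "y\<^sub>3 \<in> J" "y\<^sub>4 \<in> J" for y\<^sub>1 y\<^sub>2 y\<^sub>3 y\<^sub>4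
    using assms(3)[OF that(1-3) I_mult2[OF that(4)]] by (intro LvI) (simp add: mult.assoc)
  then have "x \<in> Lv H a b (Suc (Suc (Suc (Suc 0))))" by (intro Lv_SucI assms(1,2))
  then show ?thesis by (simp add: eval_nat_numeral)
qed

lemma Rt_flip: "Rt a b x = Rt b a (- (cj (lam F) * cj x))"
proof -
  have "Rt a b x = ET (- cj (lam F) *s ax b) (axis a x)" unfolding Rt_def by (rule ET_swap)
  also have "\<dots> = Rt b a (- cj (lam F) * cj x)" by (simp add: axis_scale ET_axis)
  finally show ?thesis by simp
qed

lemma Lv_flip: "x \<in> Lv H a b m \<Longrightarrow> cj x \<in> Lv H b a m"
proof (rule LvI)
  fix y assume x: "x \<in> Lv H a b m" and y: "y \<in> Jp m"
  have "Rt a b (x * (- cj (lam F) * cj y)) \<in> H" by (rule LvD[OF x]) (intro Jp_mult Jp_cj y)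
  then show "Rt b a (cj x * y) \<in> H" by (simp add: Rt_flip[of b a] ac_simps)
qed

text \<open>A commutator with a root element of \<open>EJ\<close> replaces one index of a root and costs one
  factor from \<open>J\<close>.\<close>

lemma Lv_move1:
  assumes H: "good H" and r: "rt a b" "rt c b" "rt c a" and x: "x \<in> Lv H a b m"
  shows "x \<in> Lv H c b (Suc m)"
proof (rule Lv_SucI[OF H r(2)], rule LvI)
  note R = rtD[OF r(1)] rtD[OF r(2)] rtD[OF r(3)]
  fix z y assume z: "z \<in> J" and y: "y \<in> Jp m"
  define d where "d = - (cj (lam F) * kap (- a) * cj z)"
  define \<theta> where "\<theta> = Rt (- a) c d"
  have \<theta>: "\<theta> \<in> EJ" unfolding \<theta>_def using z R by (intro EJ_Rt) (auto simp: d_def intro!: I_minus I_mult I_cj)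
  note \<theta>U = EJ_UU[OF \<theta>]
  have k: "kap (- a) * cj (kap (- a)) = 1" using R by (intro kap_unit) simp
  have "- (cj (lam F) * (cj d * kap (- a))) = (lam F * cj (lam F)) * (kap (- a) * cj (kap (- a))) * z"
    by (simp only: d_def cj_minus cj_mult cj_cj minus_mult_left[symmetric] minus_mult_right[symmetric] minus_minus ac_simps)
  then have e: "- (cj (lam F) * (cj d * kap (- a))) = z" by (simp add: k)
  have ta: "\<theta> *v axis a (x * y) = axis a (x * y) + axis c (x * z * y)"
  proof -
    have 0: "Bf (ax c) (axis a (x * y) :: 'a^'c signed) = 0" using R by (simp add: B_axis_axis)
    have "\<theta> *v axis a (x * y) = axis a (x * y) + (- (cj (lam F) * (cj d * kap (- a))) * (x * y)) *s ax c"
      unfolding \<theta>_def Rt_def Ei_apply 0 by (simp add: B_axis_axis vec_eq_iff algebra_simps)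
    then show ?thesis unfolding e by (simp add: axis_scale ac_simps)
  qed
  have tb: "\<theta> *v ax b = ax b" unfolding \<theta>_def Rt_def Ei_apply using R by (simp add: B_axis_axis)
  have m: "Rt a b (x * y) \<in> H" by (rule LvD[OF x y])
  have "cjg \<theta> (Rt a b (x * y)) = ET (axis c (x * z * y) + axis a (x * y)) (ax b)"
    unfolding Rt_def[of a b] cjg_Ei[OF \<theta>U] ta tb by (simp add: add.commute)
  also have "\<dots> = Rt c b (x * z * y) ** Rt a b (x * y)"
    unfolding Rt_def using R by (intro ET_add_left) (simp_all add: B_axis_axis)
  finally have "Rt c b (x * z * y) ** Rt a b (x * y) \<in> H" using good_EJ[OF H \<theta> m] by simp
  from good_mult[OF H this good_iv[OF H m]]
  show "Rt c b (x * z * y) \<in> H" using iv_right[OF good_UU[OF H m]] by (simp add: matrix_mul_assoc[symmetric])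
qed

lemma Lv_move2:
  assumes H: "good H" and r: "rt a b" "rt a c" "rt c b" and x: "x \<in> Lv H a b m"
  shows "x \<in> Lv H a c (Suc m)"
  using Lv_flip[OF Lv_move1[OF H rt_sym[OF r(1)] rt_sym[OF r(2)] r(3) Lv_flip[OF x]]] by simp

text \<open>An elementary conjugation that fixes both basis vectors of a root fixes its root
  elements.\<close>

lemma Lv_cjg:
  assumes "good H" "\<rho> \<in> EU F" "\<rho> *v ax a = ax a" "\<rho> *v ax b = ax b" "x \<in> Lv (cjg (iv \<rho>) ` H) a b m"
  shows "x \<in> Lv H a b m"
proof (rule LvI)
  fix y assume "y \<in> Jp m"
  then have "Rt a b (x * y) \<in> cjg (iv \<rho>) ` H" by (rule LvD[OF assms(5)])
  then obtain h where h: "h \<in> H" "Rt a b (x * y) = cjg (iv \<rho>) h" by blast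
  note \<rho>U = EU_UU[OF assms(2)]
  have e: "axis a (x * y) = (x * y) *s (ax a :: 'a^'c signed)" by (simp add: axis_scale)
  have "cjg \<rho> (Rt a b (x * y)) = Rt a b (x * y)"
    unfolding Rt_def cjg_Ei[OF \<rho>U] e by (simp add: matrix_vector_scale assms(3,4))
  then show "Rt a b (x * y) \<in> H" using h cjg_iv(2)[OF \<rho>U, of h] by simp
qed

text \<open>A root with first index \<open>k\<close> can be moved to every root whose first index is not \<open>- k\<close>:
  first the first index, then the second, and a third move when an intermediate root
  would be degenerate.\<close>

lemma Lv_reach3:
  fixes a b k s :: "'n::finite signed"
  assumes n: "CARD('n) \<ge> 4" and H: "good H" and r: "rt k s" "rt a b" "a \<noteq> - k" and x: "x \<in> Lv H k s m"
  shows "x \<in> Lv H a b (m + 3)"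
proof -
  have 1: "x \<in> Lv H c s (m + 1)" if "rt c s" "c \<noteq> - k" for c
  proof (cases "c = k")
    case True
    then show ?thesis using Lv_mono[OF x] by simp
  next
    case False
    then have "rt c k" using that rtD[OF r(1)] rtD[OF that(1)] by (simp add: rt_def)
    then show ?thesis using Lv_move1[OF H r(1) that(1) _ x] by simp
  qed
  have 2: "x \<in> Lv H c d (m + 2)" if "rt c s" "c \<noteq> - k" "rt c d" "rt d s" for c d
    using Lv_move2[OF H that(1,3,4) 1[OF that(1,2)]] by simp
  show ?thesis
  proof (cases "rt a s")
    case True
    show ?thesis
    proof (cases "rt b s")
      case rbs: True
      show ?thesis using Lv_mono[OF 2[OF True r(3,2) rbs]] by simp
    next
      case False
      then have b: "b = s \<or> b = - s" using rtD[OF r(2)] rtD[OF True] by (auto simp: rt_def)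
      obtain y where y: "y \<noteq> 0" "y \<noteq> s" "y \<noteq> - s" "y \<noteq> a" "y \<noteq> - a" using rt_other[OF n, of s a a] by metis
      have "rt a y" "rt y s" "rt b y" using y b rtD[OF True] by (auto simp: rt_def)
      then show ?thesis using Lv_move2[OF H _ r(2) _ 2[OF True r(3)]] by (simp add: eval_nat_numeral)
    qed
  next
    case False
    then have a: "a = s \<or> a = - s" using rtD[OF r(1)] rtD[OF r(2)] by (auto simp: rt_def)
    obtain y where y: "y \<noteq> 0" "y \<noteq> s" "y \<noteq> - s" "y \<noteq> b" "y \<noteq> - b" "y \<noteq> k" "y \<noteq> - k" using rt_other[OF n, of s b k] by metis
    have "rt y s" "rt y b" "rt b s" "rt a y"
      using y a rtD[OF r(2)] rtD[OF r(1)] by (auto simp: rt_def)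
    then show ?thesis using Lv_move1[OF H _ r(2) _ 2[of y b]] y by (simp add: eval_nat_numeral)
  qed
qed

text \<open>If the root can be chosen freely outside two pairs of indices, then each of its two
  indices has to be corrected at most once.\<close>

lemma Lv_reach2:
  fixes a b k l :: "'n::finite signed"
  assumes n: "CARD('n) \<ge> 4" and H: "good H" and r: "rt k l" "rt a b"
    and x: "\<And>c d. rt c d \<Longrightarrow> rt c k \<Longrightarrow> rt c l \<Longrightarrow> rt d k \<Longrightarrow> rt d l \<Longrightarrow> x \<in> Lv H c d m"
  shows "x \<in> Lv H a b (m + 2)"
proof -
  have 1: "x \<in> Lv H c d (m + 1)" if d: "rt c d" "rt d k" "rt d l" for c d
  proof (cases "rt c k \<and> rt c l")
    case True
    then show ?thesis using Lv_mono[OF x[OF d(1) _ _ d(2,3)]] by simp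
  next
    case False
    obtain y where y: "y \<noteq> 0" "y \<noteq> k" "y \<noteq> - k" "y \<noteq> l" "y \<noteq> - l" "y \<noteq> d" "y \<noteq> - d" using rt_other[OF n, of k l d] by metis
    have y': "rt y k" "rt y l" "rt y d" "rt c y" using False y d r rtD[OF d(1)] rtD[OF r(1)] by (auto simp: rt_def)
    then show ?thesis using Lv_move1[OF H _ d(1) _ x[of y d]] d by simp
  qed
  show ?thesis
  proof (cases "rt b k \<and> rt b l")
    case True
    then show ?thesis using Lv_mono[OF 1[OF r(2)]] by simp
  next
    case False
    obtain y where y: "y \<noteq> 0" "y \<noteq> k" "y \<noteq> - k" "y \<noteq> l" "y \<noteq> - l" "y \<noteq> a" "y \<noteq> - a" using rt_other[OF n, of k l a] by metis
    have y': "rt y k" "rt y l" "rt a y" "rt b y" using False y r rtD[OF r(2)] rtD[OF r(1)] by (auto simp: rt_def)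
    then show ?thesis using Lv_move2[OF H _ r(2) _ 1[of a y]] by (simp add: eval_nat_numeral)
  qed
qed

section \<open>Koszul transvections and the entries of a column\<close>

text \<open>The values of the Hermitian form of the \<open>k\<close>-th column with the basis vectors: up to
  units and conjugation, the entries of that column.\<close>

definition col_coeff :: "('a, 'n::finite) sq_mat \<Rightarrow> 'n signed \<Rightarrow> 'n signed \<Rightarrow> 'a" where
  "col_coeff \<sigma> k i = Bf (\<sigma> *v ax k) (ax i)"

text \<open>The Koszul syzygies of these coefficients; as vectors they are orthogonal to the \<open>k\<close>-th
  column.\<close>

definition koszul :: "('a, 'n::finite) sq_mat \<Rightarrow> 'n signed \<Rightarrow> 'n signed \<Rightarrow> 'n signed \<Rightarrow> 'a^'n signed" where
  "koszul \<sigma> k a b = axis a (col_coeff \<sigma> k b) - axis b (col_coeff \<sigma> k a)"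

lemma col_coeff_axis: "Bf (\<sigma> *v ax k) (axis i x) = col_coeff \<sigma> k i * x"
proof -
  have "axis i x = x *s (ax i :: 'a^'c signed)" by (simp add: axis_scale)
  then show ?thesis by (simp add: col_coeff_def B_lin mult.commute)
qed

lemma koszul_perp: "Bf (\<sigma> *v ax k) (koszul \<sigma> k a b) = 0"
  by (simp add: koszul_def B_lin col_coeff_axis)

lemma ET_same_Lo:
  assumes "a \<noteq> 0"
  shows "ET (axis a \<alpha>) (axis a \<beta>) = Lo a (0, tr (if a \<in> Theta_pos then cj (\<alpha> * cj \<beta>) else lam F * (\<alpha> * cj \<beta>)))"
proof -
  define s where "s = \<alpha> * cj \<beta>"
  have *: "ET (axis a \<alpha>) (axis a \<beta>) = Ei (ax a) 0 (s - cj (lam F) * cj s)"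
    using assms(1)
    by (intro matrix_eqI)
      (simp add: Ei_apply B_axis_left B_lin axis_scale, simp add: vec_eq_iff axis_def s_def algebra_simps)
  have l: "lam F * (s * cj (lam F)) = s" for s by (metis mult.commute mult.assoc lam_cj mult_1)
  show ?thesis
  proof (cases "a \<in> Theta_pos")
    case True
    then show ?thesis
      unfolding * by (simp add: Lo_eq_Ei[OF assms(1)] tr_def s_def mult.commute)
  next
    case False
    have "tr (lam F * s) * cj (lam F) = lam F * (s * cj (lam F)) - cj s * cj (lam F) * (lam F * cj (lam F))"
      unfolding tr_def cj_mult left_diff_distrib by (simp only: ac_simps)
    then have "tr (lam F * s) * cj (lam F) = s - cj (lam F) * cj s" by (simp add: l mult.commute)
    then show ?thesis
      unfolding * using False by (simp add: Lo_eq_Ei[OF assms(1)] s_def)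
  qed
qed

lemma ET_same_axis:
  assumes "a \<noteq> 0" "\<alpha> \<in> J" shows "ET (axis a \<alpha>) (axis a \<beta>) \<in> EJ"
proof -
  interpret m: form_ideal F J "Omega_min F J" by (rule form_ideal_min)
  have "\<alpha> * cj \<beta> \<in> J" using assms by (simp add: I_mult2)
  then have "(if a \<in> Theta_pos then cj (\<alpha> * cj \<beta>) else lam F * (\<alpha> * cj \<beta>)) \<in> J"
    by (metis I_cj I_mult)
  then show ?thesis unfolding ET_same_Lo[OF assms(1)] by (intro EJ_Lo[OF assms(1)] m.Omega_tr)
qed

lemma EJ_ET_axis: "a \<noteq> 0 \<Longrightarrow> b \<noteq> 0 \<Longrightarrow> a \<noteq> - b \<Longrightarrow> \<alpha> \<in> J \<Longrightarrow> ET (axis a \<alpha>) (axis b \<beta>) \<in> EJ"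
  using ET_same_axis EJ_Rt[of a b "\<alpha> * cj \<beta>"] by (cases "a = b") (auto simp: ET_axis I_mult2)

text \<open>For pairwise orthogonal indices, two Koszul vectors with a common index span an
  isotropic plane orthogonal to the \<open>k\<close>-th column, so the transvection along it fixes
  this column; it belongs to \<open>EJ\<close> since it splits into root elements with parameters in
  \<open>J\<close>.\<close>

lemma koszul_transvection:
  fixes \<sigma> :: "('a, 'n::finite) sq_mat" and k a b d :: "'n signed"
  assumes "rt a b" "rt a d" "rt b d" "x \<in> J"
  defines "t \<equiv> ET (x *s koszul \<sigma> k a b) (koszul \<sigma> k a d)"
  shows "t \<in> EJ" "t *v (\<sigma> *v ax k) = \<sigma> *v ax k"
    and "i \<noteq> - a \<Longrightarrow> i \<noteq> - b \<Longrightarrow> i \<noteq> - d \<Longrightarrow> t *v ax i = ax i"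
    and "t *v ax k = ax k + (x * Bf (koszul \<sigma> k a d) (ax k)) *s koszul \<sigma> k a b
            - (cj (lam F) * cj x * Bf (koszul \<sigma> k a b) (ax k)) *s koszul \<sigma> k a d"
proof -
  note R = rtD[OF assms(1)] rtD[OF assms(2)] rtD[OF assms(3)]
  let ?u1 = "axis a (x * col_coeff \<sigma> k b) :: 'a^'n signed" and ?u2 = "axis b (- (x * col_coeff \<sigma> k a)) :: 'a^'n signed"
  let ?v1 = "axis a (col_coeff \<sigma> k d) :: 'a^'n signed" and ?v2 = "axis d (- col_coeff \<sigma> k a) :: 'a^'n signed"
  have u: "x *s koszul \<sigma> k a b = ?u1 + ?u2" by (simp add: koszul_def vec_eq_iff axis_def algebra_simps)
  have v: "koszul \<sigma> k a d = ?v1 + ?v2" by (simp add: koszul_def vec_eq_iff axis_def algebra_simps)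
  have "t = ET ?u1 (?v1 + ?v2) ** ET ?u2 (?v1 + ?v2)"
    unfolding t_def u v using R by (intro ET_add_left) (simp_all add: B_lin B_axis_axis)
  also have "ET ?u1 (?v1 + ?v2) = ET ?u1 ?v1 ** ET ?u1 ?v2"
    using R by (intro ET_add_right) (simp_all add: B_axis_axis)
  also have "ET ?u2 (?v1 + ?v2) = ET ?u2 ?v1 ** ET ?u2 ?v2"
    using R by (intro ET_add_right) (simp_all add: B_axis_axis)
  finally have t: "t = ET ?u1 ?v1 ** ET ?u1 ?v2 ** (ET ?u2 ?v1 ** ET ?u2 ?v2)" .
  show "t \<in> EJ" unfolding t using R assms(4)
    by (intro EJ_mult EJ_ET_axis) (auto intro: I_mult2 I_minus)
  have "Bf (koszul \<sigma> k c e) (\<sigma> *v ax k) = 0" for c e using koszul_perp B_self_skew by metis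
  then show "t *v (\<sigma> *v ax k) = \<sigma> *v ax k" unfolding t_def by (simp add: Ei_apply B_lin)
  show "t *v ax k = ax k + (x * Bf (koszul \<sigma> k a d) (ax k)) *s koszul \<sigma> k a b
            - (cj (lam F) * cj x * Bf (koszul \<sigma> k a b) (ax k)) *s koszul \<sigma> k a d"
    unfolding t_def by (simp add: Ei_apply B_lin vec_eq_iff algebra_simps)
  show "t *v ax i = ax i" if i: "i \<noteq> - a" "i \<noteq> - b" "i \<noteq> - d"
  proof -
    have "Bf (koszul \<sigma> k a b) (ax i) = 0" "Bf (koszul \<sigma> k a d) (ax i) = 0"
      using i by (simp_all add: koszul_def B_lin B_axis_axis)
    then show ?thesis unfolding t_def by (simp add: Ei_apply B_lin)
  qed
qed

lemma koszul_nth: "rt a b \<Longrightarrow> koszul \<sigma> k a b $ a = col_coeff \<sigma> k b" "rt a b \<Longrightarrow> koszul \<sigma> k a b $ b = - col_coeff \<sigma> k a"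
  "i \<noteq> a \<Longrightarrow> i \<noteq> b \<Longrightarrow> koszul \<sigma> k a b $ i = 0"
  by (auto simp: koszul_def axis_def rt_def)

lemma koszul_B: "Bf (koszul \<sigma> k a b) (ax k) = cj (koszul \<sigma> k a b $ (- k)) * kap (- k)"
  by (simp add: B_axis_right)

text \<open>The Koszul transvection of the indices \<open>S\<close>, \<open>L\<close>, \<open>- k\<close> changes \<open>e\<^sub>k\<close> by a vector with
  indices \<open>S\<close> and \<open>L\<close>. Then \<open>t e\<^sub>k\<close> stays orthogonal to \<open>e\<^sub>k\<close>, and the cheaper form of
  the extraction applies.\<close>

lemma quad_A:
  fixes k L S :: "'n::finite signed"
  assumes H: "good H" and s: "\<sigma> \<in> H" and r: "rt k L" "rt k S" "rt L S"
  shows "col_coeff \<sigma> k L * cj (col_coeff \<sigma> k S) \<in> Lv H k (- S) 4" and "col_coeff \<sigma> k S * cj (col_coeff \<sigma> k S) \<in> Lv H k (- L) 4"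
proof -
  note R = rtD[OF r(1)] rtD[OF r(2)] rtD[OF r(3)]
  have kk: "kap (- k) * cj (kap (- k)) = 1" using R by (intro kap_unit) simp
  have main: "Rt k (- S) (col_coeff \<sigma> k L * cj (col_coeff \<sigma> k S) * (y\<^sub>1 * y\<^sub>2 * y\<^sub>3 * y\<^sub>4)) \<in> H
      \<and> Rt k (- L) (col_coeff \<sigma> k S * cj (col_coeff \<sigma> k S) * (y\<^sub>1 * y\<^sub>2 * y\<^sub>3 * y\<^sub>4)) \<in> H"
    if y: "y\<^sub>1 \<in> J" "y\<^sub>2 \<in> J" "y\<^sub>3 \<in> J" "y\<^sub>4 \<in> J" for y\<^sub>1 y\<^sub>2 y\<^sub>3 y\<^sub>4
  proof -
    have test: "\<exists>t\<in>EJ. t *v (\<sigma> *v ax k) = \<sigma> *v ax k \<and> Bf (t *v ax k) (ax k) = 0 \<and>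
        (\<forall>i. i \<noteq> - S \<longrightarrow> i \<noteq> - L \<longrightarrow> i \<noteq> k \<longrightarrow> t *v ax i = ax i) \<and>
        (t *v ax k) $ S = col_coeff \<sigma> k L * cj (col_coeff \<sigma> k S) * e * y\<^sub>1 \<and> (t *v ax k) $ L = - (col_coeff \<sigma> k S * cj (col_coeff \<sigma> k S) * e * y\<^sub>1)"
      if e: "e = 1 \<or> e = -1" for e
    proof -
      define x where "x = - e * cj (kap (- k)) * y\<^sub>1"
      have xJ: "x \<in> J" unfolding x_def by (intro I_mult y)
      note K = koszul_transvection[OF _ _ _ xJ, where a = S and b = L and d = "- k" and \<sigma> = \<sigma> and k = k]
      have rr: "rt S L" "rt S (- k)" "rt L (- k)" using r by (auto intro: rt_sym)
      note K = K[OF rr]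
      have B1: "Bf (koszul \<sigma> k S L) (ax k) = 0" unfolding koszul_B using R by (simp add: koszul_nth(3))
      have B2: "Bf (koszul \<sigma> k S (- k)) (ax k) = - cj (col_coeff \<sigma> k S) * kap (- k)"
        unfolding koszul_B using rr by (simp add: koszul_nth(2))
      have tk: "ET (x *s koszul \<sigma> k S L) (koszul \<sigma> k S (- k)) *v ax k
          = ax k + (e * cj (col_coeff \<sigma> k S) * y\<^sub>1) *s koszul \<sigma> k S L"
      proof -
        have "x * (- cj (col_coeff \<sigma> k S) * kap (- k)) = e * cj (col_coeff \<sigma> k S) * y\<^sub>1 * (kap (- k) * cj (kap (- k)))"
          by (simp add: x_def ac_simps)
        then show ?thesis unfolding K(4) B1 B2 by (simp add: kk)
      qed
      show ?thesis
        using K(1,2) K(3) R rr tk B1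
        by (intro bexI[OF _ K(1)]) (auto simp: B_lin B_axis_axis koszul_nth axis_nth_neq algebra_simps)
    qed
    obtain t where t: "t \<in> EJ" "t *v (\<sigma> *v ax k) = \<sigma> *v ax k" "Bf (t *v ax k) (ax k) = 0"
        "\<And>i. i \<noteq> - S \<Longrightarrow> i \<noteq> - L \<Longrightarrow> i \<noteq> k \<Longrightarrow> t *v ax i = ax i" "(t *v ax k) $ S = col_coeff \<sigma> k L * cj (col_coeff \<sigma> k S) * y\<^sub>1"
      using test[of 1] by auto
    obtain t' where t': "t' \<in> EJ" "t' *v (\<sigma> *v ax k) = \<sigma> *v ax k" "Bf (t' *v ax k) (ax k) = 0"
        "\<And>i. i \<noteq> - S \<Longrightarrow> i \<noteq> - L \<Longrightarrow> i \<noteq> k \<Longrightarrow> t' *v ax i = ax i" "(t' *v ax k) $ L = col_coeff \<sigma> k S * cj (col_coeff \<sigma> k S) * y\<^sub>1"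
      using test[of "-1"] by auto
    have "Rt k (- S) ((t *v ax k) $ (- (- S)) * (y\<^sub>2 * y\<^sub>3 * y\<^sub>4)) \<in> H"
      by (rule extraction(1)[OF H s t(1,2) t(4)[of L]]) (use R t(3) y in auto)
    moreover have "Rt k (- L) ((t' *v ax k) $ (- (- L)) * (y\<^sub>2 * y\<^sub>3 * y\<^sub>4)) \<in> H"
      by (rule extraction(1)[OF H s t'(1,2) t'(4)[of S]]) (use R t'(3) y in auto)
    ultimately show ?thesis using t(5) t'(5) by (simp add: mult.assoc)
  qed
  show "col_coeff \<sigma> k L * cj (col_coeff \<sigma> k S) \<in> Lv H k (- S) 4" using main r by (intro Lv_4I[OF H]) auto
  show "col_coeff \<sigma> k S * cj (col_coeff \<sigma> k S) \<in> Lv H k (- L) 4" using main r by (intro Lv_4I[OF H]) auto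
qed

text \<open>Here the Koszul transvection uses the indices \<open>- k\<close>, \<open>- c\<close>, \<open>d\<close>; it makes the coordinate
  of \<open>t e\<^sub>k\<close> at \<open>- k\<close> nonzero in general, so the longer form of the extraction is
  needed, at a root that avoids \<open>k\<close> and \<open>d\<close>.\<close>

lemma quad_B:
  fixes k d b c :: "'n::finite signed"
  assumes H: "good H" and s: "\<sigma> \<in> H" and r: "rt k d" "rt b k" "rt b d" "rt c k" "rt c d" "rt b c"
  shows "col_coeff \<sigma> k (- k) * cj (col_coeff \<sigma> k d) \<in> Lv H b c 5"
proof -
  note R = rtD[OF r(1)] rtD[OF r(2)] rtD[OF r(3)] rtD[OF r(4)] rtD[OF r(5)] rtD[OF r(6)]
  have kk: "kap (- k) * cj (kap (- k)) = 1" using R by (intro kap_unit) simp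
  have main: "Rt b c (col_coeff \<sigma> k (- k) * cj (col_coeff \<sigma> k d) * z * (y\<^sub>1 * y\<^sub>2 * y\<^sub>3 * y\<^sub>4)) \<in> H"
    if y: "z \<in> J" "y\<^sub>1 \<in> J" "y\<^sub>2 \<in> J" "y\<^sub>3 \<in> J" "y\<^sub>4 \<in> J" for z y\<^sub>1 y\<^sub>2 y\<^sub>3 y\<^sub>4
  proof -
    define x where "x = - cj (kap (- k)) * z"
    have xJ: "x \<in> J" unfolding x_def by (intro I_mult y)
    have rr: "rt (- k) (- c)" "rt (- k) d" "rt (- c) d" using r by (auto intro: rt_sym)
    note K = koszul_transvection[OF rr xJ, where \<sigma> = \<sigma> and k = k]
    let ?t = "ET (x *s koszul \<sigma> k (- k) (- c)) (koszul \<sigma> k (- k) d)"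
    have B2: "Bf (koszul \<sigma> k (- k) d) (ax k) = cj (col_coeff \<sigma> k d) * kap (- k)"
      unfolding koszul_B using rr by (simp add: koszul_nth(1))
    have "(?t *v ax k) $ (- c) = x * (cj (col_coeff \<sigma> k d) * kap (- k)) * - col_coeff \<sigma> k (- k)"
      unfolding K(4) B2 using R rr by (simp add: koszul_nth axis_nth_neq)
    also have "\<dots> = col_coeff \<sigma> k (- k) * cj (col_coeff \<sigma> k d) * z * (kap (- k) * cj (kap (- k)))"
      by (simp add: x_def ac_simps)
    finally have f: "(?t *v ax k) $ (- c) = col_coeff \<sigma> k (- k) * cj (col_coeff \<sigma> k d) * z" by (simp add: kk)
    have "Rt b c ((?t *v ax k) $ (- c) * (y\<^sub>1 * y\<^sub>2 * y\<^sub>3 * y\<^sub>4)) \<in> H"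
      by (rule extraction(2)[OF H s K(1,2) K(3)[of d]]) (use R y in auto)
    then show ?thesis unfolding f .
  qed
  have "col_coeff \<sigma> k (- k) * cj (col_coeff \<sigma> k d) \<in> Lv H b c (Suc 4)"
    by (intro Lv_SucI[OF H r(6)] Lv_4I[OF H r(6)] main)
  then show ?thesis by (simp add: eval_nat_numeral)
qed

lemma col_coeff_cjg:
  assumes "\<sigma> \<in> UU" "\<rho> \<in> UU" "\<rho> *v ax k = ax k"
  shows "col_coeff (cjg (iv \<rho>) \<sigma>) k i = Bf (\<sigma> *v ax k) (\<rho> *v ax i)"
proof -
  have "cjg (iv \<rho>) \<sigma> *v ax k = iv \<rho> *v (\<sigma> *v ax k)"
    by (simp add: cjg_def matrix_vector_mul_assoc[symmetric] iv_iv assms)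
  then show ?thesis
    unfolding col_coeff_def using UU_B[OF assms(2), of "iv \<rho> *v (\<sigma> *v ax k)" "ax i"] by (simp add: iv_apply assms(2))
qed

lemma Rt_apply_axis:
  assumes "rt a b"
  shows "i \<noteq> - a \<Longrightarrow> i \<noteq> - b \<Longrightarrow> Rt a b x *v ax i = ax i"
    "Rt a b x *v ax (- b) = ax (- b) + axis a (x * kap b)"
    "Rt a b x *v ax (- a) = ax (- a) - axis b (cj (lam F) * cj x * kap a)"
  using rtD[OF assms] by (simp_all add: Rt_def Ei_apply B_axis_axis axis_scale ac_simps)

text \<open>Linearise \<open>quad_A\<close>: conjugation by an elementary matrix that fixes \<open>e\<^sub>k\<close> and adds \<open>e\<^sub>k\<close>
  to \<open>e\<^sub>S\<close> replaces the coefficient of \<open>S\<close> by its sum with that of \<open>k\<close>.\<close>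

lemma quad_k:
  fixes k L S :: "'n::finite signed"
  assumes H: "good H" and s: "\<sigma> \<in> H" and r: "rt k L" "rt k S" "rt L S"
  shows "col_coeff \<sigma> k L * cj (col_coeff \<sigma> k k) \<in> Lv H k (- S) 4"
proof -
  note R = rtD[OF r(1)] rtD[OF r(2)] rtD[OF r(3)]
  define \<rho> where "\<rho> = Rt k (- S) (cj (kap (- S)))"
  have rr: "rt k (- S)" using r by simp
  have \<rho>: "\<rho> \<in> EU F" unfolding \<rho>_def using rtD[OF rr] by (intro Rt_EU) auto
  note \<rho>U = EU_UU[OF \<rho>]
  have kS: "cj (kap (- S)) * kap (- S) = 1" using kap_unit[of "- S"] R by (simp add: mult.commute)
  have f: "\<rho> *v ax k = ax k" "\<rho> *v ax (- S) = ax (- S)" "\<rho> *v ax L = ax L" "\<rho> *v ax S = ax S + ax k"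
    unfolding \<rho>_def using Rt_apply_axis[OF rr] R kS Rt_apply_axis(2)[OF rr, of "cj (kap (- S))"] by auto
  note sU = good_UU[OF H s]
  let ?H = "cjg (iv \<rho>) ` H" and ?s = "cjg (iv \<rho>) \<sigma>"
  have H': "good ?H" by (intro good_cjg H EU_iv \<rho>)
  have c: "col_coeff ?s k L = col_coeff \<sigma> k L" "col_coeff ?s k S = col_coeff \<sigma> k S + col_coeff \<sigma> k k"
    unfolding col_coeff_cjg[OF sU \<rho>U f(1)] f by (simp_all add: col_coeff_def B_lin)
  have "col_coeff ?s k L * cj (col_coeff ?s k S) \<in> Lv ?H k (- S) 4"
    using s by (intro quad_A H' r) auto
  then have "col_coeff ?s k L * cj (col_coeff ?s k S) \<in> Lv H k (- S) 4"
    by (rule Lv_cjg[OF H \<rho> f(1,2)])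
  from Lv_diff[OF H rr this quad_A(1)[OF H s r]] show ?thesis
    unfolding c by (simp add: distrib_left)
qed

lemma Lo_apply:
  assumes "k \<noteq> 0"
  shows "i \<noteq> 0 \<Longrightarrow> i \<noteq> - k \<Longrightarrow> Lo k (x, y) *v ax i = ax i"
    "Lo k (x, y) *v ax (- k) = ax (- k) + axis 0 x + axis k (if k \<in> Theta_pos then cj y else y)"
proof -
  have *: "Lo k (x, y) *v w = w + axis 0 (x * w $ (- k)) - axis k (lam_pow F (- ((1 + eps k) div 2)) * cj x * mu F * w $ 0)
      + axis k ((if k \<in> Theta_pos then cj y else y) * w $ (- k))" for w
    by (simp add: Lo_def T_long_def matrix_vector_mult_add_rdistrib matrix_vector_mult_diff_rdistrib mat_unit_apply)
  show "i \<noteq> 0 \<Longrightarrow> i \<noteq> - k \<Longrightarrow> Lo k (x, y) *v ax i = ax i"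
    unfolding * by (simp add: axis_nth_neq)
  show "Lo k (x, y) *v ax (- k) = ax (- k) + axis 0 x + axis k (if k \<in> Theta_pos then cj y else y)"
    unfolding * using assms by (simp add: axis_nth_neq axis_nth)
qed

text \<open>The same device with a long root element of index \<open>k\<close>, applied to \<open>quad_B\<close>: it adds the
  zeroth coefficient to that of \<open>- k\<close>.\<close>

lemma quad_0:
  fixes k d b c :: "'n::finite signed"
  assumes H: "good H" and s: "\<sigma> \<in> H" and r: "rt k d" "rt b k" "rt b d" "rt c k" "rt c d" "rt b c"
    and xy: "(x, y) \<in> \<Delta>"
  shows "(col_coeff \<sigma> k 0 * x + col_coeff \<sigma> k k * (if k \<in> Theta_pos then cj y else y)) * cj (col_coeff \<sigma> k d) \<in> Lv H b c 5"
proof -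
  note R = rtD[OF r(1)] rtD[OF r(2)] rtD[OF r(3)] rtD[OF r(4)] rtD[OF r(5)] rtD[OF r(6)]
  define \<rho> where "\<rho> = Lo k (x, y)"
  have \<rho>: "\<rho> \<in> EU F" unfolding \<rho>_def using R xy by (intro Lo_EU) auto
  note \<rho>U = EU_UU[OF \<rho>]
  let ?z = "if k \<in> Theta_pos then cj y else y"
  have f: "\<rho> *v ax k = ax k" "\<rho> *v ax b = ax b" "\<rho> *v ax c = ax c" "\<rho> *v ax d = ax d"
     "\<rho> *v ax (- k) = ax (- k) + axis 0 x + axis k ?z"
    unfolding \<rho>_def using R by (simp_all add: Lo_apply)
  note sU = good_UU[OF H s]
  let ?H = "cjg (iv \<rho>) ` H" and ?s = "cjg (iv \<rho>) \<sigma>"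
  have H': "good ?H" by (intro good_cjg H EU_iv \<rho>)
  have c: "col_coeff ?s k d = col_coeff \<sigma> k d" "col_coeff ?s k (- k) = col_coeff \<sigma> k (- k) + col_coeff \<sigma> k 0 * x + col_coeff \<sigma> k k * ?z"
    unfolding col_coeff_cjg[OF sU \<rho>U f(1)] f by (simp_all add: B_lin col_coeff_axis col_coeff_def[symmetric])
  have "col_coeff ?s k (- k) * cj (col_coeff ?s k d) \<in> Lv ?H b c 5"
    using s by (intro quad_B H' r) auto
  then have "col_coeff ?s k (- k) * cj (col_coeff ?s k d) \<in> Lv H b c 5"
    by (rule Lv_cjg[OF H \<rho> f(2,3)])
  from Lv_diff[OF H r(6) this quad_B[OF H s r]] show ?thesis
    unfolding c by (simp add: algebra_simps)
qed

text \<open>A product of opposite coefficients is only obtained together with another such product,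
  because the elementary matrix that adds \<open>e\<^sub>m\<close> to \<open>e\<^sub>l\<close> changes the coefficients at
  both \<open>l\<close> and \<open>- m\<close>.\<close>

lemma quad_D:
  fixes k l m :: "'n::finite signed"
  assumes H: "good H" and s: "\<sigma> \<in> H" and r: "rt k l" "rt k m" "rt l m"
  shows "\<exists>u u'. u * cj u = 1 \<and> u * (col_coeff \<sigma> k l * cj (col_coeff \<sigma> k (- l))) + col_coeff \<sigma> k m * cj (col_coeff \<sigma> k (- m) + u' * col_coeff \<sigma> k (- l)) \<in> Lv H k m 4"
proof -
  note R = rtD[OF r(1)] rtD[OF r(2)] rtD[OF r(3)]
  define \<rho> where "\<rho> = Rt m (- l) (cj (kap (- l)))"
  have rr: "rt m (- l)" "rt k (- m)" "rt l (- m)" using r by (auto intro: rt_sym)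
  have \<rho>: "\<rho> \<in> EU F" unfolding \<rho>_def using rtD[OF rr(1)] by (intro Rt_EU) auto
  note \<rho>U = EU_UU[OF \<rho>]
  define u where "u = cj (lam F) * kap (- l) * kap m"
  have kl: "cj (kap (- l)) * kap (- l) = 1" "kap m * cj (kap m) = 1"
    using kap_unit[of "- l"] kap_unit[of m] R by (simp_all add: mult.commute)
  have uu: "u * cj u = 1"
  proof -
    have "u * cj u = (lam F * cj (lam F)) * (cj (kap (- l)) * kap (- l)) * (kap m * cj (kap m))"
      by (simp only: u_def cj_mult cj_cj ac_simps)
    then show ?thesis by (simp add: kl)
  qed
  have f: "\<rho> *v ax k = ax k" "\<rho> *v ax m = ax m" "\<rho> *v ax l = ax l + ax m" "\<rho> *v ax (- m) = ax (- m) - axis (- l) u"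
    unfolding \<rho>_def using Rt_apply_axis[OF rr(1)] R Rt_apply_axis(2)[OF rr(1), of "cj (kap (- l))"]
      Rt_apply_axis(3)[OF rr(1), of "cj (kap (- l))"] kl by (auto simp: u_def)
  note sU = good_UU[OF H s]
  let ?H = "cjg (iv \<rho>) ` H" and ?s = "cjg (iv \<rho>) \<sigma>"
  have H': "good ?H" by (intro good_cjg H EU_iv \<rho>)
  have c: "col_coeff ?s k l = col_coeff \<sigma> k l + col_coeff \<sigma> k m" "col_coeff ?s k (- m) = col_coeff \<sigma> k (- m) - col_coeff \<sigma> k (- l) * u"
    unfolding col_coeff_cjg[OF sU \<rho>U f(1)] f by (simp_all add: B_lin col_coeff_axis col_coeff_def[symmetric])
  have "col_coeff ?s k l * cj (col_coeff ?s k (- m)) \<in> Lv ?H k (- (- m)) 4"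
    using s by (intro quad_A H' r(1) rr) auto
  then have "col_coeff ?s k l * cj (col_coeff ?s k (- m)) \<in> Lv H k m 4"
    using Lv_cjg[OF H \<rho> f(1,2)] by simp
  moreover have "col_coeff \<sigma> k l * cj (col_coeff \<sigma> k (- m)) \<in> Lv H k m 4"
    using quad_A(1)[OF H s r(1) rr(2,3)] by simp
  ultimately have "col_coeff ?s k l * cj (col_coeff ?s k (- m)) - col_coeff \<sigma> k l * cj (col_coeff \<sigma> k (- m)) \<in> Lv H k m 4"
    by (rule Lv_diff[OF H r(2)])
  then have "(- cj u) * (col_coeff \<sigma> k l * cj (col_coeff \<sigma> k (- l))) + col_coeff \<sigma> k m * cj (col_coeff \<sigma> k (- m) + (- u) * col_coeff \<sigma> k (- l)) \<in> Lv H k m 4"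
    unfolding c by (simp add: algebra_simps)
  moreover have "(- cj u) * cj (- cj u) = 1" using uu by (simp add: mult.commute)
  ultimately show ?thesis by blast
qed

text \<open>All products of two coefficients are available except those of opposite indices. The
  column is unimodular, so multiplying a relation of unimodularity by one coefficient
  expresses it through the missing product; the latter is eliminated with the help of
  \<open>quad_D\<close>.\<close>

lemma column_entries:
  fixes k d :: "'n::finite signed"
  assumes n: "CARD('n) \<ge> 4" and H: "good H" and s: "\<sigma> \<in> H" and r: "rt k d" and ab: "rt a b" "a \<noteq> - k" "b \<noteq> - k"
  shows "\<sigma> $ d $ k \<in> Lv H a b 7"
proof -
  note sU = good_UU[OF H s]
  define A where "A = {x. \<forall>a b. rt a b \<longrightarrow> a \<noteq> - k \<longrightarrow> b \<noteq> - k \<longrightarrow> x \<in> Lv H a b 7}"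
  have Aadd: "x + y \<in> A" if "x \<in> A" "y \<in> A" for x y using that Lv_add[OF H] by (simp add: A_def)
  have Amult: "w * x \<in> A" if "x \<in> A" for x w using that by (auto simp: A_def intro: Lv_mult)
  have Aminus: "- x \<in> A" if "x \<in> A" for x using Amult[OF that, of "-1"] by simp
  have Adiff: "x - y \<in> A" if "x \<in> A" "y \<in> A" for x y using Aadd[OF that(1) Aminus[OF that(2)]] by simp
  have Asum: "sum f T \<in> A" if "\<And>i. i \<in> T \<Longrightarrow> f i \<in> A" for f and T :: "'n signed set"
    using that Amult[of _ 0]
  proof (induction T rule: infinite_finite_induct)
    case (insert t T) then show ?case using Aadd by simp
  qed (auto simp: A_def Lv_def Rt_zero good_one[OF H])
  have Acj: "cj x \<in> A" if "x \<in> A" for x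
    using that Lv_flip rt_sym by (simp add: A_def) blast
  have A3: "x \<in> A" if "rt k c" "x \<in> Lv H k c 4" for x c
    using Lv_reach3[OF n H that(1) _ _ that(2)] by (simp add: A_def)
  have A2: "x \<in> A" if "rt k e" "\<And>b c. rt b c \<Longrightarrow> rt b k \<Longrightarrow> rt b e \<Longrightarrow> rt c k \<Longrightarrow> rt c e \<Longrightarrow> x \<in> Lv H b c 5" for x e
    using Lv_reach2[OF n H that(1) _ that(2)] by (simp add: A_def)
  let ?c = "col_coeff \<sigma> k"
  have other: "\<exists>m. rt k m \<and> rt e m" if "rt k e" for e
  proof -
    obtain m where "m \<noteq> 0" "m \<noteq> k" "m \<noteq> - k" "m \<noteq> e" "m \<noteq> - e" using rt_other[OF n, of k e e] by metis
    then show ?thesis using that by (intro exI[of _ m]) (auto simp: rt_def)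
  qed
  have known: "?c i * cj (?c e) \<in> A" if e: "rt k e" and i: "i \<noteq> 0" "i \<noteq> - e" for i e
  proof -
    obtain m where m: "rt k m" "rt e m" using other[OF e] by blast
    have "k = - i \<Longrightarrow> i = - k" by simp
    then consider "i = - k" | "i = k" | "i = e" | "rt k i" "rt i e"
      using i e unfolding rt_def by blast
    then show ?thesis
    proof cases
      case 1
      then show ?thesis using quad_B[OF H s e] by (intro A2[OF e]) auto
    next
      case 2
      have "?c e * cj (?c k) \<in> A" by (rule A3[OF _ quad_k[OF H s e m]]) (use m in simp)
      then show ?thesis using Acj[of "?c e * cj (?c k)"] 2 by (simp add: mult.commute)
    next
      case 3
      show ?thesis unfolding 3 by (rule A3[OF _ quad_A(2)[OF H s m(1) e rt_sym[OF m(2)]]]) (use m in simp)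
    next
      case 4
      show ?thesis by (rule A3[OF _ quad_A(1)[OF H s 4(1) e 4(2)]]) (use e in simp)
    qed
  qed
  have known0: "?c 0 * x * cj (?c e) \<in> A" if e: "rt k e" and x: "x \<in> JD" for x e
  proof -
    obtain y where y: "(x, y) \<in> \<Delta>" using x by (rule JD_E)
    let ?z = "if k \<in> Theta_pos then cj y else y"
    have "(?c 0 * x + ?c k * ?z) * cj (?c e) \<in> A"
      using quad_0[OF H s e _ _ _ _ _ y] by (intro A2[OF e]) auto
    moreover have "?z * (?c k * cj (?c e)) \<in> A" using e by (intro Amult known) (auto simp: rt_def)
    ultimately have "(?c 0 * x + ?c k * ?z) * cj (?c e) - ?z * (?c k * cj (?c e)) \<in> A" by (rule Adiff)
    then show ?thesis by (simp add: algebra_simps)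
  qed
  define v where "v = \<sigma> *v ax (- k)"
  have v0: "v $ 0 \<in> JD"
    using UU_M[OF sU ax_M[of "- k" 1]] rtD[OF r] by (simp add: v_def M_Delta_def)
  (* the columns of index k and - k pair to a unit *)
  have uni: "kap k = (\<Sum>i\<in>UNIV. ?c i * v $ i)"
    using B_expand_right[of "\<sigma> *v ax k" v] UU_B[OF sU, of "ax k" "ax (- k)"]
    by (simp add: v_def col_coeff_def B_axis_axis)
  (* multiplying the unimodularity relation by a coefficient leaves a single unknown product *)
  have red: "cj (?c e) * kap k - v $ (- e) * (?c (- e) * cj (?c e)) \<in> A" if e: "rt k e" for e
  proof -
    have "cj (?c e) * kap k = (\<Sum>i\<in>UNIV. v $ i * (?c i * cj (?c e)))"
      unfolding uni sum_distrib_left by (intro sum.cong) (simp_all add: ac_simps)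
    also have "\<dots> = v $ (- e) * (?c (- e) * cj (?c e)) + (\<Sum>i\<in>UNIV - {- e}. v $ i * (?c i * cj (?c e)))"
      by (rule sum.remove) simp_all
    finally have "cj (?c e) * kap k - v $ (- e) * (?c (- e) * cj (?c e)) = (\<Sum>i\<in>UNIV - {- e}. v $ i * (?c i * cj (?c e)))"
      by simp
    also have "\<dots> \<in> A"
    proof (rule Asum)
      fix i assume i: "i \<in> UNIV - {- e}"
      show "v $ i * (?c i * cj (?c e)) \<in> A"
      proof (cases "i = 0")
        case True
        then show ?thesis using known0[OF e v0] by (simp add: ac_simps)
      next
        case False
        then show ?thesis using i by (intro Amult known e) auto
      qed
    qed
    finally show ?thesis .
  qed
  have kk: "kap k * cj (kap k) = 1" using r by (intro kap_unit) (simp add: rt_def)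
  have unit: "x \<in> A" if "x * kap k \<in> A" for x
  proof -
    have "cj (kap k) * (x * kap k) = x * (kap k * cj (kap k))" by (simp only: ac_simps)
    then show ?thesis using Amult[OF that, of "cj (kap k)"] by (simp add: kk)
  qed
  (* multiplied by one more coefficient, the second term of quad_D becomes known *)
  have sq: "cj (?c e) * cj (?c e) \<in> A" if e: "rt k e" for e
  proof -
    obtain m where m: "rt k m" "rt e m" using other[OF e] by blast
    obtain u u' where u: "u * cj u = 1" and D: "u * (?c (- e) * cj (?c (- (- e)))) + ?c m * cj (?c (- m) + u' * ?c (- (- e))) \<in> Lv H k m 4"
      using quad_D[OF H s _ m(1), of "- e"] e m(2) by auto
    have "u * (?c (- e) * cj (?c e)) + ?c m * cj (?c (- m) + u' * ?c e) \<in> A"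
      using A3[OF m(1) D] by simp
    then have "cj (?c e) * (u * (?c (- e) * cj (?c e)) + ?c m * cj (?c (- m) + u' * ?c e)) \<in> A" by (rule Amult)
    moreover have "cj (?c (- m) + u' * ?c e) * (?c m * cj (?c e)) \<in> A"
      by (rule Amult, rule known) (use m e in \<open>auto simp: rt_def\<close>)
    ultimately have "cj (?c e) * (u * (?c (- e) * cj (?c e)) + ?c m * cj (?c (- m) + u' * ?c e))
       - cj (?c (- m) + u' * ?c e) * (?c m * cj (?c e)) \<in> A" by (rule Adiff)
    then have "u * (?c (- e) * cj (?c e) * cj (?c e)) \<in> A" by (simp add: algebra_simps)
    then have "cj u * (u * (?c (- e) * cj (?c e) * cj (?c e))) \<in> A" by (rule Amult)
    moreover have "cj u * (u * (?c (- e) * cj (?c e) * cj (?c e))) = (u * cj u) * (?c (- e) * cj (?c e) * cj (?c e))"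
      by (simp only: ac_simps)
    then have "cj u * (u * (?c (- e) * cj (?c e) * cj (?c e))) = ?c (- e) * cj (?c e) * cj (?c e)"
      unfolding u by simp
    ultimately have "?c (- e) * cj (?c e) * cj (?c e) \<in> A" by simp
    then have 1: "v $ (- e) * (?c (- e) * cj (?c e) * cj (?c e)) \<in> A" by (rule Amult)
    have "cj (?c e) * (cj (?c e) * kap k - v $ (- e) * (?c (- e) * cj (?c e))) \<in> A" by (intro Amult red e)
    from Aadd[OF this 1] have "cj (?c e) * cj (?c e) * kap k \<in> A" by (simp add: algebra_simps)
    then show ?thesis by (rule unit)
  qed
  (* eliminate the unknown product between the relations for e and - e *)
  have fin: "cj (?c e) \<in> A" if e: "rt k e" for e
  proof -
    have e': "rt k (- e)" using e by simp
    have "cj (cj (?c (- e)) * kap k - v $ (- (- e)) * (?c (- (- e)) * cj (?c (- e)))) \<in> A"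
      by (rule Acj[OF red[OF e']])
    then have "?c (- e) * cj (kap k) - cj (v $ e) * (cj (?c e) * ?c (- e)) \<in> A" by simp
    then have "(kap k * v $ (- e) * cj (?c e)) * (?c (- e) * cj (kap k) - cj (v $ e) * (cj (?c e) * ?c (- e))) \<in> A"
      by (rule Amult)
    moreover have "(kap k * v $ (- e) * cj (v $ e) * ?c (- e)) * (cj (?c e) * cj (?c e)) \<in> A"
      by (intro Amult sq e)
    ultimately have "(kap k * v $ (- e) * cj (?c e)) * (?c (- e) * cj (kap k) - cj (v $ e) * (cj (?c e) * ?c (- e)))
       + (kap k * v $ (- e) * cj (v $ e) * ?c (- e)) * (cj (?c e) * cj (?c e)) \<in> A" by (rule Aadd)
    then have "(kap k * cj (kap k)) * (v $ (- e) * (?c (- e) * cj (?c e))) \<in> A" by (simp add: algebra_simps)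
    then have "v $ (- e) * (?c (- e) * cj (?c e)) \<in> A" by (simp add: kk)
    from Aadd[OF red[OF e] this] have "cj (?c e) * kap k \<in> A" by simp
    then show ?thesis by (rule unit)
  qed
  have "rt k (- d)" using r by simp
  then have "cj (kap d) * cj (?c (- d)) \<in> A" by (intro Amult fin)
  moreover have "cj (kap d) * cj (?c (- d)) = \<sigma> $ d $ k * (cj (kap d) * cj (kap d))"
    by (simp add: col_coeff_def B_axis_right matrix_vector_axis ac_simps)
  ultimately have "\<sigma> $ d $ k * (cj (kap d) * cj (kap d)) \<in> A" by simp
  then have "kap d * kap d * (\<sigma> $ d $ k * (cj (kap d) * cj (kap d))) \<in> A" by (rule Amult)
  moreover have "kap d * kap d * (\<sigma> $ d $ k * (cj (kap d) * cj (kap d))) = \<sigma> $ d $ k * (kap d * cj (kap d)) * (kap d * cj (kap d))"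
    by (simp only: ac_simps)
  ultimately have "\<sigma> $ d $ k \<in> A" using kap_unit[of d] r by (simp add: rt_def)
  then show ?thesis using ab by (simp add: A_def)
qed

end

section \<open>Short root elements with parameters from the upper ideal\<close>

lemma rt_avoid:
  fixes a b :: "'n::finite signed"
  assumes n: "CARD('n) \<ge> 4" and r: "rt a b" and S: "finite S" "card S \<le> 3"
  obtains c where "rt c a" "rt c b" "c \<notin> S"
proof -
  obtain x where x: "x \<noteq> 0" "x \<noteq> a" "x \<noteq> - a" "x \<noteq> b" "x \<noteq> - b" using rt_other[OF n, of a b b] by metis
  obtain y where y: "y \<noteq> 0" "y \<noteq> a" "y \<noteq> - a" "y \<noteq> b" "y \<noteq> - b" "y \<noteq> x" "y \<noteq> - x"
    using rt_other[OF n, of a b x] by metis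
  have "- x \<noteq> x" "- y \<noteq> y" "- x \<noteq> y" using x y by auto
  then have "card {x, - x, y, - y} = 4" using x y by (auto simp: card_insert_if)
  then have "\<not> {x, - x, y, - y} \<subseteq> S" using card_mono[OF S(1), of "{x, - x, y, - y}"] S(2) by linarith
  moreover have "rt x a" "rt x b" "rt y a" "rt y b" using x y rtD[OF r] by (auto simp: rt_def)
  ultimately show ?thesis using that[of x] that[of "- x"] that[of y] that[of "- y"] by auto
qed

context level
begin

text \<open>Conjugation arguments lose the roots that touch a moved basis vector. The set of
  exceptional indices records this loss until it is made up for by moving roots.\<close>

definition LB :: "('a, 'n::finite) sq_mat set \<Rightarrow> 'n signed set \<Rightarrow> nat \<Rightarrow> 'a set" where
  "LB H S m = {x. \<forall>a b. rt a b \<longrightarrow> a \<notin> S \<longrightarrow> b \<notin> S \<longrightarrow> x \<in> Lv H a b m}"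

lemma LBD: "x \<in> LB H S m \<Longrightarrow> rt a b \<Longrightarrow> a \<notin> S \<Longrightarrow> b \<notin> S \<Longrightarrow> x \<in> Lv H a b m" by (simp add: LB_def)
lemma LB_add: "good H \<Longrightarrow> x \<in> LB H S m \<Longrightarrow> y \<in> LB H S m \<Longrightarrow> x + y \<in> LB H S m"
  by (simp add: LB_def Lv_add)
lemma LB_diff: "good H \<Longrightarrow> x \<in> LB H S m \<Longrightarrow> y \<in> LB H S m \<Longrightarrow> x - y \<in> LB H S m"
  by (simp add: LB_def Lv_diff)
lemma LB_mult: "x \<in> LB H S m \<Longrightarrow> r * x \<in> LB H S m"
  by (simp add: LB_def Lv_mult)
lemma LB_mult2: "x \<in> LB H S m \<Longrightarrow> x * r \<in> LB H S m"
  by (subst mult.commute) (rule LB_mult)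
lemma LB_cj: "x \<in> LB H S m \<Longrightarrow> cj x \<in> LB H S m"
  unfolding LB_def using Lv_flip rt_sym by blast
lemma LB_subset: "x \<in> LB H S m \<Longrightarrow> S \<subseteq> T \<Longrightarrow> m \<le> m' \<Longrightarrow> x \<in> LB H T m'"
  unfolding LB_def using Lv_mono by blast
lemma LB_zero: "good H \<Longrightarrow> 0 \<in> LB H S m"
  by (simp add: LB_def Lv_def Rt_zero good_one)

lemma LB_unit: "kap a * x \<in> LB H S m \<Longrightarrow> a \<noteq> 0 \<Longrightarrow> x \<in> LB H S m"
proof -
  assume a: "kap a * x \<in> LB H S m" "a \<noteq> 0"
  have "cj (kap a) * (kap a * x) = (kap a * cj (kap a)) * x" by (simp only: ac_simps)
  then show ?thesis using LB_mult[OF a(1), of "cj (kap a)"] kap_unit[OF a(2)] by simp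
qed

text \<open>Every root can be reached in two moves from a root that avoids three given indices.\<close>

lemma LB_reach:
  fixes S :: "'n::finite signed set"
  assumes n: "CARD('n) \<ge> 4" and H: "good H" and S: "finite S" "card S \<le> 3" and x: "x \<in> LB H S m"
  shows "x \<in> LB H {} (m + 2)"
  unfolding LB_def
proof (intro CollectI allI impI)
  fix a b :: "'n signed" assume ab: "rt a b"
  obtain c where c: "rt c a" "rt c b" "c \<notin> S" using rt_avoid[OF n ab S] .
  obtain d where d: "rt d b" "rt d c" "d \<notin> S" using rt_avoid[OF n rt_sym[OF c(2)] S] .
  have "x \<in> Lv H c b (Suc m)"
    by (rule Lv_move2[OF H rt_sym[OF d(2)] c(2) rt_sym[OF d(1)] LBD[OF x rt_sym[OF d(2)] c(3) d(3)]])
  then show "x \<in> Lv H a b (m + 2)" using Lv_move1[OF H c(2) ab rt_sym[OF c(1)]] by simp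
qed

lemma LB_cjg:
  assumes "good H" "\<rho> \<in> EU F" "\<And>i. i \<noteq> 0 \<Longrightarrow> i \<notin> T \<Longrightarrow> \<rho> *v ax i = ax i" "x \<in> LB (cjg (iv \<rho>) ` H) S m" "S \<subseteq> T"
  shows "x \<in> LB H T m"
  unfolding LB_def
proof (intro CollectI allI impI)
  fix a b assume ab: "rt a b" "a \<notin> T" "b \<notin> T"
  show "x \<in> Lv H a b m"
    by (rule Lv_cjg[OF assms(1,2) assms(3) assms(3) LBD[OF assms(4)]]) (use ab assms(5) rtD[OF ab(1)] in auto)
qed

lemma B_cjg:
  assumes "\<sigma> \<in> UU" "\<rho> \<in> UU"
  shows "Bf y (cjg (iv \<rho>) \<sigma> *v x) = Bf (\<rho> *v y) (\<sigma> *v (\<rho> *v x))"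
  using UU_B[OF assms(2), of y "iv \<rho> *v (\<sigma> *v (\<rho> *v x))"]
  by (simp add: cjg_def iv_iv assms(2) iv_apply[OF assms(2)] matrix_vector_mul_assoc[symmetric])

lemma Lo_axis0:
  assumes "k \<noteq> 0"
  shows "Lo k (x, z) *v axis 0 y = axis 0 y - axis k (cj (lam F) * kap k * cj x * mu F * y)"
  using assms by (simp add: Lo_def T_long_def matrix_vector_mult_add_rdistrib matrix_vector_mult_diff_rdistrib
      mat_unit_apply axis_nth axis_nth_neq lam_pow_kap)

definition zt :: "'n signed \<Rightarrow> 'a \<Rightarrow> 'a" where "zt k z = (if k \<in> Theta_pos then cj z else z)"

lemma entry_off:
  fixes H :: "('a, 'n::finite) sq_mat set"
  assumes n: "CARD('n) \<ge> 4" and H: "good H" and s: "\<sigma> \<in> H" and r: "rt i k"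
  shows "Bf (ax i) (\<sigma> *v ax k) \<in> LB H {- k} 7"
proof -
  have "\<sigma> $ (- i) $ k \<in> LB H {- k} 7"
    unfolding LB_def using column_entries[OF n H s, of k "- i"] rt_sym[OF r] by auto
  then show ?thesis by (simp add: B_axis_left matrix_vector_axis LB_mult)
qed

text \<open>Conjugation by an elementary matrix that adds \<open>e\<^sub>k\<close> to \<open>e\<^sub>i\<close> turns an off-diagonal entry
  into its sum with the wanted one. The roots that involve a vector moved by this matrix
  have to be avoided; this is why the sets of exceptional indices are carried along.\<close>

lemma entry_anti:
  fixes H :: "('a, 'n::finite) sq_mat set"
  assumes n: "CARD('n) \<ge> 4" and H: "good H" and s: "\<sigma> \<in> H" and r: "rt i k"
  shows "Bf (ax k) (\<sigma> *v ax k) \<in> LB H {- k, i} 7"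
proof -
  note R = rtD[OF r]
  define \<rho> where "\<rho> = Rt k (- i) (cj (kap (- i)))"
  have rr: "rt k (- i)" using r by (simp add: rt_sym)
  have \<rho>: "\<rho> \<in> EU F" unfolding \<rho>_def using rtD[OF rr] by (intro Rt_EU) auto
  have kS: "cj (kap (- i)) * kap (- i) = 1" using kap_unit[of "- i"] R by (simp add: mult.commute)
  have f: "\<rho> *v ax k = ax k" "\<rho> *v ax i = ax i + ax k" "\<And>j. j \<notin> {- k, i} \<Longrightarrow> \<rho> *v ax j = ax j"
    unfolding \<rho>_def using Rt_apply_axis[OF rr] R kS Rt_apply_axis(2)[OF rr, of "cj (kap (- i))"] by auto
  have "Bf (ax i) (cjg (iv \<rho>) \<sigma> *v ax k) \<in> LB (cjg (iv \<rho>) ` H) {- k} 7"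
    using s by (intro entry_off[OF n good_cjg[OF H EU_iv[OF \<rho>]] _ r]) auto
  then have "Bf (ax i) (cjg (iv \<rho>) \<sigma> *v ax k) \<in> LB H {- k, i} 7"
    by (intro LB_cjg[OF H \<rho>, of "{- k, i}"]) (use f in auto)
  then have "Bf (ax i) (\<sigma> *v ax k) + Bf (ax k) (\<sigma> *v ax k) \<in> LB H {- k, i} 7"
    unfolding B_cjg[OF good_UU[OF H s] EU_UU[OF \<rho>]] f by (simp add: B_lin)
  from LB_diff[OF H this LB_subset[OF entry_off[OF n H s r], of "{- k, i}" 7]] show ?thesis by simp
qed

text \<open>The same device with the elementary matrix that adds \<open>e\<^sub>i\<close> to \<open>e\<^sub>j\<close>: the off-diagonal
  entry in the position of the root picks up the difference of two diagonal entries.\<close>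

lemma entry_diag:
  fixes H :: "('a, 'n::finite) sq_mat set"
  assumes n: "CARD('n) \<ge> 4" and H: "good H" and s: "\<sigma> \<in> H" and r: "rt i j"
  shows "\<sigma> $ i $ i - \<sigma> $ j $ j \<in> LB H {- i, j, - j} 7"
proof -
  note R = rtD[OF r]
  define \<rho> where "\<rho> = Rt i (- j) (cj (kap (- j)))"
  have rr: "rt i (- j)" "rt (- i) j" "rt (- j) i" using r by (auto intro: rt_sym)
  have \<rho>: "\<rho> \<in> EU F" unfolding \<rho>_def using rtD[OF rr(1)] by (intro Rt_EU) auto
  have kS: "cj (kap (- j)) * kap (- j) = 1" using kap_unit[of "- j"] R by (simp add: mult.commute)
  let ?u = "cj (lam F) * kap (- j) * kap i"
  have f: "\<rho> *v ax j = ax j + ax i" "\<rho> *v ax (- i) = ax (- i) - axis (- j) ?u" "\<And>l. l \<notin> {- i, j} \<Longrightarrow> \<rho> *v ax l = ax l"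
    unfolding \<rho>_def using Rt_apply_axis(1,3)[OF rr(1)] R kS Rt_apply_axis(2)[OF rr(1), of "cj (kap (- j))"] by auto
  let ?S = "{- i, j, - j}"
  have "Bf (ax (- i)) (cjg (iv \<rho>) \<sigma> *v ax j) \<in> LB (cjg (iv \<rho>) ` H) {- j} 7"
    using s by (intro entry_off[OF n good_cjg[OF H EU_iv[OF \<rho>]] _ rr(2)]) auto
  then have "Bf (ax (- i)) (cjg (iv \<rho>) \<sigma> *v ax j) \<in> LB H ?S 7"
    by (intro LB_cjg[OF H \<rho>, of ?S]) (use f in auto)
  moreover have "Bf (ax (- i)) (cjg (iv \<rho>) \<sigma> *v ax j) = kap (- i) * (\<sigma> $ i $ i - \<sigma> $ j $ j)
       + (Bf (ax (- i)) (\<sigma> *v ax j) - kap (- i) * cj (kap (- j)) * Bf (ax (- j)) (\<sigma> *v ax i))"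
  proof -
    have "cj ?u = kap (- i) * cj (kap (- j))" unfolding cj_kap[symmetric] by (simp add: ac_simps)
    moreover have "kap (- i) * (cj (kap (- j)) * (kap (- j) * x)) = kap (- i) * x" for x
      using kS by (metis mult.assoc mult_1)
    ultimately show ?thesis
      unfolding B_cjg[OF good_UU[OF H s] EU_UU[OF \<rho>]] f
      by (simp add: B_axis_left B_diff_left matrix_vector_right_distrib matrix_vector_axis distrib_left right_diff_distrib mult.assoc)
  qed
  ultimately have 1: "kap (- i) * (\<sigma> $ i $ i - \<sigma> $ j $ j)
       + (Bf (ax (- i)) (\<sigma> *v ax j) - kap (- i) * cj (kap (- j)) * Bf (ax (- j)) (\<sigma> *v ax i)) \<in> LB H ?S 7" by simp
  have 2: "Bf (ax (- i)) (\<sigma> *v ax j) - kap (- i) * cj (kap (- j)) * Bf (ax (- j)) (\<sigma> *v ax i) \<in> LB H ?S 7"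
    by (intro LB_diff[OF H] LB_mult LB_subset[OF entry_off[OF n H s rr(2)]] LB_subset[OF entry_off[OF n H s rr(3)]]) auto
  from LB_diff[OF H 1 2] show ?thesis using LB_unit[of "- i"] R by simp
qed

text \<open>The same device with a long root element, which adds a multiple of the zeroth basis
  vector to \<open>e\<^sub>j\<close>.\<close>

lemma entry_right0:
  fixes H :: "('a, 'n::finite) sq_mat set"
  assumes n: "CARD('n) \<ge> 4" and H: "good H" and s: "\<sigma> \<in> H" and r: "rt i j" and y: "y \<in> JD"
  shows "Bf (ax i) (\<sigma> *v axis 0 y) \<in> LB H {j, - j} 7"
proof -
  note R = rtD[OF r]
  obtain z where z: "(y, z) \<in> \<Delta>" using y by (rule JD_E)
  define \<rho> where "\<rho> = Lo (- j) (y, z)"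
  have \<rho>: "\<rho> \<in> EU F" unfolding \<rho>_def using R z by (intro Lo_EU) auto
  have f: "\<rho> *v ax j = ax j + axis 0 y + axis (- j) (zt (- j) z)" "\<And>l. l \<noteq> 0 \<Longrightarrow> l \<notin> {j, - j} \<Longrightarrow> \<rho> *v ax l = ax l"
    unfolding \<rho>_def zt_def using Lo_apply[of "- j"] R by auto
  have fi: "\<rho> *v ax i = ax i" using R by (intro f(2)) auto
  have "Bf (ax i) (cjg (iv \<rho>) \<sigma> *v ax j) \<in> LB (cjg (iv \<rho>) ` H) {- j} 7"
    using s by (intro entry_off[OF n good_cjg[OF H EU_iv[OF \<rho>]] _ r]) auto
  then have 1: "Bf (ax i) (cjg (iv \<rho>) \<sigma> *v ax j) \<in> LB H {j, - j} 7"
    by (intro LB_cjg[OF H \<rho>, of "{j, - j}"]) (use f in auto)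
  have 2: "Bf (ax i) (cjg (iv \<rho>) \<sigma> *v ax j)
     = Bf (ax i) (\<sigma> *v axis 0 y) + (Bf (ax i) (\<sigma> *v ax j) + zt (- j) z * Bf (ax i) (\<sigma> *v ax (- j)))"
    unfolding B_cjg[OF good_UU[OF H s] EU_UU[OF \<rho>]] f fi
    by (simp add: B_axis_left matrix_vector_right_distrib matrix_vector_axis algebra_simps)
  have r': "rt i (- j)" using r by simp
  have 3: "Bf (ax i) (\<sigma> *v ax j) + zt (- j) z * Bf (ax i) (\<sigma> *v ax (- j)) \<in> LB H {j, - j} 7"
    by (intro LB_add[OF H] LB_mult LB_subset[OF entry_off[OF n H s r]] LB_subset[OF entry_off[OF n H s r']]) auto
  from LB_diff[OF H 1[unfolded 2] 3] show ?thesis by simp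
qed

lemma entry_left0:
  fixes H :: "('a, 'n::finite) sq_mat set"
  assumes n: "CARD('n) \<ge> 4" and H: "good H" and s: "\<sigma> \<in> H" and r: "rt i j" and y: "y \<in> JD"
  shows "Bf (axis 0 y) (\<sigma> *v ax i) \<in> LB H {j, - j} 7"
proof -
  have "Bf (axis 0 y) (\<sigma> *v ax i) = Bf (iv \<sigma> *v axis 0 y) (ax i)"
    using iv_B[OF iv_UU[OF good_UU[OF H s]], of "axis 0 y" "ax i"] by (simp add: iv_iv good_UU[OF H s])
  also have "\<dots> = cj (Bf (ax i) (iv \<sigma> *v axis 0 y)) * lam F" by (rule B_herm)
  finally show ?thesis using entry_right0[OF n H good_iv[OF H s] r y] by (simp add: LB_mult2 LB_cj)
qed

text \<open>A long root element moves \<open>e\<^sub>j\<close> by a multiple of \<open>e\<^sub>0\<close> and \<open>e\<^sub>0\<close> by a multiple of the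
  basis vector of index \<open>- j\<close>, so that both the zeroth and a \<open>j\<close>-th diagonal entry
  appear.\<close>

lemma entry_00:
  fixes H :: "('a, 'n::finite) sq_mat set"
  assumes n: "CARD('n) \<ge> 4" and H: "good H" and s: "\<sigma> \<in> H" and j: "j \<noteq> 0" and y: "y \<in> JD" "y' \<in> JD"
    and off: "\<And>i k. i \<noteq> 0 \<Longrightarrow> k \<noteq> 0 \<Longrightarrow> i \<noteq> - k \<Longrightarrow> Bf (ax i) (\<sigma> *v ax k) \<in> LB H {} 9"
    and r0: "\<And>i y. i \<noteq> 0 \<Longrightarrow> y \<in> JD \<Longrightarrow> Bf (ax i) (\<sigma> *v axis 0 y) \<in> LB H {} 9"
    and l0: "\<And>i y. i \<noteq> 0 \<Longrightarrow> y \<in> JD \<Longrightarrow> Bf (axis 0 y) (\<sigma> *v ax i) \<in> LB H {} 9"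
  shows "cj y * mu F * (\<sigma> $ 0 $ 0 - \<sigma> $ j $ j) * y' \<in> LB H {} 9"
proof -
  obtain l where l: "l \<noteq> 0" "l \<noteq> j" "l \<noteq> - j" using rt_other[OF n, of j j j] by metis
  have r: "rt j l" using l j by (auto simp: rt_def)
  obtain z where z: "(y', z) \<in> \<Delta>" using y(2) by (rule JD_E)
  define \<rho> where "\<rho> = Lo (- j) (y', z)"
  have j': "- j \<noteq> 0" using j by simp
  have \<rho>: "\<rho> \<in> EU F" unfolding \<rho>_def using j' z by (intro Lo_EU) auto
  let ?S = "{l, - l, j}"
  have f: "\<rho> *v ax j = ax j + axis 0 y' + axis (- j) (zt (- j) z)" "\<And>i. i \<noteq> 0 \<Longrightarrow> i \<notin> ?S \<Longrightarrow> \<rho> *v ax i = ax i"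
    unfolding \<rho>_def zt_def using Lo_apply[OF j'] by auto
  let ?x = "cj (lam F) * kap (- j) * cj y' * mu F * y"
  have f0: "\<rho> *v axis 0 y = axis 0 y - axis (- j) ?x" unfolding \<rho>_def by (rule Lo_axis0[OF j'])
  have "Bf (axis 0 y) (cjg (iv \<rho>) \<sigma> *v ax j) \<in> LB (cjg (iv \<rho>) ` H) {l, - l} 7"
    using s by (intro entry_left0[OF n good_cjg[OF H EU_iv[OF \<rho>]] _ r y(1)]) auto
  then have "Bf (axis 0 y) (cjg (iv \<rho>) \<sigma> *v ax j) \<in> LB H ?S 7"
    by (intro LB_cjg[OF H \<rho>, of ?S]) (use f in auto)
  then have 1: "Bf (axis 0 y) (cjg (iv \<rho>) \<sigma> *v ax j) \<in> LB H {} 9"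
    using LB_reach[OF n H, of ?S _ 7] by (simp add: card_insert_if)
  let ?z = "zt (- j) z"
  have 2: "Bf (axis 0 y) (cjg (iv \<rho>) \<sigma> *v ax j) = cj y * mu F * (\<sigma> $ 0 $ 0 - \<sigma> $ j $ j) * y'
     + (Bf (axis 0 y) (\<sigma> *v ax j) + ?z * Bf (axis 0 y) (\<sigma> *v ax (- j))
        - cj ?x * (Bf (ax (- j)) (\<sigma> *v axis 0 y') + ?z * Bf (ax (- j)) (\<sigma> *v ax (- j))))"
  proof -
    have "cj ?x * kap (- j) = cj y * mu F * y' * ((lam F * cj (lam F)) * (kap (- j) * cj (kap (- j))))"
      unfolding cj_mult cj_cj cj_mu by (simp only: ac_simps)
    then have x: "cj ?x * kap (- j) = cj y * mu F * y'" using kap_unit[OF j'] by simp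
    have "Bf (axis (- j) ?x) w = cj ?x * Bf (ax (- j)) w" for w by (simp add: B_axis_left)
    moreover have "cj ?x * Bf (ax (- j)) (\<sigma> *v ax j) = cj y * mu F * y' * \<sigma> $ j $ j"
      unfolding x[symmetric] by (simp only: B_axis_left cj_one matrix_vector_axis signed_minus_minus mult_1_left mult_1_right mult.assoc)
    moreover have "\<sigma> *v (ax j + axis 0 y' + axis (- j) ?z) = \<sigma> *v ax j + \<sigma> *v axis 0 y' + ?z *s (\<sigma> *v ax (- j))"
      by (simp add: matrix_vector_right_distrib vec_eq_iff matrix_vector_axis mult.commute)
    moreover have "Bf (axis 0 y) (\<sigma> *v axis 0 y') = cj y * mu F * \<sigma> $ 0 $ 0 * y'"
      by (simp add: B_axis_left matrix_vector_axis mult.assoc)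
    ultimately show ?thesis
      unfolding B_cjg[OF good_UU[OF H s] EU_UU[OF \<rho>]] f f0 B_diff_left
      by (simp only: B_add_right B_scale_right distrib_left right_diff_distrib left_diff_distrib ac_simps) (simp add: algebra_simps)
  qed
  have 3: "Bf (axis 0 y) (\<sigma> *v ax j) + ?z * Bf (axis 0 y) (\<sigma> *v ax (- j))
        - cj ?x * (Bf (ax (- j)) (\<sigma> *v axis 0 y') + ?z * Bf (ax (- j)) (\<sigma> *v ax (- j))) \<in> LB H {} 9"
    using j j' y by (intro LB_add[OF H] LB_diff[OF H] LB_mult off r0 l0) auto
  from LB_diff[OF H 1[unfolded 2] 3] show ?thesis by simp
qed

text \<open>All generators of the upper ideal are obtained at level 7 for roots avoiding at most
  three indices, and two moves remove the exceptions.\<close>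

lemma upper_ideal_LB:
  fixes H :: "('a, 'n::finite) sq_mat set"
  assumes n: "CARD('n) \<ge> 4" and H: "good H"
  shows "upper_ideal F H \<subseteq> LB H {} 9"
proof (rule upper_ideal_min)
  show "inv_ideal F (LB H {} 9)"
    unfolding inv_ideal_def inv_ideal_axioms_def ideal_UNIV_iff involution_invariant_def
    using hermitian_form_ring_axioms LB_zero[OF H] LB_add[OF H] LB_mult LB_cj by blast
  have other: "\<exists>l. rt i l" if "i \<noteq> 0" for i :: "'n signed"
  proof -
    obtain l where "l \<noteq> 0" "l \<noteq> i" "l \<noteq> - i" using rt_other[OF n, of i i i] by metis
    then show ?thesis using that by (intro exI[of _ l]) (auto simp: rt_def)
  qed
  have off: "Bf (ax i) (\<sigma> *v ax k) \<in> LB H {} 9" if s: "\<sigma> \<in> H" and ik: "i \<noteq> 0" "k \<noteq> 0" "i \<noteq> - k" for \<sigma> i k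
  proof (cases "i = k")
    case True
    obtain l where "rt k l" using other[OF ik(2)] by blast
    then show ?thesis unfolding True
      using LB_reach[OF n H _ _ entry_anti[OF n H s rt_sym]] by (simp add: card_insert_if)
  next
    case False
    then have "rt i k" using ik by (auto simp: rt_def)
    then show ?thesis using LB_reach[OF n H _ _ entry_off[OF n H s]] by (simp add: card_insert_if)
  qed
  have r0: "Bf (ax i) (\<sigma> *v axis 0 y) \<in> LB H {} 9" if s: "\<sigma> \<in> H" and i: "i \<noteq> 0" and y: "y \<in> JD" for \<sigma> i y
    using other[OF i] LB_reach[OF n H _ _ entry_right0[OF n H s _ y]] by (auto simp: card_insert_if)
  have l0: "Bf (axis 0 y) (\<sigma> *v ax i) \<in> LB H {} 9" if s: "\<sigma> \<in> H" and i: "i \<noteq> 0" and y: "y \<in> JD" for \<sigma> i y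
    using other[OF i] LB_reach[OF n H _ _ entry_left0[OF n H s _ y]] by (auto simp: card_insert_if)
  have dg: "\<sigma> $ i $ i - \<sigma> $ j $ j \<in> LB H {} 9" if s: "\<sigma> \<in> H" and r: "rt i j" for \<sigma> i j
    using LB_reach[OF n H _ _ entry_diag[OF n H s r]] by (simp add: card_insert_if)
  show "upper_Y F H \<subseteq> LB H {} 9"
  proof
    fix x assume "x \<in> upper_Y F H"
    then obtain \<sigma> i j where s: "\<sigma> \<in> H" "i \<noteq> 0" "j \<noteq> 0" "i \<noteq> j" and
      x: "x = \<sigma> $ i $ j \<or> x = \<sigma> $ i $ i - \<sigma> $ j $ j \<or> (\<exists>y\<in>JD. x = \<sigma> $ i $ 0 * y)
       \<or> (\<exists>y\<in>JD. x = cj y * mu F * \<sigma> $ 0 $ j)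
       \<or> (\<exists>y\<in>JD. \<exists>y'\<in>JD. x = cj y * mu F * (\<sigma> $ 0 $ 0 - \<sigma> $ j $ j) * y')"
      by (rule upper_Y_cases)
    have "kap (- i) * \<sigma> $ i $ j \<in> LB H {} 9"
      using off[OF s(1), of "- i" j] s by (simp add: B_axis_left matrix_vector_axis)
    then have 1: "\<sigma> $ i $ j \<in> LB H {} 9" by (rule LB_unit) (use s in simp)
    have 2: "\<sigma> $ i $ i - \<sigma> $ j $ j \<in> LB H {} 9"
    proof (cases "rt i j")
      case False
      then have j: "j = - i" using s by (auto simp: rt_def)
      obtain l where l: "rt i l" using other[OF s(2)] by blast
      then have "rt l j" unfolding j by (simp add: rt_sym)
      from LB_add[OF H dg[OF s(1) l] dg[OF s(1) this]] show ?thesis by simp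
    qed (rule dg[OF s(1)])
    have 3: "\<sigma> $ i $ 0 * y \<in> LB H {} 9" if "y \<in> JD" for y
    proof -
      have "kap (- i) * (\<sigma> $ i $ 0 * y) \<in> LB H {} 9"
        using r0[OF s(1), of "- i" y] s that by (simp add: B_axis_left matrix_vector_axis)
      then show ?thesis by (rule LB_unit) (use s in simp)
    qed
    have 4: "cj y * mu F * \<sigma> $ 0 $ j \<in> LB H {} 9" if "y \<in> JD" for y
      using l0[OF s(1,3) that] by (simp add: B_axis_left matrix_vector_axis)
    have 5: "cj y * mu F * (\<sigma> $ 0 $ 0 - \<sigma> $ j $ j) * y' \<in> LB H {} 9" if "y \<in> JD" "y' \<in> JD" for y y'
      by (rule entry_00[OF n H s(1,3) that]) (use off[OF s(1)] r0[OF s(1)] l0[OF s(1)] in auto)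
    show "x \<in> LB H {} 9" using x 1 2 3 4 5 by auto
  qed
qed

end

context hermitian_form_ring
begin

section \<open>Transport of long root elements\<close>

text \<open>Splitting the isotropic vector of a Siegel transformation; the last factor accounts for
  the quadratic dependence of the transformation on that vector.\<close>

lemma Ei_add_axis:
  assumes uu: "Bf u\<^sub>1 u\<^sub>1 = 0" "Bf u\<^sub>1 u\<^sub>2 = 0" "Bf u\<^sub>2 u\<^sub>2 = 0" and uv: "Bf u\<^sub>1 v = 0" "Bf u\<^sub>2 v = 0"
    and y: "lam F * y + cj y + Bf v v = 0"
  shows "Ei (u\<^sub>1 + u\<^sub>2) v y = Ei u\<^sub>1 v y ** (Ei u\<^sub>2 v y ** ET (y *s u\<^sub>2) u\<^sub>1)"
proof (rule matrix_eqI)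
  fix w
  have s: "Bf u\<^sub>2 u\<^sub>1 = 0" "Bf v u\<^sub>1 = 0" "Bf v u\<^sub>2 = 0" using uu uv B_self_skew by metis+
  have y': "Bf v v = - (lam F * y) - cj y"
    using y by (metis (no_types, lifting) add_diff_cancel_left' add_uminus_conv_diff diff_0 minus_add_distrib)
  obtain A1 A2 where A: "lam F = A1" "cj A1 = A2" by blast
  have A': "A1 * A2 = 1" "cj A2 = A1" using A lam_cj by auto
  have A'': "A1 * (A2 * z) = z" for z using A'(1) by (metis mult.assoc mult_1)
  show "Ei (u\<^sub>1 + u\<^sub>2) v y *v w = Ei u\<^sub>1 v y ** (Ei u\<^sub>2 v y ** ET (y *s u\<^sub>2) u\<^sub>1) *v w"
    unfolding matrix_vector_mul_assoc[symmetric]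
    by (simp add: Ei_apply B_lin uu uv s y' vec_eq_iff A algebra_simps A' A'')
qed

text \<open>The scalar of a long root element in its description as a Siegel transformation.\<close>

definition lv :: "'n signed \<Rightarrow> 'a \<times> 'a \<Rightarrow> 'a" where
  "lv i \<alpha> = (if i \<in> Theta_pos then cj (snd \<alpha>) else snd \<alpha> * cj (lam F))"

lemma Lo_Ei: "i \<noteq> 0 \<Longrightarrow> Lo i \<alpha> = Ei (ax i) (axis 0 (- fst \<alpha> * lam F * cj (kap i))) (lv i \<alpha>)"
  by (cases \<alpha>) (simp add: Lo_eq_Ei lv_def)

text \<open>Conjugation of a long root element of index \<open>b\<close> by an element that adds a multiple of
  \<open>e\<^sub>i\<close> to \<open>e\<^sub>b\<close>. The middle factor is a long root element of index \<open>i\<close>, so this formula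
  transports long root elements between indices; the short factor has to be disposed of
  by other means.\<close>

lemma cjg_Lo:
  fixes i b :: "'n::finite signed"
  assumes r: "i \<noteq> 0" "b \<noteq> 0" "i \<noteq> b" "i \<noteq> - b" and \<alpha>: "\<alpha> \<in> \<Delta>"
    and \<theta>: "\<theta> \<in> UU" "\<theta> *v ax b = ax b + axis i s" "\<theta> *v ax 0 = ax 0"
  shows "cjg \<theta> (Lo b \<alpha>) = Lo b \<alpha> ** (Ei (axis i s) (axis 0 (- fst \<alpha> * lam F * cj (kap b))) (lv b \<alpha>) ** Rt i b (lv b \<alpha> * s))"
proof -
  let ?v = "axis 0 (- fst \<alpha> * lam F * cj (kap b)) :: 'a^'n signed"
  have "\<theta> *v ?v = ?v"
  proof -
    have "?v = (- fst \<alpha> * lam F * cj (kap b)) *s ax 0" by (simp add: axis_scale)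
    then show ?thesis by (simp add: matrix_vector_scale \<theta>(3))
  qed
  then have "cjg \<theta> (Lo b \<alpha>) = Ei (ax b + axis i s) ?v (lv b \<alpha>)"
    unfolding Lo_Ei[OF r(2)] cjg_Ei[OF \<theta>(1)] \<theta>(2) by simp
  also have "\<dots> = Ei (ax b) ?v (lv b \<alpha>) ** (Ei (axis i s) ?v (lv b \<alpha>) ** ET (lv b \<alpha> *s axis i s) (ax b))"
  proof (rule Ei_add_axis)
    have "- i \<noteq> b" using r(4) by auto
    then show "Bf (ax b) (axis i s) = (0::'a)" "Bf (ax b) (ax b) = (0::'a)" "Bf (axis i s) (axis i s) = (0::'a)"
        "Bf (ax b) ?v = (0::'a)" "Bf (axis i s) ?v = (0::'a)"
      using r by (auto simp: B_axis_axis)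
    have m: "(fst \<alpha>, snd \<alpha>) \<in> Delta_max F" using Delta_in_max[OF \<alpha>] by simp
    show "lam F * lv b \<alpha> + cj (lv b \<alpha>) + Bf ?v ?v = 0"
      unfolding lv_def using Lo_Ei_iso[OF r(2) m] .
  qed
  finally show ?thesis unfolding Lo_Ei[OF r(2)] by (simp add: Rt_def axis_scale)
qed

lemma Ei_axis_same:
  fixes i b :: "'n::finite signed"
  assumes "i \<noteq> 0" "b \<noteq> 0" "i \<in> Theta_pos \<longleftrightarrow> b \<in> Theta_pos"
  shows "Ei (axis i s) (axis 0 (- fst \<alpha> * lam F * cj (kap b))) (lv b \<alpha>) = Lo i (\<alpha> \<star> cj s)"
proof -
  have k: "kap i = kap b" using assms by (cases i; cases b) (auto simp: zero_signed_def kap_def)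
  have e: "axis i s = s *s (ax i :: 'a^'n signed)" by (simp add: axis_scale)
  show ?thesis unfolding Lo_Ei[OF assms(1)]
    using assms(3) k by (cases \<alpha>) (subst e, subst Ei_scale, simp add: lv_def circ_pair axis_scale ac_simps)
qed

text \<open>Between indices of opposite signs the transport inverts the parameter in the Heisenberg
  group.\<close>

lemma Ei_axis_opposite:
  fixes i :: "'n::finite"
  assumes "\<alpha> \<in> \<Delta>"
  shows "Ei (axis (Pos i) (- cj (lam F))) (axis 0 (- fst \<alpha> * lam F * cj (kap (Neg b)))) (lv (Neg b) \<alpha>)
    = Lo (Pos i) (inv\<^bsub>heis F\<^esub> \<alpha>)"
proof -
  obtain x y where \<alpha>: "\<alpha> = (x, y)" by force
  have D: "cj x * mu F * x + y + cj y * lam F = 0" using Delta_maxD assms \<alpha> by simp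
  have e: "axis (Pos i) (- cj (lam F)) = (- cj (lam F)) *s (ax (Pos i) :: 'a^'n signed)" by (simp add: axis_scale)
  have "cj (- y - cj x * mu F * x) = cj (cj y * lam F)"
    using D by (metis (no_types, lifting) add.assoc add.commute add_diff_cancel_left' diff_0 diff_minus_eq_add minus_add_distrib uminus_add_conv_diff)
  then have c: "cj (- y - cj x * mu F * x) = y * cj (lam F)" by simp
  have l: "y * cj (lam F) * (- cj (lam F)) * cj (- cj (lam F)) = y * cj (lam F)"
    by (simp add: mult.assoc)
  have l2: "- x * lam F * cj (kap (Neg b)) = - x" by (simp add: mult.assoc)
  have l3: "y * (cj (lam F) * (lam F * cj (lam F))) = y * cj (lam F)" "x * (lam F * cj (lam F)) = x" by simp_all
  show ?thesis unfolding Lo_Ei[of "Pos i", simplified] \<alpha> heis_inv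
    using c l l2 l3 by (subst e, subst Ei_scale) (simp add: lv_def image_iff axis_scale ac_simps)
qed

end

context level
begin

section \<open>The elementary core\<close>

text \<open>The largest subgroup of \<open>H\<close> that is normalised by the elementary group. Membership may
  be tested on all elementary conjugates of \<open>H\<close>.\<close>

definition core :: "('a, 'n::finite) sq_mat set \<Rightarrow> ('a, 'n) sq_mat set" where
  "core H = {g. g \<in> UU \<and> (\<forall>\<tau>\<in>EU F. cjg \<tau> g \<in> H)}"

lemma core_UU:
  fixes H :: "('a, 'n::finite) sq_mat set"
  shows "g \<in> core H \<Longrightarrow> g \<in> UU" by (simp add: core_def)

lemma core_le:
  fixes H :: "('a, 'n::finite) sq_mat set"
  shows "core H \<subseteq> H"
proof
  fix g :: "('a, 'n::finite) sq_mat" assume g: "g \<in> core H"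
  have 1: "mat 1 \<in> EU F" using subgroup.one_closed[OF subgroup_EU] by simp
  have i: "iv (mat 1) = (mat 1 :: ('a, 'n) sq_mat)" by (intro iv_unique one_UU) simp
  show "g \<in> H" using g 1 by (auto simp: core_def cjg_def i dest: bspec[of _ _ "mat 1"])
qed

lemma core_cjg:
  fixes H :: "('a, 'n::finite) sq_mat set"
  shows "\<tau> \<in> EU F \<Longrightarrow> g \<in> core H \<Longrightarrow> cjg \<tau> g \<in> core H"
  using EU_mult by (auto simp: core_def cjg_UU EU_UU cjg_cjg)

lemma core_mult:
  fixes H :: "('a, 'n::finite) sq_mat set"
  shows "good H \<Longrightarrow> g \<in> core H \<Longrightarrow> h \<in> core H \<Longrightarrow> g ** h \<in> core H"
  using good_mult[of H] by (auto simp: core_def mult_UU EU_UU cjg_mult)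

lemma core_iv:
  fixes H :: "('a, 'n::finite) sq_mat set"
  shows "good H \<Longrightarrow> g \<in> core H \<Longrightarrow> iv g \<in> core H"
  using good_iv[of H] by (auto simp: core_def iv_UU EU_UU cjg_of_iv)

lemma core_subgroup:
  fixes H :: "('a, 'n::finite) sq_mat set"
  shows "good H \<Longrightarrow> subgroup (core H) UG"
proof
  assume H: "good H"
  show "core H \<subseteq> UU" using core_UU by blast
  show "\<one>\<^bsub>UG\<^esub> \<in> core H" using good_one[OF H] by (auto simp: core_def one_UU cjg_def iv_right EU_UU)
qed (auto intro: core_mult core_iv)

lemma coreI:
  fixes H :: "('a, 'n::finite) sq_mat set"
  assumes "g \<in> UU" "\<And>\<tau>. \<tau> \<in> EU F \<Longrightarrow> g \<in> cjg \<tau> ` H" shows "g \<in> core H"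
proof -
  have "cjg \<tau> g \<in> H" if t: "\<tau> \<in> EU F" for \<tau>
  proof -
    obtain h where h: "h \<in> H" "g = cjg (iv \<tau>) h" using assms(2)[OF EU_iv[OF t]] by blast
    then show ?thesis by (simp add: cjg_iv(2)[OF EU_UU[OF t]])
  qed
  then show ?thesis using assms(1) by (simp add: core_def)
qed

lemma cancel_left: "good H \<Longrightarrow> g \<in> H \<Longrightarrow> h \<in> UU \<Longrightarrow> g ** h \<in> H \<Longrightarrow> h \<in> H"
  using good_mult[of H "iv g" "g ** h"] good_iv[of H g]
  by (simp add: matrix_mul_assoc iv_left good_UU)

lemma cancel_right: "good H \<Longrightarrow> h \<in> H \<Longrightarrow> g \<in> UU \<Longrightarrow> g ** h \<in> H \<Longrightarrow> g \<in> H"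
  using good_mult[of H "g ** h" "iv h"] good_iv[of H h]
  by (simp add: matrix_mul_assoc[symmetric] iv_right good_UU)

text \<open>The ideal of parameters for which short root elements will be found in \<open>H\<close>.\<close>

definition short_ideal :: "('a, 'n::finite) sq_mat set \<Rightarrow> 'a set" where
  "short_ideal H = ideal_prod ring_UNIV (upper_ideal F H) (Jp 9)"

lemma ideal_prod_inv:
  assumes A: "inv_ideal F A" and B: "inv_ideal F B" shows "inv_ideal F (ideal_prod ring_UNIV A B)"
proof -
  interpret a: inv_ideal F A by fact
  interpret b: inv_ideal F B by fact
  have "cj x \<in> ideal_prod ring_UNIV A B" if "x \<in> ideal_prod ring_UNIV A B" for x
    using that
  proof (induction rule: ideal_prod.induct)
    case (prod i j)
    then show ?case using ideal_prod.prod[of "cj i" A "cj j" B ring_UNIV] by (simp add: a.I_cj b.I_cj)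
  next
    case (sum x y)
    then show ?case using ideal_prod.sum[of "cj x" ring_UNIV A B "cj y"] by simp
  qed
  then show ?thesis
    using hermitian_form_ring_axioms ring.ideal_prod_is_ideal[OF ring_from_type_algebra a.I_ideal b.I_ideal]
    by (simp add: inv_ideal_def inv_ideal_axioms_def involution_invariant_def)
qed

lemma Jp_inv: "inv_ideal F (Jp m)"
  using hermitian_form_ring_axioms Jp_ideal Jp_cj
  by (simp add: inv_ideal_def inv_ideal_axioms_def involution_invariant_def)

lemma short_ideal_inv: "inv_ideal F (short_ideal H)"
  unfolding short_ideal_def by (intro ideal_prod_inv upper_ideal_inv Jp_inv)

lemma short_ideal_I: "x \<in> upper_ideal F H \<Longrightarrow> y \<in> Jp 9 \<Longrightarrow> x * y \<in> short_ideal H"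
  unfolding short_ideal_def using ideal_prod.prod[of x "upper_ideal F H" y "Jp 9" ring_UNIV] by simp

text \<open>The elementary conjugates of \<open>H\<close> have the same upper ideal, and \<open>upper_ideal_LB\<close> applies
  to each of them.\<close>

lemma core_Rt:
  fixes H :: "('a, 'n::finite) sq_mat set"
  assumes n: "CARD('n) \<ge> 4" and H: "good H" and r: "rt a b" and x: "x \<in> short_ideal H"
  shows "Rt a b x \<in> core H"
  using x unfolding short_ideal_def
proof (induction rule: ideal_prod.induct)
  case (prod x y)
  have "Rt a b (x * y) \<in> cjg \<tau> ` H" if t: "\<tau> \<in> EU F" for \<tau>
  proof -
    have "H \<subseteq> UU" using good_UU[OF H] by blast
    then have "x \<in> upper_ideal F (cjg \<tau> ` H)" using prod upper_cjg(1)[OF _ t] by blast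
    then have "x \<in> LB (cjg \<tau> ` H) {} 9" using upper_ideal_LB[OF n good_cjg[OF H t]] by blast
    from LvD[OF LBD[OF this r]] show ?thesis using prod by simp
  qed
  then show ?case using rtD[OF r] by (simp add: coreI Rt_UU)
next
  case (sum x y)
  then show ?case using core_mult[OF H sum(3,4)] rtD[OF r] by (simp add: Rt_mult)
qed

text \<open>A short root element of the core is conjugated by an element that adds \<open>e\<^sub>i\<close> to its
  second basis vector.\<close>

lemma core_tr:
  fixes H :: "('a, 'n::finite) sq_mat set"
  assumes n: "CARD('n) \<ge> 4" and H: "good H" and i: "i \<noteq> 0" and x: "x \<in> short_ideal H"
  shows "ET (axis i x) (ax i) \<in> core H" "Lo i (0, tr x) \<in> core H"
proof -
  interpret K: inv_ideal F "short_ideal H" by (rule short_ideal_inv)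
  have *: "ET (axis i x) (ax i) \<in> core H" if x: "x \<in> short_ideal H" for x
  proof -
    obtain b where b: "b \<noteq> 0" "b \<noteq> i" "b \<noteq> - i" using rt_other[OF n, of i i i] by metis
    then have r: "rt i b" "rt i (- b)" "rt b i" using i by (auto simp: rt_def)
    define \<theta> where "\<theta> = Rt i (- b) (cj (kap (- b)))"
    have \<theta>: "\<theta> \<in> EU F" unfolding \<theta>_def using rtD[OF r(2)] by (intro Rt_EU) auto
    have k: "cj (kap (- b)) * kap (- b) = 1" using kap_unit[of "- b"] b by (simp add: mult.commute)
    have f: "\<theta> *v ax b = ax b + ax i" "\<theta> *v ax i = ax i"
      unfolding \<theta>_def using Rt_apply_axis(1)[OF r(2)] Rt_apply_axis(2)[OF r(2), of "cj (kap (- b))"] k b i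
      by auto
    have e: "axis i x = x *s (ax i :: 'a^'n signed)" by (simp add: axis_scale)
    have R: "Rt i b x \<in> core H" by (rule core_Rt[OF n H r(1) x])
    have "cjg \<theta> (Rt i b x) = ET (axis i x) (ax b + ax i)"
      unfolding Rt_def cjg_Ei[OF EU_UU[OF \<theta>]] e by (simp add: f matrix_vector_scale)
    also have "\<dots> = ET (axis i x) (ax b) ** ET (axis i x) (ax i)"
      using rtD[OF r(1)] by (intro ET_add_right) (simp_all add: B_axis_axis)
    finally have c: "Rt i b x ** ET (axis i x) (ax i) \<in> core H"
      using core_cjg[OF \<theta> R] by (simp add: Rt_def)
    have U: "ET (axis i x) (ax i) \<in> UU" unfolding ET_same_Lo[OF i] by (intro Lo_UU i Delta_tr)
    have "iv (Rt i b x) ** (Rt i b x ** ET (axis i x) (ax i)) \<in> core H"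
      by (intro core_mult[OF H] core_iv[OF H] R c)
    then show ?thesis using core_UU[OF R] by (simp add: matrix_mul_assoc iv_left)
  qed
  show "ET (axis i x) (ax i) \<in> core H" by (rule *[OF x])
  show "Lo i (0, tr x) \<in> core H"
  proof (cases "i \<in> Theta_pos")
    case True
    then show ?thesis using *[OF K.I_cj[OF x]] unfolding ET_same_Lo[OF i] by simp
  next
    case False
    have "lam F * (cj (lam F) * x) = x" by (simp add: mult.assoc[symmetric])
    then show ?thesis using False *[OF K.I_mult[OF x, of "cj (lam F)"]] unfolding ET_same_Lo[OF i] by simp
  qed
qed

text \<open>Commutator of a short root element of the core with a long root element of another
  index.\<close>

lemma core_circ:
  fixes H :: "('a, 'n::finite) sq_mat set"
  assumes n: "CARD('n) \<ge> 4" and H: "good H" and i: "i \<noteq> 0" and x: "x \<in> short_ideal H" and \<alpha>: "\<alpha> \<in> \<Delta>"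
  shows "Lo i (\<alpha> \<star> x) \<in> core H"
proof -
  interpret K: inv_ideal F "short_ideal H" by (rule short_ideal_inv)
  obtain b where b: "b \<noteq> 0" "b \<noteq> i" "b \<noteq> - i" "b \<in> Theta_pos \<longleftrightarrow> i \<in> Theta_pos"
  proof -
    obtain b where b: "b \<noteq> 0" "b \<noteq> i" "b \<noteq> - i" using rt_other[OF n, of i i i] by metis
    then have b': "- b \<noteq> 0" "- b \<noteq> i" "- b \<noteq> - i" by auto
    have "b \<in> Theta_pos \<longleftrightarrow> - b \<notin> Theta_pos" using b by (cases b) (auto simp: zero_signed_def)
    then show ?thesis using that[OF b] that[OF b'] by blast
  qed
  then have r: "rt i b" "rt i (- b)" using i by (auto simp: rt_def)
  define \<theta> where "\<theta> = Rt i (- b) (cj (kap (- b)) * cj x)"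
  have \<theta>c: "\<theta> \<in> core H" unfolding \<theta>_def by (rule core_Rt[OF n H r(2)]) (intro K.I_mult K.I_cj x)
  note \<theta>U = core_UU[OF \<theta>c]
  have k: "cj (kap (- b)) * cj x * kap (- b) = cj x"
    using kap_unit[of "- b"] b by (metis mult.commute mult.assoc mult_1 signed_minus_eq_0_iff)
  have f: "\<theta> *v ax b = ax b + axis i (cj x)" "\<theta> *v ax 0 = ax 0"
    unfolding \<theta>_def using Rt_apply_axis(1)[OF r(2), of 0] Rt_apply_axis(2)[OF r(2), of "cj (kap (- b)) * cj x"] k b i
    by auto
  have "Lo b \<alpha> \<in> EU F" using b \<alpha> by (intro Lo_EU)
  note L = this EU_UU[OF this]
  have c: "cjg \<theta> (Lo b \<alpha>) = Lo b \<alpha> ** (Lo i (\<alpha> \<star> x) ** Rt i b (lv b \<alpha> * cj x))"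
  proof -
    have nb: "i \<noteq> b" "i \<noteq> - b" using b by auto
    show ?thesis using cjg_Lo[OF i b(1) nb \<alpha> \<theta>U f] b(4) Ei_axis_same[OF i b(1), of "cj x" \<alpha>] by simp
  qed
  have "iv (Lo b \<alpha>) ** cjg \<theta> (Lo b \<alpha>) = cjg (iv (Lo b \<alpha>)) \<theta> ** iv \<theta>"
    using L(2) by (simp add: cjg_def iv_iv matrix_mul_assoc)
  also have "\<dots> \<in> core H" by (intro core_mult[OF H] core_cjg core_iv[OF H] \<theta>c EU_iv L)
  finally have "Lo i (\<alpha> \<star> x) ** Rt i b (lv b \<alpha> * cj x) \<in> core H"
    unfolding c using L(2) by (simp add: matrix_mul_assoc iv_left)
  moreover have R: "Rt i b (lv b \<alpha> * cj x) \<in> core H" by (rule core_Rt[OF n H r(1)]) (intro K.I_mult K.I_cj x)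
  ultimately have "Lo i (\<alpha> \<star> x) ** Rt i b (lv b \<alpha> * cj x) ** iv (Rt i b (lv b \<alpha> * cj x)) \<in> core H"
    by (rule core_mult[OF H _ core_iv[OF H]])
  then show ?thesis using core_UU[OF R] by (simp add: matrix_mul_assoc[symmetric] iv_right)
qed

lemma Lo_subgroup:
  assumes "subgroup N UG" "i \<noteq> 0"
  shows "subgroup {\<alpha> \<in> \<Delta>. Lo i \<alpha> \<in> N} (heis F)"
proof -
  interpret N: subgroup N UG by fact
  show ?thesis
  proof
    show "\<one>\<^bsub>heis F\<^esub> \<in> {\<alpha> \<in> \<Delta>. Lo i \<alpha> \<in> N}"
      using N.one_closed Lo_zero[OF assms(2)] by (simp add: heis_one Delta_zero)
    show "x \<boxplus> y \<in> {\<alpha> \<in> \<Delta>. Lo i \<alpha> \<in> N}" if "x \<in> {\<alpha> \<in> \<Delta>. Lo i \<alpha> \<in> N}" "y \<in> {\<alpha> \<in> \<Delta>. Lo i \<alpha> \<in> N}" for x y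
      using that N.m_closed[of "Lo i x" "Lo i y"] N.m_closed[of "Lo i y" "Lo i x"] assms(2)
      by (cases i) (auto simp: Lo_mult Delta_add zero_signed_def)
    show "inv\<^bsub>heis F\<^esub> x \<in> {\<alpha> \<in> \<Delta>. Lo i \<alpha> \<in> N}" if "x \<in> {\<alpha> \<in> \<Delta>. Lo i \<alpha> \<in> N}" for x
      using that N.m_inv_closed[of "Lo i x"] by (auto simp: iv_Lo[OF assms(2), symmetric] Delta_inv)
  qed simp
qed

text \<open>Both kinds of generators of the smallest form parameter have been treated; parameters
  whose long root elements lie in a given subgroup form a subgroup.\<close>

lemma core_Omega_min:
  fixes H :: "('a, 'n::finite) sq_mat set"
  assumes n: "CARD('n) \<ge> 4" and H: "good H" and i: "i \<noteq> 0" and \<omega>: "\<omega> \<in> Omega_min F (short_ideal H)"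
  shows "Lo i \<omega> \<in> core H"
proof -
  interpret K: inv_ideal F "short_ideal H" by (rule short_ideal_inv)
  have "Omega_min F (short_ideal H) \<subseteq> {\<alpha> \<in> \<Delta>. Lo i \<alpha> \<in> core H}"
    unfolding Omega_min_def
    using core_tr[OF n H i] core_circ[OF n H i]
    by (intro K.set_mult_least circ_set_least Lo_subgroup core_subgroup H i)
       (auto simp: trace_pairs_iff Delta_tr Delta_circ)
  then show ?thesis using \<omega> by blast
qed

end

context hermitian_form_ring
begin

section \<open>Long root elements from the columns\<close>

lemma UU_Q_isotropic: "\<sigma> \<in> UU \<Longrightarrow> Q_form F u = (0, 0) \<Longrightarrow> Q_form F (\<sigma> *v u) \<in> \<Delta>"
  using UU_Q[of \<sigma> u] by (cases "Q_form F (\<sigma> *v u)") (simp add: hminus_pair)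

text \<open>The values of the Hermitian form that appear when the three summands are separated
  combine to a trace, so the formula holds exactly and not only modulo \<open>\<Delta>\<close>.\<close>

lemma Q_form_ET:
  fixes a b w :: "'a^'n::finite signed"
  assumes "Bf a b = 0"
  defines "\<beta> \<equiv> Bf b w" and "\<gamma> \<equiv> cj (lam F) * Bf a w"
  shows "Q_form F (ET a b *v w) = Q_form F w \<boxplus> Q_form F a \<star> \<beta> \<boxplus> Q_form F b \<star> (- \<gamma>)
    \<boxplus> (0, tr (\<beta> * cj \<gamma> + bq (\<beta> *s a) w - bq (\<gamma> *s b) (w + \<beta> *s a)))"
proof -
  have e: "ET a b *v w = w + \<beta> *s a + (- \<gamma>) *s b"
    by (simp add: Ei_apply \<beta>_def \<gamma>_def vec_eq_iff)
  have 1: "Bf w a = cj \<gamma>" using B_herm[of w a] by (simp add: \<gamma>_def mult.commute)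
  have 2: "Bf w b = cj \<beta> * lam F" using B_herm[of w b] by (simp add: \<beta>_def)
  have 3: "Bf w (\<beta> *s a) + Bf (w + \<beta> *s a) ((- \<gamma>) *s b) = tr (\<beta> * cj \<gamma>)"
    using assms(1) by (simp add: B_lin 1 2 tr_def algebra_simps)
  have 4: "A \<boxplus> B \<boxplus> (0, s) \<boxplus> C \<boxplus> (0, t) = A \<boxplus> B \<boxplus> C \<boxplus> (0, s + t)" for A B C s t
    by (cases A; cases B; cases C) (simp add: hadd_pair algebra_simps)
  have 5: "bq ((- \<gamma>) *s b) (w + \<beta> *s a) = - bq (\<gamma> *s b) (w + \<beta> *s a)"
    by (simp add: bq_lin)
  have "Bf w (\<beta> *s a) + tr (bq (\<beta> *s a) w) + (Bf (w + \<beta> *s a) ((- \<gamma>) *s b) + tr (bq ((- \<gamma>) *s b) (w + \<beta> *s a)))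
      = tr (\<beta> * cj \<gamma> + bq (\<beta> *s a) w - bq (\<gamma> *s b) (w + \<beta> *s a))"
    unfolding 5 diff_conv_add_uminus tr_add 3[symmetric] by (simp only: ac_simps)
  then show ?thesis
    unfolding e Q_form_add Q_form_scale 4 by simp
qed

end

context level
begin

lemma Jp_1: "Jp 1 \<subseteq> J"
proof -
  have "x \<in> J" if "x \<in> Jp (Suc 0)" for x using that by (induction rule: Jp_Suc_induct) (auto intro: I_mult I_add)
  then show ?thesis by auto
qed

lemma Rt_same_add: "a \<noteq> 0 \<Longrightarrow> Rt a a (x + y) = Rt a a x ** Rt a a y"
  unfolding Rt_def axis_add[symmetric] by (intro ET_add_left) (simp_all add: B_axis_axis)

text \<open>Conjugating a root element by an element of \<open>EJ\<close> that adds a multiple of \<open>e\<^sub>a\<close> to \<open>e\<^sub>c\<close>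
  splits off a degenerate root element, that is, a long one whose parameter is a trace.\<close>

lemma Lv_trace:
  fixes H :: "('a, 'n::finite) sq_mat set"
  assumes H: "good H" and r: "rt a c" and x: "x \<in> Lv H a c m" and y: "y \<in> Jp (Suc m)"
  shows "Rt a a (x * y) \<in> H"
  using y
proof (induction rule: Jp_Suc_induct)
  case (prod y z)
  note R = rtD[OF r]
  have r': "rt a (- c)" using r by simp
  define \<theta> where "\<theta> = Rt a (- c) (cj z * cj (kap (- c)))"
  have \<theta>: "\<theta> \<in> EJ" unfolding \<theta>_def using prod R by (intro EJ_Rt) (auto intro: I_mult2 I_cj)
  have k: "cj z * cj (kap (- c)) * kap (- c) = cj z"
    using kap_unit[of "- c"] R by (simp add: mult.assoc mult.commute[of "cj (kap (- c))"])
  have f: "\<theta> *v ax c = ax c + axis a (cj z)" "\<theta> *v axis a (x * y) = axis a (x * y)"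
  proof -
    show "\<theta> *v ax c = ax c + axis a (cj z)"
      unfolding \<theta>_def using Rt_apply_axis(2)[OF r', of "cj z * cj (kap (- c))"] k by simp
    have e: "axis a (x * y) = (x * y) *s (ax a :: 'a^'n signed)" by (simp add: axis_scale)
    have "\<theta> *v ax a = ax a" unfolding \<theta>_def using Rt_apply_axis(1)[OF r', of a] R by auto
    then show "\<theta> *v axis a (x * y) = axis a (x * y)" unfolding e by (simp add: matrix_vector_scale)
  qed
  have m: "Rt a c (x * y) \<in> H" using LvD[OF x prod(1)] .
  have "cjg \<theta> (Rt a c (x * y)) = ET (axis a (x * y)) (ax c + axis a (cj z))"
    unfolding Rt_def cjg_Ei[OF EJ_UU[OF \<theta>]] f ..
  also have "\<dots> = Rt a c (x * y) ** ET (axis a (x * y)) (axis a (cj z))"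
    unfolding Rt_def using R by (intro ET_add_right) (simp_all add: B_axis_axis)
  also have "ET (axis a (x * y)) (axis a (cj z)) = Rt a a (x * (y * z))"
    by (simp add: ET_axis mult.assoc)
  finally have "Rt a c (x * y) ** Rt a a (x * (y * z)) \<in> H" using good_EJ[OF H \<theta> m] by simp
  from good_mult[OF H good_iv[OF H m] this] show ?case
    using good_UU[OF H m] by (simp add: matrix_mul_assoc iv_left)
next
  case (sum x1 y1)
  then show ?case using good_mult[OF H sum] Rt_same_add[of a] rtD(1)[OF r] by (simp add: distrib_left)
qed

lemma sum_axis_nth: "(\<Sum>l\<in>A. axis l (f l)) $ i = (if i \<in> A then f i else 0)"
  for A :: "'n::finite signed set" and f :: "'n signed \<Rightarrow> 'a"
  by (simp add: axis_def if_distrib cong: if_cong)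

lemma core_ET_sum:
  fixes H :: "('a, 'n::finite) sq_mat set"
  assumes n: "CARD('n) \<ge> 4" and H: "good H" and k: "k \<noteq> 0"
    and A: "- k \<notin> A" "\<And>l l'. l \<in> A \<Longrightarrow> l' \<in> A \<Longrightarrow> l' \<noteq> - l" and f: "\<And>l. l \<in> A \<Longrightarrow> f l \<in> short_ideal H"
  shows "ET (ax k) (\<Sum>l\<in>A. axis l (f l)) \<in> core H"
proof -
  interpret K: inv_ideal F "short_ideal H" by (rule short_ideal_inv)
  have 1: "ET (ax k) (axis l (f l)) \<in> core H" if "l \<in> A" for l
  proof (cases "l = k")
    case True
    then show ?thesis using core_tr(1)[OF n H k, of "cj (f l)"] K.I_cj[OF f[OF that]] by (simp add: ET_axis)
  next
    case False
    have "l \<noteq> 0" "l \<noteq> - k" using A that by force+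
    then have "rt k l" using False k by (auto simp: rt_def)
    then show ?thesis using core_Rt[OF n H _ K.I_cj[OF f[OF that]]] by (simp add: Rt_ET_right)
  qed
  have "finite A" by simp
  then show ?thesis using A 1
  proof (induction A rule: finite_induct)
    case empty
    then show ?case using subgroup.one_closed[OF core_subgroup[OF H]] by simp
  next
    case (insert l A)
    have B: "Bf (ax k) (\<Sum>l\<in>A. axis l (f l)) = 0" "Bf (\<Sum>l\<in>A. axis l (f l)) (axis l (f l)) = 0"
         "Bf (\<Sum>l\<in>A. axis l (f l)) (ax k) = 0"
      using insert.prems(1) insert.prems(2)[of l] insert.prems(2)[of _ l]
      by (auto simp: B_axis_left B_axis_right sum_axis_nth simp del: sum_component)
    have "ET (ax k) ((\<Sum>l\<in>A. axis l (f l)) + axis l (f l))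
        = ET (ax k) (\<Sum>l\<in>A. axis l (f l)) ** ET (ax k) (axis l (f l))"
      using B k insert.prems(1) by (intro ET_add_right) (auto simp: B_axis_axis)
    then show ?case using core_mult[OF H insert.IH] insert by (simp add: add.commute)
  qed
qed

text \<open>The coordinates of \<open>z\<close> other than the zeroth one give short root elements of the core
  and can be removed. The parts with positive and with negative indices are isotropic
  but not orthogonal to each other: their product contributes the value of the quadratic
  form to the scalar.\<close>

lemma Ei_split:
  fixes H :: "('a, 'n::finite) sq_mat set" and k :: "'n signed"
  assumes n: "CARD('n) \<ge> 4" and H: "good H" and k: "k \<noteq> 0"
    and z: "z $ (- k) = 0" "\<And>l. l \<noteq> 0 \<Longrightarrow> z $ l \<in> short_ideal H" and m: "Ei (ax k) z y \<in> H"
  shows "Ei (ax k) (axis 0 (z $ 0)) (y + q z * cj (lam F)) \<in> H"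
proof -
  define zp where "zp = (\<Sum>l\<in>Theta_pos - {- k}. axis l (z $ l))"
  define zm where "zm = (\<Sum>l\<in>Theta_neg - {- k}. axis l (z $ l))"
  have zp: "zp $ i = (if i \<in> Theta_pos then z $ i else 0)" for i
    using z(1) unfolding zp_def sum_axis_nth by auto
  have zm: "zm $ i = (if i \<in> Theta_neg then z $ i else 0)" for i
    using z(1) unfolding zm_def sum_axis_nth by auto
  have c: "ET (ax k) zp \<in> core H" "ET (ax k) zm \<in> core H"
    unfolding zp_def zm_def by (rule core_ET_sum[OF n H k]; use z(2) in auto)+
  have zz: "z = zp + zm + axis 0 (z $ 0)"
  proof (unfold vec_eq_iff, rule allI)
    fix i show "z $ i = (zp + zm + axis 0 (z $ 0)) $ i"
      by (cases i) (auto simp: zp zm axis_def zero_signed_def)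
  qed
  have kz: "zp $ (- k) = 0" "zm $ (- k) = 0" using z(1) by (simp_all add: zp zm)
  have 0: "zp $ 0 = 0" "zm $ 0 = 0" by (auto simp: zp zm)
  have q: "Bf zp zm = q z"
  proof -
    have "Pos l \<notin> Theta_neg" "Neg l \<notin> Theta_pos" for l :: 'n by auto
    moreover have "0 \<notin> (Theta_pos :: 'n signed set)" by (auto simp: zero_signed_def)
    ultimately show ?thesis unfolding B_eq_bq by (simp add: bq_def 0 zp zm)
  qed
  have kk: "Bf (ax k) (ax k) = 0" using k by (simp add: B_axis_axis)
  define E where "E = ET (ax k) zp ** ET (ax k) zm"
  have E: "E = Ei (ax k) (zp + zm) (- (q z * cj (lam F)))"
    unfolding E_def using k by (subst Ei_mult) (simp_all add: axis_nth_neq B_axis_left kz q)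
  have "E ** Ei (ax k) (axis 0 (z $ 0)) (y + q z * cj (lam F)) = Ei (ax k) (zp + zm + axis 0 (z $ 0)) y"
    unfolding E using k by (subst Ei_mult) (auto simp: kk B_axis_left B_lin kz B_axis_right 0 axis_nth_neq)
  then have m': "E ** Ei (ax k) (axis 0 (z $ 0)) (y + q z * cj (lam F)) \<in> H" using m zz by simp
  have EH: "E \<in> H" unfolding E_def using core_mult[OF H c] core_le by blast
  from good_mult[OF H good_iv[OF H EH] m'] show ?thesis
    using good_UU[OF H EH] by (simp add: matrix_mul_assoc iv_left)
qed

lemma Ei_axis0_Lo: "Ei (ax (Neg i)) (axis 0 x) y = Lo (Neg i) (- x, y * lam F)"
proof -
  have "y * lam F * cj (lam F) = y" "x * lam F * cj (lam F) = x" by (simp_all add: mult.assoc)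
  then show ?thesis unfolding Lo_eq_Ei[OF Theta_pos_neg_disjoint(2)] by (simp add: image_iff)
qed

text \<open>The core contains the long root elements with parameters in
  \<open>Omega_min F (short_ideal H)\<close>, so congruent parameters are interchangeable.\<close>

lemma Lo_cong:
  fixes H :: "('a, 'n::finite) sq_mat set" and i :: "'n signed"
  assumes n: "CARD('n) \<ge> 4" and H: "good H" and i: "i \<noteq> 0"
    and c: "form_ideal.cg F (Omega_min F (short_ideal H)) \<alpha> \<beta>" and m: "Lo i \<alpha> \<in> H"
  shows "Lo i \<beta> \<in> H"
proof -
  interpret K: inv_ideal F "short_ideal H" by (rule short_ideal_inv)
  interpret k: form_ideal F "short_ideal H" "Omega_min F (short_ideal H)" by (rule K.form_ideal_min)
  let ?S = "{\<alpha> \<in> \<Delta>. Lo i \<alpha> \<in> H}"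
  have S: "subgroup ?S (heis F)" by (intro Lo_subgroup good_subgroup H i)
  have c': "\<alpha> \<in> \<Delta>" "\<beta> \<in> \<Delta>" "\<beta> \<boxminus> \<alpha> \<in> Omega_min F (short_ideal H)" using c k.cg_sym[OF c] by (auto simp: k.cg_def)
  have "\<beta> \<boxminus> \<alpha> \<in> ?S"
    using core_Omega_min[OF n H i c'(3)] core_le Delta_minus c' by blast
  then have "(\<beta> \<boxminus> \<alpha>) \<boxplus> \<alpha> \<in> ?S" using m c' by (intro subgroup.m_closed[OF S]) auto
  moreover have "(\<beta> \<boxminus> \<alpha>) \<boxplus> \<alpha> = \<beta>" by (cases \<alpha>; cases \<beta>) (simp add: hminus_pair hadd_pair algebra_simps)
  ultimately show ?thesis by simp
qed

text \<open>The commutator argument of the extraction with only one commutator, so that the result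
  is a transvection along \<open>e\<^sub>k\<close> and a vector \<open>v\<close> built from columns of \<open>\<sigma>\<close>. The
  transvection \<open>t\<close> does not fix \<open>e\<^sub>k\<close>; but up to root elements already known to lie in
  \<open>H\<close> it equals a short root element that does, and its commutator contributes the
  correction \<open>v\<^sub>0\<close>.\<close>

lemma column_commutator:
  fixes H :: "('a, 'n::finite) sq_mat set" and k i j :: "'n signed"
  assumes n: "CARD('n) \<ge> 4" and H: "good H" and s: "\<sigma> \<in> H" and r: "rt k i" "rt k j" "rt i j"
    and x: "x \<in> Jp 8" and y: "y \<in> J"
  defines "a \<equiv> Bf (ax k) (\<sigma> *v ax i)" and "b \<equiv> Bf (ax k) (\<sigma> *v ax j)" and "e \<equiv> Bf (ax k) (\<sigma> *v ax (- k))"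
  defines "U \<equiv> a *s (\<sigma> *v ax (- k)) - e *s (\<sigma> *v ax i)" and "V \<equiv> b *s (\<sigma> *v ax (- k)) - e *s (\<sigma> *v ax j)"
  defines "w \<equiv> axis (- j) y"
  defines "v \<equiv> ET (x *s U) V *v w" and "v\<^sub>0 \<equiv> w + axis i (x * e * cj e * kap j * y)"
  shows "Ei (ax k) (v - v\<^sub>0) (Bf v v\<^sub>0 * cj (lam F)) \<in> H" and "(v - v\<^sub>0) $ (- k) = 0"
proof -
  note R = rtD[OF r(1)] rtD[OF r(2)] rtD[OF r(3)]
  note sU = good_UU[OF H s]
  define \<tau> where "\<tau> = iv \<sigma>"
  have \<tau>: "\<tau> \<in> H" "\<tau> \<in> UU" "iv \<tau> = \<sigma>" unfolding \<tau>_def using sU good_iv[OF H s] by (simp_all add: iv_UU iv_iv)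
  have col_coeff: "col_coeff \<tau> k l = Bf (ax k) (\<sigma> *v ax l)" for l
    using iv_B[OF \<tau>(2), of "ax k" "ax l"] \<tau>(3) by (simp add: col_coeff_def)
  have cfs: "col_coeff \<tau> k i = a" "col_coeff \<tau> k j = b" "col_coeff \<tau> k (- k) = e" by (simp_all add: col_coeff a_def b_def e_def)
  have xJ: "x \<in> J" using Jp_mono[of 1 8] x Jp_1 by auto
  have rr: "rt (- k) i" "rt (- k) j" using r by simp_all
  define t where "t = ET (x *s koszul \<tau> k (- k) i) (koszul \<tau> k (- k) j)"
  note T = koszul_transvection[OF rr r(3) xJ, where \<sigma> = \<tau> and k = k, folded t_def]
  have tU: "t \<in> UU" by (rule EJ_UU[OF T(1)])
  define t' where "t' = cjg \<sigma> t"
  have t'U: "t' \<in> UU" unfolding t'_def by (intro cjg_UU sU tU)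
  have K: "\<sigma> *v koszul \<tau> k (- k) i = U" "\<sigma> *v koszul \<tau> k (- k) j = V"
  proof -
    have *: "axis m z = z *s (ax m :: 'a^'n signed)" for m z by (simp add: axis_scale)
    show "\<sigma> *v koszul \<tau> k (- k) i = U" "\<sigma> *v koszul \<tau> k (- k) j = V"
      unfolding koszul_def col_coeff U_def V_def a_def b_def e_def *[of _ "Bf _ _"]
      by (simp_all add: matrix_vector_mult_diff_distrib matrix_vector_scale)
  qed
  have t': "t' = ET (x *s U) V"
    unfolding t'_def t_def cjg_Ei[OF sU] by (simp add: matrix_vector_scale K)
  have t'k: "t' *v ax k = ax k"
    using T(2) iv_apply(2)[OF sU, of "ax k"]
    unfolding t'_def cjg_def \<tau>_def by (simp add: matrix_vector_mul_assoc[symmetric])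
  (* the four root elements into which t splits; the first three are in H by entry_off, the
     last fixes e_k *)
  define E1 where "E1 = Rt (- k) (- k) (x * a * cj b)"
  define E2 where "E2 = Rt (- k) j (x * a * cj (- e))"
  define E3 where "E3 = Rt i (- k) (- (x * e) * cj b)"
  define t0 where "t0 = Rt i j (- (x * e) * cj (- e))"
  have aL: "a \<in> LB H {- i} 7" and bL: "b \<in> LB H {- j} 7"
    unfolding a_def b_def using entry_off[OF n H s] r by blast+
  have xx: "x \<in> Jp 7" using Jp_mono[of 7 8] x by auto
  have m1: "E1 \<in> H"
  proof -
    have "a \<in> Lv H (- k) j 7" using LBD[OF aL rr(2)] R by auto
    from Lv_trace[OF H rr(2) this, of "cj b * x"] Jp_mult[OF x, of "cj b"] show ?thesis
      by (simp add: E1_def ac_simps)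
  qed
  have m2: "E2 \<in> H"
    using LvD[OF LBD[OF aL rr(2)], of "x * cj (- e)"] R xx Jp_mult[of x 7 "cj (- e)"]
    by (auto simp: E2_def ac_simps)
  have m3: "E3 \<in> H"
    using LvD[OF LBD[OF LB_cj[OF bL] rt_sym[OF rr(1)]], of "- (x * e)"] R Jp_mult[OF xx, of "- e"]
    by (auto simp: E3_def ac_simps)
  have t0J: "t0 \<in> EJ" unfolding t0_def using R by (intro EJ_Rt) (auto intro: I_mult2 I_minus xJ)
  have t0U: "t0 \<in> UU" by (rule EJ_UU[OF t0J])
  have tt: "t = (E1 ** E2) ** (E3 ** t0)"
  proof -
    have u: "x *s koszul \<tau> k (- k) i = axis (- k) (x * a) + axis i (- (x * e))"
      unfolding koszul_def cfs using R by (simp add: vec_eq_iff axis_def algebra_simps)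
    have v: "koszul \<tau> k (- k) j = axis (- k) b + axis j (- e)"
      unfolding koszul_def cfs using R by (simp add: vec_eq_iff axis_def algebra_simps)
    have "t = ET (axis (- k) (x * a)) (axis (- k) b + axis j (- e)) ** ET (axis i (- (x * e))) (axis (- k) b + axis j (- e))"
      unfolding t_def u v using R by (intro ET_add_left) (simp_all add: B_lin B_axis_axis)
    also have "ET (axis (- k) (x * a)) (axis (- k) b + axis j (- e)) = E1 ** E2"
      unfolding E1_def E2_def ET_axis[symmetric] using R by (intro ET_add_right) (simp_all add: B_axis_axis)
    also have "ET (axis i (- (x * e))) (axis (- k) b + axis j (- e)) = E3 ** t0"
      unfolding E3_def t0_def ET_axis[symmetric] using R by (intro ET_add_right) (simp_all add: B_axis_axis)
    finally show ?thesis .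
  qed
  have "t ** iv t' = cjg t \<sigma> ** iv \<sigma>"
    unfolding t'_def by (simp add: cjg_def iv_mult mult_UU iv_UU iv_iv sU tU matrix_mul_assoc)
  then have tiv: "t ** iv t' \<in> H"
    using good_mult[OF H good_EJ[OF H T(1) s] good_iv[OF H s]] by simp
  have EE: "E1 ** E2 \<in> H" by (rule good_mult[OF H m1 m2])
  have "t0 ** iv t' = iv E3 ** (iv (E1 ** E2) ** (t ** iv t'))"
  proof -
    have c: "iv A ** (A ** B) = B" if "A \<in> H" for A B using good_UU[OF H that] by (simp add: matrix_mul_assoc iv_left)
    have "t ** iv t' = (E1 ** E2) ** (E3 ** (t0 ** iv t'))" by (simp only: tt matrix_mul_assoc)
    then show ?thesis by (simp only: c[OF EE] c[OF m3])
  qed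
  then have t0iv: "t0 ** iv t' \<in> H"
    using good_mult[OF H good_iv[OF H m3] good_mult[OF H good_iv[OF H EE] tiv]] by simp
  (* commutators of t0 and of the conjugate of t with epsilon agree modulo H *)
  define \<epsilon> where "\<epsilon> = Rt k (- j) (cj y)"
  have \<epsilon>E: "\<epsilon> \<in> EJ" unfolding \<epsilon>_def using R y by (intro EJ_Rt) (auto intro: I_cj)
  note \<epsilon>U = EJ_UU[OF \<epsilon>E]
  have \<epsilon>: "\<epsilon> = ET (ax k) w" by (simp add: \<epsilon>_def Rt_ET_right w_def)
  have t0w: "t0 *v w = v\<^sub>0" "t0 *v ax k = ax k"
  proof -
    have *: "w = y *s ax (- j)" by (simp add: w_def axis_scale)
    show "t0 *v w = v\<^sub>0"
      unfolding t0_def * matrix_vector_scale Rt_apply_axis(2)[OF r(3)]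
      by (simp add: v\<^sub>0_def w_def vec_eq_iff axis_def algebra_simps)
    show "t0 *v ax k = ax k" unfolding t0_def using R by (intro Rt_apply_axis(1) r) auto
  qed
  have nt': "group.norms UG H t'"
  proof -
    have "group.norms UG H (\<sigma> \<otimes>\<^bsub>UG\<^esub> t \<otimes>\<^bsub>UG\<^esub> iv \<sigma>)"
      using good_UU[OF H] good_norms[OF H T(1)] group.norms_self[OF group_UG good_subgroup[OF H] s]
      by (intro group.norms_mult[OF group_UG] group.norms_inv[OF group_UG]) auto
    then show ?thesis by (simp add: t'_def cjg_def)
  qed
  have c: "cmt t0 \<epsilon> ** iv (cmt t' \<epsilon>) \<in> H"
    using group.commut_cong[OF group_UG good_subgroup[OF H] good_norms[OF H t0J] nt' good_norms[OF H \<epsilon>E]] t0iv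
    by simp
  define D where "D = cjg t' \<epsilon>"
  define D0 where "D0 = cjg t0 \<epsilon>"
  have DU: "D \<in> UU" "D0 \<in> UU" unfolding D_def D0_def by (intro cjg_UU t'U t0U \<epsilon>U)+
  have "cmt t0 \<epsilon> ** iv (cmt t' \<epsilon>) = D0 ** iv D"
    unfolding cmt_eq[OF t0U \<epsilon>U] cmt_eq[OF t'U \<epsilon>U] D_def[symmetric] D0_def[symmetric]
    using DU \<epsilon>U by (simp add: iv_mult iv_UU iv_iv matrix_mul_assoc) (simp add: matrix_mul_assoc[symmetric] iv_left)
  then have "iv (D0 ** iv D) \<in> H" using good_iv[OF H c] by simp
  then have DD: "D ** iv D0 \<in> H" using DU by (simp add: iv_mult iv_UU iv_iv)
  have D: "D = ET (ax k) v" unfolding D_def \<epsilon> cjg_Ei[OF t'U] t'k v_def t'[symmetric] ..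
  have D0: "D0 = ET (ax k) v\<^sub>0" unfolding D0_def \<epsilon> cjg_Ei[OF t0U] t0w ..
  have kw: "Bf (ax k) w = 0" using R by (simp add: w_def B_axis_axis)
  have ww: "Bf w w = 0" using R by (simp add: w_def B_axis_axis)
  have kk: "Bf (ax k) (ax k) = 0" using R by (simp add: B_axis_axis)
  have kv: "Bf (ax k) v = 0" using UU_B[OF t'U, of "ax k" w] kw t'k by (simp add: v_def t'[symmetric])
  have kv0: "Bf (ax k) v\<^sub>0 = 0" using UU_B[OF t0U, of "ax k" w] kw t0w by simp
  have vv0: "Bf v\<^sub>0 v\<^sub>0 = 0" using UU_B[OF t0U, of w w] ww t0w by simp
  have "iv D0 = ET (- ax k) v\<^sub>0" unfolding D0 by (rule iv_ET(1)) (use DU D0 kk kv0 vv0 in auto)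
  also have "\<dots> = ET (ax k) (- v\<^sub>0)" by (simp add: ET_Nn Nn_lin)
  finally have "D ** iv D0 = Ei (ax k) (v + - v\<^sub>0) (0 + 0 - Bf v (- v\<^sub>0) * cj (lam F))"
    unfolding D by (simp only:) (rule Ei_mult, simp_all add: kk kv kv0 B_lin)
  then show "Ei (ax k) (v - v\<^sub>0) (Bf v v\<^sub>0 * cj (lam F)) \<in> H" using DD by (simp add: B_lin)
  have "Bf (ax k) (v - v\<^sub>0) = 0" using kv kv0 by (simp add: B_lin)
  then have "cj (kap k) * (kap k * (v - v\<^sub>0) $ (- k)) = 0" by (simp add: B_axis_left)
  then show "(v - v\<^sub>0) $ (- k) = 0" using kap_unit[of k] R by (simp add: mult.assoc[symmetric] mult.commute[of "cj _"])
qed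

text \<open>All coordinates of \<open>v - v\<^sub>0\<close> except the zeroth one lie in the short ideal, because \<open>\<sigma>\<close>
  is a scalar modulo the upper ideal. After removing them a long root element remains.
  Its parameter is the quadratic value of \<open>v\<close>, which agrees with a multiple of the
  quadratic value of the \<open>i\<close>-th column modulo \<open>Omega_min F (short_ideal H)\<close>; the factor
  is a unit modulo the upper ideal times \<open>x y\<close>, and the unit is compensated in the
  choice of \<open>x\<close>.\<close>

lemma column_Lo_product:
  fixes H :: "('a, 'n::finite) sq_mat set" and k i :: "'n signed"
  assumes n: "CARD('n) \<ge> 4" and H: "good H" and s: "\<sigma> \<in> H" and k: "k \<in> Theta_neg" and ki: "rt k i"
    and x: "x \<in> Jp 8" and y: "y \<in> J"
  shows "Lo k (Q_form F (\<sigma> *v ax i) \<star> (x * y)) \<in> H"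
proof -
  obtain j where "j \<noteq> 0" "j \<noteq> k" "j \<noteq> - k" "j \<noteq> i" "j \<noteq> - i" using rt_other[OF n, of k i i] by metis
  then have r: "rt k i" "rt k j" "rt i j" using ki rtD[OF ki] by (auto simp: rt_def)
  note R = rtD[OF r(1)] rtD[OF r(2)] rtD[OF r(3)]
  note sU = good_UU[OF H s]
  let ?I = "upper_ideal F H"
  interpret I: inv_ideal F ?I by (rule upper_ideal_inv)
  interpret K: inv_ideal F "short_ideal H" by (rule short_ideal_inv)
  interpret K: form_ideal F "short_ideal H" "Omega_min F (short_ideal H)" by (rule K.form_ideal_min)
  define c where "c = \<sigma> $ i $ i"
  have sc: "I.scal c \<sigma>" unfolding c_def by (rule I.scal_of_upper_Y[OF s sU upper_Y_le R(2)])
  have cc: "c * cj c - 1 \<in> ?I" by (rule I.scal_norm[OF sc])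
  have coord: "(\<sigma> *v ax m) $ l - (if l = m then c else 0) \<in> ?I" if "m \<noteq> 0" "l \<noteq> 0" for m l
    using I.scal_coord[OF sc ax_M[OF that(1), of 1] that(2)] by (cases "l = m") (auto simp: axis_nth axis_nth_neq)
  (* the factor in front of x inverts, modulo the upper ideal, the unit that the computation
     below produces *)
  define x1 where "x1 = - (c * cj (kap j)) * x"
  have x1: "x1 \<in> Jp 8" unfolding x1_def by (rule Jp_mult[OF x])
  define p where "p = \<sigma> *v ax (- k)"
  define u where "u = \<sigma> *v ax i"
  define u' where "u' = \<sigma> *v ax j"
  define a where "a = Bf (ax k) u"
  define b where "b = Bf (ax k) u'"
  define e where "e = Bf (ax k) p"
  define U where "U = a *s p - e *s u"
  define V where "V = b *s p - e *s u'"
  define w where "w = (axis (- j) y :: 'a^'n signed)"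
  define v where "v = ET (x1 *s U) V *v w"
  define v0 where "v0 = w + axis i (x1 * e * cj e * kap j * y)"
  define z where "z = v - v0"
  note C = column_commutator[OF n H s r x1 y, folded p_def u_def u'_def, folded a_def b_def e_def,
      folded U_def V_def w_def, folded v_def v0_def, folded z_def]
  define \<beta> where "\<beta> = Bf V w"
  define \<gamma> where "\<gamma> = cj (lam F) * Bf (x1 *s U) w"
  define \<beta>' where "\<beta>' = cj b * cj (p $ j) * kap j - cj e * cj (u' $ j) * kap j"
  define \<gamma>' where "\<gamma>' = cj a * cj (p $ j) * kap j - cj e * cj (u $ j) * kap j"
  have \<beta>: "\<beta> = y * \<beta>'" unfolding \<beta>_def \<beta>'_def V_def w_def by (simp add: B_axis_right algebra_simps)
  have \<gamma>: "\<gamma> = \<gamma>' * (cj (lam F) * (cj x1 * y))"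
    unfolding \<gamma>_def \<gamma>'_def U_def w_def by (simp add: B_lin B_axis_right algebra_simps)
  have x1y: "x1 * y \<in> Jp 9" "cj x1 * y \<in> Jp 9"
    using Jp_prod[OF x1 y] Jp_prod[OF Jp_cj[OF x1] y] by (simp_all add: eval_nat_numeral)
  have aI: "a \<in> ?I" and bI: "b \<in> ?I" and eI: "e - kap k * c \<in> ?I"
    using coord[of i "- k"] coord[of j "- k"] I.I_mult[OF coord[of "- k" "- k"], of "kap k"] R
    by (auto simp: a_def b_def e_def u_def u'_def p_def B_axis_left right_diff_distrib intro: I.I_mult)
  have uI: "u $ l - (if l = i then c else 0) \<in> ?I" if "l \<noteq> 0" for l
    unfolding u_def using coord[OF R(2) that] .
  have u'I: "u' $ l - (if l = j then c else 0) \<in> ?I" if "l \<noteq> 0" for l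
    unfolding u'_def using coord[OF _ that, of j] R by simp
  have uj: "u $ j \<in> ?I" using uI[of j] R by auto
  have kk: "kap k * cj (kap k) = 1" "kap j * cj (kap j) = 1" using R by (auto intro: kap_unit)
  have ee: "e * cj e - 1 \<in> ?I"
  proof -
    have "e * cj e - kap k * c * cj (kap k * c) \<in> ?I" by (rule I.cI_mult[OF eI I.cI_cj[OF eI]])
    moreover have "kap k * c * cj (kap k * c) = c * cj c * (kap k * cj (kap k))" by (simp only: cj_mult ac_simps)
    ultimately show ?thesis using I.cI_trans[of "e * cj e" "c * cj c" 1] cc by (simp add: kk)
  qed
  have \<beta>I: "\<beta>' - - (cj e * cj c * kap j) \<in> ?I"
  proof -
    have "cj b * cj (p $ j) * kap j - 0 \<in> ?I" using bI by (simp add: I.I_cj I.I_mult2)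
    moreover have "cj e * cj (u' $ j) * kap j - cj e * cj c * kap j \<in> ?I"
      using u'I[of j] R by (intro I.cI_mult I.cI_refl I.cI_cj) auto
    ultimately show ?thesis unfolding \<beta>'_def using I.cI_diff by fastforce
  qed
  have \<gamma>I: "\<gamma>' \<in> ?I" unfolding \<gamma>'_def 
    by (rule I.I_diff; rule I.I_mult2) (simp_all add: aI uj I.I_mult I.I_mult2 I.I_cj)
  have \<gamma>K: "\<gamma> \<in> short_ideal H" unfolding \<gamma> by (intro short_ideal_I \<gamma>I Jp_mult x1y)
  (* modulo the upper ideal U is the multiple - e c of e_i *)
  have UI: "U $ l - (if l = i then - (e * c) else 0) \<in> ?I" if "l \<noteq> 0" for l
  proof -
    have "a * p $ l - 0 \<in> ?I" using aI by (simp add: I.I_mult2)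
    moreover have "e * u $ l - e * (if l = i then c else 0) \<in> ?I"
      using uI[OF that] by (intro I.cI_mult I.cI_refl) auto
    ultimately have "(a * p $ l - e * u $ l) - (0 - e * (if l = i then c else 0)) \<in> ?I" by (rule I.cI_diff)
    then show ?thesis by (auto simp: U_def split: if_splits)
  qed
  have v: "v = w + \<beta> *s (x1 *s U) - \<gamma> *s V"
    unfolding v_def by (simp add: Ei_apply \<beta>_def \<gamma>_def)
  (* at the index i the correction v0 cancels the only coordinate that is not small *)
  have zK: "z $ l \<in> short_ideal H" if l: "l \<noteq> 0" for l
  proof -
    have "\<beta>' * U $ l - - (cj e * cj c * kap j) * (if l = i then - (e * c) else 0) \<in> ?I"
      by (intro I.cI_mult \<beta>I UI l)
    moreover have "- (cj e * cj c * kap j) * (if l = i then - (e * c) else 0) - (if l = i then e * cj e * kap j else 0) \<in> ?I"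
      using I.I_mult[OF cc, of "e * cj e * kap j"] by (simp add: algebra_simps)
    ultimately have 1: "\<beta>' * U $ l - (if l = i then e * cj e * kap j else 0) \<in> ?I" by (rule I.cI_trans)
    have "z $ l = (\<beta>' * U $ l - (if l = i then e * cj e * kap j else 0)) * (x1 * y) - \<gamma> * V $ l"
      unfolding z_def v v0_def \<beta> by (simp add: axis_def algebra_simps)
    then show ?thesis using short_ideal_I[OF 1 x1y(1)] \<gamma>K by (simp add: K.I_diff K.I_mult2)
  qed
  obtain \<kappa> where \<kappa>: "k = Neg \<kappa>" using k by blast
  have v00: "v0 $ 0 = 0" unfolding v0_def w_def using R by (simp add: axis_nth_neq)
  have qv0: "q v0 = 0" unfolding v0_def w_def using R by (auto simp: bq_lin bq_axis_left axis_nth_neq)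
  have tK: "bq v0 v \<in> short_ideal H"
  proof -
    have "bq v0 v = bq v0 z" unfolding z_def by (simp add: bq_lin qv0)
    then show ?thesis using zK by (simp add: bq_def K.I_sum K.I_mult)
  qed
  have l: "t * cj (lam F) * lam F = t" for t by (simp add: mult.assoc)
  have "Ei (ax k) (axis 0 (z $ 0)) (Bf v v0 * cj (lam F) + q z * cj (lam F)) \<in> H"
    by (rule Ei_split[OF n H R(1) C(2) zK C(1)])
  then have "Lo k (- (v $ 0), Bf v v0 + q z) \<in> H"
    unfolding \<kappa> Ei_axis0_Lo by (simp add: z_def v00 distrib_right l)
  moreover have "(- (v $ 0), Bf v v0 + q z) = Q_form F v \<star> (- 1) \<boxplus> (0, tr (- bq v0 v))"
    unfolding z_def B_eq_bq by (simp add: Q_form_eq circ_pair hadd_pair bq_lin qv0 v00 tr_def)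
  ultimately have m: "Lo k (Q_form F v \<star> (- 1) \<boxplus> (0, tr (- bq v0 v))) \<in> H" by simp
  define h where "h = x1 * y * \<beta>'"
  have ax0: "Q_form F (axis l t :: 'a^'n signed) = (0, 0)" if "l \<noteq> 0" for l t
    using that by (simp add: Q_form_eq q_axis axis_nth_neq)
  have QD: "Q_form F p \<in> \<Delta>" "Q_form F u \<in> \<Delta>" "Q_form F u' \<in> \<Delta>"
    unfolding p_def u_def u'_def using R by (auto intro!: UU_Q_isotropic sU ax0)
  have Bp: "Bf p p = 0" "Bf p u = 0" "Bf p u' = 0" "Bf u p = 0" "Bf u u' = 0"
    unfolding p_def u_def u'_def UU_B[OF sU] using R by (auto simp: B_axis_axis)
  have ve: "t *s f + - e *s g = t *s f - e *s g" for t and f g :: "'a^'n signed" by (simp add: vec_eq_iff)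
  have QV: "Q_form F V \<in> \<Delta>"
  proof -
    have "Q_form F V = Q_form F p \<star> b \<boxplus> Q_form F u' \<star> (- e) \<boxplus> (0, tr (bq (- e *s u') (b *s p)))"
      using Q_form_add[of "b *s p" "- e *s u'"] unfolding ve V_def Q_form_scale by (simp add: B_lin Bp)
    then show ?thesis using QD by (simp add: Delta_add Delta_circ Delta_tr)
  qed
  have QU: "Q_form F U = Q_form F p \<star> a \<boxplus> Q_form F u \<star> (- e) \<boxplus> (0, tr (bq (- e *s u) (a *s p)))"
    using Q_form_add[of "a *s p" "- e *s u"] unfolding ve U_def Q_form_scale by (simp add: B_lin Bp)
  then have QUD: "Q_form F U \<in> \<Delta>" using QD by (simp add: Delta_add Delta_circ Delta_tr)
  have bUV: "Bf (x1 *s U) V = 0" unfolding U_def V_def by (simp add: B_lin Bp)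
  define T where "T = \<beta> * cj \<gamma> + bq (\<beta> *s (x1 *s U)) w - bq (\<gamma> *s V) (w + \<beta> *s (x1 *s U))"
  have TK: "T \<in> short_ideal H"
  proof -
    have "cj (U $ j) * (cj x1 * y) \<in> short_ideal H" using UI[of j] R by (intro short_ideal_I x1y I.I_cj) auto
    then have "cj \<beta> * (cj x1 * (cj (U $ j) * y)) \<in> short_ideal H" by (metis K.I_mult mult.left_commute)
    moreover have "bq U w = (if - j \<in> Theta_neg then cj (U $ j) * y else 0)" by (simp add: w_def bq_axis_right)
    ultimately have 1: "bq (\<beta> *s (x1 *s U)) w \<in> short_ideal H" unfolding bq_scale_left by (cases "- j \<in> Theta_neg") simp_all
    have 2: "bq (\<gamma> *s V) g \<in> short_ideal H" for g unfolding bq_scale_left by (rule K.I_mult2[OF K.I_cj[OF \<gamma>K]])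
    show ?thesis unfolding T_def by (rule K.I_diff[OF K.I_add[OF K.I_mult[OF K.I_cj[OF \<gamma>K]] 1] 2])
  qed
  have Qv: "Q_form F v = Q_form F U \<star> h \<boxplus> (Q_form F V \<star> (- \<gamma>) \<boxplus> (0, tr T))"
  proof -
    have Qw: "Q_form F w = (0, 0)" unfolding w_def using R by (intro ax0) auto
    have "Q_form F (x1 *s U) \<star> \<beta> = Q_form F U \<star> h"
      by (simp add: Q_form_scale circ_circ \<beta> h_def ac_simps)
    then show ?thesis
      using Q_form_ET[OF bUV, of w] unfolding v_def[symmetric] \<beta>_def[symmetric] \<gamma>_def[symmetric] T_def[symmetric] Qw
      by (simp add: hadd_zero hadd_assoc)
  qed
  have QvD: "Q_form F v \<in> \<Delta>" unfolding Qv using QUD QV by (simp add: Delta_add Delta_circ Delta_tr)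
  (* Q v is a multiple of Q U, and Q U one of Q u, up to the smallest form parameter *)
  have 1: "K.cg (Q_form F v \<star> (- 1)) (Q_form F U \<star> h \<star> (- 1))"
    unfolding Qv by (intro K.cg_circ K.cg_add_Omega Delta_circ QUD K.Omega_add K.Omega_circ_I K.Omega_tr K.I_minus \<gamma>K TK QV)
  have h: "a * h \<in> short_ideal H" unfolding h_def using short_ideal_I[OF aI x1y(1)] by (metis K.I_mult2 mult.assoc)
  have 2: "K.cg (Q_form F U \<star> h) (Q_form F u \<star> (- e) \<star> h)"
  proof -
    have "(0, tr (bq (- e *s u) (a *s p))) \<star> h = (0, tr (cj h * bq (- e *s u) (a *s p) * h))"
      by (simp add: circ_pair tr_scale)
    moreover have "cj h * bq (- e *s u) (a *s p) * h \<in> short_ideal H"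
      using K.I_mult[OF h, of "cj h * bq (- e *s u) p"] by (simp add: bq_lin ac_simps)
    ultimately have t: "(0, tr (bq (- e *s u) (a *s p))) \<star> h \<in> Omega_min F (short_ideal H)" using K.Omega_tr by simp
    have p: "Q_form F p \<star> a \<star> h \<in> Omega_min F (short_ideal H)"
      unfolding circ_circ by (rule K.Omega_circ_I[OF QD(1) h])
    have "K.cg (Q_form F p \<star> a \<star> h \<boxplus> Q_form F u \<star> (- e) \<star> h \<boxplus> (0, tr (bq (- e *s u) (a *s p))) \<star> h)
        (Q_form F p \<star> a \<star> h \<boxplus> Q_form F u \<star> (- e) \<star> h)"
      by (intro K.cg_add_Omega Delta_add Delta_circ QD t)
    also have "K.cg (Q_form F p \<star> a \<star> h \<boxplus> Q_form F u \<star> (- e) \<star> h) (Q_form F u \<star> (- e) \<star> h)"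
      by (intro K.cg_Omega_add Delta_circ QD p)
    finally show ?thesis unfolding QU circ_hadd .
  qed
  have 3: "K.cg (Q_form F u \<star> (- e) \<star> h \<star> (- 1)) (Q_form F u \<star> (x * y))"
  proof -
    have "e * \<beta>' - e * - (cj e * cj c * kap j) \<in> ?I" by (intro I.cI_mult I.cI_refl \<beta>I)
    moreover have "e * - (cj e * cj c * kap j) - 1 * - (cj c * kap j) \<in> ?I"
      using I.I_mult[OF ee, of "- (cj c * kap j)"] by (simp add: algebra_simps)
    ultimately have "e * \<beta>' - - (cj c * kap j) \<in> ?I" using I.cI_trans by fastforce
    from I.cI_mult[OF I.cI_refl[of "- (c * cj (kap j))"] this]
    have "- (c * cj (kap j)) * (e * \<beta>') - - (c * cj (kap j)) * - (cj c * kap j) \<in> ?I" .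
    moreover have "- (c * cj (kap j)) * - (cj c * kap j) = c * cj c * (kap j * cj (kap j))" by (simp add: ac_simps)
    ultimately have "- (c * cj (kap j)) * (e * \<beta>') - 1 \<in> ?I" using I.cI_trans[OF _ cc] by (simp add: kk)
    moreover have "x * y \<in> Jp 9" using Jp_prod[OF x y] by (simp add: eval_nat_numeral)
    ultimately have "(- (c * cj (kap j)) * (e * \<beta>') - 1) * (x * y) \<in> short_ideal H" by (rule short_ideal_I)
    moreover have "(- (c * cj (kap j)) * (e * \<beta>') - 1) * (x * y) = e * h - x * y"
      by (simp add: h_def x1_def algebra_simps)
    ultimately have "e * h - x * y \<in> short_ideal H" by simp
    from K.cg_circ_scalar[OF this QD(2)] show ?thesis by (simp add: circ_circ)
  qed
  have "K.cg (Q_form F v \<star> (- 1) \<boxplus> (0, tr (- bq v0 v))) (Q_form F v \<star> (- 1))"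
    by (intro K.cg_add_Omega Delta_circ QvD K.Omega_tr K.I_minus tK)
  then have "K.cg (Q_form F v \<star> (- 1) \<boxplus> (0, tr (- bq v0 v))) (Q_form F u \<star> (x * y))"
    using K.cg_trans[OF _ K.cg_trans[OF 1 K.cg_trans[OF K.cg_circ[OF 2] 3]]] by blast
  from Lo_cong[OF n H R(1) this m] show ?thesis unfolding u_def .
qed

lemma column_Omega_max:
  fixes H :: "('a, 'n::finite) sq_mat set"
  assumes "H \<subseteq> UU" "\<sigma> \<in> H" "i \<noteq> 0"
  shows "Q_form F (\<sigma> *v ax i) \<in> Omega_max F (upper_ideal F H)"
proof -
  interpret I: inv_ideal F "upper_ideal F H" by (rule upper_ideal_inv)
  have "Q_form F (column i \<sigma>) \<in> upper_Z F H" using assms(2,3) by (auto simp: upper_Z_def)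
  then show ?thesis using I.upper_Z_Omega_max[OF _ upper_Y_le] assms(1) by (auto simp: column_eq)
qed

text \<open>The defect of additivity of the scalar action is a trace of an element of the short
  ideal.\<close>

lemma Lo_circ_add:
  fixes H :: "('a, 'n::finite) sq_mat set"
  assumes n: "CARD('n) \<ge> 4" and H: "good H" and k: "k \<in> Theta_neg"
    and \<alpha>: "\<alpha> \<in> \<Delta>" "snd \<alpha> \<in> upper_ideal F H" and r: "r \<in> Jp 9"
    and m: "Lo k (\<alpha> \<star> r) \<in> H" "Lo k (\<alpha> \<star> s) \<in> H"
  shows "Lo k (\<alpha> \<star> (r + s)) \<in> H"
proof -
  obtain \<kappa> where \<kappa>: "k = Neg \<kappa>" using k by blast
  interpret K: inv_ideal F "short_ideal H" by (rule short_ideal_inv)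
  obtain x y where xy: "\<alpha> = (x, y)" by force
  have 1: "\<alpha> \<star> (r + s) = \<alpha> \<star> r \<boxplus> \<alpha> \<star> s \<boxplus> (0, tr (cj s * y * r))"
    unfolding xy by (rule circ_plus) (use Delta_in_max[OF \<alpha>(1)] xy in simp)
  have "y * r \<in> short_ideal H" using \<alpha>(2) r xy by (simp add: short_ideal_I)
  then have "cj s * y * r \<in> short_ideal H" by (simp add: mult.assoc K.I_mult)
  then have "Lo k (0, tr (cj s * y * r)) \<in> H" using core_tr(2)[OF n H, of k] core_le \<kappa> by auto
  then have "Lo k (\<alpha> \<star> r) ** Lo k (\<alpha> \<star> s) ** Lo k (0, tr (cj s * y * r)) \<in> H"
    by (intro good_mult H m)
  then show ?thesis unfolding 1 \<kappa> by (simp add: Lo_mult)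
qed

lemma column_Lo:
  fixes H :: "('a, 'n::finite) sq_mat set" and k i :: "'n signed"
  assumes n: "CARD('n) \<ge> 4" and H: "good H" and s: "\<sigma> \<in> H" and k: "k \<in> Theta_neg" and ki: "rt k i"
    and r: "r \<in> Jp 9"
  shows "Lo k (Q_form F (\<sigma> *v ax i) \<star> r) \<in> H"
proof -
  have HU: "H \<subseteq> UU" using good_UU[OF H] by blast
  have Q: "Q_form F (\<sigma> *v ax i) \<in> \<Delta>" "snd (Q_form F (\<sigma> *v ax i)) \<in> upper_ideal F H"
    using column_Omega_max[OF HU s rtD(2)[OF ki]] by (auto simp: Omega_max_def)
  have "r \<in> Jp (Suc 8)" using r by (simp add: eval_nat_numeral)
  then have "r \<in> Jp 9 \<and> Lo k (Q_form F (\<sigma> *v ax i) \<star> r) \<in> H"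
  proof (induction rule: Jp_Suc_induct)
    case (prod x y)
    then show ?case using column_Lo_product[OF n H s k ki prod] Jp_prod[OF prod] by (simp add: eval_nat_numeral)
  next
    case (sum x y)
    then show ?case using Lo_circ_add[OF n H k Q, of x y] Jp_add by blast
  qed
  then show ?thesis by simp
qed

text \<open>The columns \<open>k\<close> and \<open>- k\<close> are not reached directly; for them a long root element of
  another index is transported to \<open>k\<close>, at the price of the tenth factor from \<open>J\<close>.\<close>

lemma column_Lo_all:
  fixes H :: "('a, 'n::finite) sq_mat set" and k i :: "'n signed"
  assumes n: "CARD('n) \<ge> 4" and H: "good H" and s: "\<sigma> \<in> H" and k: "k \<in> Theta_neg" and i: "i \<noteq> 0"
    and r: "r \<in> Jp 10"
  shows "Lo k (Q_form F (\<sigma> *v ax i) \<star> r) \<in> H"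
proof (cases "rt k i")
  case True
  then show ?thesis using column_Lo[OF n H s k True] Jp_mono[of 9 10] r by auto
next
  case False
  have HU: "H \<subseteq> UU" using good_UU[OF H] by blast
  interpret K: inv_ideal F "short_ideal H" by (rule short_ideal_inv)
  define \<alpha> where "\<alpha> = Q_form F (\<sigma> *v ax i)"
  have Q: "\<alpha> \<in> \<Delta>" "snd \<alpha> \<in> upper_ideal F H"
    using column_Omega_max[OF HU s i] by (auto simp: \<alpha>_def Omega_max_def)
  have kp: "k \<notin> Theta_pos" "k \<noteq> 0" using k by auto
  obtain b where b: "b \<in> Theta_neg" "b \<noteq> k" "b \<noteq> - k"
  proof -
    obtain b where b: "b \<noteq> 0" "b \<noteq> k" "b \<noteq> - k" using rt_other[OF n, of k k k] by metis
    then have "- b \<noteq> k" "- b \<noteq> - k" by auto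
    moreover have "b \<in> Theta_neg \<or> - b \<in> Theta_neg" using b(1) by (cases b) (auto simp: zero_signed_def)
    ultimately show ?thesis using that b by blast
  qed
  have bp: "b \<notin> Theta_pos" "b \<noteq> 0" using b by auto
  have rr: "rt k b" "rt k (- b)" "rt b i" using b bp kp False i by (auto simp: rt_def)
  have "r \<in> Jp (Suc 9)" using r by (simp add: eval_nat_numeral)
  then have "r \<in> Jp 9 \<and> Lo k (\<alpha> \<star> r) \<in> H"
  proof (induction rule: Jp_Suc_induct)
    case (prod x y)
    define \<theta> where "\<theta> = Rt k (- b) (cj y * cj (kap (- b)))"
    have \<theta>: "\<theta> \<in> EJ" unfolding \<theta>_def using prod rtD[OF rr(2)] by (intro EJ_Rt) (auto intro: I_mult2 I_cj)
    have u: "cj y * cj (kap (- b)) * kap (- b) = cj y"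
      using kap_unit[of "- b"] bp by (simp add: mult.assoc mult.commute[of "cj (kap (- b))"])
    have f: "\<theta> *v ax b = ax b + axis k (cj y)" "\<theta> *v ax 0 = ax 0"
      unfolding \<theta>_def using Rt_apply_axis(1)[OF rr(2), of 0] Rt_apply_axis(2)[OF rr(2), of "cj y * cj (kap (- b))"] u bp kp
      by auto
    define \<beta> where "\<beta> = \<alpha> \<star> x"
    have \<beta>D: "\<beta> \<in> \<Delta>" unfolding \<beta>_def by (rule Delta_circ[OF Q(1)])
    have m: "Lo b \<beta> \<in> H" unfolding \<beta>_def \<alpha>_def by (rule column_Lo[OF n H s b(1) rr(3) prod(1)])
    have ne: "k \<noteq> b" "k \<noteq> - b" using b by auto
    have c: "cjg \<theta> (Lo b \<beta>) = Lo b \<beta> ** (Lo k (\<beta> \<star> y) ** Rt k b (lv b \<beta> * cj y))"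
      using cjg_Lo[OF kp(2) bp(2) ne \<beta>D EJ_UU[OF \<theta>] f] Ei_axis_same[OF kp(2) bp(2), of "cj y" \<beta>] bp kp by simp
    have "lv b \<beta> \<in> short_ideal H"
    proof -
      have "snd \<alpha> * x \<in> short_ideal H" by (rule short_ideal_I[OF Q(2) prod(1)])
      from K.I_mult2[OF K.I_mult[OF this, of "cj x"], of "cj (lam F)"]
      show ?thesis using bp by (simp add: lv_def \<beta>_def circ_def mult.assoc)
    qed
    then have R: "Rt k b (lv b \<beta> * cj y) \<in> H" using core_Rt[OF n H rr(1)] core_le K.I_mult2 by blast
    have UR: "Rt k b (lv b \<beta> * cj y) \<in> UU" "Lo b \<beta> \<in> UU" using good_UU[OF H] R m by auto
    have "Lo k (\<beta> \<star> y) ** Rt k b (lv b \<beta> * cj y) \<in> H"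
      using good_mult[OF H good_iv[OF H m] good_EJ[OF H \<theta> m]] UR unfolding c by (simp add: matrix_mul_assoc iv_left)
    then have "Lo k (\<beta> \<star> y) \<in> H"
      using cancel_right[OF H R] Lo_UU[OF kp(2) Delta_circ[OF \<beta>D]] by blast
    then show ?case using Jp_mult[OF prod(1), of y] by (simp add: \<beta>_def circ_circ mult.commute)
  next
    case (sum x y)
    then show ?case using Lo_circ_add[OF n H k Q, of x y] Jp_add by blast
  qed
  then show ?thesis by (simp add: \<alpha>_def)
qed

section \<open>The form parameter of the upper level\<close>

text \<open>The parameters all of whose multiples by \<open>J\<^sup>1\<^sup>0\<close> occur in \<open>H\<close>. This set will be seen to
  contain the form parameter of the upper level.\<close>

definition long_params :: "('a, 'n::finite) sq_mat set \<Rightarrow> 'n signed \<Rightarrow> ('a \<times> 'a) set" where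
  "long_params H k = {\<alpha> \<in> \<Delta>. \<forall>r\<in>Jp 10. Lo k (\<alpha> \<star> r) \<in> H}"

lemma long_params_subgroup:
  fixes H :: "('a, 'n::finite) sq_mat set"
  assumes H: "subgroup H UG" and k: "k \<noteq> 0"
  shows "subgroup (long_params H k) (heis F)"
proof -
  note S = Lo_subgroup[OF H k]
  show ?thesis
  proof
    show "\<one>\<^bsub>heis F\<^esub> \<in> long_params H k"
      using subgroup.one_closed[OF S] by (simp add: long_params_def heis_one circ_pair)
    show "x \<boxplus> y \<in> long_params H k" if "x \<in> long_params H k" "y \<in> long_params H k" for x y
      using that subgroup.m_closed[OF S] by (auto simp: long_params_def circ_hadd Delta_add Delta_circ)
    show "inv\<^bsub>heis F\<^esub> x \<in> long_params H k" if "x \<in> long_params H k" for x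
      using that subgroup.m_inv_closed[OF S] by (auto simp: long_params_def circ_inv Delta_inv Delta_circ)
  qed simp
qed

lemma long_params_circ: "\<alpha> \<in> long_params H k \<Longrightarrow> \<alpha> \<star> s \<in> long_params H k"
  by (auto simp: long_params_def Delta_circ circ_circ Jp_mult)

lemma Omega_min_circ_short_ideal:
  fixes H :: "('a, 'n::finite) sq_mat set"
  assumes "\<omega> \<in> Omega_min F (upper_ideal F H)" "r \<in> Jp 9"
  shows "\<omega> \<star> r \<in> Omega_min F (short_ideal H)"
proof -
  interpret K: inv_ideal F "short_ideal H" by (rule short_ideal_inv)
  interpret K: form_ideal F "short_ideal H" "Omega_min F (short_ideal H)" by (rule K.form_ideal_min)
  interpret I: inv_ideal F "upper_ideal F H" by (rule upper_ideal_inv)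
  let ?S = "{\<omega>. \<omega> \<star> r \<in> Omega_min F (short_ideal H)}"
  have S: "subgroup ?S (heis F)"
  proof
    show "\<one>\<^bsub>heis F\<^esub> \<in> ?S" using K.Omega_zero by (simp add: heis_one circ_pair)
  qed (auto simp: circ_hadd circ_inv K.Omega_add K.Omega_neg)
  have "Omega_min F (upper_ideal F H) \<subseteq> ?S"
    unfolding Omega_min_def[of F "upper_ideal F H"]
  proof (intro I.set_mult_least S circ_set_least)
    show "trace_pairs F (upper_ideal F H) \<subseteq> ?S"
    proof
      fix a assume "a \<in> trace_pairs F (upper_ideal F H)"
      then obtain x where x: "x \<in> upper_ideal F H" "a = (0, tr x)" by (auto simp: trace_pairs_iff)
      have "cj r * x * r \<in> short_ideal H" using K.I_mult[OF short_ideal_I[OF x(1) assms(2)], of "cj r"] by (simp add: mult.assoc)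
      then show "a \<in> ?S" using K.Omega_tr by (simp add: x circ_pair tr_scale)
    qed
    show "\<alpha> \<star> x \<in> ?S" if "\<alpha> \<in> \<Delta>" "x \<in> upper_ideal F H" for \<alpha> x
      using K.Omega_circ_I[OF that(1) short_ideal_I[OF that(2) assms(2)]] by (simp add: circ_circ)
  qed
  then show ?thesis using assms(1) by blast
qed

lemma Omega_min_long_params:
  fixes H :: "('a, 'n::finite) sq_mat set"
  assumes n: "CARD('n) \<ge> 4" and H: "good H" and k: "k \<noteq> 0"
  shows "Omega_min F (upper_ideal F H) \<subseteq> long_params H k"
proof
  fix \<omega> assume w: "\<omega> \<in> Omega_min F (upper_ideal F H)"
  interpret I: inv_ideal F "upper_ideal F H" by (rule upper_ideal_inv)
  have "\<omega> \<in> \<Delta>" using w I.Omega_min_le_max by (auto simp: Omega_max_def)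
  moreover have "Lo k (\<omega> \<star> r) \<in> H" if "r \<in> Jp 10" for r
    using core_Omega_min[OF n H k Omega_min_circ_short_ideal[OF w]] that Jp_mono[of 9 10] core_le by auto
  ultimately show "\<omega> \<in> long_params H k" by (simp add: long_params_def)
qed

lemma long_params_cong:
  fixes H :: "('a, 'n::finite) sq_mat set"
  assumes n: "CARD('n) \<ge> 4" and H: "good H" and k: "k \<noteq> 0"
    and c: "form_ideal.cg F (Omega_min F (upper_ideal F H)) \<alpha> \<beta>" and a: "\<alpha> \<in> long_params H k"
  shows "\<beta> \<in> long_params H k"
proof -
  interpret I: inv_ideal F "upper_ideal F H" by (rule upper_ideal_inv)
  interpret I: form_ideal F "upper_ideal F H" "Omega_min F (upper_ideal F H)" by (rule I.form_ideal_min)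
  have "\<beta> \<boxminus> \<alpha> \<in> long_params H k"
    using I.cg_sym[OF c] Omega_min_long_params[OF n H k] by (auto simp: I.cg_def)
  then have "(\<beta> \<boxminus> \<alpha>) \<boxplus> \<alpha> \<in> long_params H k"
    using a by (rule subgroup.m_closed[OF long_params_subgroup[OF good_subgroup[OF H] k]])
  moreover have "(\<beta> \<boxminus> \<alpha>) \<boxplus> \<alpha> = \<beta>" by (cases \<alpha>; cases \<beta>) (simp add: hminus_pair hadd_pair algebra_simps)
  ultimately show ?thesis by simp
qed

lemma column_long_params:
  fixes H :: "('a, 'n::finite) sq_mat set"
  assumes n: "CARD('n) \<ge> 4" and H: "good H" and s: "\<sigma> \<in> H" and k: "k \<in> Theta_neg" and i: "i \<noteq> 0"
  shows "Q_form F (\<sigma> *v ax i) \<in> long_params H k"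
proof -
  have HU: "H \<subseteq> UU" using good_UU[OF H] by blast
  show ?thesis using column_Omega_max[OF HU s i] column_Lo_all[OF n H s k i]
    by (auto simp: long_params_def Omega_max_def)
qed

text \<open>The long root element of index \<open>m\<close> fixes \<open>e\<^sub>k\<close> but moves \<open>e\<^sub>0\<close> by a multiple of \<open>e\<^sub>m\<close>.\<close>

lemma cjg_Lo_Lo:
  fixes k m :: "'n::finite signed"
  assumes r: "rt k m \<or> k = m" "k \<noteq> 0" "m \<noteq> 0" and yz: "(y, z) \<in> \<Delta>"
  shows "cjg (Lo m (y, z)) (Lo k \<alpha>)
    = Rt k m (cj (cj (lam F) * kap m * cj y * mu F * (fst \<alpha> * lam F * cj (kap k)))) ** Lo k \<alpha>"
proof -
  have "- m \<noteq> k" using r by (auto simp: rt_def)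
  note ne = this this[symmetric]
  let ?t = "- fst \<alpha> * lam F * cj (kap k)"
  let ?s = "cj (lam F) * kap m * cj y * mu F * (fst \<alpha> * lam F * cj (kap k))"
  have U: "Lo m (y, z) \<in> UU" by (rule Lo_UU[OF r(3) yz])
  have f: "Lo m (y, z) *v ax k = ax k" using ne r by (intro Lo_apply) auto
  have t: "Lo m (y, z) *v axis 0 ?t = axis m ?s + axis 0 ?t"
    unfolding Lo_axis0[OF r(3)] by (simp add: vec_eq_iff axis_def)
  have "cjg (Lo m (y, z)) (Lo k \<alpha>) = Ei (ax k) (axis m ?s + axis 0 ?t) (lv k \<alpha>)"
    unfolding Lo_Ei[OF r(2)] cjg_Ei[OF U] f t ..
  also have "\<dots> = ET (ax k) (axis m ?s) ** Ei (ax k) (axis 0 ?t) (lv k \<alpha>)"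
    using ne r by (subst Ei_mult) (auto simp: B_axis_axis)
  finally show ?thesis unfolding Lo_Ei[OF r(2)] Rt_ET_right by simp
qed

text \<open>Conjugation of \<open>\<sigma>\<close> by the long root element with parameter \<open>(y, z)\<close> and some positive
  index \<open>m\<close> maps the column of \<open>- m\<close> to a vector in which the images of \<open>e\<^sub>0 y\<close> and of
  two basis vectors are combined. Its quadratic value is the wanted parameter up to
  quadratic values of columns, which have been dealt with.\<close>

lemma column0_long_params:
  fixes H :: "('a, 'n::finite) sq_mat set"
  assumes n: "CARD('n) \<ge> 4" and H: "good H" and s: "\<sigma> \<in> H" and k: "k \<in> Theta_neg" and i: "i \<noteq> 0"
    and yz: "(y, z) \<in> \<Delta>"
  shows "P (\<sigma> *v axis 0 y) z \<boxminus> (y, z) \<star> (\<sigma> $ i $ i) \<in> long_params H k"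
proof -
  have HU: "H \<subseteq> UU" using good_UU[OF H] by blast
  note sU = good_UU[OF H s]
  let ?I = "upper_ideal F H" and ?L = "long_params H k"
  interpret I: inv_ideal F ?I by (rule upper_ideal_inv)
  interpret I: form_ideal F ?I "Omega_min F ?I" by (rule I.form_ideal_min)
  interpret K: inv_ideal F "short_ideal H" by (rule short_ideal_inv)
  define c where "c = \<sigma> $ i $ i"
  have sc: "I.scal c \<sigma>" unfolding c_def by (rule I.scal_of_upper_Y[OF s sU upper_Y_le i])
  have k0: "k \<noteq> 0" using k by auto
  note L = long_params_subgroup[OF good_subgroup[OF H] k0]
  obtain \<kappa> where \<kappa>: "k = Neg \<kappa>" using k by blast
  (* the negative of this index has to differ from k, so that tau fixes e_k *)
  obtain m :: 'n where m: "m \<noteq> \<kappa>"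
  proof -
    obtain b where b: "b \<noteq> 0" "b \<noteq> k" "b \<noteq> - k" using rt_other[OF n, of k k k] by metis
    then show ?thesis using that by (cases b) (auto simp: \<kappa> zero_signed_def)
  qed
  have km: "rt k (Pos m)" using m by (auto simp: rt_def \<kappa>)
  have yJ: "y \<in> JD" by (rule JD_I[OF yz])
  define \<tau> where "\<tau> = Lo (Pos m) (y, z)"
  have \<tau>: "\<tau> \<in> EU F" unfolding \<tau>_def by (intro Lo_EU yz) simp
  note \<tau>U = EU_UU[OF \<tau>]
  define \<sigma>' where "\<sigma>' = cjg (iv \<tau>) \<sigma>"
  let ?H = "cjg (iv \<tau>) ` H"
  have H': "good ?H" by (intro good_cjg H EU_iv \<tau>)
  have s': "\<sigma>' \<in> ?H" unfolding \<sigma>'_def using s by blast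
  define \<alpha> where "\<alpha> = Q_form F (\<sigma>' *v ax (Neg m))"
  have \<alpha>m: "\<alpha> \<in> Omega_max F ?I"
    using column_Omega_max[OF _ s', of "Neg m"] good_UU[OF H'] upper_cjg(1)[OF HU EU_iv[OF \<tau>]]
    by (auto simp: \<alpha>_def)
  have \<alpha>L: "\<alpha> \<in> ?L"
  proof -
    have "Lo k (\<alpha> \<star> r) \<in> H" if r: "r \<in> Jp 10" for r
    proof -
      have "Lo k (\<alpha> \<star> r) \<in> ?H" unfolding \<alpha>_def by (rule column_Lo_all[OF n H' s' k _ r]) simp
      then obtain h where h: "h \<in> H" "Lo k (\<alpha> \<star> r) = cjg (iv \<tau>) h" by blast
      have "cjg \<tau> (Lo k (\<alpha> \<star> r)) \<in> H" using h cjg_iv(2)[OF \<tau>U, of h] by simp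
      then have prod: "Rt k (Pos m) (cj (cj (lam F) * kap (Pos m) * cj y * mu F * (fst (\<alpha> \<star> r) * lam F * cj (kap k)))) ** Lo k (\<alpha> \<star> r) \<in> H"
        using cjg_Lo_Lo[of k "Pos m" y z "\<alpha> \<star> r"] km k0 yz by (simp add: \<tau>_def)
      have short: "Rt k (Pos m) (cj (cj (lam F) * kap (Pos m) * cj y * mu F * (fst (\<alpha> \<star> r) * lam F * cj (kap k)))) \<in> H"
      proof -
        have "cj y * mu F * fst \<alpha> \<in> ?I" using \<alpha>m yJ by (cases \<alpha>) (auto simp: I.Omega_max_iff)
        then have "(cj y * mu F * fst \<alpha>) * r \<in> short_ideal H" using r Jp_mono[of 9 10] by (intro short_ideal_I) auto
        from K.I_mult[OF this, of "cj (lam F) * lam F * kap (Pos m) * cj (kap k)"]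
        have "cj (lam F) * kap (Pos m) * cj y * mu F * (fst (\<alpha> \<star> r) * lam F * cj (kap k)) \<in> short_ideal H"
          by (simp only: circ_def fst_conv ac_simps)
        then show ?thesis using core_Rt[OF n H km K.I_cj] core_le by blast
      qed
      have "\<alpha> \<in> \<Delta>" using \<alpha>m by (simp add: Omega_max_def)
      from cancel_left[OF H short Lo_UU[OF k0 Delta_circ[OF this]] prod] show ?thesis .
    qed
    then show ?thesis using \<alpha>m by (simp add: long_params_def Omega_max_def)
  qed
  (* the order of the summands in v puts the wanted vector p2 last: the known ones then split
     off on the left *)
  define p1 where "p1 = \<sigma> *v ax (Neg m)"
  define p2 where "p2 = \<sigma> *v axis 0 y"
  define p3 where "p3 = \<sigma> *v axis (Pos m) (cj z)"
  define v where "v = (p1 + p3) + p2"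
  have M: "ax (Neg m) \<in> (M_Delta F :: ('a^'n signed) set)" "axis (Pos m) (cj z) \<in> (M_Delta F :: ('a^'n signed) set)"
      "axis 0 y \<in> (M_Delta F :: ('a^'n signed) set)"
    using yJ by (simp_all add: ax0_M)
  have \<tau>e: "\<tau> *v ax (Neg m) = (ax (Neg m) + axis (Pos m) (cj z)) + axis 0 y"
    unfolding \<tau>_def using Lo_apply(2)[of "Pos m" y z] by (simp add: add.assoc add.commute[of "axis 0 y"])
  have v: "\<sigma>' *v ax (Neg m) = iv \<tau> *v v"
    unfolding \<sigma>'_def cjg_def v_def p1_def p2_def p3_def
    by (simp add: matrix_vector_mul_assoc[symmetric] iv_iv[OF \<tau>U] \<tau>e matrix_vector_right_distrib)
  have \<alpha>: "\<alpha> = P v 0 \<boxplus> (inv\<^bsub>heis F\<^esub> (y, z)) \<star> (v $ Neg m)"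
  proof -
    have "iv \<tau> = Lo (Pos m) (inv\<^bsub>heis F\<^esub> (y, z))" unfolding \<tau>_def by (rule iv_Lo[OF _ yz]) simp
    then show ?thesis unfolding \<alpha>_def v by (simp add: Q_form_Lo P_Q hadd_zero)
  qed
  have vm: "v $ Neg m - c \<in> ?I"
  proof -
    have "\<sigma> *v ((ax (Neg m) + axis (Pos m) (cj z)) + axis 0 y) = v"
      by (simp add: v_def p1_def p2_def p3_def matrix_vector_right_distrib)
    then show ?thesis
      using I.scal_coord[OF sc M_add[OF M_add[OF M(1,2)] M(3)], of "Neg m"]
      by (simp add: axis_nth axis_nth_neq)
  qed
  have B: "Bf (p1 + p3) p2 = 0" "Bf p1 p3 = lam F * cj z"
    unfolding p1_def p2_def p3_def by (simp_all add: B_lin UU_B[OF sU] B_axis_axis)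
  define E where "E = Q_form F p1 \<boxplus> Q_form F p3 \<boxplus> (0, tr (- z + bq p3 p1 + bq p2 (p1 + p3)))"
  have Pv: "P v 0 = E \<boxplus> P p2 z"
  proof -
    have "P v 0 = P (p1 + p3) (- z) \<boxplus> P p2 z \<boxplus> (0, tr (bq p2 (p1 + p3)))"
      unfolding v_def using P_add[of "p1 + p3" p2 0 "- z"] by (simp add: B)
    also have "P (p1 + p3) (- z) = P p1 0 \<boxplus> P p3 (- z + lam F * cj z) \<boxplus> (0, tr (bq p3 p1))"
      using P_add[of p1 p3 "- z" 0] by (simp add: B)
    also have "P p3 (- z + lam F * cj z) = Q_form F p3 \<boxplus> (0, tr (- z))"
      unfolding P_Q by (simp add: tr_def mult.commute)
    finally show ?thesis
      unfolding E_def P_Q[of p1 0] tr_add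
      by (cases "Q_form F p1"; cases "Q_form F p3"; cases "P p2 z") (simp add: hadd_pair algebra_simps)
  qed
  have EL: "E \<in> ?L"
  proof -
    have q1: "Q_form F p1 \<in> ?L" unfolding p1_def by (rule column_long_params[OF n H s k]) simp
    have "axis (Pos m) (cj z) = cj z *s (ax (Pos m) :: 'a^'n signed)" by (simp add: axis_scale)
    then have "Q_form F p3 = Q_form F (\<sigma> *v ax (Pos m)) \<star> cj z"
      unfolding p3_def by (simp add: matrix_vector_scale Q_form_scale)
    then have q3: "Q_form F p3 \<in> ?L" using long_params_circ[OF column_long_params[OF n H s k, of "Pos m"]] by simp
    (* this trace cancels the one that comes from the scalar of p3 *)
    have b1: "bq p3 p1 - z \<in> ?I"
    proof -
      have "bq p3 p1 - cj c * z * c \<in> ?I"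
        using I.scal_bq[OF sc M(2,1)] by (simp add: p3_def p1_def bq_axis_left axis_nth)
      moreover have "cj c * z * c - z \<in> ?I" using I.I_mult[OF I.scal_norm[OF sc], of z] by (simp add: algebra_simps)
      ultimately show ?thesis by (rule I.cI_trans)
    qed
    have b2: "bq p2 (p1 + p3) \<in> ?I"
      using I.scal_bq[OF sc M(3) M_add[OF M(1,2)]]
      by (simp add: p3_def p1_def p2_def bq_axis_left matrix_vector_right_distrib zero_signed_def image_iff)
    have "- z + bq p3 p1 + bq p2 (p1 + p3) \<in> ?I" using I.I_add[OF b1 b2] by (simp add: algebra_simps)
    then have "(0, tr (- z + bq p3 p1 + bq p2 (p1 + p3))) \<in> ?L"
      using I.Omega_tr Omega_min_long_params[OF n H k0] by blast
    then show ?thesis unfolding E_def using q1 q3 by (intro subgroup.m_closed[OF L])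
  qed
  have "\<alpha> = E \<boxplus> (P p2 z \<boxplus> (inv\<^bsub>heis F\<^esub> (y, z)) \<star> (v $ Neg m))" unfolding \<alpha> Pv hadd_assoc ..
  then have "inv\<^bsub>heis F\<^esub> E \<boxplus> \<alpha> = P p2 z \<boxplus> (inv\<^bsub>heis F\<^esub> (y, z)) \<star> (v $ Neg m)"
    by (simp add: hadd_assoc[symmetric] hadd_inv hadd_zero)
  then have 1: "P p2 z \<boxplus> (inv\<^bsub>heis F\<^esub> (y, z)) \<star> (v $ Neg m) \<in> ?L"
    using subgroup.m_closed[OF L subgroup.m_inv_closed[OF L EL] \<alpha>L] by simp
  have p2D: "P p2 z \<in> \<Delta>" unfolding p2_def by (rule P_UU[OF sU]) (use yz in \<open>simp add: P_axis\<close>)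
  have "I.cg (P p2 z \<boxplus> (inv\<^bsub>heis F\<^esub> (y, z)) \<star> (v $ Neg m)) (P p2 z \<boxplus> (inv\<^bsub>heis F\<^esub> (y, z)) \<star> c)"
    by (intro I.cg_add I.cg_refl p2D I.cg_circ_scalar vm Delta_inv yz)
  from long_params_cong[OF n H k0 this 1] show ?thesis
    by (simp add: p2_def c_def hminus_def circ_inv)
qed

lemma upper_Omega_long_params:
  fixes H :: "('a, 'n::finite) sq_mat set"
  assumes n: "CARD('n) \<ge> 4" and H: "good H" and k: "k \<in> Theta_neg"
  shows "upper_Omega H \<subseteq> long_params H k"
proof -
  have HU: "H \<subseteq> UU" using good_UU[OF H] by blast
  have k0: "k \<noteq> 0" using k by auto
  interpret I: inv_ideal F "upper_ideal F H" by (rule upper_ideal_inv)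
  note L = long_params_subgroup[OF good_subgroup[OF H] k0]
  have "\<alpha> \<in> long_params H k" if "\<alpha> \<in> upper_Z F H" for \<alpha>
    using that column_long_params[OF n H _ k] column0_long_params[OF n H _ k]
    by (auto simp: upper_Z_def column_eq Z2_eq[unfolded column_eq])
  then show ?thesis
    unfolding upper_Omega_eq
    by (intro I.set_mult_least circ_set_least L Omega_min_long_params[OF n H k0] long_params_circ)
qed

section \<open>One normal step\<close>

text \<open>Since elementary conjugation changes neither the hypothesis nor the upper level, the
  long root elements lie in all elementary conjugates of \<open>H\<close>, first for negative
  indices; for positive ones they are transported inside the core.\<close>

lemma upper_Omega_core:
  fixes H :: "('a, 'n::finite) sq_mat set"
  assumes n: "CARD('n) \<ge> 4" and H: "good H" and i: "i \<noteq> 0" and w: "\<omega> \<in> upper_Omega H" and r: "r \<in> Jp 10"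
  shows "Lo i (\<omega> \<star> r) \<in> core H"
proof -
  have HU: "H \<subseteq> UU" using good_UU[OF H] by blast
  interpret I: form_ideal F "upper_ideal F H" "upper_Omega H" by (rule form_ideal_upper[OF HU])
  interpret K: inv_ideal F "short_ideal H" by (rule short_ideal_inv)
  have wD: "\<omega> \<star> r \<in> \<Delta>" by (rule Delta_circ[OF I.Omega_Delta[OF w]])
  have neg: "Lo k (\<omega> \<star> r) \<in> core H" if k: "k \<in> Theta_neg" for k
  proof (rule coreI)
    show "Lo k (\<omega> \<star> r) \<in> UU" using k by (intro Lo_UU wD) auto
    fix \<tau> assume t: "\<tau> \<in> (EU F :: ('a, 'n) sq_mat set)"
    have "\<omega> \<in> long_params (cjg \<tau> ` H) k"
      using upper_Omega_long_params[OF n good_cjg[OF H t] k] upper_cjg(2)[OF HU t] w by blast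
    then show "Lo k (\<omega> \<star> r) \<in> cjg \<tau> ` H" using r by (simp add: long_params_def)
  qed
  show ?thesis
  proof (cases "i \<in> Theta_neg")
    case True
    then show ?thesis by (rule neg)
  next
    case False
    then obtain m where m: "i = Pos m" using i by (cases i) (auto simp: zero_signed_def)
    obtain l :: 'n where l: "l \<noteq> m"
    proof -
      obtain b where b: "b \<noteq> 0" "b \<noteq> i" "b \<noteq> - i" using rt_other[OF n, of i i i] by metis
      then show ?thesis using that by (cases b) (auto simp: m zero_signed_def)
    qed
    have rr: "rt i (Neg l)" "rt i (Pos l)" using l by (auto simp: rt_def m)
    (* theta adds to the basis vector of index Neg l the multiple of e_i that makes
       Ei_axis_opposite applicable *)
    define \<theta> where "\<theta> = Rt i (Pos l) (- cj (lam F))"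
    have \<theta>: "\<theta> \<in> EU F" unfolding \<theta>_def using rtD[OF rr(2)] by (intro Rt_EU) auto
    have f: "\<theta> *v ax (Neg l) = ax (Neg l) + axis i (- cj (lam F))" "\<theta> *v ax 0 = ax 0"
      unfolding \<theta>_def using Rt_apply_axis(1)[OF rr(2), of 0] Rt_apply_axis(2)[OF rr(2), of "- cj (lam F)"] by (auto simp: m)
    let ?x = "lv (Neg l) (\<omega> \<star> r)"
    have ne: "i \<noteq> Neg l" "i \<noteq> - Neg l" using l by (auto simp: m)
    have c: "cjg \<theta> (Lo (Neg l) (\<omega> \<star> r)) = Lo (Neg l) (\<omega> \<star> r) ** (Lo i (inv\<^bsub>heis F\<^esub> (\<omega> \<star> r)) ** Rt i (Neg l) (?x * - cj (lam F)))"
      using cjg_Lo[OF i _ ne wD EU_UU[OF \<theta>] f] Ei_axis_opposite[OF wD, of m l] by (simp add: m)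
    have L: "Lo (Neg l) (\<omega> \<star> r) \<in> core H" by (rule neg) simp
    have "?x \<in> short_ideal H"
    proof -
      have "snd \<omega> \<in> upper_ideal F H" using I.Omega_snd[of "fst \<omega>" "snd \<omega>"] w by simp
      then have "snd \<omega> * r \<in> short_ideal H" using r Jp_mono[of 9 10] by (intro short_ideal_I) auto
      from K.I_mult2[OF K.I_mult[OF this, of "cj r"], of "cj (lam F)"]
      show ?thesis by (simp add: lv_def circ_def mult.assoc image_iff)
    qed
    then have R: "Rt i (Neg l) (?x * - cj (lam F)) \<in> core H" by (intro core_Rt[OF n H rr(1)] K.I_mult2)
    have UR: "Rt i (Neg l) (?x * - cj (lam F)) \<in> UU" "Lo (Neg l) (\<omega> \<star> r) \<in> UU" using core_UU R L by auto
    have "iv (Lo (Neg l) (\<omega> \<star> r)) ** cjg \<theta> (Lo (Neg l) (\<omega> \<star> r)) \<in> core H"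
      by (intro core_mult[OF H] core_iv[OF H] core_cjg \<theta> L)
    then have "Lo i (inv\<^bsub>heis F\<^esub> (\<omega> \<star> r)) ** Rt i (Neg l) (?x * - cj (lam F)) \<in> core H"
      unfolding c using UR by (simp add: matrix_mul_assoc iv_left)
    then have "Lo i (inv\<^bsub>heis F\<^esub> (\<omega> \<star> r)) ** Rt i (Neg l) (?x * - cj (lam F)) ** iv (Rt i (Neg l) (?x * - cj (lam F))) \<in> core H"
      by (rule core_mult[OF H _ core_iv[OF H R]])
    then have "Lo i (inv\<^bsub>heis F\<^esub> (\<omega> \<star> r)) \<in> core H"
      using UR(1) by (simp add: matrix_mul_assoc[symmetric] iv_right)
    then have "iv (iv (Lo i (\<omega> \<star> r))) \<in> core H" using core_iv[OF H] by (simp add: iv_Lo[OF i wD])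
    then show ?thesis using Lo_UU[OF i wD] by (simp add: iv_iv)
  qed
qed

lemma EU_rel_le:
  fixes H :: "('a, 'n::finite) sq_mat set"
  assumes n: "CARD('n) \<ge> 4" and H: "good H" and I: "form_ideal F A \<Gamma>" and A: "A \<subseteq> short_ideal H"
    and G: "\<And>i. i \<noteq> 0 \<Longrightarrow> \<Gamma> \<subseteq> {\<alpha> \<in> \<Delta>. Lo i \<alpha> \<in> core H}"
  shows "EU_rel F (A, \<Gamma>) \<subseteq> H"
proof -
  have "gens A \<Gamma> \<subseteq> core H"
  proof
    fix g :: "('a, 'n) sq_mat" assume "g \<in> gens A \<Gamma>"
    then show "g \<in> core H"
    proof (cases rule: gens_cases)
      case (Rt a b x)
      then show ?thesis using core_Rt[OF n H, of a b x] A by (auto simp: rt_def)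
    next
      case (Lo i \<alpha>)
      then show ?thesis using G by auto
    qed
  qed
  then have "EU_rel F (A, \<Gamma>) \<subseteq> core H"
    by (intro EU_rel_least[OF I core_subgroup[OF H]] core_cjg)
  then show ?thesis using core_le by blast
qed

lemma Omega_min_mono:
  assumes "A \<subseteq> B" "inv_ideal F B" shows "Omega_min F A \<subseteq> Omega_min F B"
proof -
  interpret B: inv_ideal F B by fact
  interpret B: form_ideal F B "Omega_min F B" by (rule B.form_ideal_min)
  show ?thesis unfolding Omega_min_def[of F A]
    using assms(1) B.Omega_tr B.Omega_circ_I
    by (intro B.set_mult_least circ_set_least B.Omega_min_subgroup) (auto simp: trace_pairs_iff subset_iff)
qed

lemma Omega_min_core:
  fixes H :: "('a, 'n::finite) sq_mat set"
  assumes n: "CARD('n) \<ge> 4" and H: "good H" and A: "A \<subseteq> short_ideal H" and i: "i \<noteq> 0"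
  shows "Omega_min F A \<subseteq> {\<alpha> \<in> \<Delta>. Lo i \<alpha> \<in> core H}"
proof -
  interpret K: inv_ideal F "short_ideal H" by (rule short_ideal_inv)
  show ?thesis
    using Omega_min_mono[OF A short_ideal_inv] core_Omega_min[OF n H i] K.Omega_min_le_max by (auto simp: Omega_max_def)
qed

text \<open>The two forms of the conclusion that are needed: with the smallest form parameter and an
  arbitrary smaller ideal to continue a subnormal chain downwards, and with the full
  form parameter for its last member.\<close>

lemma normal_step:
  fixes H :: "('a, 'n::finite) sq_mat set"
  assumes n: "CARD('n) \<ge> 4" and H: "good H"
  shows "inv_ideal F A \<Longrightarrow> A \<subseteq> ideal_prod ring_UNIV (upper_ideal F H) (Jp 10) \<Longrightarrow> EU_rel F (A, Omega_min F A) \<subseteq> H"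
    and "EU_rel F (form_ideal_prod F (upper_level F H) (Jp 10)) \<subseteq> H"
proof -
  have HU: "H \<subseteq> UU" using good_UU[OF H] by blast
  let ?I = "upper_ideal F H" and ?\<Omega> = "upper_Omega H"
  interpret I: form_ideal F ?I ?\<Omega> by (rule form_ideal_upper[OF HU])
  let ?P = "ideal_prod ring_UNIV ?I (Jp 10)"
  have PK: "?P \<subseteq> short_ideal H"
  proof
    interpret K: inv_ideal F "short_ideal H" by (rule short_ideal_inv)
    fix x assume "x \<in> ?P"
    then show "x \<in> short_ideal H"
    proof (induction rule: ideal_prod.induct)
      case (prod x y)
      then show ?case using short_ideal_I[of x H y] Jp_mono[of 9 10] by auto
    qed (simp add: K.I_add)
  qed
  show "EU_rel F (A, Omega_min F A) \<subseteq> H" if A: "inv_ideal F A" "A \<subseteq> ?P"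
    using EU_rel_le[OF n H inv_ideal.form_ideal_min[OF A(1)]] Omega_min_core[OF n H] A(2) PK by (meson subset_trans)
  interpret P: inv_ideal F ?P by (rule ideal_prod_inv[OF upper_ideal_inv Jp_inv])
  let ?Z = "{\<alpha> \<star> b | \<alpha> b. \<alpha> \<in> ?\<Omega> \<and> b \<in> Jp 10}"
  have Z: "circ_set F ?\<Omega> (Jp 10) = circ_set F ?Z UNIV"
  proof
    show "circ_set F ?\<Omega> (Jp 10) \<subseteq> circ_set F ?Z UNIV"
    proof (intro circ_set_least circ_set_subgroup)
      fix \<alpha> b assume "\<alpha> \<in> ?\<Omega>" "b \<in> Jp 10"
      then have "\<alpha> \<star> b \<in> ?Z" by blast
      from circ_setI[OF this, of 1 UNIV] show "\<alpha> \<star> b \<in> circ_set F ?Z UNIV" by simp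
    qed
    show "circ_set F ?Z UNIV \<subseteq> circ_set F ?\<Omega> (Jp 10)"
    proof (intro circ_set_least circ_set_subgroup)
      fix \<beta> s assume "\<beta> \<in> ?Z"
      then obtain \<alpha> b where "\<beta> = \<alpha> \<star> b" "\<alpha> \<in> ?\<Omega>" "b \<in> Jp 10" by blast
      then show "\<beta> \<star> s \<in> circ_set F ?\<Omega> (Jp 10)"
        using circ_setI[of \<alpha> ?\<Omega> "s * b" "Jp 10"] Jp_mult[of b 10 s] by (simp add: circ_circ mult.commute)
    qed
  qed
  have "?Z \<subseteq> Omega_max F ?P"
  proof
    fix \<zeta> assume "\<zeta> \<in> ?Z"
    then obtain x y b where \<zeta>: "\<zeta> = (x, y) \<star> b" and w: "(x, y) \<in> ?\<Omega>" and b: "b \<in> Jp 10" by force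
    have p: "s * b \<in> ?P" if "s \<in> ?I" for s using ideal_prod.prod[OF that b, of ring_UNIV] by simp
    have "cj z * mu F * (x * b) \<in> ?P" if "z \<in> JD" for z
      using p[OF I.Omega_fst[OF w that]] by (simp add: mult.assoc)
    moreover have "cj b * y * b \<in> ?P" using P.I_mult[OF p[OF I.Omega_snd[OF w]], of "cj b"] by (simp add: mult.assoc)
    moreover have "(x, y) \<star> b \<in> \<Delta>" by (rule Delta_circ[OF I.Omega_Delta[OF w]])
    ultimately show "\<zeta> \<in> Omega_max F ?P" by (simp add: \<zeta> circ_pair P.Omega_max_iff)
  qed
  then have f: "form_ideal F ?P (Omega_min F ?P <#>\<^bsub>heis F\<^esub> circ_set F ?\<Omega> (Jp 10))"
    unfolding Z by (rule P.form_ideal_generated)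
  have "Omega_min F ?P <#>\<^bsub>heis F\<^esub> circ_set F ?\<Omega> (Jp 10) \<subseteq> {\<alpha> \<in> \<Delta>. Lo i \<alpha> \<in> core H}" if i: "i \<noteq> 0" for i
    using upper_Omega_core[OF n H i] I.Omega_Delta
    by (intro P.set_mult_least circ_set_least Lo_subgroup core_subgroup H i Omega_min_core[OF n H PK i])
       (auto intro: Delta_circ)
  from EU_rel_le[OF n H f PK this] show "EU_rel F (form_ideal_prod F (upper_level F H) (Jp 10)) \<subseteq> H"
    by (simp add: form_ideal_prod_def upper_level_eq)
qed

end

context hermitian_form_ring
begin

section \<open>Subnormal subgroups\<close>

lemma upper_ideal_mono:
  assumes "H \<subseteq> H'" shows "upper_ideal F H \<subseteq> upper_ideal F H'"
proof -
  have "upper_Y F H \<subseteq> upper_Y F H'" unfolding upper_Y_def by (rule UN_mono[OF assms]) (rule order_refl)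
  then show ?thesis using upper_ideal_min[OF upper_ideal_inv] upper_Y_le[of H'] by (meson subset_trans)
qed

lemma ideal_power_power:
  fixes m k :: nat
  assumes "ideal A (ring_UNIV :: 'a ring)"
  shows "(A [^]\<^bsub>ideals_set ring_UNIV\<^esub> m) [^]\<^bsub>ideals_set ring_UNIV\<^esub> k = A [^]\<^bsub>ideals_set ring_UNIV\<^esub> (m * k)"
proof -
  interpret M: comm_monoid "ideals_set (ring_UNIV :: 'a ring)"
    by (rule cring.ideals_set_is_comm_monoid[OF cring_from_type_algebra])
  show ?thesis using assms by (intro M.nat_pow_pow) (simp add: ideals_set_def)
qed

lemma good_of_normal:
  fixes H N :: "('a, 'n::finite) sq_mat set"
  assumes "inv_ideal F J" "N \<lhd> UG\<lparr>carrier := H\<rparr>" "subgroup H UG" "EU_rel F (J, Omega_min F J) \<subseteq> H"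
  shows "level.good F J N"
proof -
  interpret J: inv_ideal F J by fact
  interpret J: level F J by standard
  have "subgroup N UG"
    by (rule group.incl_subgroup[OF group_UG assms(3) normal_imp_subgroup[OF assms(2)]])
  moreover have "cjg g h \<in> N" if "g \<in> EU_rel F (J, Omega_min F J)" "h \<in> N" for g h
  proof -
    have g: "g \<in> H" using that assms(4) by blast
    then show ?thesis
      using normal.inv_op_closed2[OF assms(2), of g h] that(2) group.m_inv_consistent[OF group_UG assms(3) g]
      by (simp add: cjg_def)
  qed
  ultimately show ?thesis by (simp add: J.good_def)
qed

text \<open>Let \<open>m\<close> be the sequence with \<open>m 0 = 0\<close> and \<open>m (e + 1) = 10 m e + 1\<close>. By induction the
  \<open>e\<close>-th member of the chain, counted from \<open>G\<close> downwards, contains the relative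
  elementary group of the power \<open>m e\<close> of the upper ideal of \<open>H\<close>: this ideal is contained
  in the upper ideal of every member of the chain, which accounts for the summand 1. The
  final step keeps the form parameter of \<open>H\<close> and gives the exponent \<open>10 m (d - 1)\<close>.\<close>

lemma subnormal_lower_bound:
  fixes G H :: "('a, 'n::finite) sq_mat set"
  assumes n: "CARD('n) \<ge> 4" and G: "subgroup G UG" "EU F \<subseteq> G" and d: "d > 0"
    and sn: "subnormal d H (UG\<lparr>carrier := G\<rparr>)"
  shows "EU_rel F (form_ideal_prod F (upper_level F H)
      (upper_ideal F H [^]\<^bsub>ideals_set ring_UNIV\<^esub> ((10 ^ d - 1) div 9 - 1 :: nat))) \<subseteq> H"
    and "H \<subseteq> UU"
proof -
  obtain K where K: "K 0 = H" "K d = G" "\<And>i. i < d \<Longrightarrow> K i \<lhd> UG\<lparr>carrier := K (Suc i)\<rparr>"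
    using sn by (auto simp: subnormal_def)
  have sub: "e \<le> d \<Longrightarrow> subgroup (K (d - e)) UG" for e
  proof (induction e)
    case 0
    then show ?case using K G by simp
  next
    case (Suc e)
    then have "K (d - Suc e) \<lhd> UG\<lparr>carrier := K (d - e)\<rparr>" using K(3)[of "d - Suc e"] by (simp add: Suc_diff_Suc)
    then show ?case using Suc group.incl_subgroup[OF group_UG _ normal_imp_subgroup] by simp
  qed
  have le: "e \<le> d \<Longrightarrow> H \<subseteq> K e" for e
  proof (induction e)
    case (Suc e)
    then have "K e \<subseteq> K (Suc e)" using subgroup.subset[OF normal_imp_subgroup[OF K(3)[of e]]] by simp
    then show ?case using Suc by auto
  qed (simp add: K)
  show "H \<subseteq> UU" using subgroup.subset[OF sub[of 0]] le[of d] K d by auto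
  let ?I = "upper_ideal F H"
  interpret I: inv_ideal F ?I by (rule upper_ideal_inv)
  interpret I: level F ?I by standard
  define m :: "nat \<Rightarrow> nat" where "m e = (10 ^ e - 1) div 9" for e
  have m: "m 0 = 0" "m (Suc e) = Suc (m e * 10)" for e
  proof -
    show "m 0 = 0" by (simp add: m_def)
    have "\<exists>q. (10::nat) ^ e = 9 * q + 1"
    proof (induction e)
      case (Suc e)
      then obtain q where "(10::nat) ^ e = 9 * q + 1" by blast
      then have "(10::nat) ^ Suc e = 9 * (10 * q + 1) + 1" by simp
      then show ?case by blast
    qed simp
    then obtain q where "(10::nat) ^ e = 9 * q + 1" by blast
    then show "m (Suc e) = Suc (m e * 10)" by (simp add: m_def)
  qed
  have step: "EU_rel F (I.Jp (m e), Omega_min F (I.Jp (m e))) \<subseteq> K (d - e)" if "e < d" for e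
    using that
  proof (induction e)
    case 0
    interpret u: inv_ideal F "I.Jp 0" by (rule I.Jp_inv)
    have "EU_rel F (I.Jp 0, Omega_min F (I.Jp 0)) \<subseteq> (EU F :: ('a, 'n) sq_mat set)"
      using subgroup.subset[OF normal_imp_subgroup[OF EU_rel_normal(1)[OF u.form_ideal_min]]] by simp
    then show ?case using G K by (simp add: m)
  next
    case (Suc e)
    define J where "J = I.Jp (m e)"
    interpret J: inv_ideal F J unfolding J_def by (rule I.Jp_inv)
    interpret J: level F J by standard
    have N: "K (d - Suc e) \<lhd> UG\<lparr>carrier := K (d - e)\<rparr>" using K(3)[of "d - Suc e"] Suc.prems by (simp add: Suc_diff_Suc)
    have good: "J.good (K (d - Suc e))"
      using good_of_normal[OF J.inv_ideal_axioms N sub] Suc by (simp add: J_def)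
    have J10: "J.Jp 10 = I.Jp (m e * 10)"
      unfolding J.Jp_def unfolding J_def I.Jp_def by (rule ideal_power_power[OF I.I_ideal])
    have "I.Jp (m (Suc e)) \<subseteq> ideal_prod ring_UNIV (upper_ideal F (K (d - Suc e))) (J.Jp 10)"
    proof
      interpret P: inv_ideal F "ideal_prod ring_UNIV (upper_ideal F (K (d - Suc e))) (J.Jp 10)"
        by (rule J.ideal_prod_inv[OF upper_ideal_inv J.Jp_inv])
      fix x assume "x \<in> I.Jp (m (Suc e))"
      then have "x \<in> I.Jp (Suc (m e * 10))" by (simp add: m)
      then show "x \<in> ideal_prod ring_UNIV (upper_ideal F (K (d - Suc e))) (J.Jp 10)"
      proof (induction rule: I.Jp_Suc_induct)
        case (prod y z)
        have "z \<in> upper_ideal F (K (d - Suc e))" using prod(2) upper_ideal_mono[OF le[of "d - Suc e"]] by auto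
        from ideal_prod.prod[OF this prod(1)[folded J10], of ring_UNIV] show ?case by (simp add: mult.commute)
      qed (rule P.I_add)
    qed
    from J.normal_step(1)[OF n good I.Jp_inv this] show ?case .
  qed
  obtain e where e: "d = Suc e" using d by (cases d) auto
  define J where "J = I.Jp (m e)"
  interpret J: inv_ideal F J unfolding J_def by (rule I.Jp_inv)
  interpret J: level F J by standard
  have N: "K 0 \<lhd> UG\<lparr>carrier := K (d - e)\<rparr>" using K(3)[of 0] d by (simp add: e)
  have good: "J.good H"
    using good_of_normal[OF J.inv_ideal_axioms N sub] step[of e] by (simp add: J_def e K(1))
  have "J.Jp 10 = ?I [^]\<^bsub>ideals_set ring_UNIV\<^esub> (m e * 10)"
    unfolding J.Jp_def unfolding J_def I.Jp_def by (rule ideal_power_power[OF I.I_ideal])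
  moreover have "m e * 10 = (10 ^ d - 1) div 9 - 1" using m(2)[of e] by (simp add: m_def e)
  ultimately show "EU_rel F (form_ideal_prod F (upper_level F H)
      (?I [^]\<^bsub>ideals_set ring_UNIV\<^esub> ((10 ^ d - 1) div 9 - 1 :: nat))) \<subseteq> H"
    using J.normal_step(2)[OF n good] by simp
qed

end

theorem theorem49:
  fixes F :: "'a::comm_ring_1 form_data"
    and G H :: "('a, 'n::finite) sq_mat set"
    and d :: nat and I :: "'a set" and \<Omega> :: "('a \<times> 'a) set"
  assumes "CARD('n) \<ge> 4"
    and "hermitian_form_ring F"
    and "d > 0"
    and "subgroup G (U_grp F)"
    and "EU F \<subseteq> G"
    and "subnormal d H ((U_grp F)\<lparr>carrier := G\<rparr>)"
    and "upper_level F H = (I, \<Omega>)"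
  shows "EU_rel F (form_ideal_prod F (upper_level F H)
            (I [^]\<^bsub>ideals_set ring_UNIV\<^esub> ((10 ^ d - 1) div 9 - 1 :: nat))) \<subseteq> H
         \<and> H \<subseteq> CU F (upper_level F H)"
proof -
  interpret hermitian_form_ring F by fact
  have "I = upper_ideal F H" using assms(7) by (simp add: upper_level_eq)
  then show ?thesis
    using subnormal_lower_bound[OF assms(1,4,5,3,6)] upper_bound[of H] by simp
qed

end
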